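(* Let $\xi\in(0,1)$ be an irrational number belonging to $\mathcal{M}$, i.e. such that there exist constants $K_1,K_2>0$ with $$\left(\sin^{2}(\mu)+\sin^{2}(\xi\mu)\,\sin^{2}((1-\xi)\mu)\right)e^{K_{1}\mu}\geq K_{2}\qquad\text{for all sufficiently large real }\mu .$$ Then for any $n\in\mathbb{N}$ there exists a constant $C_{\xi}>0$ such that for every initial data $(u^{0},u^{1})\in\mathcal{D}(\mathcal{A}^{n})$ the energy of the corresponding solution $(u_1,u_2)$ of the pointwise damped string system satisfies $$\mathcal{E}(u_{1},u_{2})(t)\leq\frac{C_{\xi}}{(\ln(2+t))^{2n}}\,\|(u^{0},u^{1})\|_{\mathcal{D}(\mathcal{A}^{n})}^{2}\qquad\forall\,t>0.$$
   Context: Fix $\xi\in(0,1)$. A prime denotes the space derivative and a dot the time derivative. The pointwise damped string system is $$\ddot u_1-u_1''=0 \text{ in }(0,\xi)\times(0,+\infty),\qquad \ddot u_2-u_2''=0\text{ in }(\xi,1)\times(0,+\infty),$$ with transmission conditions, for $t\in(0,+\infty)$, $$u_1(\xi,t)=u_2(\xi,t),\qquad u_2'(\xi,t)-u_1'(\xi,t)=\dot u_1(\xi,t),$$ boundary conditions $u_1(0,t)=u_2(1,t)=0$, and initial conditions $u_1(x,0)=u_1^0(x)$, $\dot u_1(x,0)=u_1^1(x)$ for $x\in(0,\xi)$ and $u_2(x,0)=u_2^0(x)$, $\dot u_2(x,0)=u_2^1(x)$ for $x\in(\xi,1)$. Write $u^0$ (resp. $u^1$) for the function on $(0,1)$ equal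 to $u_1^0$ (resp. $u_1^1$) on $(0,\xi)$ and to $u_2^0$ (resp. $u_2^1$) on $(\xi,1)$, and $u$ for the function equal to $u_1$ on $(0,\xi)$ and to $u_2$ on $(\xi,1)$. The energy is $$\mathcal{E}(u_{1},u_{2})(t)=\frac{1}{2}\left(\int_{0}^{\xi}|\dot{u}_{1}(x,t)|^{2}+|u_{1}'(x,t)|^{2}\,dx+\int_{\xi}^{1}|\dot{u}_{2}(x,t)|^{2}+|u_{2}'(x,t)|^{2}\,dx\right).$$ Let $X=H_0^1(0,1)\times L^2(0,1)$ (complex-valued functions) with norm $\|(u,v)\|^2=\|u'\|_{L^2(0,1)}^2+\|v\|_{L^2(0,1)}^2$. The operator $\mathcal{A}$ on $X$ is $$\mathcal{A}(u,v)=\left(v,\ \frac{d^2u}{dx^2}\right),$$ where $\frac{d^2u}{dx^2}$ is computed separately on $(0,\xi)$ and $(\xi,1)$, with domain $$\mathcal{D}(\mathcal{A})=\{(u,v)\in H_0^1(0,1)\times H_0^1(0,1): u_{|(0,\xi)}\in H^2(0,\xi),\ u_{|(\xi,1)}\in H^2(\xi,1),\ u'(\xi^+)-u'(\xi^-)=v(\xi)\}.$$ The operator $\mathcal{A}$ generates a $C_0$-semigroup of contractions on $X$, and the solution of the system with initial data $(u^0,u^1)$ is given by $(u(t),\dot u(t))=e^{t\mathcal{A}}(u^0,u^1)$. The space $\mathcal{D}(\mathcal{A}^n)$ is equipped with its graph norm $\|\cdot\|_{\mathcal{D}(\mathcal{A}^n)}$, e.g. $\|U\|_{\mathcal{D}(\mathcal{A}^n)}=\sum_{k=0}^n\|\mathcal{A}^kU\|$.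 The set $\mathcal{M}$ is the set of $\xi\in(0,1)$ for which there exist $K_1,K_2>0$ such that $\left(\sin^{2}(\mu)+\sin^{2}(\xi\mu)\sin^{2}((1-\xi)\mu)\right)e^{K_1\mu}\ge K_2$ for all sufficiently large real $\mu$. *)

theory Defs
  imports "HOL-Analysis.Analysis"
begin

subsection \<open>Square integrable functions and the space $L^2(0,1)$\<close>

definition square_integrable :: "real \<Rightarrow> real \<Rightarrow> (real \<Rightarrow> complex) \<Rightarrow> bool" where
  "square_integrable a b f \<longleftrightarrow>
     f \<in> borel_measurable (lebesgue_on {a<..<b}) \<and>
     integrable (lebesgue_on {a<..<b}) (\<lambda>x. (cmod (f x))\<^sup>2)"

definition L2_normsq :: "real \<Rightarrow> real \<Rightarrow> (real \<Rightarrow> complex) \<Rightarrow> real" where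
  "L2_normsq a b f = (LINT x|lebesgue_on {a<..<b}. (cmod (f x))\<^sup>2)"

lemma square_integrable_zero: "square_integrable a b (\<lambda>x. 0)"
  by (simp add: square_integrable_def)

lemma square_integrable_scale:
  "square_integrable a b f \<Longrightarrow> square_integrable a b (\<lambda>x. c * f x)"
  unfolding square_integrable_def norm_mult power_mult_distrib
  by (intro conjI borel_measurable_times borel_measurable_const integrable_mult_right) auto

lemma square_integrable_add:
  assumes "square_integrable a b f" "square_integrable a b g"
  shows "square_integrable a b (\<lambda>x. f x + g x)"
proof -
  have m: "(\<lambda>x. f x + g x) \<in> borel_measurable (lebesgue_on {a<..<b})"
    using assms unfolding square_integrable_def by (intro borel_measurable_add) auto
  have int: "integrable (lebesgue_on {a<..<b}) (\<lambda>x. 2 * (cmod (f x))\<^sup>2 + 2 * (cmod (g x))\<^sup>2)"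
    using assms by (simp add: square_integrable_def)
  have le: "(cmod (f x + g x))\<^sup>2 \<le> 2 * (cmod (f x))\<^sup>2 + 2 * (cmod (g x))\<^sup>2" for x
  proof -
    have "(cmod (f x + g x))\<^sup>2 \<le> (cmod (f x) + cmod (g x))\<^sup>2"
      by (simp add: norm_triangle_ineq power_mono)
    also have "\<dots> \<le> 2 * (cmod (f x))\<^sup>2 + 2 * (cmod (g x))\<^sup>2"
      using sum_squares_bound[of "cmod (f x)" "cmod (g x)"] by (simp add: power2_sum)
    finally show ?thesis .
  qed
  have "integrable (lebesgue_on {a<..<b}) (\<lambda>x. (cmod (f x + g x))\<^sup>2)"
  proof (rule Bochner_Integration.integrable_bound)
    show "(\<lambda>x. (cmod (f x + g x))\<^sup>2) \<in> borel_measurable (lebesgue_on {a<..<b})"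
      by (intro borel_measurable_power measurable_compose[OF m borel_measurable_norm])
  qed (use int le in auto)
  with m show ?thesis by (simp add: square_integrable_def)
qed

lemma square_integrable_inner:
  assumes "square_integrable a b f" "square_integrable a b g"
  shows "integrable (lebesgue_on {a<..<b}) (\<lambda>x. f x \<bullet> g x)"
proof (rule Bochner_Integration.integrable_bound)
  show "integrable (lebesgue_on {a<..<b}) (\<lambda>x. (cmod (f x))\<^sup>2 + (cmod (g x))\<^sup>2)"
    using assms by (simp add: square_integrable_def)
  show "(\<lambda>x. f x \<bullet> g x) \<in> borel_measurable (lebesgue_on {a<..<b})"
    using assms unfolding square_integrable_def by (intro borel_measurable_inner) auto
  have "\<bar>f x \<bullet> g x\<bar> \<le> (cmod (f x))\<^sup>2 + (cmod (g x))\<^sup>2" for x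
  proof -
    have "\<bar>f x \<bullet> g x\<bar> \<le> cmod (f x) * cmod (g x)"
      by (rule Cauchy_Schwarz_ineq2)
    also have "\<dots> \<le> (cmod (f x))\<^sup>2 + (cmod (g x))\<^sup>2"
      using sum_squares_bound[of "cmod (f x)" "cmod (g x)"]
        mult_nonneg_nonneg[of "cmod (f x)" "cmod (g x)", OF norm_ge_zero norm_ge_zero]
      by linarith
    finally show ?thesis .
  qed
  then show "AE x in lebesgue_on {a<..<b}.
      norm (f x \<bullet> g x) \<le> norm ((cmod (f x))\<^sup>2 + (cmod (g x))\<^sup>2)"
    by auto
qed

definition L2_eq :: "(real \<Rightarrow> complex) \<Rightarrow> (real \<Rightarrow> complex) \<Rightarrow> bool" where
  "L2_eq f g \<longleftrightarrow> square_integrable 0 1 f \<and> square_integrable 0 1 g \<and>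
     (AE x in lebesgue_on {0<..<1}. f x = g x)"

quotient_type L2_unit = "real \<Rightarrow> complex" / partial: L2_eq
proof (rule part_equivpI)
  show "\<exists>f. L2_eq f f"
    using square_integrable_zero by (auto simp: L2_eq_def)
  show "symp L2_eq"
    by (rule sympI) (auto simp: L2_eq_def elim: eventually_mono)
  show "transp L2_eq"
    by (rule transpI) (auto simp: L2_eq_def elim: eventually_elim2)
qed

instantiation L2_unit :: real_vector
begin

lift_definition zero_L2_unit :: L2_unit is "\<lambda>x. 0"
  by (simp add: L2_eq_def square_integrable_zero)

lift_definition plus_L2_unit :: "L2_unit \<Rightarrow> L2_unit \<Rightarrow> L2_unit" is "\<lambda>f g x. f x + g x"
  by (auto simp: L2_eq_def square_integrable_add elim: eventually_elim2)

lift_definition uminus_L2_unit :: "L2_unit \<Rightarrow> L2_unit" is "\<lambda>f x. - f x"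
  using square_integrable_scale[of 0 1 _ "-1"]
  by (auto simp: L2_eq_def elim: eventually_mono)

definition minus_L2_unit :: "L2_unit \<Rightarrow> L2_unit \<Rightarrow> L2_unit" where
  "u - v = u + (- v)" for u v :: L2_unit

lift_definition scaleR_L2_unit :: "real \<Rightarrow> L2_unit \<Rightarrow> L2_unit" is
  "\<lambda>r f x. complex_of_real r * f x"
  by (auto simp: L2_eq_def square_integrable_scale elim: eventually_mono)

instance
proof
  fix u v w :: L2_unit and r s :: real
  show "u + v + w = u + (v + w)"
    by transfer (auto simp: L2_eq_def square_integrable_add add.assoc)
  show "u + v = v + u"
    by transfer (auto simp: L2_eq_def square_integrable_add add.commute)
  show "0 + u = u"
    by transfer (auto simp: L2_eq_def)
  show "- u + u = 0"
    by transfer (auto simp: L2_eq_def square_integrable_zero)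
  show "u - v = u + - v" by (rule minus_L2_unit_def)
  show "r *\<^sub>R (u + v) = r *\<^sub>R u + r *\<^sub>R v"
    by transfer (auto simp: L2_eq_def square_integrable_add square_integrable_scale distrib_left)
  show "(r + s) *\<^sub>R u = r *\<^sub>R u + s *\<^sub>R u"
    by transfer (auto simp: L2_eq_def distrib_right
        intro!: square_integrable_add square_integrable_scale)
  show "r *\<^sub>R s *\<^sub>R u = (r * s) *\<^sub>R u"
    by transfer (auto simp: L2_eq_def square_integrable_scale mult.assoc
        intro!: square_integrable_scale)
  show "1 *\<^sub>R u = u" by transfer (auto simp: L2_eq_def)
qed

end

instantiation L2_unit :: real_inner
begin

text \<open>On complex numbers the library's inner product is the real part of the Hermitian one, so
  this is the real part of the usual scalar product of $L^2(0,1)$; it has the same norm.\<close>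

lift_definition inner_L2_unit :: "L2_unit \<Rightarrow> L2_unit \<Rightarrow> real" is
  "\<lambda>f g. LINT x|lebesgue_on {0<..<1}. f x \<bullet> g x"
proof -
  fix f f' g g' :: "real \<Rightarrow> complex"
  assume *: "L2_eq f f'" "L2_eq g g'"
  have "AE x in lebesgue_on {0<..<1}. f x \<bullet> g x = f' x \<bullet> g' x"
    using * by (auto simp: L2_eq_def elim: eventually_elim2)
  then show "(LINT x|lebesgue_on {0<..<1}. f x \<bullet> g x) = (LINT x|lebesgue_on {0<..<1}. f' x \<bullet> g' x)"
    using * by (intro integral_cong_AE) (auto simp: L2_eq_def square_integrable_def)
qed

definition norm_L2_unit :: "L2_unit \<Rightarrow> real" where "norm u = sqrt (u \<bullet> u)" for u :: L2_unit

definition sgn_L2_unit :: "L2_unit \<Rightarrow> L2_unit" where "sgn u = u /\<^sub>R norm u" for u :: L2_unit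

definition dist_L2_unit :: "L2_unit \<Rightarrow> L2_unit \<Rightarrow> real" where "dist u v = norm (u - v)" for u v :: L2_unit

definition uniformity_L2_unit :: "(L2_unit \<times> L2_unit) filter" where
  "(uniformity :: (L2_unit \<times> L2_unit) filter) = (INF e\<in>{0 <..}. principal {(u, v). dist u v < e})"

definition open_L2_unit :: "L2_unit set \<Rightarrow> bool" where
  "open U \<longleftrightarrow> (\<forall>u\<in>U. eventually (\<lambda>(u', v). u' = u \<longrightarrow> v \<in> U) uniformity)" for U :: "L2_unit set"

instance
proof
  fix u v w :: L2_unit and r :: real
  show "dist u v = norm (u - v)" by (rule dist_L2_unit_def)
  show "sgn u = u /\<^sub>R norm u" by (rule sgn_L2_unit_def)
  show "(uniformity :: (L2_unit \<times> L2_unit) filter) = (INF e\<in>{0 <..}. principal {(u, v). dist u v < e})"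
    by (rule uniformity_L2_unit_def)
  show "open U \<longleftrightarrow> (\<forall>u\<in>U. eventually (\<lambda>(u', v). u' = u \<longrightarrow> v \<in> U) uniformity)" for U :: "L2_unit set"
    by (rule open_L2_unit_def)
  show "u \<bullet> v = v \<bullet> u" by transfer (simp add: inner_commute)
  show "(u + v) \<bullet> w = u \<bullet> w + v \<bullet> w"
    by transfer (simp add: L2_eq_def inner_add_left square_integrable_inner)
  show "(r *\<^sub>R u) \<bullet> v = r * (u \<bullet> v)"
  proof transfer
    fix r :: real and f g :: "real \<Rightarrow> complex"
    have "(complex_of_real r * f x) \<bullet> g x = r * (f x \<bullet> g x)" for x
      by (metis inner_scaleR_left scaleR_conv_of_real)
    then show "(LINT x|lebesgue_on {0<..<1}. (complex_of_real r * f x) \<bullet> g x) =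
        r * (LINT x|lebesgue_on {0<..<1}. f x \<bullet> g x)"
      by simp
  qed
  show "0 \<le> u \<bullet> u" by transfer simp
  show "u \<bullet> u = 0 \<longleftrightarrow> u = 0"
  proof transfer
    fix f :: "real \<Rightarrow> complex" assume f: "L2_eq f f"
    have "(LINT x|lebesgue_on {0<..<1}. f x \<bullet> f x) = 0 \<longleftrightarrow>
        (AE x in lebesgue_on {0<..<1}. f x \<bullet> f x = 0)"
      using f by (intro integral_nonneg_eq_0_iff_AE square_integrable_inner) (auto simp: L2_eq_def)
    then show "(LINT x|lebesgue_on {0<..<1}. f x \<bullet> f x) = 0 \<longleftrightarrow> L2_eq f (\<lambda>x. 0)"
      using f by (auto simp: L2_eq_def square_integrable_zero)
  qed
  show "norm u = sqrt (u \<bullet> u)" by (rule norm_L2_unit_def)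
qed

end

subsection \<open>Sobolev spaces on an interval\<close>

definition smooth :: "(real \<Rightarrow> complex) \<Rightarrow> bool" where
  "smooth \<phi> \<longleftrightarrow> (\<forall>k x. ((\<lambda>f y. vector_derivative f (at y)) ^^ k) \<phi> differentiable (at x))"

definition test_functions :: "real \<Rightarrow> real \<Rightarrow> (real \<Rightarrow> complex) set" where
  "test_functions a b =
     {\<phi>. smooth \<phi> \<and> (\<exists>K. compact K \<and> K \<subseteq> {a<..<b} \<and> (\<forall>x. x \<notin> K \<longrightarrow> \<phi> x = 0))}"

definition has_weak_deriv ::
  "real \<Rightarrow> real \<Rightarrow> (real \<Rightarrow> complex) \<Rightarrow> (real \<Rightarrow> complex) \<Rightarrow> bool" where
  "has_weak_deriv a b f g \<longleftrightarrow>
     (\<forall>\<phi>\<in>test_functions a b.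
        (LINT x|lebesgue_on {a<..<b}. f x * vector_derivative \<phi> (at x)) =
        - (LINT x|lebesgue_on {a<..<b}. g x * \<phi> x))"

definition H1 :: "real \<Rightarrow> real \<Rightarrow> (real \<Rightarrow> complex) set" where
  "H1 a b = {f. square_integrable a b f \<and> (\<exists>g. square_integrable a b g \<and> has_weak_deriv a b f g)}"

text \<open>The weak derivative is determined almost everywhere on the interval only; all uses below
  are insensitive to the choice of a representative.\<close>

definition weak_deriv :: "real \<Rightarrow> real \<Rightarrow> (real \<Rightarrow> complex) \<Rightarrow> real \<Rightarrow> complex" where
  "weak_deriv a b f = (SOME g. square_integrable a b g \<and> has_weak_deriv a b f g)"

definition H2 :: "real \<Rightarrow> real \<Rightarrow> (real \<Rightarrow> complex) set" where
  "H2 a b = {f \<in> H1 a b. weak_deriv a b f \<in> H1 a b}"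

definition H10 :: "real \<Rightarrow> real \<Rightarrow> (real \<Rightarrow> complex) set" where
  "H10 a b = {f \<in> H1 a b. \<forall>e>0. \<exists>\<phi>\<in>test_functions a b.
     L2_normsq a b (\<lambda>x. f x - \<phi> x) +
     L2_normsq a b (\<lambda>x. weak_deriv a b f x - vector_derivative \<phi> (at x)) < e}"

text \<open>The value at a point of the closed interval of the continuous representative of a function
  in \<^term>\<open>H1 a b\<close>; at \<^term>\<open>a\<close> and \<^term>\<open>b\<close> these are the one-sided limits.\<close>

definition sobolev_trace :: "real \<Rightarrow> real \<Rightarrow> (real \<Rightarrow> complex) \<Rightarrow> real \<Rightarrow> complex" where
  "sobolev_trace a b f x = (THE c. \<exists>h. continuous_on {a..b} h \<and>
     (AE y in lebesgue_on {a<..<b}. f y = h y) \<and> h x = c)"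

subsection \<open>Strongly continuous semigroups\<close>

text \<open>The space is a linear subspace \<^term>\<open>X\<close> of a real vector space, with a norm \<^term>\<open>nrm\<close> on it.
  Only real linearity is required. If the generator is complex linear, then so is the semigroup,
  by uniqueness of the semigroup with a given generator.\<close>

definition C0_semigroup ::
  "'a::real_vector set \<Rightarrow> ('a \<Rightarrow> real) \<Rightarrow> (real \<Rightarrow> 'a \<Rightarrow> 'a) \<Rightarrow> bool" where
  "C0_semigroup X nrm S \<longleftrightarrow>
     (\<forall>t\<ge>0. (\<forall>x\<in>X. S t x \<in> X) \<and>
        (\<forall>x\<in>X. \<forall>y\<in>X. S t (x + y) = S t x + S t y) \<and>
        (\<forall>r. \<forall>x\<in>X. S t (r *\<^sub>R x) = r *\<^sub>R S t x) \<and>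
        (\<exists>M. \<forall>x\<in>X. nrm (S t x) \<le> M * nrm x)) \<and>
     (\<forall>x\<in>X. S 0 x = x) \<and>
     (\<forall>s\<ge>0. \<forall>t\<ge>0. \<forall>x\<in>X. S (s + t) x = S s (S t x)) \<and>
     (\<forall>x\<in>X. ((\<lambda>h. nrm (S h x - x)) \<longlongrightarrow> 0) (at_right 0))"

definition generator_graph ::
  "'a::real_vector set \<Rightarrow> ('a \<Rightarrow> real) \<Rightarrow> (real \<Rightarrow> 'a \<Rightarrow> 'a) \<Rightarrow> ('a \<times> 'a) set" where
  "generator_graph X nrm S =
     {(x, y). x \<in> X \<and> y \<in> X \<and> ((\<lambda>h. nrm ((S h x - x) /\<^sub>R h - y)) \<longlongrightarrow> 0) (at_right 0)}"

definition generates ::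
  "'a::real_vector set \<Rightarrow> ('a \<Rightarrow> real) \<Rightarrow> 'a set \<Rightarrow> ('a \<Rightarrow> 'a) \<Rightarrow> (real \<Rightarrow> 'a \<Rightarrow> 'a) \<Rightarrow> bool" where
  "generates X nrm D A S \<longleftrightarrow>
     C0_semigroup X nrm S \<and> generator_graph X nrm S = {(x, A x) | x. x \<in> D}"

primrec dom_power :: "'a set \<Rightarrow> 'a set \<Rightarrow> ('a \<Rightarrow> 'a) \<Rightarrow> nat \<Rightarrow> 'a set" where
  "dom_power X D A 0 = X"
| "dom_power X D A (Suc n) = {x \<in> D. A x \<in> dom_power X D A n}"

definition graph_norm :: "('a \<Rightarrow> real) \<Rightarrow> ('a \<Rightarrow> 'a) \<Rightarrow> nat \<Rightarrow> 'a \<Rightarrow> real" where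
  "graph_norm nrm A n x = (\<Sum>k\<le>n. nrm ((A ^^ k) x))"

subsection \<open>The pointwise damped string\<close>

type_synonym state = "L2_unit \<times> L2_unit"

definition H10_unit :: "L2_unit set" where
  "H10_unit = {u. rep_L2_unit u \<in> H10 0 1}"

definition state_space :: "state set" where
  "state_space = H10_unit \<times> UNIV"

definition state_norm :: "state \<Rightarrow> real" where
  "state_norm = (\<lambda>(u, v). sqrt (L2_normsq 0 1 (weak_deriv 0 1 (rep_L2_unit u)) + (norm v)\<^sup>2))"

definition domA :: "real \<Rightarrow> state set" where
  "domA \<xi> = {(u, v). u \<in> H10_unit \<and> v \<in> H10_unit \<and>
     rep_L2_unit u \<in> H2 0 \<xi> \<and> rep_L2_unit u \<in> H2 \<xi> 1 \<and>
     sobolev_trace \<xi> 1 (weak_deriv \<xi> 1 (rep_L2_unit u)) \<xi> - sobolev_trace 0 \<xi> (weak_deriv 0 \<xi> (rep_L2_unit u)) \<xi> =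
       sobolev_trace 0 1 (rep_L2_unit v) \<xi>}"

definition opA :: "real \<Rightarrow> state \<Rightarrow> state" where
  "opA \<xi> = (\<lambda>(u, v). (v, abs_L2_unit (\<lambda>x.
     if x < \<xi> then weak_deriv 0 \<xi> (weak_deriv 0 \<xi> (rep_L2_unit u)) x
     else weak_deriv \<xi> 1 (weak_deriv \<xi> 1 (rep_L2_unit u)) x)))"

text \<open>The energy of a state \<^term>\<open>(u, v)\<close>, where \<^term>\<open>v\<close> is the time derivative of \<^term>\<open>u\<close>;
  the components $u_1$, $u_2$ of the solution are the restrictions of \<^term>\<open>u\<close> to the two
  subintervals.\<close>

definition energy :: "real \<Rightarrow> state \<Rightarrow> real" where
  "energy \<xi> = (\<lambda>(u, v). 1 / 2 *
     ((LINT x|lebesgue_on {0<..<\<xi>}.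
         (cmod (rep_L2_unit v x))\<^sup>2 + (cmod (weak_deriv 0 \<xi> (rep_L2_unit u) x))\<^sup>2) +
      (LINT x|lebesgue_on {\<xi><..<1}.
         (cmod (rep_L2_unit v x))\<^sup>2 + (cmod (weak_deriv \<xi> 1 (rep_L2_unit u) x))\<^sup>2)))"

definition set_M :: "real set" where
  "set_M = {\<xi>. 0 < \<xi> \<and> \<xi> < 1 \<and> (\<exists>K\<^sub>1>0. \<exists>K\<^sub>2>0. eventually (\<lambda>\<mu>::real.
     ((sin \<mu>)\<^sup>2 + (sin (\<xi> * \<mu>))\<^sup>2 * (sin ((1 - \<xi>) * \<mu>))\<^sup>2) * exp (K\<^sub>1 * \<mu>) \<ge> K\<^sub>2) at_top)}"

end

theory Submission
  imports Defs "HOL-Real_Asymp.Real_Asymp"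
begin

text \<open>The argument takes place in the time domain and needs no resolvent estimates. Let \<open>w(t)\<close> be the
  velocity at \<open>\<xi>\<close>; the squared norm \<open>N(t)\<close> of the solution satisfies \<open>N' = - 2 |w|^2\<close>. In the sine basis the
  string becomes a family of oscillators \<open>z' = i \<sigma> k \<pi> z - sin (k \<pi> \<xi>) w\<close> with \<open>\<sigma> = 1\<close> or \<open>\<sigma> = -1\<close>, all of
  which have the period 2 when they are not forced. Integrating \<open>u(\<xi>, t)\<close> against the exponential of frequency
  \<open>\<sigma> k \<pi>\<close> over one period isolates the resonant mode, up to errors controlled by \<open>w\<close>; hence
  \<open>|sin (k \<pi> \<xi>)| |z(0)|\<close> is at most \<open>4 (k + 2)^2\<close> times the \<open>L^1(0,2)\<close> norm of \<open>w\<close>.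

  At \<open>\<mu> = k \<pi>\<close> the condition defining \<open>M\<close> bounds \<open>sin (k \<pi> \<xi>)\<close> from below by an exponential of \<open>-k\<close>, and
  irrationality takes care of the finitely many small \<open>k\<close>. The modes above a threshold \<open>n\<close> contribute at
  most \<open>3 ||A U||^2 / n^2\<close>, if the jump of \<open>u'\<close> at \<open>\<xi>\<close>, which is \<open>w\<close>, is charged to the dissipation. So
  \<open>N(3) \<le> a exp (b n) (N(0) - N(3)) + 3 ||A U||^2 / n^2\<close> for all \<open>n\<close>. With \<open>n\<close> of the order of \<open>ln t\<close> this
  iterates to a decay like \<open>1 / ln(2 + t)^2\<close> on the domain of \<open>A\<close>, and the semigroup law gives its powers.

  The semigroup is an arbitrary one with the given generator. Completeness of the state space makes it
  locally bounded, so that orbits are differentiable from both sides; contractivity then follows from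
  dissipativity and the density of the domain.\<close>

subsection \<open>Smooth functions and bumps\<close>

text \<open>Why the jump must be charged to the dissipation: expressing mode j of U through mode j
  of A U gains a factor 1/j, and the square summable coefficients of A U then give the tail bound of
  order 1/n^2. The jump enters as w sin(j pi \<xi>) / (j pi); its square is of size |w|^2/j^2
  without further decay in j, so its tail beyond n is only of order |w|^2/n. With |w| bounded by ||A
  U|| the rate would drop to 1/ln(2 + t). At a time \<tau> in [0,1] at which |w|^2 is at most its
  mean, the whole jump contribution is part of the energy lost. A full period [\<tau>, \<tau> + 2]
  has to follow, hence the time step 3.

  Why the other modes do not spoil the resonant one: the sine series of the trace carries one factor
  1/j, the distance of the frequencies supplies a second one at the price of a factor k + 1, and the
  errors sum up like 1/j^2. The trace itself is an oscillator of frequency 0 driven by w, so the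
  left side of the identity is small as well.\<close>

lemma smooth_if_closed_under_derivative:
  assumes "f \<in> F"
    and closed: "\<And>f. f \<in> F \<Longrightarrow> \<exists>f'\<in>F. \<forall>x. (f has_vector_derivative f' x) (at x)"
  shows "smooth f"
proof -
  let ?D = "\<lambda>f y. vector_derivative f (at y)"
  have D: "?D g \<in> F" if g: "g \<in> F" for g
  proof -
    obtain g' where g': "g' \<in> F" "\<And>x. (g has_vector_derivative g' x) (at x)"
      using closed[OF g] by auto
    then have "?D g = g'"
      by (auto intro!: vector_derivative_at)
    with g' show ?thesis by simp
  qed
  have "(?D ^^ k) f \<in> F" for k
    by (induction k) (auto simp: assms(1) D)
  then show ?thesis
    unfolding smooth_def using closed differentiableI_vector by blast
qed

lemma smooth_has_vector_derivative:
  assumes "smooth f"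
  shows "(f has_vector_derivative vector_derivative f (at x)) (at x)"
  using assms[unfolded smooth_def, rule_format, of 0 x] by (simp add: vector_derivative_works)

lemma smooth_vector_derivative:
  assumes "smooth f"
  shows "smooth (\<lambda>x. vector_derivative f (at x))"
  unfolding smooth_def
proof (intro allI)
  fix k x
  show "((\<lambda>f y. vector_derivative f (at y)) ^^ k) (\<lambda>x. vector_derivative f (at x)) differentiable at x"
    using assms[unfolded smooth_def, rule_format, of "Suc k" x] by (simp only: funpow_Suc_right o_def)
qed

lemma smooth_if_has_smooth_derivative:
  assumes f: "\<And>x. (f has_vector_derivative g x) (at x)" and g: "smooth g"
  shows "smooth f"
  unfolding smooth_def
proof (intro allI)
  fix k x
  show "((\<lambda>f y. vector_derivative f (at y)) ^^ k) f differentiable at x"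
  proof (cases k)
    case 0
    then show ?thesis using f differentiableI_vector by auto
  next
    case (Suc m)
    have "(\<lambda>x. vector_derivative f (at x)) = g"
      using f by (auto intro!: vector_derivative_at)
    then show ?thesis
      using g[unfolded smooth_def, rule_format, of m x] Suc by (simp only: funpow_Suc_right o_def)
  qed
qed

lemma smooth_continuous_on: "smooth f \<Longrightarrow> continuous_on S f"
  by (meson continuous_at_imp_continuous_on differentiableI_vector differentiable_imp_continuous_within
      smooth_has_vector_derivative)

text \<open>The classical flat function exp(-1/x), taken together with all multiples x^(-k)
  exp(-1/x): up to linear combinations this family is closed under differentiation.\<close>

definition flat :: "nat \<Rightarrow> real \<Rightarrow> real" where
  "flat k x = (if x > 0 then inverse x ^ k * exp (- inverse x) else 0)"

lemma flat_tendsto_0: "(flat k \<longlongrightarrow> 0) (at_right 0)"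
proof -
  have "((\<lambda>x. inverse x ^ k / exp (inverse x)) \<longlongrightarrow> (0::real)) (at_right 0)"
    by (rule filterlim_compose[OF tendsto_power_div_exp_0 filterlim_inverse_at_top_right])
  then show ?thesis
    by (rule Lim_transform_eventually)
      (auto simp: flat_def exp_minus field_simps intro!: eventually_at_rightI[of 0 1])
qed

lemma flat_deriv:
  "(flat k has_real_derivative (flat (k + 2) x - k * flat (k + 1) x)) (at x)"
proof -
  consider "x > 0" | "x < 0" | "x = 0" by linarith
  then show ?thesis
  proof cases
    case 1
    have "((\<lambda>x. inverse x ^ k * exp (- inverse x)) has_real_derivative
       (flat (k + 2) x - k * flat (k + 1) x)) (at x)"
    proof -
      have "((\<lambda>x. inverse x ^ k) has_real_derivative - real k * inverse x ^ (k + 1)) (at x)"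
        using 1 DERIV_power[OF DERIV_inverse[of x], of k]
        by (cases k) (auto simp: algebra_simps elim!: DERIV_cong)
      moreover have "((\<lambda>x. exp (- inverse x)) has_real_derivative exp (- inverse x) * inverse x ^ 2) (at x)"
        using 1 by (auto intro!: derivative_eq_intros simp: power2_eq_square)
      ultimately show ?thesis
        using 1 by (auto intro!: DERIV_cong[OF DERIV_mult] simp: flat_def algebra_simps power2_eq_square)
    qed
    then show ?thesis
      by (rule DERIV_cong_ev[THEN iffD1, rotated -1, OF _ refl _ refl])
        (use 1 in \<open>auto simp: flat_def eventually_nhds intro!: exI[of _ "{0<..}"]\<close>)
  next
    case 2
    have "((\<lambda>x. 0) has_real_derivative (flat (k + 2) x - k * flat (k + 1) x)) (at x)"
      using 2 by (simp add: flat_def)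
    then show ?thesis
      by (rule DERIV_cong_ev[THEN iffD1, rotated -1, OF _ refl _ refl])
        (use 2 in \<open>auto simp: flat_def eventually_nhds intro!: exI[of _ "{..<0}"]\<close>)
  next
    case 3
    have "((\<lambda>h. (flat k (0 + h) - flat k 0) / h) \<longlongrightarrow> 0) (at 0)"
    proof (rule filterlim_split_at)
    show "((\<lambda>h. (flat k (0 + h) - flat k 0) / h) \<longlongrightarrow> 0) (at_left 0)"
      by (rule Lim_transform_eventually[OF tendsto_const])
        (auto simp: flat_def intro!: eventually_at_leftI[of "-1"])
    \<comment> \<open>For h > 0 the difference quotient at 0 is \<open>flat (Suc k) h\<close>, the
      next member of the family.\<close>
    show "((\<lambda>h. (flat k (0 + h) - flat k 0) / h) \<longlongrightarrow> 0) (at_right 0)"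
      by (rule Lim_transform_eventually[OF flat_tendsto_0[of "Suc k"]])
        (auto simp: flat_def field_simps intro!: eventually_at_rightI[of 0 1])
    qed
    then show ?thesis
      using 3 by (simp add: DERIV_def flat_def)
  qed
qed

text \<open>One algebra, closed under differentiation, that contains the polynomials (for
  Stone-Weierstrass) and the bumps (to cut them off to compact support).\<close>

inductive_set smooth_ring :: "(real \<Rightarrow> complex) set" where
  const: "(\<lambda>x. c) \<in> smooth_ring"
| ident: "(\<lambda>x. of_real x) \<in> smooth_ring"
| flat: "(\<lambda>x. of_real (flat k (\<alpha> * x + \<beta>))) \<in> smooth_ring"
| add: "f \<in> smooth_ring \<Longrightarrow> g \<in> smooth_ring \<Longrightarrow> (\<lambda>x. f x + g x) \<in> smooth_ring"
| mult: "f \<in> smooth_ring \<Longrightarrow> g \<in> smooth_ring \<Longrightarrow> (\<lambda>x. f x * g x) \<in> smooth_ring"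

lemma smooth_ring_smooth:
  assumes "f \<in> smooth_ring"
  shows "smooth f"
  using assms
proof (rule smooth_if_closed_under_derivative)
  fix f assume "f \<in> smooth_ring"
  then show "\<exists>f'\<in>smooth_ring. \<forall>x. (f has_vector_derivative f' x) (at x)"
  proof induction
    case (const c)
    then show ?case by (auto intro!: bexI[of _ "\<lambda>x. 0"] smooth_ring.const)
  next
    case ident
    then show ?case
      by (auto intro!: bexI[of _ "\<lambda>x. 1"] smooth_ring.const has_vector_derivative_of_real derivative_eq_intros)
  next
    case (flat k \<alpha> \<beta>)
    let ?f' = "\<lambda>x. of_real \<alpha> * (of_real (flat (k + 2) (\<alpha> * x + \<beta>))
                + (- of_nat k) * of_real (flat (k + 1) (\<alpha> * x + \<beta>)))"
    have "?f' \<in> smooth_ring" by (intro smooth_ring.intros)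
    moreover have "((\<lambda>x. complex_of_real (flat k (\<alpha> * x + \<beta>))) has_vector_derivative ?f' x) (at x)" for x
    proof -
      have "((\<lambda>x. flat k (\<alpha> * x + \<beta>)) has_real_derivative
          (flat (k + 2) (\<alpha> * x + \<beta>) - k * flat (k + 1) (\<alpha> * x + \<beta>)) * \<alpha>) (at x)"
        by (rule DERIV_chain2[OF flat_deriv]) (auto intro!: derivative_eq_intros)
      then have "((\<lambda>x. complex_of_real (flat k (\<alpha> * x + \<beta>))) has_vector_derivative
          of_real ((flat (k + 2) (\<alpha> * x + \<beta>) - k * flat (k + 1) (\<alpha> * x + \<beta>)) * \<alpha>)) (at x)"
        by (rule has_vector_derivative_of_real)
      moreover have "of_real ((flat (k + 2) (\<alpha> * x + \<beta>) - k * flat (k + 1) (\<alpha> * x + \<beta>)) * \<alpha>) = ?f' x"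
        by (simp add: mult.commute)
      ultimately show ?thesis by metis
    qed
    ultimately show ?case by (intro bexI[of _ ?f']) auto
  next
    case (add f g)
    then obtain f' g' where "f' \<in> smooth_ring" "g' \<in> smooth_ring"
      "\<And>x. (f has_vector_derivative f' x) (at x)" "\<And>x. (g has_vector_derivative g' x) (at x)" by blast
    then show ?case
      by (intro bexI[of _ "\<lambda>x. f' x + g' x"]) (auto intro!: derivative_intros smooth_ring.intros)
  next
    case (mult f g)
    then obtain f' g' where "f' \<in> smooth_ring" "g' \<in> smooth_ring"
      "\<And>x. (f has_vector_derivative f' x) (at x)" "\<And>x. (g has_vector_derivative g' x) (at x)" by blast
    with mult show ?case
      by (intro bexI[of _ "\<lambda>x. f x * g' x + f' x * g x"])
        (auto intro!: has_vector_derivative_mult smooth_ring.intros)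
  qed
qed

text \<open>Since exp(-1/(n y)) tends to 1 for every y > 0, the bumps increase to the indicator of
  the interval as n grows, and multiplication by them never enlarges a function.\<close>

definition bump :: "nat \<Rightarrow> real \<Rightarrow> real \<Rightarrow> real \<Rightarrow> real" where
  "bump n c d x = flat 0 (real n * (x - c)) * flat 0 (real n * (d - x))"

lemma flat0_bounds: "0 \<le> flat 0 x" "flat 0 x \<le> 1"
  by (auto simp: flat_def)

lemma bump_bounds: "0 \<le> bump n c d x" "bump n c d x \<le> 1"
  using flat0_bounds by (auto simp: bump_def intro!: mult_le_one)

lemma bump_eq_0: "x \<notin> {c<..<d} \<Longrightarrow> bump n c d x = 0"
  by (auto simp: bump_def flat_def zero_less_mult_iff)

lemma bump_smooth_ring: "(\<lambda>x. of_real (bump n c d x)) \<in> smooth_ring"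
proof -
  have "(\<lambda>x. of_real (flat 0 (real n * x + (- real n * c))) * of_real (flat 0 (- real n * x + real n * d)))
      \<in> smooth_ring"
    by (intro smooth_ring.intros)
  then show ?thesis by (simp add: bump_def algebra_simps)
qed

lemma flat0_tendsto_1:
  assumes "(f \<longlongrightarrow> x) sequentially" "x > 0"
  shows "(\<lambda>n. flat 0 (real n * f n)) \<longlonglongrightarrow> 1"
proof -
  have "filterlim (\<lambda>n. f n * real n) at_top sequentially"
    by (rule filterlim_tendsto_pos_mult_at_top[OF assms filterlim_real_sequentially])
  then have *: "filterlim (\<lambda>n. real n * f n) at_top sequentially" by (simp add: mult.commute)
  have "(\<lambda>n. exp (- inverse (real n * f n))) \<longlonglongrightarrow> exp (- 0)"
    by (intro tendsto_intros filterlim_compose[OF tendsto_inverse_0_at_top *])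
      (rule filterlim_compose[OF tendsto_inverse_0_at_top *] filterlim_ident)+
  then have "(\<lambda>n. exp (- inverse (real n * f n))) \<longlonglongrightarrow> 1" by simp
  moreover have "\<forall>\<^sub>F n in sequentially. exp (- inverse (real n * f n)) = flat 0 (real n * f n)"
    using filterlim_at_top_dense[THEN iffD1, OF *, rule_format, of 0]
    by eventually_elim (auto simp: flat_def)
  ultimately show ?thesis by (rule Lim_transform_eventually)
qed

text \<open>The supports stay away from \<open>a\<close> and \<open>b\<close>, yet exhaust the interval.\<close>

lemma bump_tendsto_1:
  assumes "a < x" "x < b"
  shows "(\<lambda>n. bump n (a + 1 / Suc n) (b - 1 / Suc n) x) \<longlonglongrightarrow> 1"
proof -
  have "(\<lambda>n. x - (a + 1 / Suc n)) \<longlonglongrightarrow> x - (a + 0)"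
       "(\<lambda>n. (b - 1 / Suc n) - x) \<longlonglongrightarrow> (b - 0) - x"
    by (intro tendsto_intros LIMSEQ_Suc[OF lim_1_over_n])+
  then have "(\<lambda>n. bump n (a + 1 / Suc n) (b - 1 / Suc n) x) \<longlonglongrightarrow> 1 * 1"
    unfolding bump_def using assms by (intro tendsto_mult flat0_tendsto_1[where x="x-a"] flat0_tendsto_1[where x="b-x"]) auto
  then show ?thesis by simp
qed

lemma bump_mult_test_function:
  assumes "f \<in> smooth_ring" "a < c" "d < b"
  shows "(\<lambda>x. of_real (bump n c d x) * f x) \<in> test_functions a b"
  unfolding test_functions_def
  using smooth_ring_smooth[OF smooth_ring.mult[OF bump_smooth_ring assms(1)]] assms
  by (auto intro!: exI[of _ "{c..d}"] simp: bump_eq_0)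

subsection \<open>Square integrable functions on an interval\<close>

lemma sets_lebesgue_interval [simp]: "{a<..<b::real} \<in> sets lebesgue"
  by simp

lemma finite_measure_interval: "finite_measure (lebesgue_on {a<..<b::real})"
  by (rule finite_measure_lebesgue_on) simp

lemma integrable_const_interval [simp]: "integrable (lebesgue_on {a<..<b::real}) (\<lambda>x. c::'a::euclidean_space)"
  using finite_measure.integrable_const[OF finite_measure_interval] by blast

lemma measure_interval: "a \<le> b \<Longrightarrow> measure (lebesgue_on {a<..<b::real}) {a<..<b} = b - a"
  by (simp add: measure_restrict_space)

lemma continuous_on_borel_measurable_interval:
  "continuous_on {a<..<b} f \<Longrightarrow> f \<in> borel_measurable (lebesgue_on {a<..<b::real})"
  by (simp add: continuous_imp_measurable_on_sets_lebesgue)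

lemma square_integrable_measurable:
  "square_integrable a b f \<Longrightarrow> f \<in> borel_measurable (lebesgue_on {a<..<b})"
  by (simp add: square_integrable_def)

lemma square_integrable_square:
  "square_integrable a b f \<Longrightarrow> integrable (lebesgue_on {a<..<b}) (\<lambda>x. (cmod (f x))\<^sup>2)"
  by (simp add: square_integrable_def)

lemma square_integrable_uminus: "square_integrable a b f \<Longrightarrow> square_integrable a b (\<lambda>x. - f x)"
  using square_integrable_scale[of a b f "-1"] by simp

lemma square_integrable_diff:
  "square_integrable a b f \<Longrightarrow> square_integrable a b g \<Longrightarrow> square_integrable a b (\<lambda>x. f x - g x)"
  using square_integrable_add[OF _ square_integrable_uminus, of a b f g] by simp

lemma square_integrable_cnj: "square_integrable a b f \<Longrightarrow> square_integrable a b (\<lambda>x. cnj (f x))"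
  unfolding square_integrable_def
  using measurable_compose[of f "lebesgue_on {a<..<b}" borel cnj borel]
    borel_measurable_continuous_onI[OF continuous_on_cnj[OF continuous_on_id]]
  by simp

lemma square_integrable_mult:
  assumes "square_integrable a b f" "square_integrable a b g"
  shows "integrable (lebesgue_on {a<..<b}) (\<lambda>x. f x * g x)"
proof (rule Bochner_Integration.integrable_bound)
  show "integrable (lebesgue_on {a<..<b}) (\<lambda>x. (cmod (f x))\<^sup>2 + (cmod (g x))\<^sup>2)"
    using assms by (simp add: square_integrable_def)
  show "(\<lambda>x. f x * g x) \<in> borel_measurable (lebesgue_on {a<..<b})"
    using assms unfolding square_integrable_def by (intro borel_measurable_times) auto
  have "cmod (f x) * cmod (g x) \<le> (cmod (f x))\<^sup>2 + (cmod (g x))\<^sup>2" for x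
    using sum_squares_bound[of "cmod (f x)" "cmod (g x)"]
      mult_nonneg_nonneg[of "cmod (f x)" "cmod (g x)", OF norm_ge_zero norm_ge_zero] by linarith
  then show "AE x in lebesgue_on {a<..<b}. norm (f x * g x) \<le> norm ((cmod (f x))\<^sup>2 + (cmod (g x))\<^sup>2)"
    by (auto simp: norm_mult)
qed

lemma square_integrable_norm_mult:
  assumes "square_integrable a b f" "square_integrable a b g"
  shows "integrable (lebesgue_on {a<..<b}) (\<lambda>x. cmod (f x) * cmod (g x))"
  using integrable_norm[OF square_integrable_mult[OF assms]] by (simp add: norm_mult)

lemma square_integrable_bounded:
  assumes f: "f \<in> borel_measurable (lebesgue_on {a<..<b})" and B: "\<And>x. x \<in> {a<..<b} \<Longrightarrow> cmod (f x) \<le> B"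
  shows "square_integrable a b f"
  unfolding square_integrable_def
proof
  show "integrable (lebesgue_on {a<..<b}) (\<lambda>x. (cmod (f x))\<^sup>2)"
  proof (rule Bochner_Integration.integrable_bound)
    show "integrable (lebesgue_on {a<..<b}) (\<lambda>x. B\<^sup>2)" by simp
    show "AE x in lebesgue_on {a<..<b}. norm ((cmod (f x))\<^sup>2) \<le> norm (B\<^sup>2)"
      using B by (auto simp: AE_restrict_space_iff power_mono)
  qed (use f in measurable)
qed (fact f)

lemma square_integrable_continuous:
  assumes "continuous_on {a..b} f"
  shows "square_integrable a b f"
proof -
  have "compact (f ` {a..b})" by (rule compact_continuous_image[OF assms]) simp
  then obtain B where B: "\<And>x. x \<in> {a..b} \<Longrightarrow> cmod (f x) \<le> B"
    by (meson bounded_iff compact_imp_bounded image_eqI)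
  have "continuous_on {a<..<b} f" by (rule continuous_on_subset[OF assms]) auto
  then show ?thesis
    using B by (intro square_integrable_bounded[of f a b B] continuous_on_borel_measurable_interval) auto
qed

lemma square_integrable_const: "square_integrable a b (\<lambda>x. c)"
  by (rule square_integrable_bounded[of _ a b "cmod c"]) auto

lemma square_integrable_integrable:
  "square_integrable a b f \<Longrightarrow> integrable (lebesgue_on {a<..<b}) f"
  using square_integrable_mult[OF _ square_integrable_const[of a b 1]] by simp

lemma square_integrable_cong_AE:
  assumes "square_integrable a b f" "g \<in> borel_measurable (lebesgue_on {a<..<b})"
    "AE x in lebesgue_on {a<..<b}. f x = g x"
  shows "square_integrable a b g"
proof -
  have "integrable (lebesgue_on {a<..<b}) (\<lambda>x. (cmod (f x))\<^sup>2) \<longleftrightarrow>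
      integrable (lebesgue_on {a<..<b}) (\<lambda>x. (cmod (g x))\<^sup>2)"
    by (rule integrable_cong_AE)
      (use assms in \<open>auto simp: square_integrable_def elim: eventually_mono
        intro!: borel_measurable_power measurable_compose[OF _ borel_measurable_norm]\<close>)
  with assms show ?thesis by (simp add: square_integrable_def)
qed

lemma integrable_lebesgue_on_subset:
  fixes f :: "'a::euclidean_space \<Rightarrow> 'b::euclidean_space"
  assumes "integrable (lebesgue_on T) f" "S \<subseteq> T" "S \<in> sets lebesgue" "T \<in> sets lebesgue"
  shows "integrable (lebesgue_on S) f"
proof -
  have "set_integrable lebesgue T f"
    using assms by (simp add: integrable_restrict_space set_integrable_def)
  then have "set_integrable lebesgue S f"
    using assms by (rule_tac set_integrable_subset)
  then show ?thesis
    using assms by (simp add: integrable_restrict_space set_integrable_def)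
qed

lemma square_integrable_subinterval:
  assumes "square_integrable a b f" "a \<le> c" "d \<le> b"
  shows "square_integrable c d f"
proof -
  have sub: "{c<..<d} \<subseteq> {a<..<b}" using assms by auto
  have "integrable (lebesgue_on {c<..<d}) (\<lambda>x. (cmod (f x))\<^sup>2)"
    by (rule integrable_lebesgue_on_subset[of "{a<..<b}"]) (use assms sub in \<open>auto simp: square_integrable_def\<close>)
  moreover have "f \<in> borel_measurable (lebesgue_on {c<..<d})"
    using assms sub measurable_restrict_mono by (auto simp: square_integrable_def)
  ultimately show ?thesis by (simp add: square_integrable_def)
qed

section \<open>The squared L^2 norm: Cauchy-Schwarz and dominated convergence\<close>

lemma L2_normsq_nonneg: "0 \<le> L2_normsq a b f"
  by (simp add: L2_normsq_def)

lemma L2_normsq_cong_AE: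
  assumes "square_integrable a b f" "square_integrable a b g" "AE x in lebesgue_on {a<..<b}. f x = g x"
  shows "L2_normsq a b f = L2_normsq a b g"
  unfolding L2_normsq_def
  by (rule integral_cong_AE) (use assms in \<open>auto simp: square_integrable_def elim: eventually_mono\<close>)

lemma L2_normsq_commute: "L2_normsq a b (\<lambda>x. f x - g x) = L2_normsq a b (\<lambda>x. g x - f x)"
  by (simp add: L2_normsq_def norm_minus_commute)

lemma L2_normsq_add_le:
  assumes "square_integrable a b f" "square_integrable a b g"
  shows "L2_normsq a b (\<lambda>x. f x + g x) \<le> 2 * L2_normsq a b f + 2 * L2_normsq a b g"
proof -
  have "L2_normsq a b (\<lambda>x. f x + g x) \<le> (LINT x|lebesgue_on {a<..<b}. 2 * (cmod (f x))\<^sup>2 + 2 * (cmod (g x))\<^sup>2)"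
    unfolding L2_normsq_def
  proof (rule integral_mono)
    show "integrable (lebesgue_on {a<..<b}) (\<lambda>x. (cmod (f x + g x))\<^sup>2)"
      using square_integrable_add[OF assms] by (simp add: square_integrable_def)
    show "integrable (lebesgue_on {a<..<b}) (\<lambda>x. 2 * (cmod (f x))\<^sup>2 + 2 * (cmod (g x))\<^sup>2)"
      using assms by (simp add: square_integrable_def)
    fix x
    have "(cmod (f x + g x))\<^sup>2 \<le> (cmod (f x) + cmod (g x))\<^sup>2"
      by (simp add: norm_triangle_ineq power_mono)
    also have "\<dots> \<le> 2 * (cmod (f x))\<^sup>2 + 2 * (cmod (g x))\<^sup>2"
      using sum_squares_bound[of "cmod (f x)" "cmod (g x)"] by (simp add: power2_sum)
    finally show "(cmod (f x + g x))\<^sup>2 \<le> 2 * (cmod (f x))\<^sup>2 + 2 * (cmod (g x))\<^sup>2" .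
  qed
  also have "\<dots> = 2 * L2_normsq a b f + 2 * L2_normsq a b g"
    using assms by (simp add: L2_normsq_def square_integrable_def)
  finally show ?thesis .
qed

lemma L2_normsq_diff_le:
  assumes "square_integrable a b f" "square_integrable a b g" "square_integrable a b h"
  shows "L2_normsq a b (\<lambda>x. f x - h x) \<le> 2 * L2_normsq a b (\<lambda>x. f x - g x) + 2 * L2_normsq a b (\<lambda>x. g x - h x)"
  using L2_normsq_add_le[OF square_integrable_diff[OF assms(1,2)] square_integrable_diff[OF assms(2,3)]] by simp

lemma L2_normsq_subinterval:
  assumes "square_integrable a b f" "a \<le> c" "d \<le> b"
  shows "L2_normsq c d f \<le> L2_normsq a b f"
proof -
  have sub: "{c<..<d} \<subseteq> {a<..<b}" using assms by auto
  have "L2_normsq c d f = (LINT x|lebesgue_on {a<..<b}. (if x \<in> {c<..<d} then (cmod (f x))\<^sup>2 else 0))"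
    unfolding L2_normsq_def by (subst integral_restrict) (use sub in auto)
  also have "\<dots> \<le> L2_normsq a b f"
    unfolding L2_normsq_def
    by (rule integral_mono')(use assms in \<open>auto simp: square_integrable_def\<close>)
  finally show ?thesis .
qed

lemma L2_Cauchy_Schwarz_norm:
  assumes "square_integrable a b f" "square_integrable a b g"
  shows "(LINT x|lebesgue_on {a<..<b}. cmod (f x) * cmod (g x))\<^sup>2 \<le> L2_normsq a b f * L2_normsq a b g"
proof -
  define I A B where "I = (LINT x|lebesgue_on {a<..<b}. cmod (f x) * cmod (g x))"
    and "A = L2_normsq a b f" and "B = L2_normsq a b g"
  have AB: "A \<ge> 0" "B \<ge> 0" by (simp_all add: A_def B_def L2_normsq_nonneg)
  have q: "0 \<le> s\<^sup>2 * A - 2 * s * t * I + t\<^sup>2 * B" for s t :: real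
  proof -
    have "0 \<le> (LINT x|lebesgue_on {a<..<b}. (s * cmod (f x) - t * cmod (g x))\<^sup>2)" by simp
    also have "\<dots> = (LINT x|lebesgue_on {a<..<b}. s\<^sup>2 * (cmod (f x))\<^sup>2 - 2 * s * t * (cmod (f x) * cmod (g x)) + t\<^sup>2 * (cmod (g x))\<^sup>2)"
      by (simp add: power2_diff power_mult_distrib algebra_simps)
    also have "\<dots> = s\<^sup>2 * A - 2 * s * t * I + t\<^sup>2 * B"
      using assms square_integrable_norm_mult[OF assms]
      by (simp add: I_def A_def B_def L2_normsq_def square_integrable_def)
    finally show ?thesis .
  qed
  have "I\<^sup>2 \<le> A * B"
  proof (cases "B = 0")
    case True
    have "0 \<le> A - 2 * t * I" for t using q[of 1 t] True by simp
    \<comment> \<open>For nonzero I this t would make A - 2 t I equal to -1.\<close>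
    from this[of "(A + 1) / (2 * I)"] have "I = 0" by (cases "I = 0") auto
    then show ?thesis using AB by simp
  next
    case False
    \<comment> \<open>The choice s = B, t = I makes the quadratic form equal to B (A B -
      I^2).\<close>
    then have "0 \<le> B * (A * B - I\<^sup>2)"
      using q[of B I] by (simp add: algebra_simps power2_eq_square)
    then show ?thesis using False AB by (simp add: zero_le_mult_iff)
  qed
  then show ?thesis by (simp add: I_def A_def B_def)
qed

lemma L2_Cauchy_Schwarz:
  assumes "square_integrable a b f" "square_integrable a b g"
  shows "(cmod (LINT x|lebesgue_on {a<..<b}. f x * g x))\<^sup>2 \<le> L2_normsq a b f * L2_normsq a b g"
proof -
  have "cmod (LINT x|lebesgue_on {a<..<b}. f x * g x) \<le> (LINT x|lebesgue_on {a<..<b}. cmod (f x) * cmod (g x))"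
    using integral_norm_bound[of "lebesgue_on {a<..<b}" "\<lambda>x. f x * g x"] by (simp add: norm_mult)
  then have "(cmod (LINT x|lebesgue_on {a<..<b}. f x * g x))\<^sup>2 \<le>
    (LINT x|lebesgue_on {a<..<b}. cmod (f x) * cmod (g x))\<^sup>2" by (rule power_mono) simp
  with L2_Cauchy_Schwarz_norm[OF assms] show ?thesis by linarith
qed

lemma L2_integral_bound:
  assumes "square_integrable a b f" "a \<le> b"
  shows "(cmod (LINT x|lebesgue_on {a<..<b}. f x))\<^sup>2 \<le> (b - a) * L2_normsq a b f"
  using L2_Cauchy_Schwarz[OF assms(1) square_integrable_const[of a b 1]] assms(2)
  by (simp add: L2_normsq_def measure_interval mult.commute)

lemma L2_normsq_bounded:
  assumes "square_integrable a b f" "a \<le> b" and B: "\<And>x. x \<in> {a<..<b} \<Longrightarrow> cmod (f x) \<le> B"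
  shows "L2_normsq a b f \<le> (b - a) * B\<^sup>2"
proof -
  have "L2_normsq a b f \<le> (LINT x|lebesgue_on {a<..<b}. B\<^sup>2)"
    unfolding L2_normsq_def
    by (rule integral_mono) (use assms in \<open>auto simp: square_integrable_def power_mono\<close>)
  with assms(2) show ?thesis by (simp add: measure_interval)
qed

lemma L2_normsq_zero_AE:
  assumes "square_integrable a b f" "L2_normsq a b f = 0"
  shows "AE x in lebesgue_on {a<..<b}. f x = 0"
proof -
  have "AE x in lebesgue_on {a<..<b}. (cmod (f x))\<^sup>2 = 0"
    using assms integral_nonneg_eq_0_iff_AE[of "lebesgue_on {a<..<b}" "\<lambda>x. (cmod (f x))\<^sup>2"]
    by (simp add: square_integrable_def L2_normsq_def)
  then show ?thesis by (auto elim: eventually_mono)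
qed

lemma L2_dominated_convergence:
  assumes f: "square_integrable a b f" and g: "square_integrable a b g"
    and meas: "\<And>n. h n \<in> borel_measurable (lebesgue_on {a<..<b})"
    and lim: "AE x in lebesgue_on {a<..<b}. (\<lambda>n. h n x) \<longlonglongrightarrow> f x"
    and dom: "\<And>n x. x \<in> {a<..<b} \<Longrightarrow> cmod (f x - h n x) \<le> cmod (g x)"
  shows "(\<lambda>n. L2_normsq a b (\<lambda>x. f x - h n x)) \<longlonglongrightarrow> 0"
proof -
  have "(\<lambda>n. LINT x|lebesgue_on {a<..<b}. (cmod (f x - h n x))\<^sup>2) \<longlonglongrightarrow> (LINT x|lebesgue_on {a<..<b}. 0)"
  proof (rule integral_dominated_convergence[where w="\<lambda>x. (cmod (g x))\<^sup>2"])
    show "AE x in lebesgue_on {a<..<b}. (\<lambda>n. (cmod (f x - h n x))\<^sup>2) \<longlonglongrightarrow> 0"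
      using lim
    proof eventually_elim
      case (elim x)
      then have "(\<lambda>n. (cmod (f x - h n x))\<^sup>2) \<longlonglongrightarrow> (cmod (f x - f x))\<^sup>2"
        by (intro tendsto_intros)
      then show ?case by simp
    qed
    show "AE x in lebesgue_on {a<..<b}. norm ((cmod (f x - h n x))\<^sup>2) \<le> (cmod (g x))\<^sup>2" for n
      using dom by (auto simp: AE_restrict_space_iff power_mono)
  qed (use f g meas in \<open>auto simp: square_integrable_def\<close>)
  then show ?thesis by (simp add: L2_normsq_def)
qed

lemma L2_limit_obtain:
  assumes "(\<lambda>n. L2_normsq a b (\<lambda>x. f x - h n x)) \<longlonglongrightarrow> 0" "e > 0"
  obtains n where "L2_normsq a b (\<lambda>x. f x - h n x) < e"
proof -
  have "\<forall>\<^sub>F n in sequentially. L2_normsq a b (\<lambda>x. f x - h n x) < e"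
    using order_tendstoD(2)[OF assms] .
  then show ?thesis using that eventually_happens' sequentially_bot by blast
qed

section \<open>Density of test functions in L^2\<close>

lemma test_functionD:
  assumes "\<phi> \<in> test_functions a b"
  shows "smooth \<phi>" "x \<notin> {a<..<b} \<Longrightarrow> \<phi> x = 0"
  using assms by (auto simp: test_functions_def)

lemma square_integrable_smooth: "smooth \<phi> \<Longrightarrow> square_integrable a b \<phi>"
  by (intro square_integrable_continuous smooth_continuous_on)

lemma square_integrable_test_function: "\<phi> \<in> test_functions a b \<Longrightarrow> square_integrable c d \<phi>"
  using square_integrable_smooth test_functionD(1) by blast

text \<open>The radial retraction onto the disc of radius m. It is continuous, so it preserves
  continuity and pointwise limits while it makes a sequence uniformly bounded.\<close>

definition trunc :: "real \<Rightarrow> complex \<Rightarrow> complex" where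
  "trunc m z = z /\<^sub>R max 1 (cmod z / m)"

lemma trunc_bounds:
  assumes "m > 0"
  shows "cmod (trunc m z) \<le> m" "cmod (z - trunc m z) \<le> cmod z" "cmod z \<le> m \<Longrightarrow> trunc m z = z"
proof -
  define r where "r = max 1 (cmod z / m)"
  have r: "r \<ge> 1" "r * m \<ge> cmod z"
    using assms by (auto simp: r_def max_def field_simps)
  have t: "trunc m z = (1 / r) *\<^sub>R z" by (simp add: trunc_def r_def field_simps)
  show "cmod (trunc m z) \<le> m" using r by (simp add: t field_simps)
  have "z - trunc m z = (1 - 1 / r) *\<^sub>R z" by (simp add: t scaleR_left_diff_distrib)
  then have "cmod (z - trunc m z) = \<bar>1 - 1 / r\<bar> * cmod z" by (simp only: norm_scaleR)
  also have "\<dots> \<le> 1 * cmod z" using r by (intro mult_right_mono) (auto simp: field_simps)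
  finally show "cmod (z - trunc m z) \<le> cmod z" by simp
  show "trunc m z = z" if "cmod z \<le> m"
    using that assms by (simp add: trunc_def max_def)
qed

lemma continuous_on_trunc: "m > 0 \<Longrightarrow> continuous_on S (trunc m)"
  unfolding trunc_def by (intro continuous_intros) auto

lemma measurable_trunc: "m > 0 \<Longrightarrow> f \<in> borel_measurable M \<Longrightarrow> (\<lambda>x. trunc m (f x)) \<in> borel_measurable M"
  by (rule measurable_compose[OF _ borel_measurable_continuous_onI[OF continuous_on_trunc]])

text \<open>Measurability yields continuous functions that converge to f almost everywhere, but
  without a dominating function. Hence f is first truncated at some level, and then the continuous
  approximants are truncated at the same level; constants now dominate.\<close>

lemma L2_continuous_dense:
  assumes f: "square_integrable a b f" and "e > 0"
  obtains h where "continuous_on UNIV h" "L2_normsq a b (\<lambda>x. f x - h x) < e"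
proof -
  have fm: "f \<in> borel_measurable (lebesgue_on {a<..<b})" using f by (rule square_integrable_measurable)
  have "(\<lambda>n. L2_normsq a b (\<lambda>x. f x - trunc (Suc n) (f x))) \<longlonglongrightarrow> 0"
  proof (rule L2_dominated_convergence[OF f f])
    show "(\<lambda>x. trunc (Suc n) (f x)) \<in> borel_measurable (lebesgue_on {a<..<b})" for n
      using fm by (intro measurable_trunc) auto
    show "AE x in lebesgue_on {a<..<b}. (\<lambda>n. trunc (Suc n) (f x)) \<longlonglongrightarrow> f x"
    proof (rule AE_I2)
      fix x
      have "\<forall>\<^sub>F n in sequentially. f x = trunc (Suc n) (f x)"
      proof (rule eventually_sequentiallyI[of "nat \<lceil>cmod (f x)\<rceil>"])
        fix n assume "nat \<lceil>cmod (f x)\<rceil> \<le> n"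
        then have "cmod (f x) \<le> Suc n" by linarith
        then show "f x = trunc (Suc n) (f x)" using trunc_bounds(3)[of "Suc n" "f x"] by simp
      qed
      then show "(\<lambda>n. trunc (Suc n) (f x)) \<longlonglongrightarrow> f x"
        by (rule Lim_transform_eventually[OF tendsto_const])
    qed
  qed (rule trunc_bounds, simp)
  then obtain m where m: "L2_normsq a b (\<lambda>x. f x - trunc (Suc m) (f x)) < e / 4"
    by (rule L2_limit_obtain[of _ _ _ _ "e/4"]) (use \<open>e > 0\<close> in auto)
  let ?t = "trunc (Suc m)"
  have tf: "square_integrable a b (\<lambda>x. ?t (f x))"
    using fm trunc_bounds(1)[of "Suc m"] by (intro square_integrable_bounded[of _ a b "Suc m"] measurable_trunc) auto
  have "f measurable_on {a<..<b}"
    using measurable_on_iff_borel_measurable[OF sets_lebesgue_interval] fm by blast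
  then obtain N g where N: "negligible N" "\<And>n. continuous_on UNIV (g n)"
    "\<And>x. x \<notin> N \<Longrightarrow> (\<lambda>n. g n x) \<longlonglongrightarrow> (if x \<in> {a<..<b} then f x else 0)"
    by (auto simp: measurable_on_def)
  have cg: "continuous_on UNIV (\<lambda>x. ?t (g n x))" for n
    using continuous_on_compose2[OF continuous_on_trunc[of "Suc m" UNIV] N(2)] by auto
  have "(\<lambda>n. L2_normsq a b (\<lambda>x. ?t (f x) - ?t (g n x))) \<longlonglongrightarrow> 0"
  proof (rule L2_dominated_convergence[OF tf square_integrable_const[of a b "2 * Suc m"]])
    show "(\<lambda>x. ?t (g n x)) \<in> borel_measurable (lebesgue_on {a<..<b})" for n
      using cg continuous_on_subset by (blast intro: continuous_on_borel_measurable_interval)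
    have "AE x in lebesgue_on {a<..<b}. x \<notin> N"
      using AE_not_in[of N lebesgue] N(1)
      by (auto simp: negligible_iff_null_sets AE_restrict_space_iff elim: eventually_mono)
    then show "AE x in lebesgue_on {a<..<b}. (\<lambda>n. ?t (g n x)) \<longlonglongrightarrow> ?t (f x)"
    proof (rule AE_mp[OF _ AE_I2], intro impI)
      fix x assume "x \<in> space (lebesgue_on {a<..<b})" "x \<notin> N"
      then have "(\<lambda>n. g n x) \<longlonglongrightarrow> f x" using N(3)[of x] by (simp split: if_splits)
      then show "(\<lambda>n. ?t (g n x)) \<longlonglongrightarrow> ?t (f x)"
        using continuous_on_tendsto_compose[OF continuous_on_trunc[of "Suc m" UNIV], of "\<lambda>n. g n x" "f x"] by simp
    qed
    show "cmod (?t (f x) - ?t (g n x)) \<le> cmod (of_nat (2 * Suc m))" for n x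
      using norm_triangle_ineq4[of "?t (f x)" "?t (g n x)"] trunc_bounds(1)[of "Suc m" "f x"]
        trunc_bounds(1)[of "Suc m" "g n x"] unfolding norm_of_nat by simp
  qed
  then obtain n where n: "L2_normsq a b (\<lambda>x. ?t (f x) - ?t (g n x)) < e / 4"
    by (rule L2_limit_obtain[of _ _ _ _ "e/4"]) (use \<open>e > 0\<close> in auto)
  show ?thesis
  proof (rule that[OF cg[of n]])
    show "L2_normsq a b (\<lambda>x. f x - ?t (g n x)) < e"
      using L2_normsq_diff_le[OF f tf square_integrable_continuous[OF continuous_on_subset[OF cg[of n]]]] m n
      by auto
  qed
qed

text \<open>Stone-Weierstrass is applied to the real functions whose complexification lies in
  \<open>smooth_ring\<close>, once for the real and once for the imaginary part.\<close>

lemma smooth_ring_approx: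
  assumes h: "continuous_on {a..b} h" and "e > 0"
  obtains p where "p \<in> smooth_ring" "\<And>x. x \<in> {a..b} \<Longrightarrow> cmod (h x - p x) < e"
proof -
  have real: "\<exists>g. (\<lambda>x. complex_of_real (g x)) \<in> smooth_ring \<and> (\<forall>x\<in>{a..b}. \<bar>f x - g x\<bar> < e / 2)"
    if f: "continuous_on {a..b} f" for f :: "real \<Rightarrow> real"
  proof (rule Stone_Weierstrass_HOL)
    show "continuous_on {a..b} g" if "(\<lambda>x. complex_of_real (g x)) \<in> smooth_ring" for g
    proof -
      show ?thesis
        using continuous_on_Re[OF smooth_continuous_on[OF smooth_ring_smooth[OF that]], of "{a..b}"] by simp
    qed
    show "\<exists>g. (\<lambda>x. complex_of_real (g x)) \<in> smooth_ring \<and> g x \<noteq> g y"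
      if "x \<in> {a..b} \<and> y \<in> {a..b} \<and> x \<noteq> y" for x y
      using that smooth_ring.ident by (intro exI[of _ "\<lambda>x. x"]) auto
  qed (use f \<open>e > 0\<close> in \<open>auto intro: smooth_ring.intros\<close>)
  obtain g1 where g1: "(\<lambda>x. complex_of_real (g1 x)) \<in> smooth_ring" "\<And>x. x\<in>{a..b} \<Longrightarrow> \<bar>Re (h x) - g1 x\<bar> < e / 2"
    using real[of "\<lambda>x. Re (h x)"] h continuous_on_Re by blast
  obtain g2 where g2: "(\<lambda>x. complex_of_real (g2 x)) \<in> smooth_ring" "\<And>x. x\<in>{a..b} \<Longrightarrow> \<bar>Im (h x) - g2 x\<bar> < e / 2"
    using real[of "\<lambda>x. Im (h x)"] h continuous_on_Im by blast
  show ?thesis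
  proof (rule that[of "\<lambda>x. of_real (g1 x) + \<i> * of_real (g2 x)"])
    show "(\<lambda>x. of_real (g1 x) + \<i> * of_real (g2 x)) \<in> smooth_ring"
      by (intro smooth_ring.intros g1 g2)
    fix x assume x: "x \<in> {a..b}"
    have "cmod (h x - (of_real (g1 x) + \<i> * of_real (g2 x))) \<le> \<bar>Re (h x) - g1 x\<bar> + \<bar>Im (h x) - g2 x\<bar>"
      using cmod_le[of "h x - (of_real (g1 x) + \<i> * of_real (g2 x))"] by simp
    with g1(2)[OF x] g2(2)[OF x] show "cmod (h x - (of_real (g1 x) + \<i> * of_real (g2 x))) < e" by linarith
  qed
qed

lemma L2_test_functions_dense:
  assumes f: "square_integrable a b f" and "e > 0"
  obtains \<psi> where "\<psi> \<in> test_functions a b" "L2_normsq a b (\<lambda>x. f x - \<psi> x) < e"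
proof (cases "a < b")
  case False
  show ?thesis
  proof (rule that[of "\<lambda>x. 0"])
    show "(\<lambda>x. 0) \<in> test_functions a b"
      using smooth_ring_smooth[OF smooth_ring.const[of 0]]  by (auto simp: test_functions_def intro!: exI[of _ "{}"])
    show "L2_normsq a b (\<lambda>x. f x - 0) < e" using False \<open>e > 0\<close> by (simp add: L2_normsq_def)
  qed
next
  case True
  obtain h where h: "continuous_on UNIV h" "L2_normsq a b (\<lambda>x. f x - h x) < e / 4"
    by (rule L2_continuous_dense[OF f, of "e/4"]) (use \<open>e > 0\<close> in auto)
  \<comment> \<open>A uniform error d costs e/32 in the squared norm. Two applications of
    \<open>L2_normsq_diff_le\<close> then give at most 2 e/4 + 4 e/32 + 4 e/32 < e.\<close>
  define d where "d = sqrt (e / 32 / (b - a))"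
  have "d\<^sup>2 = e / 32 / (b - a)" using True \<open>e > 0\<close> by (simp add: d_def)
  moreover have "(b - a) * (e / 32 / (b - a)) = e / 32" using True by (simp only: nonzero_mult_div_cancel_left times_divide_eq_right) (simp del: divide_divide_eq_left)
  ultimately have d: "d > 0" "(b - a) * d\<^sup>2 = e / 32" using True \<open>e > 0\<close> by (auto simp only: d_def real_sqrt_gt_zero divide_pos_pos zero_less_numeral diff_gt_0_iff_gt)
  obtain p where p: "p \<in> smooth_ring" "\<And>x. x \<in> {a..b} \<Longrightarrow> cmod (h x - p x) < d"
    by (rule smooth_ring_approx[OF continuous_on_subset[OF h(1)] d(1)]) auto
  have sq: "square_integrable a b h" "square_integrable a b p"
    using square_integrable_continuous[OF continuous_on_subset[OF h(1)]] square_integrable_smooth smooth_ring_smooth p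
    by auto
  have "L2_normsq a b (\<lambda>x. h x - p x) \<le> (b - a) * d\<^sup>2"
    using p True sq by (intro L2_normsq_bounded square_integrable_diff) (auto intro: less_imp_le)
  then have hp: "L2_normsq a b (\<lambda>x. h x - p x) \<le> e / 32" using d by simp
  let ?\<psi> = "\<lambda>n x. of_real (bump n (a + 1 / Suc n) (b - 1 / Suc n) x) * p x"
  have \<psi>: "?\<psi> n \<in> test_functions a b" for n by (rule bump_mult_test_function[OF p(1)]) auto
  have "(\<lambda>n. L2_normsq a b (\<lambda>x. p x - ?\<psi> n x)) \<longlonglongrightarrow> 0"
  proof (rule L2_dominated_convergence[OF sq(2) sq(2)])
    show "?\<psi> n \<in> borel_measurable (lebesgue_on {a<..<b})" for n
      using square_integrable_test_function[OF \<psi>] square_integrable_measurable by blast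
    show "AE x in lebesgue_on {a<..<b}. (\<lambda>n. ?\<psi> n x) \<longlonglongrightarrow> p x"
    proof (rule AE_I2)
      fix x assume "x \<in> space (lebesgue_on {a<..<b})"
      then have "(\<lambda>n. ?\<psi> n x) \<longlonglongrightarrow> of_real 1 * p x"
        by (intro tendsto_intros bump_tendsto_1) auto
      then show "(\<lambda>n. ?\<psi> n x) \<longlonglongrightarrow> p x" by simp
    qed
    fix n x
    have "p x - ?\<psi> n x = of_real (1 - bump n (a + 1 / Suc n) (b - 1 / Suc n) x) * p x"
      by (simp add: algebra_simps)
    then have "cmod (p x - ?\<psi> n x) = \<bar>1 - bump n (a + 1 / Suc n) (b - 1 / Suc n) x\<bar> * cmod (p x)"
      by (simp only: norm_mult norm_of_real)
    also have "\<dots> \<le> 1 * cmod (p x)"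
      using bump_bounds[of n "a + 1 / Suc n" "b - 1 / Suc n" x] by (intro mult_right_mono) auto
    finally show "cmod (p x - ?\<psi> n x) \<le> cmod (p x)" by simp
  qed
  then obtain n where n: "L2_normsq a b (\<lambda>x. p x - ?\<psi> n x) < e / 32"
    by (rule L2_limit_obtain[of _ _ _ _ "e/32"]) (use \<open>e > 0\<close> in auto)
  show ?thesis
  proof (rule that[OF \<psi>[of n]])
    have sq\<psi>: "square_integrable a b (?\<psi> n)" using square_integrable_test_function[OF \<psi>] .
    show "L2_normsq a b (\<lambda>x. f x - ?\<psi> n x) < e"
      using L2_normsq_diff_le[OF f sq(1) sq\<psi>] L2_normsq_diff_le[OF sq(1) sq(2) sq\<psi>] n hp h(2) \<open>e > 0\<close>
      by linarith
  qed
qed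

subsection \<open>Primitives of square integrable functions\<close>

definition prim :: "real \<Rightarrow> (real \<Rightarrow> complex) \<Rightarrow> real \<Rightarrow> complex" where
  "prim a f x = (LINT y|lebesgue_on {a<..<x}. f y)"

lemma prim_self [simp]: "prim a f a = 0"
  by (simp add: prim_def)

lemma integrable_on_closed_interval:
  fixes f :: "real \<Rightarrow> 'a::euclidean_space"
  assumes "integrable (lebesgue_on {a<..<b}) f"
  shows "f integrable_on {a..b}"
  using integrable_on_lebesgue_on[OF assms] integrable_on_open_interval_real by auto

lemma LINT_interval_eq_integral:
  fixes f :: "real \<Rightarrow> 'a::euclidean_space"
  assumes "integrable (lebesgue_on {a<..<b}) f"
  shows "(LINT x|lebesgue_on {a<..<b}. f x) = integral {a..b} f"
  using lebesgue_integral_eq_integral[OF assms] integral_open_interval[of a b f] by simp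

lemma LINT_interval_split:
  fixes f :: "real \<Rightarrow> 'a::euclidean_space"
  assumes "integrable (lebesgue_on {a<..<b}) f" "a \<le> c" "c \<le> b"
  shows "(LINT x|lebesgue_on {a<..<b}. f x) = (LINT x|lebesgue_on {a<..<c}. f x) + (LINT x|lebesgue_on {c<..<b}. f x)"
proof -
  have "integrable (lebesgue_on {a<..<c}) f" "integrable (lebesgue_on {c<..<b}) f"
    using assms by (auto intro!: integrable_lebesgue_on_subset[OF assms(1)])
  with assms integrable_on_closed_interval[OF assms(1)] show ?thesis
    by (simp add: LINT_interval_eq_integral Henstock_Kurzweil_Integration.integral_combine)
qed

lemma prim_eq_integral:
  assumes "square_integrable a b f" "x \<le> b"
  shows "prim a f x = integral {a..x} f"
  unfolding prim_def
  by (rule LINT_interval_eq_integral, rule square_integrable_integrable,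
      rule square_integrable_subinterval[OF assms(1)]) (use assms in auto)

lemma continuous_on_prim:
  assumes "square_integrable a b f"
  shows "continuous_on {a..b} (prim a f)"
proof -
  have "continuous_on {a..b} (\<lambda>x. integral {a..x} f)"
    by (intro indefinite_integral_continuous_1 integrable_on_closed_interval square_integrable_integrable assms)
  then show ?thesis
    by (rule continuous_on_eq) (simp add: prim_eq_integral[OF assms])
qed

lemma square_integrable_prim: "square_integrable a b f \<Longrightarrow> square_integrable a b (prim a f)"
  by (rule square_integrable_continuous[OF continuous_on_prim])

lemma prim_add:
  assumes "square_integrable a b f" "square_integrable a b g" "x \<le> b"
  shows "prim a (\<lambda>x. f x + g x) x = prim a f x + prim a g x"
  unfolding prim_def
  by (rule Bochner_Integration.integral_add; rule square_integrable_integrable;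
      rule square_integrable_subinterval) (use assms in auto)

lemma prim_diff:
  assumes "square_integrable a b f" "square_integrable a b g" "x \<le> b"
  shows "prim a (\<lambda>x. f x - g x) x = prim a f x - prim a g x"
  unfolding prim_def
  by (rule Bochner_Integration.integral_diff; rule square_integrable_integrable;
      rule square_integrable_subinterval) (use assms in auto)

lemma prim_scale: "prim a (\<lambda>x. c * f x) x = c * prim a f x"
  by (simp add: prim_def)

lemma prim_cnj: "prim a (\<lambda>x. cnj (f x)) x = cnj (prim a f x)"
  by (simp add: prim_def)

lemma prim_cong_AE:
  assumes "square_integrable a b f" "square_integrable a b g" "x \<le> b"
    "AE x in lebesgue_on {a<..<b}. f x = g x"
  shows "prim a f x = prim a g x"
  unfolding prim_def
proof (rule integral_cong_AE)
  have "AE y in lebesgue. y \<in> {a<..<x} \<longrightarrow> f y = g y"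
    using assms by (auto simp: AE_restrict_space_iff elim!: eventually_mono)
  then show "AE y in lebesgue_on {a<..<x}. f y = g y" by (auto simp: AE_restrict_space_iff)
qed (use square_integrable_subinterval[OF assms(1)] square_integrable_subinterval[OF assms(2)] assms(3)
  in \<open>auto simp: square_integrable_def\<close>)

lemma prim_bound:
  assumes "square_integrable a b f" "x \<in> {a..b}"
  shows "(cmod (prim a f x))\<^sup>2 \<le> (b - a) * L2_normsq a b f"
proof -
  have "(cmod (prim a f x))\<^sup>2 \<le> (x - a) * L2_normsq a x f"
    unfolding prim_def using assms by (intro L2_integral_bound square_integrable_subinterval[OF assms(1)]) auto
  also have "\<dots> \<le> (b - a) * L2_normsq a b f"
    using assms by (intro mult_mono L2_normsq_subinterval L2_normsq_nonneg) auto
  finally show ?thesis .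
qed

lemma L2_normsq_prim:
  assumes "square_integrable a b f" "a \<le> b"
  shows "L2_normsq a b (prim a f) \<le> (b - a)\<^sup>2 * L2_normsq a b f"
proof -
  have "cmod (prim a f x) \<le> sqrt ((b - a) * L2_normsq a b f)" if "x \<in> {a<..<b}" for x
    using prim_bound[OF assms(1), of x] that by (intro real_le_rsqrt) auto
  then have "L2_normsq a b (prim a f) \<le> (b - a) * (sqrt ((b - a) * L2_normsq a b f))\<^sup>2"
    by (intro L2_normsq_bounded square_integrable_prim assms)
  with assms(2) show ?thesis by (simp add: L2_normsq_nonneg power2_eq_square mult_ac)
qed

lemma prim_eq_diff:
  assumes "\<And>x. x \<in> {a..b} \<Longrightarrow> (F has_vector_derivative f x) (at x within {a..b})"
    "square_integrable a b f" "x \<in> {a..b}"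
  shows "prim a f x = F x - F a"
proof -
  have "(f has_integral (F x - F a)) {a..x}"
    using assms by (intro fundamental_theorem_of_calculus)
      (auto intro: has_vector_derivative_within_subset[of F _ _ "{a..b}"])
  with assms show ?thesis by (simp add: prim_eq_integral[OF assms(2)] integral_unique)
qed

lemma prim_has_vector_derivative:
  assumes "continuous_on {a..b} f" "x \<in> {a..b}"
  shows "(prim a f has_vector_derivative f x) (at x within {a..b})"
proof -
  have "((\<lambda>u. integral {a..u} f) has_vector_derivative f x) (at x within {a..b})"
    using assms by (rule integral_has_vector_derivative)
  then show ?thesis
    by (rule has_vector_derivative_transform[OF assms(2), rotated])
      (use prim_eq_integral[OF square_integrable_continuous[OF assms(1)]] in auto)
qed

lemma prim_mult_continuous:
  assumes f: "continuous_on {a..b} f" and g: "continuous_on {a..b} g" and "a \<le> b"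
  shows "(LINT x|lebesgue_on {a<..<b}. prim a f x * g x) + (LINT x|lebesgue_on {a<..<b}. f x * prim a g x)
    = prim a f b * prim a g b"
proof -
  note sq = square_integrable_continuous[OF f] square_integrable_continuous[OF g]
  let ?h = "\<lambda>x. prim a f x * g x + f x * prim a g x"
  have "square_integrable a b ?h"
    using f g by (intro square_integrable_continuous continuous_intros continuous_on_prim sq)
  then have "prim a ?h b = prim a f b * prim a g b - prim a f a * prim a g a"
    using assms by (intro prim_eq_diff) (auto intro!: has_vector_derivative_mult prim_has_vector_derivative)
  moreover have "prim a ?h b = (LINT x|lebesgue_on {a<..<b}. prim a f x * g x) + (LINT x|lebesgue_on {a<..<b}. f x * prim a g x)"
    unfolding prim_def[of a ?h]
    by (intro Bochner_Integration.integral_add square_integrable_mult square_integrable_prim sq)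
  ultimately show ?thesis by simp
qed

text \<open>The defect in the formula of integration by parts. It vanishes on continuous functions
  by the product rule and is bounded in the L^2 norms of its arguments, so density makes it vanish
  altogether.\<close>

definition prim_form :: "real \<Rightarrow> real \<Rightarrow> (real \<Rightarrow> complex) \<Rightarrow> (real \<Rightarrow> complex) \<Rightarrow> complex" where
  "prim_form a b f g = (LINT x|lebesgue_on {a<..<b}. prim a f x * g x) +
     (LINT x|lebesgue_on {a<..<b}. f x * prim a g x) - prim a f b * prim a g b"

lemma prim_form_commute: "prim_form a b f g = prim_form a b g f"
  by (simp add: prim_form_def mult.commute)

lemma prim_form_bound:
  assumes "square_integrable a b f" "square_integrable a b g" "a \<le> b"
  shows "(cmod (prim_form a b f g))\<^sup>2 \<le> 9 * (b - a)\<^sup>2 * L2_normsq a b f * L2_normsq a b g"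
proof -
  define K where "K = (b - a)\<^sup>2 * L2_normsq a b f * L2_normsq a b g"
  let ?A = "LINT x|lebesgue_on {a<..<b}. prim a f x * g x"
  let ?B = "LINT x|lebesgue_on {a<..<b}. f x * prim a g x"
  let ?C = "prim a f b * prim a g b"
  have K0: "K \<ge> 0" by (simp add: K_def L2_normsq_nonneg)
  have "(cmod ?A)\<^sup>2 \<le> L2_normsq a b (prim a f) * L2_normsq a b g"
    by (intro L2_Cauchy_Schwarz square_integrable_prim assms)
  also have "\<dots> \<le> K"
    unfolding K_def by (intro mult_right_mono L2_normsq_prim assms L2_normsq_nonneg)
  finally have A: "cmod ?A \<le> sqrt K" by (rule real_le_rsqrt)
  have "(cmod ?B)\<^sup>2 \<le> L2_normsq a b f * L2_normsq a b (prim a g)"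
    by (intro L2_Cauchy_Schwarz square_integrable_prim assms)
  also have "\<dots> \<le> L2_normsq a b f * ((b - a)\<^sup>2 * L2_normsq a b g)"
    by (intro mult_left_mono L2_normsq_prim assms L2_normsq_nonneg)
  finally have "(cmod ?B)\<^sup>2 \<le> K" by (simp add: K_def mult_ac)
  then have B: "cmod ?B \<le> sqrt K" by (rule real_le_rsqrt)
  have "(cmod ?C)\<^sup>2 \<le> ((b - a) * L2_normsq a b f) * ((b - a) * L2_normsq a b g)"
    unfolding norm_mult power_mult_distrib using assms
    by (intro mult_mono prim_bound mult_nonneg_nonneg L2_normsq_nonneg) auto
  then have "(cmod ?C)\<^sup>2 \<le> K" by (simp add: K_def mult_ac power2_eq_square)
  then have C: "cmod ?C \<le> sqrt K" by (rule real_le_rsqrt)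
  have "cmod (prim_form a b f g) \<le> 3 * sqrt K"
    unfolding prim_form_def using A B C norm_triangle_ineq[of ?A ?B] norm_triangle_ineq4[of "?A + ?B" ?C] by linarith
  then have "(cmod (prim_form a b f g))\<^sup>2 \<le> (3 * sqrt K)\<^sup>2" by (rule power_mono) simp
  also have "\<dots> = 9 * K" using K0 by (simp add: power_mult_distrib)
  finally show ?thesis by (simp add: K_def mult_ac)
qed

lemma prim_form_diff:
  assumes "square_integrable a b f" "square_integrable a b h" "square_integrable a b g"
  shows "prim_form a b (\<lambda>x. f x - h x) g = prim_form a b f g - prim_form a b h g"
proof -
  have "(LINT x|lebesgue_on {a<..<b}. prim a (\<lambda>x. f x - h x) x * g x) =
      (LINT x|lebesgue_on {a<..<b}. prim a f x * g x - prim a h x * g x)"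
    by (rule Bochner_Integration.integral_cong) (auto simp: prim_diff[OF assms(1,2)] algebra_simps)
  also have "\<dots> = (LINT x|lebesgue_on {a<..<b}. prim a f x * g x) - (LINT x|lebesgue_on {a<..<b}. prim a h x * g x)"
    by (intro Bochner_Integration.integral_diff square_integrable_mult square_integrable_prim assms)
  finally have 1: "(LINT x|lebesgue_on {a<..<b}. prim a (\<lambda>x. f x - h x) x * g x) = \<dots>" .
  have "(LINT x|lebesgue_on {a<..<b}. (f x - h x) * prim a g x) =
      (LINT x|lebesgue_on {a<..<b}. f x * prim a g x - h x * prim a g x)"
    by (rule Bochner_Integration.integral_cong) (auto simp: algebra_simps)
  also have "\<dots> = (LINT x|lebesgue_on {a<..<b}. f x * prim a g x) - (LINT x|lebesgue_on {a<..<b}. h x * prim a g x)"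
    by (intro Bochner_Integration.integral_diff square_integrable_mult square_integrable_prim assms)
  finally have 2: "(LINT x|lebesgue_on {a<..<b}. (f x - h x) * prim a g x) = \<dots>" .
  show ?thesis unfolding prim_form_def 1 2 prim_diff[OF assms(1,2) order_refl] by (simp add: algebra_simps)
qed

lemma zero_if_le_all_positive:
  fixes z :: complex
  assumes "\<And>e. e > 0 \<Longrightarrow> (cmod z)\<^sup>2 \<le> K * e" "K \<ge> 0"
  shows "z = 0"
proof (rule ccontr)
  assume "z \<noteq> 0"
  then have z: "(cmod z)\<^sup>2 > 0" by simp
  have "(cmod z)\<^sup>2 \<le> K * ((cmod z)\<^sup>2 / (2 * (K + 1)))"
    using assms z by (intro assms(1)) auto
  also have "\<dots> = (K / (K + 1)) * ((cmod z)\<^sup>2 / 2)" by simp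
  also have "\<dots> \<le> 1 * ((cmod z)\<^sup>2 / 2)"
    using assms(2) by (intro mult_right_mono) (auto simp: field_simps)
  finally show False using z by simp
qed

lemma L2_continuous_approx:
  assumes "square_integrable a b f" "e > 0"
  obtains h where "continuous_on {a..b} h" "L2_normsq a b (\<lambda>x. f x - h x) \<le> e"
  by (rule L2_continuous_dense[OF assms]) (meson continuous_on_subset less_imp_le subset_UNIV)

lemma prim_mult:
  assumes f: "square_integrable a b f" and g: "square_integrable a b g" and "a \<le> b"
  shows "(LINT x|lebesgue_on {a<..<b}. prim a f x * g x) + (LINT x|lebesgue_on {a<..<b}. f x * prim a g x)
    = prim a f b * prim a g b"
proof -
  \<comment> \<open>Density is used for one argument at a time: this reduces the first argument to
    continuous functions, and the symmetry of the form then brings the second one into its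
    place.\<close>
  have step: "prim_form a b f g = 0"
    if f: "square_integrable a b f" and g: "square_integrable a b g"
      and c: "\<And>h. continuous_on {a..b} h \<Longrightarrow> prim_form a b h g = 0" for f g
  proof (rule zero_if_le_all_positive[where K="9 * (b - a)\<^sup>2 * L2_normsq a b g"])
    fix e :: real assume "e > 0"
    then obtain h where h: "continuous_on {a..b} h" "L2_normsq a b (\<lambda>x. f x - h x) \<le> e"
      by (rule L2_continuous_approx[OF f])
    have sh: "square_integrable a b h" by (rule square_integrable_continuous[OF h(1)])
    have "prim_form a b f g = prim_form a b (\<lambda>x. f x - h x) g"
      using c[OF h(1)] by (simp add: prim_form_diff[OF f sh g])
    also have "(cmod \<dots>)\<^sup>2 \<le> 9 * (b - a)\<^sup>2 * L2_normsq a b (\<lambda>x. f x - h x) * L2_normsq a b g"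
      by (intro prim_form_bound square_integrable_diff f g sh \<open>a \<le> b\<close>)
    also have "\<dots> \<le> 9 * (b - a)\<^sup>2 * e * L2_normsq a b g"
      using h(2) by (intro mult_mono mult_left_mono L2_normsq_nonneg) (auto simp: \<open>e > 0\<close> less_imp_le)
    finally show "(cmod (prim_form a b f g))\<^sup>2 \<le> 9 * (b - a)\<^sup>2 * L2_normsq a b g * e" by (simp add: mult_ac)
  qed (simp add: L2_normsq_nonneg)
  have cc: "prim_form a b h k = 0" if "continuous_on {a..b} h" "continuous_on {a..b} k" for h k
    using prim_mult_continuous[OF that \<open>a \<le> b\<close>] by (simp add: prim_form_def)
  have "prim_form a b f g = 0"
  proof (rule step[OF f g])
    fix h :: "real \<Rightarrow> complex" assume h: "continuous_on {a..b} h"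
    have "prim_form a b g h = 0"
      by (rule step[OF g square_integrable_continuous[OF h]]) (rule cc[OF _ h])
    then show "prim_form a b h g = 0" by (simp add: prim_form_commute)
  qed
  then show ?thesis by (simp add: prim_form_def)
qed

lemma prim_by_parts:
  assumes g: "square_integrable a b g" and "a \<le> b"
    and Q: "\<And>x. x \<in> {a..b} \<Longrightarrow> (Q has_vector_derivative q x) (at x within {a..b})" and q: "continuous_on {a..b} q"
  shows "(LINT x|lebesgue_on {a<..<b}. prim a g x * q x) = prim a g b * Q b - (LINT x|lebesgue_on {a<..<b}. g x * Q x)"
proof -
  note sq = square_integrable_continuous[OF q]
  have pq: "prim a q x = Q x - Q a" if "x \<in> {a..b}" for x
    by (rule prim_eq_diff[OF Q sq that])
  have contQ: "continuous_on {a..b} Q"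
    using Q by (meson continuous_on_eq_continuous_within has_vector_derivative_continuous)
  have "(LINT x|lebesgue_on {a<..<b}. g x * prim a q x) = (LINT x|lebesgue_on {a<..<b}. g x * Q x - g x * Q a)"
    by (rule Bochner_Integration.integral_cong) (auto simp: pq algebra_simps)
  also have "\<dots> = (LINT x|lebesgue_on {a<..<b}. g x * Q x) - (LINT x|lebesgue_on {a<..<b}. g x * Q a)"
    by (intro Bochner_Integration.integral_diff square_integrable_mult g square_integrable_continuous contQ
        square_integrable_const)
  also have "(LINT x|lebesgue_on {a<..<b}. g x * Q a) = prim a g b * Q a" by (simp add: prim_def)
  finally have "(LINT x|lebesgue_on {a<..<b}. g x * prim a q x) = (LINT x|lebesgue_on {a<..<b}. g x * Q x) - prim a g b * Q a" .
  note by_parts = this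
  have "(LINT x|lebesgue_on {a<..<b}. prim a g x * q x) + (LINT x|lebesgue_on {a<..<b}. g x * prim a q x) =
      prim a g b * (Q b - Q a)"
    using prim_mult[OF g sq \<open>a \<le> b\<close>] pq[of b] \<open>a \<le> b\<close> by simp
  then have "(LINT x|lebesgue_on {a<..<b}. prim a g x * q x) =
      prim a g b * (Q b - Q a) - (LINT x|lebesgue_on {a<..<b}. g x * prim a q x)"
    by (simp only: eq_diff_eq)
  then show ?thesis unfolding by_parts by (simp add: algebra_simps)
qed

subsection \<open>Weak derivatives and traces\<close>

lemma test_function_mono:
  "\<phi> \<in> test_functions c d \<Longrightarrow> a \<le> c \<Longrightarrow> d \<le> b \<Longrightarrow> \<phi> \<in> test_functions a b"
  unfolding test_functions_def by force

lemma test_function_deriv: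
  assumes "\<phi> \<in> test_functions a b"
  shows "(\<lambda>x. vector_derivative \<phi> (at x)) \<in> test_functions a b"
proof -
  obtain K where K: "compact K" "K \<subseteq> {a<..<b}" "\<And>x. x \<notin> K \<Longrightarrow> \<phi> x = 0"
    using assms by (auto simp: test_functions_def)
  have "vector_derivative \<phi> (at x) = 0" if "x \<notin> K" for x
  proof -
    have "((\<lambda>x. 0) has_vector_derivative 0) (at x)" by simp
    then have "(\<phi> has_vector_derivative 0) (at x)"
    proof (rule has_vector_derivative_transform_within_open)
      show "open (- K)" using K(1) by (simp add: compact_imp_closed open_Compl)
    qed (use K that in auto)
    then show ?thesis by (rule vector_derivative_at)
  qed
  with K smooth_vector_derivative[OF test_functionD(1)[OF assms]] show ?thesis
    by (auto simp: test_functions_def)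
qed

lemma test_function_deriv_zero:
  "\<phi> \<in> test_functions a b \<Longrightarrow> x \<notin> {a<..<b} \<Longrightarrow> vector_derivative \<phi> (at x) = 0"
  using test_functionD(2)[OF test_function_deriv] by blast

lemma test_function_prim:
  assumes "\<phi> \<in> test_functions a b" "x \<in> {a..b}"
  shows "prim a (\<lambda>x. vector_derivative \<phi> (at x)) x = \<phi> x"
proof -
  have "prim a (\<lambda>x. vector_derivative \<phi> (at x)) x = \<phi> x - \<phi> a"
    by (rule prim_eq_diff[OF _ square_integrable_smooth[OF smooth_vector_derivative] assms(2)])
      (auto intro: has_vector_derivative_at_within smooth_has_vector_derivative test_functionD(1)[OF assms(1)])
  also have "\<phi> a = 0" by (rule test_functionD(2)[OF assms(1)]) simp
  finally show ?thesis by simp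
qed

text \<open>Test functions approximate \<open>cnj h\<close>, so orthogonality passes to the integral
  of |h|^2.\<close>

lemma AE_zero_if_orthogonal_to_test_functions:
  assumes h: "square_integrable a b h"
    and z: "\<And>\<phi>. \<phi> \<in> test_functions a b \<Longrightarrow> (LINT x|lebesgue_on {a<..<b}. h x * \<phi> x) = 0"
  shows "AE x in lebesgue_on {a<..<b}. h x = 0"
proof (rule L2_normsq_zero_AE[OF h])
  have c: "(LINT x|lebesgue_on {a<..<b}. h x * cnj (h x)) = of_real (L2_normsq a b h)"
    unfolding L2_normsq_def complex_norm_square[symmetric] by (rule integral_complex_of_real)
  have "(LINT x|lebesgue_on {a<..<b}. h x * cnj (h x)) = 0"
  proof (rule zero_if_le_all_positive[where K="L2_normsq a b h"])
    fix e :: real assume "e > 0"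
    obtain \<psi> where \<psi>: "\<psi> \<in> test_functions a b" "L2_normsq a b (\<lambda>x. cnj (h x) - \<psi> x) < e"
      by (rule L2_test_functions_dense[OF square_integrable_cnj[OF h] \<open>e > 0\<close>])
    note s = square_integrable_test_function[OF \<psi>(1)]
    have "(LINT x|lebesgue_on {a<..<b}. h x * (cnj (h x) - \<psi> x)) =
        (LINT x|lebesgue_on {a<..<b}. h x * cnj (h x)) - (LINT x|lebesgue_on {a<..<b}. h x * \<psi> x)"
      by (simp add: right_diff_distrib square_integrable_mult[OF h square_integrable_cnj[OF h]] square_integrable_mult[OF h s])
    then have "(cmod (LINT x|lebesgue_on {a<..<b}. h x * cnj (h x)))\<^sup>2 =
        (cmod (LINT x|lebesgue_on {a<..<b}. h x * (cnj (h x) - \<psi> x)))\<^sup>2"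
      using z[OF \<psi>(1)] by simp
    also have "\<dots> \<le> L2_normsq a b h * L2_normsq a b (\<lambda>x. cnj (h x) - \<psi> x)"
      by (intro L2_Cauchy_Schwarz h square_integrable_diff square_integrable_cnj s)
    also have "\<dots> \<le> L2_normsq a b h * e"
      using \<psi>(2) by (intro mult_left_mono L2_normsq_nonneg) auto
    finally show "(cmod (LINT x|lebesgue_on {a<..<b}. h x * cnj (h x)))\<^sup>2 \<le> L2_normsq a b h * e" .
  qed (rule L2_normsq_nonneg)
  with c show "L2_normsq a b h = 0" by simp
qed

lemma has_weak_deriv_unique:
  assumes "square_integrable a b g" "square_integrable a b h" "has_weak_deriv a b f g" "has_weak_deriv a b f h"
  shows "AE x in lebesgue_on {a<..<b}. g x = h x"
proof -
  have "AE x in lebesgue_on {a<..<b}. g x - h x = 0"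
  proof (rule AE_zero_if_orthogonal_to_test_functions)
    fix \<phi> assume \<phi>: "\<phi> \<in> test_functions a b"
    have "(LINT x|lebesgue_on {a<..<b}. g x * \<phi> x) = (LINT x|lebesgue_on {a<..<b}. h x * \<phi> x)"
      using assms(3,4) \<phi> unfolding has_weak_deriv_def by (metis neg_equal_iff_equal)
    moreover note square_integrable_mult[OF assms(1) square_integrable_test_function[OF \<phi>]]
      square_integrable_mult[OF assms(2) square_integrable_test_function[OF \<phi>]]
    ultimately show "(LINT x|lebesgue_on {a<..<b}. (g x - h x) * \<phi> x) = 0"
      by (simp add: left_diff_distrib)
  qed (intro square_integrable_diff assms)
  then show ?thesis by simp
qed

lemma has_weak_deriv_cong_AE:
  assumes "square_integrable a b f" "square_integrable a b f'" "AE x in lebesgue_on {a<..<b}. f x = f' x"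
    and "square_integrable a b g" "square_integrable a b g'" "AE x in lebesgue_on {a<..<b}. g x = g' x"
    and w: "has_weak_deriv a b f g"
  shows "has_weak_deriv a b f' g'"
  unfolding has_weak_deriv_def
proof
  have cong: "(LINT x|lebesgue_on {a<..<b}. u x * \<phi> x) = (LINT x|lebesgue_on {a<..<b}. v x * \<phi> x)"
    if "square_integrable a b u" "square_integrable a b v" "AE x in lebesgue_on {a<..<b}. u x = v x"
      "square_integrable a b \<phi>" for u v \<phi>
    by (rule integral_cong_AE) (use that in \<open>auto simp: square_integrable_def elim!: eventually_mono\<close>)
  fix \<phi> assume \<phi>: "\<phi> \<in> test_functions a b"
  show "(LINT x|lebesgue_on {a<..<b}. f' x * vector_derivative \<phi> (at x)) =
         - (LINT x|lebesgue_on {a<..<b}. g' x * \<phi> x)"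
    using w \<phi> cong[OF assms(1-3) square_integrable_test_function[OF test_function_deriv[OF \<phi>]]]
      cong[OF assms(4-6) square_integrable_test_function[OF \<phi>]]
    by (simp add: has_weak_deriv_def)
qed

lemma has_weak_deriv_prim:
  assumes g: "square_integrable a b g"
  shows "has_weak_deriv a b (\<lambda>x. c + prim a g x) g"
  unfolding has_weak_deriv_def
proof
  fix \<phi> assume \<phi>: "\<phi> \<in> test_functions a b"
  show "(LINT x|lebesgue_on {a<..<b}. (c + prim a g x) * vector_derivative \<phi> (at x)) =
         - (LINT x|lebesgue_on {a<..<b}. g x * \<phi> x)"
  proof (cases "a \<le> b")
    case True
    let ?\<phi>' = "\<lambda>x. vector_derivative \<phi> (at x)"
    have sm: "smooth \<phi>" "smooth ?\<phi>'"
      using test_functionD(1)[OF \<phi>] smooth_vector_derivative by blast+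
    have "(LINT x|lebesgue_on {a<..<b}. prim a g x * ?\<phi>' x) = prim a g b * \<phi> b - (LINT x|lebesgue_on {a<..<b}. g x * \<phi> x)"
      by (rule prim_by_parts[OF g True])
        (auto intro: has_vector_derivative_at_within smooth_has_vector_derivative smooth_continuous_on sm)
    moreover have "\<phi> b = 0" by (rule test_functionD(2)[OF \<phi>]) simp
    moreover have "(LINT x|lebesgue_on {a<..<b}. ?\<phi>' x) = 0"
      using test_function_prim[OF \<phi>, of b] True \<open>\<phi> b = 0\<close> by (simp add: prim_def)
    moreover have "(LINT x|lebesgue_on {a<..<b}. (c + prim a g x) * ?\<phi>' x) =
        c * (LINT x|lebesgue_on {a<..<b}. ?\<phi>' x) + (LINT x|lebesgue_on {a<..<b}. prim a g x * ?\<phi>' x)"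
      using square_integrable_mult[OF square_integrable_prim[OF g] square_integrable_smooth[OF sm(2)]]
        square_integrable_integrable[OF square_integrable_smooth[OF sm(2)]]
      by (simp add: distrib_right)
    ultimately show ?thesis by simp
  qed simp
qed

lemma has_weak_deriv_subinterval:
  assumes w: "has_weak_deriv a b f g" and "a \<le> c" "d \<le> b"
  shows "has_weak_deriv c d f g"
  unfolding has_weak_deriv_def
proof
  fix \<phi> assume \<phi>: "\<phi> \<in> test_functions c d"
  have restr: "(LINT x|lebesgue_on {a<..<b}. u x * \<psi> x) = (LINT x|lebesgue_on {c<..<d}. u x * \<psi> x)"
    if "\<And>x. x \<notin> {c<..<d} \<Longrightarrow> \<psi> x = 0" for u \<psi> :: "real \<Rightarrow> complex"
  proof -
    have "(LINT x|lebesgue_on {c<..<d}. u x * \<psi> x) =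
        (LINT x|lebesgue_on {a<..<b}. (if x \<in> {c<..<d} then u x * \<psi> x else 0))"
      using assms by (intro integral_restrict[symmetric]) auto
    also have "\<dots> = (LINT x|lebesgue_on {a<..<b}. u x * \<psi> x)"
      by (rule Bochner_Integration.integral_cong) (use that in \<open>auto simp del: greaterThanLessThan_iff\<close>)
    finally show ?thesis by simp
  qed
  show "(LINT x|lebesgue_on {c<..<d}. f x * vector_derivative \<phi> (at x)) = - (LINT x|lebesgue_on {c<..<d}. g x * \<phi> x)"
    using w[unfolded has_weak_deriv_def, rule_format, OF test_function_mono[OF \<phi> assms(2,3)]]
      restr[of "\<lambda>x. vector_derivative \<phi> (at x)" f, OF test_function_deriv_zero[OF \<phi>]]
      restr[of \<phi> g, OF test_functionD(2)[OF \<phi>]]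
    by simp
qed

section \<open>Mean-zero test functions and the lemma of du Bois-Reymond\<close>

lemma smooth_add:
  assumes "smooth f" "smooth g"
  shows "smooth (\<lambda>x. f x + g x)"
proof (rule smooth_if_closed_under_derivative[where F="{\<lambda>x. u x + v x | u v. smooth u \<and> smooth v}"])
  fix f assume "f \<in> {\<lambda>x. u x + v x | u v. smooth u \<and> smooth v}"
  then obtain u v where u: "f = (\<lambda>x. u x + v x)" "smooth u" "smooth v" by auto
  show "\<exists>f'\<in>{\<lambda>x. u x + v x | u v. smooth u \<and> smooth v}. \<forall>x. (f has_vector_derivative f' x) (at x)"
  proof
    show "\<forall>x. (f has_vector_derivative vector_derivative u (at x) + vector_derivative v (at x)) (at x)"
      unfolding u(1) by (intro allI has_vector_derivative_add smooth_has_vector_derivative u)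
    show "(\<lambda>x. vector_derivative u (at x) + vector_derivative v (at x)) \<in> {\<lambda>x. u x + v x | u v. smooth u \<and> smooth v}"
      unfolding mem_Collect_eq
      by (rule exI[of _ "\<lambda>x. vector_derivative u (at x)"], rule exI[of _ "\<lambda>x. vector_derivative v (at x)"])
        (use smooth_vector_derivative[OF u(2)] smooth_vector_derivative[OF u(3)] in simp)
  qed
qed (use assms in auto)

lemma smooth_scale:
  assumes "smooth f"
  shows "smooth (\<lambda>x. c * f x)"
proof (rule smooth_if_closed_under_derivative[where F="{\<lambda>x. c * u x | u. smooth u}"])
  fix f assume "f \<in> {\<lambda>x. c * u x | u. smooth u}"
  then obtain u where u: "f = (\<lambda>x. c * u x)" "smooth u" by auto
  show "\<exists>f'\<in>{\<lambda>x. c * u x | u. smooth u}. \<forall>x. (f has_vector_derivative f' x) (at x)"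
  proof
    show "\<forall>x. (f has_vector_derivative c * vector_derivative u (at x)) (at x)"
      unfolding u(1) by (intro allI has_vector_derivative_mult_right smooth_has_vector_derivative u)
    show "(\<lambda>x. c * vector_derivative u (at x)) \<in> {\<lambda>x. c * u x | u. smooth u}"
      unfolding mem_Collect_eq
      by (rule exI[of _ "\<lambda>x. vector_derivative u (at x)"]) (use smooth_vector_derivative[OF u(2)] in simp)
  qed
qed (use assms in auto)

lemma test_function_add:
  assumes "\<phi> \<in> test_functions a b" "\<psi> \<in> test_functions a b"
  shows "(\<lambda>x. \<phi> x + \<psi> x) \<in> test_functions a b"
proof -
  obtain K L where K: "compact K" "K \<subseteq> {a<..<b}" "\<And>x. x \<notin> K \<Longrightarrow> \<phi> x = 0"
    and L: "compact L" "L \<subseteq> {a<..<b}" "\<And>x. x \<notin> L \<Longrightarrow> \<psi> x = 0"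
    using assms by (auto simp: test_functions_def)
  have "compact (K \<union> L)" "K \<union> L \<subseteq> {a<..<b}" using K L by auto
  moreover have "\<forall>x. x \<notin> K \<union> L \<longrightarrow> \<phi> x + \<psi> x = 0" using K(3) L(3) by simp
  ultimately show ?thesis
    using smooth_add[OF assms[THEN test_functionD(1)]] unfolding test_functions_def by blast
qed

lemma test_function_scale: "\<phi> \<in> test_functions a b \<Longrightarrow> (\<lambda>x. c * \<phi> x) \<in> test_functions a b"
  using smooth_scale by (auto simp: test_functions_def)

text \<open>Left of the support of \<psi> the primitive is 0, and right of it it has its final
  value, which is the vanishing total integral; so the primitive has compact support again.\<close>

lemma test_function_primitive:
  assumes \<psi>: "\<psi> \<in> test_functions a b" and "prim a \<psi> b = 0" and "a < b"
  obtains \<phi> where "\<phi> \<in> test_functions a b" "\<And>x. vector_derivative \<phi> (at x) = \<psi> x"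
proof -
  obtain c d where cd: "a < c" "c \<le> d" "d < b" "\<And>x. x \<notin> {c..d} \<Longrightarrow> \<psi> x = 0"
  proof -
    obtain K where K: "compact K" "K \<subseteq> {a<..<b}" "\<And>x. x \<notin> K \<Longrightarrow> \<psi> x = 0"
      using \<psi> by (auto simp: test_functions_def)
    show ?thesis
    proof (cases "K = {}")
      case True
      then show ?thesis using that[of "(a + b) / 2" "(a + b) / 2"] K \<open>a < b\<close> by auto
    next
      case False
      obtain c where c: "c \<in> K" "\<And>x. x \<in> K \<Longrightarrow> c \<le> x" using compact_attains_inf[OF K(1) False] by auto
      obtain d where d: "d \<in> K" "\<And>x. x \<in> K \<Longrightarrow> x \<le> d" using compact_attains_sup[OF K(1) False] by auto
      show ?thesis
      proof (rule that[of c d])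
        show "\<psi> x = 0" if "x \<notin> {c..d}" for x
          using that c(2)[of x] d(2)[of x] K(3)[of x] by auto
      qed (use c d K(2) in auto)
    qed
  qed
  define \<phi> where "\<phi> = (\<lambda>x. if x \<in> {a..b} then prim a \<psi> x else 0)"
  note sm = test_functionD(1)[OF \<psi>]
  note sq = square_integrable_smooth[OF sm]
  have zero: "\<phi> x = 0" if "x \<notin> {c..d}" for x
  proof (cases "x \<in> {a..b}")
    case True
    have "x < c \<or> x > d" using that by auto
    then consider "x < c" | "x > d" by blast
    then have "prim a \<psi> x = 0"
    proof cases
      case 1
      then have "prim a \<psi> x = (LINT y|lebesgue_on {a<..<x}. 0)"
        unfolding prim_def by (intro Bochner_Integration.integral_cong) (auto intro!: cd(4))
      then show ?thesis by simp
    next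
      case 2
      have "prim a \<psi> b = prim a \<psi> x + (LINT y|lebesgue_on {x<..<b}. \<psi> y)"
        unfolding prim_def using True by (intro LINT_interval_split square_integrable_integrable sq) auto
      also have "(LINT y|lebesgue_on {x<..<b}. \<psi> y) = (LINT y|lebesgue_on {x<..<b}. 0)"
        using 2 by (intro Bochner_Integration.integral_cong) (auto intro!: cd(4))
      finally show ?thesis using assms(2) by simp
    qed
    then show ?thesis by (simp add: \<phi>_def)
  next
    case False
    then show ?thesis unfolding \<phi>_def by (rule if_not_P)
  qed
  have deriv: "(\<phi> has_vector_derivative \<psi> x) (at x)" for x
  proof (cases "x \<in> {a<..<b}")
    case True
    have "(prim a \<psi> has_vector_derivative \<psi> x) (at x within {a..b})"
      using True by (intro prim_has_vector_derivative smooth_continuous_on sm) auto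
    then have "(prim a \<psi> has_vector_derivative \<psi> x) (at x)"
      using True at_within_Icc_at[of a x b] by simp
    then show ?thesis
    proof (rule has_vector_derivative_transform_within_open)
      show "open {a<..<b}" "x \<in> {a<..<b}" using True by auto
      show "prim a \<psi> y = \<phi> y" if "y \<in> {a<..<b}" for y using that by (simp add: \<phi>_def)
    qed
  next
    case False
    then have x: "x \<notin> {c..d}" using cd by auto
    have "((\<lambda>x. 0) has_vector_derivative 0) (at x)" by simp
    then have "(\<phi> has_vector_derivative 0) (at x)"
    proof (rule has_vector_derivative_transform_within_open)
      show "open (- {c..d})" by (simp add: open_Compl)
      show "x \<in> - {c..d}" using x by simp
      show "0 = \<phi> y" if "y \<in> - {c..d}" for y using that zero by simp
    qed
    then show ?thesis using cd(4)[OF x] by simp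
  qed
  show ?thesis
  proof (rule that)
    show "\<phi> \<in> test_functions a b"
      using smooth_if_has_smooth_derivative[OF deriv sm] zero cd
      by (auto simp: test_functions_def intro!: exI[of _ "{c..d}"])
    show "vector_derivative \<phi> (at x) = \<psi> x" for x
      using deriv by (rule vector_derivative_at)
  qed
qed

lemma test_function_mean_one:
  assumes "a < b"
  obtains \<rho> where "\<rho> \<in> test_functions a b" "prim a \<rho> b = 1"
proof -
  \<comment> \<open>The tolerance is the squared norm of the constant 1: a mean-zero \<rho> would be
    orthogonal to 1, hence at squared distance at least b - a from it. Scaling then normalises the
    mean.\<close>
  obtain \<rho> where \<rho>: "\<rho> \<in> test_functions a b" "L2_normsq a b (\<lambda>x. 1 - \<rho> x) < b - a"
    by (rule L2_test_functions_dense[OF square_integrable_const[of a b 1], of "b - a"]) (use \<open>a < b\<close> in auto)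
  have s: "square_integrable a b \<rho>" by (rule square_integrable_test_function[OF \<rho>(1)])
  have "prim a \<rho> b \<noteq> 0"
  proof
    assume "prim a \<rho> b = 0"
    then have "prim a (\<lambda>x. 1 - \<rho> x) b = of_real (b - a)"
      using \<open>a < b\<close> by (subst prim_diff[OF square_integrable_const s order_refl])
        (simp add: prim_def measure_interval scaleR_conv_of_real)
    then have "(b - a)\<^sup>2 \<le> (b - a) * L2_normsq a b (\<lambda>x. 1 - \<rho> x)"
      using prim_bound[OF square_integrable_diff[OF square_integrable_const[of a b 1] s], of b] \<open>a < b\<close>
      by (simp only: norm_of_real power2_abs) auto
    also have "\<dots> < (b - a) * (b - a)" using \<rho>(2) \<open>a < b\<close> by (intro mult_strict_left_mono) auto
    finally show False by (simp add: power2_eq_square)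
  qed
  then show ?thesis
    using that[OF test_function_scale[OF \<rho>(1), of "1 / prim a \<rho> b"]] by (simp only: prim_scale) simp
qed

text \<open>Subtracting from a test function its mean times \<rho> leaves a mean-zero test function,
  which is the derivative of a test function and so is annihilated by h. The constant is therefore
  the integral of h against \<rho>.\<close>

lemma weak_deriv_zero_const:
  assumes h: "square_integrable a b h" and "a < b" and w: "has_weak_deriv a b h (\<lambda>x. 0)"
  obtains c where "AE x in lebesgue_on {a<..<b}. h x = c"
proof -
  obtain \<rho> where \<rho>: "\<rho> \<in> test_functions a b" "prim a \<rho> b = 1"
    by (rule test_function_mean_one[OF \<open>a < b\<close>])
  define c where "c = (LINT x|lebesgue_on {a<..<b}. h x * \<rho> x)"
  have "AE x in lebesgue_on {a<..<b}. h x - c = 0"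
  proof (rule AE_zero_if_orthogonal_to_test_functions)
    show "square_integrable a b (\<lambda>x. h x - c)" by (intro square_integrable_diff h square_integrable_const)
    fix \<psi> assume \<psi>: "\<psi> \<in> test_functions a b"
    define m where "m = prim a \<psi> b"
    define \<omega> where "\<omega> = (\<lambda>x. \<psi> x + (- m) * \<rho> x)"
    have \<omega>: "\<omega> \<in> test_functions a b" unfolding \<omega>_def by (intro test_function_add test_function_scale \<psi> \<rho>(1))
    note s = square_integrable_test_function[OF \<psi>, of a b] square_integrable_test_function[OF \<rho>(1), of a b]
    have "prim a \<omega> b = m + (- m) * 1"
      unfolding \<omega>_def by (subst prim_add[OF s(1) square_integrable_scale[OF s(2)] order_refl])
        (simp only: prim_scale \<rho>(2) m_def)
    then obtain \<phi> where \<phi>: "\<phi> \<in> test_functions a b" "\<And>x. vector_derivative \<phi> (at x) = \<omega> x"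
      using test_function_primitive[OF \<omega> _ \<open>a < b\<close>] by auto
    have "(LINT x|lebesgue_on {a<..<b}. h x * \<omega> x) = 0"
      using w \<phi> unfolding has_weak_deriv_def by auto
    moreover have "(LINT x|lebesgue_on {a<..<b}. h x * \<omega> x) = (LINT x|lebesgue_on {a<..<b}. h x * \<psi> x) - m * c"
    proof -
      have "(LINT x|lebesgue_on {a<..<b}. h x * \<omega> x) = (LINT x|lebesgue_on {a<..<b}. h x * \<psi> x - m * (h x * \<rho> x))"
        by (simp add: \<omega>_def algebra_simps)
      also have "\<dots> = (LINT x|lebesgue_on {a<..<b}. h x * \<psi> x) - (LINT x|lebesgue_on {a<..<b}. m * (h x * \<rho> x))"
        by (intro Bochner_Integration.integral_diff integrable_mult_right square_integrable_mult h s)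
      finally show ?thesis by (simp add: c_def)
    qed
    moreover have "(LINT x|lebesgue_on {a<..<b}. (h x - c) * \<psi> x) = (LINT x|lebesgue_on {a<..<b}. h x * \<psi> x) - c * m"
    proof -
      have "(LINT x|lebesgue_on {a<..<b}. (h x - c) * \<psi> x) = (LINT x|lebesgue_on {a<..<b}. h x * \<psi> x - c * \<psi> x)"
        by (simp add: algebra_simps)
      also have "\<dots> = (LINT x|lebesgue_on {a<..<b}. h x * \<psi> x) - (LINT x|lebesgue_on {a<..<b}. c * \<psi> x)"
        by (intro Bochner_Integration.integral_diff integrable_mult_right square_integrable_mult h s square_integrable_integrable)
      finally show ?thesis by (simp add: m_def prim_def)
    qed
    ultimately show "(LINT x|lebesgue_on {a<..<b}. (h x - c) * \<psi> x) = 0" by (simp add: mult.commute)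
  qed
  then show ?thesis using that[of c] by simp
qed

lemma has_weak_deriv_diff:
  assumes "square_integrable a b f" "square_integrable a b f'" "square_integrable a b g" "square_integrable a b g'"
    "has_weak_deriv a b f f'" "has_weak_deriv a b g g'"
  shows "has_weak_deriv a b (\<lambda>x. f x - g x) (\<lambda>x. f' x - g' x)"
  unfolding has_weak_deriv_def
proof
  fix \<phi> assume \<phi>: "\<phi> \<in> test_functions a b"
  note s = square_integrable_test_function[OF \<phi>, of a b] square_integrable_test_function[OF test_function_deriv[OF \<phi>], of a b]
  show "(LINT x|lebesgue_on {a<..<b}. (f x - g x) * vector_derivative \<phi> (at x)) =
       - (LINT x|lebesgue_on {a<..<b}. (f' x - g' x) * \<phi> x)"
    using assms(5,6) \<phi> square_integrable_mult[OF assms(1) s(2)] square_integrable_mult[OF assms(3) s(2)]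
      square_integrable_mult[OF assms(2) s(1)] square_integrable_mult[OF assms(4) s(1)]
    by (simp add: has_weak_deriv_def left_diff_distrib)
qed

lemma du_Bois_Reymond:
  assumes f: "square_integrable a b f" and g: "square_integrable a b g" and w: "has_weak_deriv a b f g" and "a < b"
  obtains c where "AE x in lebesgue_on {a<..<b}. f x = c + prim a g x"
proof -
  have "has_weak_deriv a b (\<lambda>x. f x - (0 + prim a g x)) (\<lambda>x. g x - g x)"
    by (intro has_weak_deriv_diff has_weak_deriv_prim f g w) (simp add: square_integrable_prim[OF g])
  then have "has_weak_deriv a b (\<lambda>x. f x - prim a g x) (\<lambda>x. 0)" by simp
  then obtain c where "AE x in lebesgue_on {a<..<b}. f x - prim a g x = c"
    using weak_deriv_zero_const[OF square_integrable_diff[OF f square_integrable_prim[OF g]] \<open>a < b\<close>] by blast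
  then have "AE x in lebesgue_on {a<..<b}. f x = c + prim a g x"
    by (auto elim!: eventually_mono simp: algebra_simps)
  then show ?thesis by (rule that)
qed

section \<open>Sobolev functions: traces, and H^1_0 described by primitives\<close>

lemma H1_weak_deriv:
  assumes "f \<in> H1 a b"
  shows "square_integrable a b f" "square_integrable a b (weak_deriv a b f)" "has_weak_deriv a b f (weak_deriv a b f)"
proof -
  have "square_integrable a b (weak_deriv a b f) \<and> has_weak_deriv a b f (weak_deriv a b f)"
    unfolding weak_deriv_def
    by (rule someI_ex[of "\<lambda>g. square_integrable a b g \<and> has_weak_deriv a b f g"]) (use assms in \<open>auto simp: H1_def\<close>)
  then show "square_integrable a b (weak_deriv a b f)" "has_weak_deriv a b f (weak_deriv a b f)" by auto
qed (use assms in \<open>auto simp: H1_def\<close>)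

lemma weak_deriv_unique:
  assumes "square_integrable a b f" "square_integrable a b g" "has_weak_deriv a b f g"
  shows "f \<in> H1 a b" "AE x in lebesgue_on {a<..<b}. weak_deriv a b f x = g x"
proof -
  show "f \<in> H1 a b" using assms by (auto simp: H1_def)
  from H1_weak_deriv[OF this] assms show "AE x in lebesgue_on {a<..<b}. weak_deriv a b f x = g x"
    by (intro has_weak_deriv_unique[of a b _ _ f])
qed

lemma H1_subinterval:
  assumes "f \<in> H1 a b" "a \<le> c" "d \<le> b"
  shows "f \<in> H1 c d" "AE x in lebesgue_on {c<..<d}. weak_deriv c d f x = weak_deriv a b f x"
  by (rule weak_deriv_unique; use H1_weak_deriv[OF assms(1)] square_integrable_subinterval[OF _ assms(2,3)]
      has_weak_deriv_subinterval[OF _ assms(2,3)] in blast)+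

text \<open>The uniqueness behind the definite description in \<open>sobolev_trace\<close>.\<close>

lemma continuous_AE_eq_imp_eq:
  fixes h k :: "real \<Rightarrow> complex"
  assumes h: "continuous_on {a..b} h" and k: "continuous_on {a..b} k" and "a < b"
    and ae: "AE x in lebesgue_on {a<..<b}. h x = k x" and "x \<in> {a..b}"
  shows "h x = k x"
proof -
  let ?f = "\<lambda>x. (cmod (h x - k x))\<^sup>2"
  have s: "square_integrable a b (\<lambda>x. h x - k x)"
    by (intro square_integrable_diff square_integrable_continuous h k)
  have "(LINT x|lebesgue_on {a<..<b}. ?f x) = 0"
    by (rule integral_eq_zero_AE) (use ae in \<open>auto elim: eventually_mono\<close>)
  then have "integral {a..b} ?f = 0"
    using LINT_interval_eq_integral[OF square_integrable_square[OF s]] by simp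
  then have "(?f has_integral 0) (cbox a b)"
    using integrable_integral[OF integrable_on_closed_interval[OF square_integrable_square[OF s]]] by simp
  then have "?f x = 0"
    by (rule has_integral_0_cbox_imp_0[rotated 2])
      (use assms in \<open>auto intro!: continuous_intros\<close>)
  then show ?thesis by simp
qed

lemma sobolev_trace_eq:
  assumes "continuous_on {a..b} h" "AE x in lebesgue_on {a<..<b}. f x = h x" "a < b" "x \<in> {a..b}"
  shows "sobolev_trace a b f x = h x"
  unfolding sobolev_trace_def
proof (rule the_equality)
  show "\<exists>k. continuous_on {a..b} k \<and> (AE y in lebesgue_on {a<..<b}. f y = k y) \<and> k x = h x"
    using assms by blast
  fix c assume "\<exists>k. continuous_on {a..b} k \<and> (AE y in lebesgue_on {a<..<b}. f y = k y) \<and> k x = c"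
  then obtain k where k: "continuous_on {a..b} k" "AE y in lebesgue_on {a<..<b}. f y = k y" "k x = c" by auto
  have "AE y in lebesgue_on {a<..<b}. k y = h y" using k(2) assms(2) by eventually_elim simp
  from continuous_AE_eq_imp_eq[OF k(1) assms(1,3) this assms(4)] k(3) show "c = h x" by simp
qed

lemma test_function_weak_deriv:
  assumes "smooth \<phi>"
  shows "has_weak_deriv a b \<phi> (\<lambda>x. vector_derivative \<phi> (at x))"
proof -
  have s: "square_integrable a b \<phi>" "square_integrable a b (\<lambda>x. vector_derivative \<phi> (at x))"
    using assms square_integrable_smooth smooth_vector_derivative by blast+
  have eq: "\<phi> a + prim a (\<lambda>x. vector_derivative \<phi> (at x)) x = \<phi> x" if "x \<in> {a..b}" for x
    using prim_eq_diff[OF has_vector_derivative_at_within[OF smooth_has_vector_derivative[OF assms]] s(2) that]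
    by simp
  show ?thesis
    by (rule has_weak_deriv_cong_AE[OF _ s(1) _ s(2) s(2) _ has_weak_deriv_prim[OF s(2), of "\<phi> a"]])
      (use eq in \<open>auto intro!: square_integrable_add square_integrable_const square_integrable_prim s AE_I2\<close>)
qed

text \<open>\<open>H10\<close> is a closure of test functions, so boundary values must be extracted
  from approximants: the primitive of the weak derivative is uniformly close to a test function
  whenever the derivatives are close in L^2, and test functions vanish at both ends.\<close>

lemma H10_imp_prim:
  assumes f: "f \<in> H10 a b" and "a < b"
  shows "AE x in lebesgue_on {a<..<b}. f x = prim a (weak_deriv a b f) x" "prim a (weak_deriv a b f) b = 0"
proof -
  have "f \<in> H1 a b" using f by (simp add: H10_def)
  note H1 = H1_weak_deriv[OF this]
  let ?g = "weak_deriv a b f"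
  obtain c where c: "AE x in lebesgue_on {a<..<b}. f x = c + prim a ?g x"
    by (rule du_Bois_Reymond[OF H1 \<open>a < b\<close>])
  have approx: "\<exists>\<phi>. \<phi> \<in> test_functions a b \<and> L2_normsq a b (\<lambda>x. f x - \<phi> x) \<le> e \<and>
      L2_normsq a b (\<lambda>x. ?g x - vector_derivative \<phi> (at x)) \<le> e" if "e > 0" for e
  proof -
    obtain \<phi> where \<phi>: "\<phi> \<in> test_functions a b"
      "L2_normsq a b (\<lambda>x. f x - \<phi> x) + L2_normsq a b (\<lambda>x. ?g x - vector_derivative \<phi> (at x)) < e"
      using f \<open>e > 0\<close> unfolding H10_def by blast
    with L2_normsq_nonneg[of a b "\<lambda>x. f x - \<phi> x"] L2_normsq_nonneg[of a b "\<lambda>x. ?g x - vector_derivative \<phi> (at x)"]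
    show ?thesis by (intro exI[of _ \<phi>]) auto
  qed
  have pb: "(cmod (prim a ?g x - \<phi> x))\<^sup>2 \<le> (b - a) * L2_normsq a b (\<lambda>x. ?g x - vector_derivative \<phi> (at x))"
    if \<phi>: "\<phi> \<in> test_functions a b" and x: "x \<in> {a..b}" for \<phi> x
  proof -
    note s = square_integrable_test_function[OF test_function_deriv[OF \<phi>], of a b]
    show ?thesis
      using prim_bound[OF square_integrable_diff[OF H1(2) s] x] x
      by (simp add: prim_diff[OF H1(2) s] test_function_prim[OF \<phi> x])
  qed
  have "prim a ?g b = 0"
  proof (rule zero_if_le_all_positive[where K="b - a"])
    fix e :: real assume "e > 0"
    then obtain \<phi> where \<phi>: "\<phi> \<in> test_functions a b" "L2_normsq a b (\<lambda>x. ?g x - vector_derivative \<phi> (at x)) \<le> e"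
      using approx by blast
    have "\<phi> b = 0" by (rule test_functionD(2)[OF \<phi>(1)]) simp
    then have "(cmod (prim a ?g b))\<^sup>2 \<le> (b - a) * L2_normsq a b (\<lambda>x. ?g x - vector_derivative \<phi> (at x))"
      using pb[OF \<phi>(1), of b] \<open>a < b\<close> by simp
    also have "\<dots> \<le> (b - a) * e" using \<phi>(2) \<open>a < b\<close> by (intro mult_left_mono) auto
    finally show "(cmod (prim a ?g b))\<^sup>2 \<le> (b - a) * e" .
  qed (use \<open>a < b\<close> in auto)
  then show "prim a ?g b = 0" .
  \<comment> \<open>The constant is the difference of f and the primitive, and both are L^2 close to
    the same test function.\<close>
  have "c = 0"
  proof (rule zero_if_le_all_positive[where K="(2 + 2 * (b - a)\<^sup>2) / (b - a)"])
    fix e :: real assume "e > 0"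
    then obtain \<phi> where \<phi>: "\<phi> \<in> test_functions a b" "L2_normsq a b (\<lambda>x. f x - \<phi> x) \<le> e"
      "L2_normsq a b (\<lambda>x. ?g x - vector_derivative \<phi> (at x)) \<le> e"
      using approx by blast
    note s = square_integrable_test_function[OF \<phi>(1), of a b] square_integrable_prim[OF H1(2)]
    have "(b - a) * (cmod c)\<^sup>2 = L2_normsq a b (\<lambda>x. c)"
      using \<open>a < b\<close> by (simp add: L2_normsq_def measure_interval)
    also have "\<dots> = L2_normsq a b (\<lambda>x. f x - prim a ?g x)"
      by (rule L2_normsq_cong_AE) (use c in \<open>auto intro!: square_integrable_const square_integrable_diff H1 s elim: eventually_mono\<close>)
    also have "\<dots> \<le> 2 * L2_normsq a b (\<lambda>x. f x - \<phi> x) + 2 * L2_normsq a b (\<lambda>x. \<phi> x - prim a ?g x)"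
      by (intro L2_normsq_diff_le H1 s)
    also have "L2_normsq a b (\<lambda>x. \<phi> x - prim a ?g x) \<le> (b - a) * (sqrt ((b - a) * e))\<^sup>2"
    proof (intro L2_normsq_bounded square_integrable_diff s)
      fix x assume "x \<in> {a<..<b}"
      then have "(cmod (prim a ?g x - \<phi> x))\<^sup>2 \<le> (b - a) * L2_normsq a b (\<lambda>x. ?g x - vector_derivative \<phi> (at x))"
        using pb[OF \<phi>(1)] by simp
      also have "\<dots> \<le> (b - a) * e" using \<phi>(3) \<open>a < b\<close> by (intro mult_left_mono) auto
      finally show "cmod (\<phi> x - prim a ?g x) \<le> sqrt ((b - a) * e)"
        unfolding norm_minus_commute[of "\<phi> x"] by (rule real_le_rsqrt)
    qed (use \<open>a < b\<close> in auto)
    finally have "(b - a) * (cmod c)\<^sup>2 \<le> (2 + 2 * (b - a)\<^sup>2) * e"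
      using \<phi>(2) \<open>a < b\<close> \<open>e > 0\<close> by (simp add: power2_eq_square algebra_simps)
    then show "(cmod c)\<^sup>2 \<le> (2 + 2 * (b - a)\<^sup>2) / (b - a) * e"
      using \<open>a < b\<close> by (simp add: field_simps)
  qed (use \<open>a < b\<close> in auto)
  with c show "AE x in lebesgue_on {a<..<b}. f x = prim a ?g x" by simp
qed

text \<open>The derivative g is approximated by test functions whose mean is corrected to 0 with
  \<rho>; their primitives are test functions that approximate f.\<close>

lemma prim_in_H10:
  assumes f: "square_integrable a b f" and g: "square_integrable a b g" and "a < b"
    and fg: "AE x in lebesgue_on {a<..<b}. f x = prim a g x" and z: "prim a g b = 0"
  shows "f \<in> H10 a b" "AE x in lebesgue_on {a<..<b}. weak_deriv a b f x = g x"
proof -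
  note sp = square_integrable_prim[OF g]
  have w: "has_weak_deriv a b f g"
    by (rule has_weak_deriv_cong_AE[OF sp f _ g g _ has_weak_deriv_prim[OF g, of 0, simplified]])
      (use fg in \<open>auto elim: eventually_mono\<close>)
  note u = weak_deriv_unique[OF f g w]
  note H1 = H1_weak_deriv[OF u(1)]
  show "AE x in lebesgue_on {a<..<b}. weak_deriv a b f x = g x" by (rule u)
  obtain \<rho> where \<rho>: "\<rho> \<in> test_functions a b" "prim a \<rho> b = 1"
    by (rule test_function_mean_one[OF \<open>a < b\<close>])
  note s\<rho> = square_integrable_test_function[OF \<rho>(1), of a b]
  have "\<exists>\<phi>\<in>test_functions a b. L2_normsq a b (\<lambda>x. f x - \<phi> x) +
      L2_normsq a b (\<lambda>x. weak_deriv a b f x - vector_derivative \<phi> (at x)) < e" if "e > 0" for e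
  proof -
    \<comment> \<open>The first factor is the loss caused by correcting the mean of \<psi>, the
      second adds the error of the primitive to that of the derivative.\<close>
    define A where "A = (2 + 2 * (b - a) * L2_normsq a b \<rho>) * ((b - a)\<^sup>2 + 1)"
    have A: "A > 0" unfolding A_def using \<open>a < b\<close> L2_normsq_nonneg[of a b \<rho>]
      by (intro mult_pos_pos add_pos_nonneg mult_nonneg_nonneg) (auto intro: add_nonneg_pos)
    obtain \<psi> where \<psi>: "\<psi> \<in> test_functions a b" "L2_normsq a b (\<lambda>x. g x - \<psi> x) < e / A"
      by (rule L2_test_functions_dense[OF g, of "e / A"]) (use A \<open>e > 0\<close> in auto)
    define m where "m = prim a \<psi> b"
    note s\<psi> = square_integrable_test_function[OF \<psi>(1), of a b]
    define \<omega> where "\<omega> = (\<lambda>x. \<psi> x + (- m) * \<rho> x)"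
    have \<omega>: "\<omega> \<in> test_functions a b" unfolding \<omega>_def by (intro test_function_add test_function_scale \<psi> \<rho>(1))
    have "prim a \<omega> b = m + (- m) * 1"
      unfolding \<omega>_def by (subst prim_add[OF s\<psi> square_integrable_scale[OF s\<rho>] order_refl])
        (simp only: prim_scale \<rho>(2) m_def)
    then obtain \<phi> where \<phi>: "\<phi> \<in> test_functions a b" "\<And>x. vector_derivative \<phi> (at x) = \<omega> x"
      using test_function_primitive[OF \<omega> _ \<open>a < b\<close>] by auto
    note s\<phi> = square_integrable_test_function[OF \<phi>(1), of a b] and s\<omega> = square_integrable_test_function[OF \<omega>, of a b]
    have m: "(cmod m)\<^sup>2 \<le> (b - a) * L2_normsq a b (\<lambda>x. g x - \<psi> x)"
      using prim_bound[OF square_integrable_diff[OF g s\<psi>], of b] \<open>a < b\<close> z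
      by (simp add: prim_diff[OF g s\<psi>] m_def)
    have "L2_normsq a b (\<lambda>x. g x - \<omega> x) = L2_normsq a b (\<lambda>x. (g x - \<psi> x) + m * \<rho> x)"
      by (simp add: \<omega>_def algebra_simps)
    also have "\<dots> \<le> 2 * L2_normsq a b (\<lambda>x. g x - \<psi> x) + 2 * L2_normsq a b (\<lambda>x. m * \<rho> x)"
      by (intro L2_normsq_add_le square_integrable_diff square_integrable_scale g s\<psi> s\<rho>)
    also have "L2_normsq a b (\<lambda>x. m * \<rho> x) = (cmod m)\<^sup>2 * L2_normsq a b \<rho>"
      by (simp add: L2_normsq_def norm_mult power_mult_distrib)
    also have "(cmod m)\<^sup>2 * L2_normsq a b \<rho> \<le> ((b - a) * L2_normsq a b (\<lambda>x. g x - \<psi> x)) * L2_normsq a b \<rho>"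
      by (intro mult_right_mono m L2_normsq_nonneg)
    finally have gx: "L2_normsq a b (\<lambda>x. g x - \<omega> x) \<le> (2 + 2 * (b - a) * L2_normsq a b \<rho>) * L2_normsq a b (\<lambda>x. g x - \<psi> x)"
      by (simp add: algebra_simps)
    have "L2_normsq a b (\<lambda>x. f x - \<phi> x) = L2_normsq a b (prim a (\<lambda>x. g x - \<omega> x))"
    proof (rule L2_normsq_cong_AE)
      have eq: "prim a \<omega> x = \<phi> x" if "x \<in> {a<..<b}" for x
        using test_function_prim[OF \<phi>(1), of x] that by (simp add: \<phi>(2))
      show "AE x in lebesgue_on {a<..<b}. f x - \<phi> x = prim a (\<lambda>x. g x - \<omega> x) x"
        using fg AE_space[of "lebesgue_on {a<..<b}"] by eventually_elim (auto simp: prim_diff[OF g s\<omega>] eq)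
    qed (intro square_integrable_diff square_integrable_prim f s\<phi> g s\<omega>)+
    also have "\<dots> \<le> (b - a)\<^sup>2 * L2_normsq a b (\<lambda>x. g x - \<omega> x)"
      using \<open>a < b\<close> by (intro L2_normsq_prim square_integrable_diff g s\<omega>) auto
    moreover have "L2_normsq a b (\<lambda>x. weak_deriv a b f x - vector_derivative \<phi> (at x)) = L2_normsq a b (\<lambda>x. g x - \<omega> x)"
      unfolding \<phi>(2) by (rule L2_normsq_cong_AE) (use u(2) in \<open>auto intro!: square_integrable_diff H1 g s\<omega> elim: eventually_mono\<close>)
    ultimately have "L2_normsq a b (\<lambda>x. f x - \<phi> x) + L2_normsq a b (\<lambda>x. weak_deriv a b f x - vector_derivative \<phi> (at x))
        \<le> ((b - a)\<^sup>2 + 1) * L2_normsq a b (\<lambda>x. g x - \<omega> x)" by (simp add: algebra_simps)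
    also have "\<dots> \<le> ((b - a)\<^sup>2 + 1) * ((2 + 2 * (b - a) * L2_normsq a b \<rho>) * L2_normsq a b (\<lambda>x. g x - \<psi> x))"
      by (intro mult_left_mono gx) auto
    also have "\<dots> = A * L2_normsq a b (\<lambda>x. g x - \<psi> x)" by (simp add: A_def algebra_simps)
    also have "\<dots> < A * (e / A)" using \<psi>(2) A by (intro mult_strict_left_mono)
    also have "\<dots> = e" using A by simp
    finally show ?thesis using \<phi>(1) by blast
  qed
  then show "f \<in> H10 a b" using u(1) by (simp add: H10_def)
qed

subsection \<open>Sine and cosine coefficients on the unit interval\<close>

definition sn :: "nat \<Rightarrow> real \<Rightarrow> complex" where "sn j x = of_real (sin (real j * pi * x))"
definition cs :: "nat \<Rightarrow> real \<Rightarrow> complex" where "cs j x = of_real (cos (real j * pi * x))"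

text \<open>The systems \<open>sn\<close> and \<open>cs\<close> are real, hence no conjugate; their
  members of positive index have squared norm 1/2, which is the origin of the factors 2 in all
  expansions.\<close>

definition coeff :: "(nat \<Rightarrow> real \<Rightarrow> complex) \<Rightarrow> (real \<Rightarrow> complex) \<Rightarrow> nat \<Rightarrow> complex" where
  "coeff \<theta> f j = (LINT x|lebesgue_on {0<..<1}. f x * \<theta> j x)"

lemma continuous_on_sn: "continuous_on S (sn j)" and continuous_on_cs: "continuous_on S (cs j)"
  unfolding sn_def cs_def by (intro continuous_intros)+

lemma square_integrable_sn: "square_integrable a b (sn j)" and square_integrable_cs: "square_integrable a b (cs j)"
  by (intro square_integrable_continuous continuous_on_sn continuous_on_cs)+

lemma norm_sn: "cmod (sn j x) \<le> 1"
  by (simp add: sn_def)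

lemma cs_has_derivative: "(cs j has_vector_derivative of_real (- (real j * pi)) * sn j x) (at x within S)"
proof -
  have "((\<lambda>x. cos (real j * pi * x)) has_real_derivative - (real j * pi) * sin (real j * pi * x)) (at x within S)"
    by (auto intro!: derivative_eq_intros)
  from has_vector_derivative_of_real[OF this] show ?thesis
    unfolding cs_def sn_def by simp
qed

lemma sn_has_derivative: "(sn j has_vector_derivative of_real (real j * pi) * cs j x) (at x within S)"
proof -
  have "((\<lambda>x. sin (real j * pi * x)) has_real_derivative (real j * pi) * cos (real j * pi * x)) (at x within S)"
    by (auto intro!: derivative_eq_intros)
  from has_vector_derivative_of_real[OF this] show ?thesis
    unfolding cs_def sn_def by simp
qed

section \<open>Orthogonality and the Bessel inequality\<close>

lemma LINT_cos_int:
  "(LINT x|lebesgue_on {0<..<1}. cos (real_of_int m * pi * x)) = (if m = 0 then 1 else 0)"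
proof (cases "m = 0")
  case False
  have int: "integrable (lebesgue_on {0<..<1}) (\<lambda>x. cos (real_of_int m * pi * x))"
    by (rule integrable_lebesgue_on_subset[OF continuous_imp_integrable_real[of 0 1]])
      (auto intro!: continuous_intros)
  have "((\<lambda>x. cos (real_of_int m * pi * x)) has_integral
      (sin (real_of_int m * pi * 1) / (real_of_int m * pi) - sin (real_of_int m * pi * 0) / (real_of_int m * pi))) {0..1}"
    by (rule fundamental_theorem_of_calculus)
      (use False in \<open>auto intro!: derivative_eq_intros simp flip: has_real_derivative_iff_has_vector_derivative\<close>)
  moreover have "sin (real_of_int m * pi) = 0" by (simp add: sin_zero_iff_int2)
  ultimately have "integral {0..1} (\<lambda>x. cos (real_of_int m * pi * x)) = 0" by (simp add: integral_unique)
  with int False show ?thesis by (simp add: LINT_interval_eq_integral)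
qed (simp add: measure_interval)

lemma integrable_cos_int: "integrable (lebesgue_on {0<..<1}) (\<lambda>x. cos (real_of_int m * pi * x))"
  by (rule integrable_lebesgue_on_subset[OF continuous_imp_integrable_real[of 0 1]])
    (auto intro!: continuous_intros)

lemma coeff_orthogonal:
  assumes "i > 0" "j > 0"
  shows "coeff sn (sn i) j = (if i = j then 1/2 else 0)" "coeff cs (cs i) j = (if i = j then 1/2 else 0)"
proof -
  let ?m = "int i - int j" and ?p = "int i + int j"
  have p: "?p \<noteq> 0" using assms by simp
  have "sn i x * sn j x = of_real ((cos (real_of_int ?m * pi * x) - cos (real_of_int ?p * pi * x)) / 2)" for x
    by (simp add: sn_def sin_times_sin algebra_simps flip: of_real_mult)
  then have "coeff sn (sn i) j = of_real (LINT x|lebesgue_on {0<..<1}. (cos (real_of_int ?m * pi * x) - cos (real_of_int ?p * pi * x)) / 2)"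
    unfolding coeff_def by (simp only: integral_complex_of_real)
  also have "\<dots> = (if i = j then 1/2 else 0)"
    using p integrable_cos_int[of ?m] integrable_cos_int[of ?p] LINT_cos_int[of ?m] LINT_cos_int[of ?p]
    by (simp del: of_int_diff of_int_add)
  finally show "coeff sn (sn i) j = (if i = j then 1/2 else 0)" .
  have "cs i x * cs j x = of_real ((cos (real_of_int ?m * pi * x) + cos (real_of_int ?p * pi * x)) / 2)" for x
    by (simp add: cs_def cos_times_cos algebra_simps flip: of_real_mult)
  then have "coeff cs (cs i) j = of_real (LINT x|lebesgue_on {0<..<1}. (cos (real_of_int ?m * pi * x) + cos (real_of_int ?p * pi * x)) / 2)"
    unfolding coeff_def by (simp only: integral_complex_of_real)
  also have "\<dots> = (if i = j then 1/2 else 0)"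
    using p integrable_cos_int[of ?m] integrable_cos_int[of ?p] LINT_cos_int[of ?m] LINT_cos_int[of ?p]
    by (simp del: of_int_diff of_int_add)
  finally show "coeff cs (cs i) j = (if i = j then 1/2 else 0)" .
qed

lemma coeff_diff:
  assumes "square_integrable 0 1 f" "square_integrable 0 1 g" "square_integrable 0 1 (\<theta> j)"
  shows "coeff \<theta> (\<lambda>x. f x - g x) j = coeff \<theta> f j - coeff \<theta> g j"
  using square_integrable_mult[OF assms(1,3)] square_integrable_mult[OF assms(2,3)]
  by (simp add: coeff_def left_diff_distrib)

lemma coeff_scale: "coeff \<theta> (\<lambda>x. c * f x) j = c * coeff \<theta> f j"
  by (simp add: coeff_def mult.assoc)

lemma coeff_cong_AE:
  assumes "square_integrable 0 1 f" "square_integrable 0 1 g" "square_integrable 0 1 (\<theta> j)"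
    "AE x in lebesgue_on {0<..<1}. f x = g x"
  shows "coeff \<theta> f j = coeff \<theta> g j"
  unfolding coeff_def
  by (rule integral_cong_AE) (use assms in \<open>auto simp: square_integrable_def elim!: eventually_mono\<close>)

lemma L2_normsq_diff_expand:
  assumes f: "square_integrable a b f" and g: "square_integrable a b g"
  shows "L2_normsq a b (\<lambda>x. f x - g x) = L2_normsq a b f
    - 2 * Re (LINT x|lebesgue_on {a<..<b}. f x * cnj (g x)) + L2_normsq a b g"
proof -
  note i = square_integrable_mult[OF f square_integrable_cnj[OF g]]
  have "(cmod (f x - g x))\<^sup>2 = (cmod (f x))\<^sup>2 - 2 * Re (f x * cnj (g x)) + (cmod (g x))\<^sup>2" for x
    unfolding cmod_power2 by (simp add: power2_eq_square algebra_simps)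
  then have "L2_normsq a b (\<lambda>x. f x - g x) =
      (LINT x|lebesgue_on {a<..<b}. (cmod (f x))\<^sup>2 - 2 * Re (f x * cnj (g x)) + (cmod (g x))\<^sup>2)"
    by (simp only: L2_normsq_def)
  also have "\<dots> = L2_normsq a b f - 2 * (LINT x|lebesgue_on {a<..<b}. Re (f x * cnj (g x))) + L2_normsq a b g"
    using square_integrable_square[OF f] square_integrable_square[OF g] integrable_Re[OF i]
    by (simp only: L2_normsq_def Bochner_Integration.integral_add Bochner_Integration.integral_diff
        Bochner_Integration.integrable_diff integrable_mult_right integral_mult_right_zero simp_thms)
  also have "(LINT x|lebesgue_on {a<..<b}. Re (f x * cnj (g x))) = Re (LINT x|lebesgue_on {a<..<b}. f x * cnj (g x))"
    by (rule integral_Re[OF i])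
  finally show ?thesis .
qed

lemma bessel_step:
  assumes f: "square_integrable 0 1 f" and \<theta>: "square_integrable 0 1 (\<theta> j)"
    and real: "\<And>x. cnj (\<theta> j x) = \<theta> j x" and half: "coeff \<theta> (\<theta> j) j = 1/2"
  shows "L2_normsq 0 1 (\<lambda>x. f x - 2 * coeff \<theta> f j * \<theta> j x) = L2_normsq 0 1 f - 2 * (cmod (coeff \<theta> f j))\<^sup>2"
proof -
  let ?c = "2 * coeff \<theta> f j"
  have "(LINT x|lebesgue_on {0<..<1}. f x * cnj (?c * \<theta> j x)) = cnj ?c * coeff \<theta> f j"
  proof -
    have "f x * cnj (?c * \<theta> j x) = cnj ?c * (f x * \<theta> j x)" for x by (simp add: real mult_ac)
    then show ?thesis unfolding coeff_def[of \<theta> f] by (simp only: integral_mult_right_zero)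
  qed
  then have 1: "Re (LINT x|lebesgue_on {0<..<1}. f x * cnj (?c * \<theta> j x)) = 2 * (cmod (coeff \<theta> f j))\<^sup>2"
    unfolding cmod_power2 by (simp add: power2_eq_square)
  have "of_real (L2_normsq 0 1 (\<theta> j)) = coeff \<theta> (\<theta> j) j"
    unfolding L2_normsq_def coeff_def integral_complex_of_real[symmetric] complex_norm_square real ..
  then have "L2_normsq 0 1 (\<theta> j) = 1/2"
    using half by (metis Re_complex_of_real of_real_divide of_real_numeral of_real_1)
  moreover have "L2_normsq 0 1 (\<lambda>x. ?c * \<theta> j x) = (cmod ?c)\<^sup>2 * L2_normsq 0 1 (\<theta> j)"
    by (simp add: L2_normsq_def norm_mult power_mult_distrib)
  ultimately have 2: "L2_normsq 0 1 (\<lambda>x. ?c * \<theta> j x) = 2 * (cmod (coeff \<theta> f j))\<^sup>2"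
    by (simp add: norm_mult power_mult_distrib)
  show ?thesis
    unfolding L2_normsq_diff_expand[OF f square_integrable_scale[OF \<theta>]] 1 2 by simp
qed

text \<open>The projections are removed one by one. The residual r keeps the coefficients that are
  still to come and loses twice the squared coefficient at each step; its squared norm stays
  nonnegative.\<close>

lemma bessel:
  assumes f: "square_integrable 0 1 f" and \<theta>: "\<And>j. square_integrable 0 1 (\<theta> j)"
    and real: "\<And>j x. cnj (\<theta> j x) = \<theta> j x"
    and orth: "\<And>i j. i > 0 \<Longrightarrow> j > 0 \<Longrightarrow> coeff \<theta> (\<theta> i) j = (if i = j then 1/2 else 0)"
  shows "(\<Sum>j<N. 2 * (cmod (coeff \<theta> f (Suc j)))\<^sup>2) \<le> L2_normsq 0 1 f"
proof -
  define r where "r = (\<lambda>N x. f x - (\<Sum>j<N. 2 * coeff \<theta> f (Suc j) * \<theta> (Suc j) x))"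
  have rSuc: "r (Suc N) = (\<lambda>x. r N x - 2 * coeff \<theta> f (Suc N) * \<theta> (Suc N) x)" for N
    by (simp add: r_def algebra_simps)
  have r: "square_integrable 0 1 (r N) \<and> (\<forall>k\<ge>N. coeff \<theta> (r N) (Suc k) = coeff \<theta> f (Suc k)) \<and>
      L2_normsq 0 1 (r N) = L2_normsq 0 1 f - (\<Sum>j<N. 2 * (cmod (coeff \<theta> f (Suc j)))\<^sup>2)" for N
  proof (induction N)
    case 0
    have "r 0 = f" by (simp add: r_def)
    then show ?case using f by simp
  next
    case (Suc N)
    have sq: "square_integrable 0 1 (\<lambda>x. 2 * coeff \<theta> f (Suc N) * \<theta> (Suc N) x)"
      by (intro square_integrable_scale \<theta>)
    have "coeff \<theta> (r (Suc N)) (Suc k) = coeff \<theta> f (Suc k)" if "k \<ge> Suc N" for k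
      unfolding rSuc using that Suc orth[of "Suc N" "Suc k"]
      by (subst coeff_diff) (auto simp: sq \<theta> coeff_scale)
    moreover have "L2_normsq 0 1 (r (Suc N)) = L2_normsq 0 1 f - (\<Sum>j<Suc N. 2 * (cmod (coeff \<theta> f (Suc j)))\<^sup>2)"
    proof -
      have "r (Suc N) = (\<lambda>x. r N x - 2 * coeff \<theta> (r N) (Suc N) * \<theta> (Suc N) x)"
        unfolding rSuc using Suc by simp
      then show ?thesis
        using Suc bessel_step[of "r N" \<theta> "Suc N", OF _ \<theta> real] orth[of "Suc N" "Suc N"] by simp
    qed
    moreover have "square_integrable 0 1 (r (Suc N))"
      unfolding rSuc using Suc sq by (intro square_integrable_diff) auto
    ultimately show ?case by simp
  qed
  from r[of N] L2_normsq_nonneg[of 0 1 "r N"] show ?thesis by simp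
qed

lemma bessel_sn: "square_integrable 0 1 f \<Longrightarrow> (\<Sum>j<N. 2 * (cmod (coeff sn f (Suc j)))\<^sup>2) \<le> L2_normsq 0 1 f"
  by (rule bessel) (auto simp: square_integrable_sn coeff_orthogonal, simp add: sn_def)

lemma bessel_cs: "square_integrable 0 1 f \<Longrightarrow> (\<Sum>j<N. 2 * (cmod (coeff cs f (Suc j)))\<^sup>2) \<le> L2_normsq 0 1 f"
  by (rule bessel) (auto simp: square_integrable_cs coeff_orthogonal, simp add: cs_def)

lemma coeff_prim:
  assumes g: "square_integrable 0 1 g" and "prim 0 g 1 = 0"
  shows "coeff cs g j = of_real (real j * pi) * coeff sn (prim 0 g) j"
proof -
  have "(LINT x|lebesgue_on {0<..<1}. prim 0 g x * (of_real (- (real j * pi)) * sn j x)) =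
      prim 0 g 1 * cs j 1 - (LINT x|lebesgue_on {0<..<1}. g x * cs j x)"
    by (rule prim_by_parts[OF g]) (auto intro!: cs_has_derivative[simplified] continuous_intros continuous_on_sn)
  moreover have "(LINT x|lebesgue_on {0<..<1}. prim 0 g x * (of_real (- (real j * pi)) * sn j x)) =
      of_real (- (real j * pi)) * coeff sn (prim 0 g) j"
    unfolding coeff_def integral_mult_right_zero[symmetric] by (simp add: mult_ac)
  ultimately show ?thesis using assms by (simp add: coeff_def)
qed

text \<open>A further factor cos(pi x) shifts the frequency by 1 up and down, so orthogonality to
  all cosines survives multiplication by powers of cos(pi x).\<close>

lemma cos_power_orthogonal:
  fixes u :: "real \<Rightarrow> real"
  assumes u: "continuous_on {0..1} u"
    and z: "\<And>k::nat. integral {0..1} (\<lambda>x. u x * cos (real k * pi * x)) = 0"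
  shows "integral {0..1} (\<lambda>x. u x * cos (pi * x) ^ m * cos (real k * pi * x)) = 0"
proof (induction m arbitrary: k)
  case (Suc m)
  have int: "(\<lambda>x. u x * cos (pi * x) ^ m * cos (real k * pi * x)) integrable_on {0..1}" for k
    by (intro integrable_continuous_interval continuous_intros u)
  show ?case
  proof (cases k)
    case 0
    \<comment> \<open>At k = 0 the shift down would leave the natural numbers; here the additional
      factor itself is the cosine of frequency 1.\<close>
    then show ?thesis using Suc[of 1] by (simp add: mult_ac)
  next
    case (Suc l)
    have "u x * cos (pi * x) ^ Suc m * cos (real k * pi * x) =
        (u x * cos (pi * x) ^ m * cos (real (Suc k) * pi * x) + u x * cos (pi * x) ^ m * cos (real l * pi * x)) / 2" for x
    proof -
      have "cos (pi * x) * cos (real k * pi * x) = (cos (real (Suc k) * pi * x) + cos (real l * pi * x)) / 2"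
        using cos_times_cos[of "real k * pi * x" "pi * x"] Suc by (simp add: algebra_simps)
      moreover have "u x * cos (pi * x) ^ Suc m * cos (real k * pi * x) =
          u x * cos (pi * x) ^ m * (cos (pi * x) * cos (real k * pi * x))" by (simp add: mult_ac)
      ultimately show ?thesis by (simp only: distrib_left times_divide_eq_right)
    qed
    then show ?thesis using int[of "Suc k"] int[of l] Suc.IH[of "Suc k"] Suc.IH[of l]
      by (simp only: Henstock_Kurzweil_Integration.integral_add integral_divide) simp
  qed
qed (use z in simp)

text \<open>The substitution y = cos(pi x) turns polynomials in cos(pi x) into algebraic ones. By
  Weierstrass they approximate u uniformly, and u is orthogonal to all of them, hence to
  itself.\<close>

lemma cosine_uniqueness:
  fixes u :: "real \<Rightarrow> real"
  assumes u: "continuous_on {0..1} u"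
    and z: "\<And>k::nat. integral {0..1} (\<lambda>x. u x * cos (real k * pi * x)) = 0"
    and "x \<in> {0..1}"
  shows "u x = 0"
proof -
  have int: "integral {0..1} (\<lambda>x. u x * u x) = 0"
  proof (rule ccontr)
    assume nz: "integral {0..1} (\<lambda>x. u x * u x) \<noteq> 0"
    define I where "I = integral {0..1} (\<lambda>x. u x * u x)"
    have Ipos: "I > 0"
      using nz integral_nonneg[of "\<lambda>x. u x * u x" "{0..1}"] u
      by (force simp: I_def intro!: integrable_continuous_interval continuous_intros)
    define J where "J = integral {0..1} (\<lambda>x. \<bar>u x\<bar>)"
    have J: "J \<ge> 0" unfolding J_def
      by (intro integral_nonneg integrable_continuous_interval continuous_intros u) auto
    \<comment> \<open>Chosen so that e J < I; the summand 1 covers the case J = 0.\<close>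
    define e where "e = I / (2 * (J + 1))"
    have e: "e > 0" "e * J < I" using Ipos J mult_nonneg_nonneg[of I J]
      by (auto simp: e_def field_simps intro: add_nonneg_pos)
    let ?h = "\<lambda>y. u (arccos y / pi)"
    have "continuous_on {-1..1} ?h"
      by (rule continuous_on_compose2[OF u]) (auto intro!: continuous_intros simp: arccos_lbound arccos_ubound divide_le_eq)
    then obtain p where p: "real_polynomial_function p" "\<And>y. y \<in> {-1..1} \<Longrightarrow> \<bar>?h y - p y\<bar> < e"
      using Stone_Weierstrass_real_polynomial_function[of "{-1..1::real}" ?h e] e by auto
    obtain a n where a: "p = (\<lambda>y. \<Sum>i\<le>n. a i * y ^ i)"
      using p(1) real_polynomial_function_iff_sum by auto
    let ?q = "\<lambda>x. \<Sum>i\<le>n. a i * cos (pi * x) ^ i"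
    have q: "\<bar>u x - ?q x\<bar> \<le> e" if "x \<in> {0..1}" for x
    proof -
      have "arccos (cos (pi * x)) = pi * x" using that by (intro arccos_cos) (auto simp: mult_le_cancel_left1)
      then have "?h (cos (pi * x)) = u x" by simp
      then show ?thesis using p(2)[of "cos (pi * x)"] a by simp
    qed
    have "integral {0..1} (\<lambda>x. u x * ?q x) = integral {0..1} (\<lambda>x. \<Sum>i\<le>n. a i * (u x * cos (pi * x) ^ i * cos (real 0 * pi * x)))"
      by (rule Henstock_Kurzweil_Integration.integral_cong) (simp add: sum_distrib_left mult_ac)
    also have "\<dots> = (\<Sum>i\<le>n. integral {0..1} (\<lambda>x. a i * (u x * cos (pi * x) ^ i * cos (real 0 * pi * x))))"
      by (intro Henstock_Kurzweil_Integration.integral_sum integrable_continuous_interval continuous_intros u) auto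
    also have "\<dots> = 0" using cos_power_orthogonal[OF u z, of _ 0] by (simp only: integral_mult_right) simp
    finally have "integral {0..1} (\<lambda>x. u x * ?q x) = 0" .
    moreover have "integral {0..1} (\<lambda>x. u x * (u x - ?q x)) = I - integral {0..1} (\<lambda>x. u x * ?q x)"
      unfolding I_def right_diff_distrib
      by (intro Henstock_Kurzweil_Integration.integral_diff integrable_continuous_interval continuous_intros u)
    ultimately have "I = integral {0..1} (\<lambda>x. u x * (u x - ?q x))" by simp
    also have "\<dots> \<le> integral {0..1} (\<lambda>x. e * \<bar>u x\<bar>)"
    proof (rule integral_le)
      fix x :: real assume x: "x \<in> {0..1}"
      have "u x * (u x - ?q x) \<le> \<bar>u x\<bar> * \<bar>u x - ?q x\<bar>" using abs_ge_self[of "u x * (u x - ?q x)"] by (simp only: abs_mult)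
      also have "\<dots> \<le> \<bar>u x\<bar> * e" using q[OF x] by (rule mult_left_mono) simp
      finally show "u x * (u x - ?q x) \<le> e * \<bar>u x\<bar>" by (simp add: mult.commute)
    qed (intro integrable_continuous_interval continuous_intros u)+
    also have "\<dots> = e * J" by (simp add: J_def)
    finally show False using e by simp
  qed
  have "((\<lambda>x. u x * u x) has_integral 0) (cbox 0 1)"
    using integrable_integral[of "\<lambda>x. u x * u x" "{0..1}"] int u
    by (auto intro!: integrable_continuous_interval continuous_intros)
  then have "u x * u x = 0"
    by (rule has_integral_0_cbox_imp_0[rotated 2]) (use assms in \<open>auto intro!: continuous_intros\<close>)
  then show ?thesis by simp
qed

text \<open>By product-to-sum formulas f(x) sin(pi x) is orthogonal to all cosines, and sin(pi x)
  has no zero in the open interval.\<close>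

lemma sine_uniqueness_real:
  fixes f :: "real \<Rightarrow> real"
  assumes f: "continuous_on {0..1} f"
    and z: "\<And>k::nat. integral {0..1} (\<lambda>x. f x * sin (real k * pi * x)) = 0"
    and x: "x \<in> {0<..<1}"
  shows "f x = 0"
proof -
  have "f x * sin (pi * x) = 0"
  proof (rule cosine_uniqueness[where u="\<lambda>x. f x * sin (pi * x)"])
    show "continuous_on {0..1} (\<lambda>x. f x * sin (pi * x))" by (intro continuous_intros f)
    fix k :: nat
    have int: "(\<lambda>x. f x * sin (real k * pi * x)) integrable_on {0..1}" for k :: nat
      by (intro integrable_continuous_interval continuous_intros f)
    show "integral {0..1} (\<lambda>x. f x * sin (pi * x) * cos (real k * pi * x)) = 0"
    proof (cases k)
      case 0
      then show ?thesis using z[of 1] by simp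
    next
      case (Suc l)
      have "f x * sin (pi * x) * cos (real k * pi * x) =
          (f x * sin (real (Suc k) * pi * x) - f x * sin (real l * pi * x)) / 2" for x
      proof -
        have "sin (pi * x) * cos (real k * pi * x) = (sin (real (Suc k) * pi * x) - sin (real l * pi * x)) / 2"
          using cos_times_sin[of "real k * pi * x" "pi * x"] Suc by (simp add: algebra_simps)
        moreover have "f x * sin (pi * x) * cos (real k * pi * x) = f x * (sin (pi * x) * cos (real k * pi * x))"
          by simp
        ultimately show ?thesis by (simp only: right_diff_distrib times_divide_eq_right)
      qed
      then show ?thesis using int[of "Suc k"] int[of l] z[of "Suc k"] z[of l]
        by (simp only: Henstock_Kurzweil_Integration.integral_diff integral_divide) simp
    qed
  qed (use x in auto)
  moreover have "sin (pi * x) > 0" using x by (intro sin_gt_zero) auto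
  ultimately show ?thesis by simp
qed

lemma sine_uniqueness:
  assumes f: "continuous_on {0..1} f" and z: "\<And>j. j > 0 \<Longrightarrow> coeff sn f j = 0" and x: "x \<in> {0..1}"
  shows "f x = 0"
proof -
  have int: "integrable (lebesgue_on {0<..<1}) (\<lambda>x. f x * sn k x)" for k
    by (intro square_integrable_mult square_integrable_sn square_integrable_continuous f)
  have c: "coeff sn f k = 0" for k
    using z by (cases "k = 0") (auto simp: coeff_def sn_def)
  have Re: "integral {0..1} (\<lambda>x. Re (f x) * sin (real k * pi * x)) = 0" for k
  proof -
    have "(LINT x|lebesgue_on {0<..<1}. Re (f x * sn k x)) = 0"
      using integral_Re[OF int[of k]] c[of k] by (simp add: coeff_def)
    then show ?thesis using LINT_interval_eq_integral[OF integrable_Re[OF int[of k]]] by (simp add: sn_def)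
  qed
  have Im: "integral {0..1} (\<lambda>x. Im (f x) * sin (real k * pi * x)) = 0" for k
  proof -
    have "(LINT x|lebesgue_on {0<..<1}. Im (f x * sn k x)) = 0"
      using integral_Im[OF int[of k]] c[of k] by (simp add: coeff_def)
    then show ?thesis using LINT_interval_eq_integral[OF integrable_Im[OF int[of k]]] by (simp add: sn_def)
  qed
  have "f y = 0" if "y \<in> {0<..<1}" for y
    using sine_uniqueness_real[OF continuous_on_Re[OF f] Re that] sine_uniqueness_real[OF continuous_on_Im[OF f] Im that]
    by (simp add: complex_eq_iff)
  then have "AE y in lebesgue_on {0<..<1}. f y = 0" by (intro AE_I2) simp
  then show ?thesis
    using continuous_AE_eq_imp_eq[OF f continuous_on_const _ _ x] by simp
qed


text \<open>For j > 0 and g of mean zero this is the sine coefficient of the primitive of g. Written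
  through the cosine coefficients of g it shows the product of 1/j and a square summable
  sequence.\<close>

definition sine_coeff :: "(real \<Rightarrow> complex) \<Rightarrow> nat \<Rightarrow> complex" where
  "sine_coeff g j = coeff cs g j / of_real (real j * pi)"

lemma coeff_sn_prim:
  assumes "square_integrable 0 1 g" "prim 0 g 1 = 0" "j > 0"
  shows "coeff sn (prim 0 g) j = sine_coeff g j"
  using coeff_prim[OF assms(1,2), of j] assms(3) by (simp add: sine_coeff_def)

text \<open>The inequality 2 a b \<le> a^2 + b^2 with b = 1/j makes the coefficients absolutely
  summable.\<close>

lemma sine_coeff_bound:
  "cmod (2 * sine_coeff g (Suc j)) \<le> (cmod (coeff cs g (Suc j)))\<^sup>2 + 1 / (real (Suc j))\<^sup>2"
proof -
  define a b where "a = cmod (coeff cs g (Suc j))" and "b = 1 / real (Suc j)"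
  have ab: "a \<ge> 0" "b \<ge> 0" by (auto simp: a_def b_def)
  have "cmod (2 * sine_coeff g (Suc j)) = 2 * a * b / pi"
    by (simp add: sine_coeff_def a_def b_def norm_mult norm_divide del: of_nat_Suc)
  also have "\<dots> \<le> 2 * a * b"
    using ab pi_gt3 by (simp add: divide_le_eq mult_le_cancel_left1) (smt (verit) mult_nonneg_nonneg)
  also have "\<dots> \<le> a\<^sup>2 + b\<^sup>2" by (rule sum_squares_bound)
  finally show ?thesis by (simp add: a_def b_def power_divide)
qed

lemma summable_inverse_Suc_squares: "summable (\<lambda>j. 1 / (real (Suc j))\<^sup>2)"
  using inverse_power_summable[of 2, where 'a=real] by (subst summable_Suc_iff) (simp add: inverse_eq_divide power_one_over)

lemma summable_coeff_cs:
  assumes "square_integrable 0 1 g"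
  shows "summable (\<lambda>j. (cmod (coeff cs g (Suc j)))\<^sup>2)"
proof -
  have "summable (\<lambda>j. 2 * (cmod (coeff cs g (Suc j)))\<^sup>2)"
    by (rule bounded_imp_summable[of _ "L2_normsq 0 1 g"])
      (use bessel_cs[OF assms, of "Suc _"] in \<open>auto simp: lessThan_Suc_atMost\<close>)
  then show ?thesis by simp
qed

lemma summable_sine_coeff:
  assumes "square_integrable 0 1 g"
  shows "summable (\<lambda>j. cmod (2 * sine_coeff g (Suc j)))"
  by (rule summable_comparison_test_ev[OF _ summable_add[OF summable_coeff_cs[OF assms] summable_inverse_Suc_squares]])
    (use sine_coeff_bound in auto)

lemma uniform_limit_mult_integral:
  assumes u: "uniform_limit {0..1} S s sequentially" and f: "square_integrable 0 1 f"
    and S: "\<And>n. continuous_on {0..1} (S n)" and s: "continuous_on {0..1} s"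
  shows "(\<lambda>n. LINT x|lebesgue_on {0<..<1}. f x * S n x) \<longlonglongrightarrow> (LINT x|lebesgue_on {0<..<1}. f x * s x)"
proof (rule LIMSEQ_I)
  fix r :: real assume "r > 0"
  define e where "e = r / (1 + sqrt (L2_normsq 0 1 f))"
  have "e > 0" using \<open>r > 0\<close> L2_normsq_nonneg[of 0 1 f] by (auto simp: e_def intro!: divide_pos_pos add_pos_nonneg)
  then obtain N where N: "\<And>n x. n \<ge> N \<Longrightarrow> x \<in> {0..1} \<Longrightarrow> dist (S n x) (s x) < e"
    using uniform_limitD[OF u \<open>e > 0\<close>] unfolding eventually_sequentially by blast
  note sq = square_integrable_continuous[OF S] square_integrable_continuous[OF s]
  have "cmod ((LINT x|lebesgue_on {0<..<1}. f x * S n x) - (LINT x|lebesgue_on {0<..<1}. f x * s x)) < r" if "n \<ge> N" for n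
  proof -
    have "(LINT x|lebesgue_on {0<..<1}. f x * S n x) - (LINT x|lebesgue_on {0<..<1}. f x * s x) =
        (LINT x|lebesgue_on {0<..<1}. f x * (S n x - s x))"
      using square_integrable_mult[OF f sq(1)] square_integrable_mult[OF f sq(2)] by (simp add: right_diff_distrib)
    also have "(cmod \<dots>)\<^sup>2 \<le> L2_normsq 0 1 f * L2_normsq 0 1 (\<lambda>x. S n x - s x)"
      by (intro L2_Cauchy_Schwarz f square_integrable_diff sq)
    also have "\<dots> \<le> L2_normsq 0 1 f * ((1 - 0) * e\<^sup>2)"
      using N[OF that] by (intro mult_left_mono L2_normsq_bounded L2_normsq_nonneg square_integrable_diff sq)
        (auto simp: dist_norm less_imp_le)
    also have "\<dots> = (sqrt (L2_normsq 0 1 f) * e)\<^sup>2" by (simp add: power_mult_distrib L2_normsq_nonneg)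
    finally have "cmod ((LINT x|lebesgue_on {0<..<1}. f x * S n x) - (LINT x|lebesgue_on {0<..<1}. f x * s x))
        \<le> sqrt (L2_normsq 0 1 f) * e"
      using \<open>e > 0\<close> L2_normsq_nonneg[of 0 1 f] by (auto intro: power2_le_imp_le)
    also have "\<dots> < (1 + sqrt (L2_normsq 0 1 f)) * e" using \<open>e > 0\<close> by simp
    also have "\<dots> = r" using L2_normsq_nonneg[of 0 1 f] real_sqrt_ge_zero[of "L2_normsq 0 1 f"] by (simp add: e_def add_nonneg_eq_0_iff)
    finally show ?thesis .
  qed
  then show "\<exists>N. \<forall>n\<ge>N. cmod ((LINT x|lebesgue_on {0<..<1}. f x * S n x) - (LINT x|lebesgue_on {0<..<1}. f x * s x)) < r"
    by blast
qed

text \<open>Absolutely summable coefficients make the series converge uniformly to some continuous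
  s; s and the primitive have the same sine coefficients, so \<open>sine_uniqueness\<close>
  identifies them.\<close>

lemma sine_series:
  assumes g: "square_integrable 0 1 g" and z: "prim 0 g 1 = 0"
  shows "uniform_limit {0..1} (\<lambda>n x. \<Sum>j<n. 2 * sine_coeff g (Suc j) * sn (Suc j) x) (prim 0 g) sequentially"
proof -
  let ?t = "\<lambda>j x. 2 * sine_coeff g (Suc j) * sn (Suc j) x"
  define s where "s = (\<lambda>x. suminf (\<lambda>j. ?t j x))"
  have ul: "uniform_limit {0..1} (\<lambda>n x. \<Sum>j<n. ?t j x) s sequentially"
    unfolding s_def
  proof (rule Weierstrass_m_test[OF _ summable_sine_coeff[OF g]])
    fix j and x :: real
    show "cmod (?t j x) \<le> cmod (2 * sine_coeff g (Suc j))"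
      unfolding norm_mult[of _ "sn (Suc j) x"] by (rule mult_right_le_one_le) (auto simp: norm_sn)
  qed
  have cS: "continuous_on {0..1} (\<lambda>x. \<Sum>j<n. ?t j x)" for n
    by (intro continuous_intros continuous_on_sn)
  have cs: "continuous_on {0..1} s"
    by (rule uniform_limit_theorem[OF _ ul]) (auto simp: cS)
  have "s x - prim 0 g x = 0" if x: "x \<in> {0..1}" for x
  proof (rule sine_uniqueness[where f="\<lambda>x. s x - prim 0 g x", OF _ _ x])
    show "continuous_on {0..1} (\<lambda>x. s x - prim 0 g x)"
      by (intro continuous_intros cs continuous_on_prim g)
    fix k :: nat assume "k > 0"
    have "(\<lambda>n. LINT x|lebesgue_on {0<..<1}. sn k x * (\<Sum>j<n. ?t j x)) \<longlonglongrightarrow> (LINT x|lebesgue_on {0<..<1}. sn k x * s x)"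
      by (rule uniform_limit_mult_integral[OF ul square_integrable_sn cS cs])
    \<comment> \<open>Frequency k sits at the index k - 1, so the coefficient is final as soon as n
      \<ge> k.\<close>
    moreover have "\<forall>\<^sub>F n in sequentially. (LINT x|lebesgue_on {0<..<1}. sn k x * (\<Sum>j<n. ?t j x)) = sine_coeff g k"
    proof (rule eventually_sequentiallyI[of k])
      fix n assume "k \<le> n"
      have i: "integrable (lebesgue_on {0<..<1}) (\<lambda>x. sn k x * sn j x)" for j
        by (intro square_integrable_mult square_integrable_sn)
      have "sn k x * (\<Sum>j<n. ?t j x) = (\<Sum>j<n. 2 * sine_coeff g (Suc j) * (sn k x * sn (Suc j) x))" for x
        by (simp add: sum_distrib_left mult_ac)
      then have "(LINT x|lebesgue_on {0<..<1}. sn k x * (\<Sum>j<n. ?t j x)) =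
          (\<Sum>j<n. LINT x|lebesgue_on {0<..<1}. 2 * sine_coeff g (Suc j) * (sn k x * sn (Suc j) x))"
        by (simp only: Bochner_Integration.integral_sum integrable_mult_right i)
      also have "\<dots> = (\<Sum>j<n. 2 * sine_coeff g (Suc j) * coeff sn (sn k) (Suc j))"
        by (simp add: coeff_def)
      also have "\<dots> = (\<Sum>j<n. if j = k - 1 then sine_coeff g k else 0)"
        using \<open>k > 0\<close> by (intro sum.cong) (auto simp: coeff_orthogonal)
      also have "\<dots> = sine_coeff g k" using \<open>k \<le> n\<close> \<open>k > 0\<close> by simp
      finally show "(LINT x|lebesgue_on {0<..<1}. sn k x * (\<Sum>j<n. ?t j x)) = sine_coeff g k" .
    qed
    then have "(\<lambda>n. LINT x|lebesgue_on {0<..<1}. sn k x * (\<Sum>j<n. ?t j x)) \<longlonglongrightarrow> sine_coeff g k"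
      by (rule tendsto_eventually)
    ultimately have "(LINT x|lebesgue_on {0<..<1}. sn k x * s x) = sine_coeff g k"
      by (rule LIMSEQ_unique)
    then have "coeff sn s k = sine_coeff g k" by (simp add: coeff_def mult.commute)
    then show "coeff sn (\<lambda>x. s x - prim 0 g x) k = 0"
      using coeff_sn_prim[OF g z \<open>k > 0\<close>]
      by (simp add: coeff_diff[OF square_integrable_continuous[OF cs] square_integrable_prim[OF g] square_integrable_sn])
  qed
  then have "s x = prim 0 g x" if "x \<in> {0..1}" for x using that by simp
  then show ?thesis using uniform_limit_cong'[of "{0..1}" _ _ s "prim 0 g" sequentially] ul by blast
qed

lemma sine_series_pointwise:
  assumes "square_integrable 0 1 g" "prim 0 g 1 = 0" "x \<in> {0..1}"
  shows "(\<lambda>j. 2 * sine_coeff g (Suc j) * sn (Suc j) x) sums prim 0 g x"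
  using tendsto_uniform_limitI[OF sine_series[OF assms(1,2)] assms(3)] by (simp add: sums_def)

text \<open>A Parseval formula in which only one of the two functions must be a primitive; f is an
  arbitrary square integrable function.\<close>

lemma sine_series_integral:
  assumes g: "square_integrable 0 1 g" and z: "prim 0 g 1 = 0" and f: "square_integrable 0 1 f"
  shows "(\<lambda>j. 2 * sine_coeff g (Suc j) * coeff sn f (Suc j)) sums (LINT x|lebesgue_on {0<..<1}. f x * prim 0 g x)"
proof -
  let ?t = "\<lambda>j x. 2 * sine_coeff g (Suc j) * sn (Suc j) x"
  have "(\<lambda>n. LINT x|lebesgue_on {0<..<1}. f x * (\<Sum>j<n. ?t j x)) \<longlonglongrightarrow> (LINT x|lebesgue_on {0<..<1}. f x * prim 0 g x)"
    by (rule uniform_limit_mult_integral[OF sine_series[OF g z] f])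
      (intro continuous_intros continuous_on_sn continuous_on_prim g)+
  moreover have "(LINT x|lebesgue_on {0<..<1}. f x * (\<Sum>j<n. ?t j x)) =
      (\<Sum>j<n. 2 * sine_coeff g (Suc j) * coeff sn f (Suc j))" for n
  proof -
    have i: "integrable (lebesgue_on {0<..<1}) (\<lambda>x. f x * sn j x)" for j
      by (intro square_integrable_mult square_integrable_sn f)
    have "f x * (\<Sum>j<n. ?t j x) = (\<Sum>j<n. 2 * sine_coeff g (Suc j) * (f x * sn (Suc j) x))" for x
      by (simp add: sum_distrib_left mult_ac)
    then have "(LINT x|lebesgue_on {0<..<1}. f x * (\<Sum>j<n. ?t j x)) =
        (\<Sum>j<n. LINT x|lebesgue_on {0<..<1}. 2 * sine_coeff g (Suc j) * (f x * sn (Suc j) x))"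
      by (simp only: Bochner_Integration.integral_sum integrable_mult_right i)
    then show ?thesis by (simp add: coeff_def)
  qed
  ultimately show ?thesis by (simp add: sums_def)
qed

subsection \<open>The space \<open>L2_unit\<close>\<close>

lemma rep_L2_square_integrable: "square_integrable 0 1 (rep_L2_unit u)"
  using Quotient3_rep_reflp[OF Quotient3_L2_unit, of u] by (simp add: L2_eq_def)

lemma rep_abs_L2:
  assumes "square_integrable 0 1 f"
  shows "AE x in lebesgue_on {0<..<1}. rep_L2_unit (abs_L2_unit f) x = f x"
  using Quotient3_rep_abs[OF Quotient3_L2_unit, of f] assms by (simp add: L2_eq_def)

lemma L2_eq_refl: "L2_eq f f \<longleftrightarrow> square_integrable 0 1 f"
  by (simp add: L2_eq_def)

lemma abs_rep_L2: "abs_L2_unit (rep_L2_unit u) = u"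
  by (rule Quotient3_abs_rep[OF Quotient3_L2_unit])

lemma abs_L2_cong:
  assumes "square_integrable 0 1 f" "square_integrable 0 1 g" "AE x in lebesgue_on {0<..<1}. f x = g x"
  shows "abs_L2_unit f = abs_L2_unit g"
  using Quotient3_rel_abs[OF Quotient3_L2_unit, of f g] assms by (simp add: L2_eq_def)

lemma L2_unit_eqI:
  assumes "AE x in lebesgue_on {0<..<1}. rep_L2_unit u x = rep_L2_unit v x"
  shows "u = v"
  using abs_L2_cong[OF rep_L2_square_integrable rep_L2_square_integrable assms] by (simp add: abs_rep_L2)

lemma rep_L2_add: "AE x in lebesgue_on {0<..<1}. rep_L2_unit (u + v) x = rep_L2_unit u x + rep_L2_unit v x"
proof -
  have "u + v = abs_L2_unit (\<lambda>x. rep_L2_unit u x + rep_L2_unit v x)"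
    using plus_L2_unit.abs_eq[of "rep_L2_unit u" "rep_L2_unit v"]
    by (simp add: L2_eq_refl rep_L2_square_integrable abs_rep_L2)
  then show ?thesis using rep_abs_L2[OF square_integrable_add[OF rep_L2_square_integrable rep_L2_square_integrable]] by simp
qed

lemma rep_L2_scaleR: "AE x in lebesgue_on {0<..<1}. rep_L2_unit (r *\<^sub>R u) x = of_real r * rep_L2_unit u x"
proof -
  have "r *\<^sub>R u = abs_L2_unit (\<lambda>x. of_real r * rep_L2_unit u x)"
    using scaleR_L2_unit.abs_eq[of "rep_L2_unit u" r]
    by (simp add: L2_eq_refl rep_L2_square_integrable abs_rep_L2)
  then show ?thesis using rep_abs_L2[OF square_integrable_scale[OF rep_L2_square_integrable]] by simp
qed

lemma rep_L2_diff: "AE x in lebesgue_on {0<..<1}. rep_L2_unit (u - v) x = rep_L2_unit u x - rep_L2_unit v x"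
  using rep_L2_add[of u "(-1) *\<^sub>R v"] rep_L2_scaleR[of "-1" v] by eventually_elim simp

lemma inner_L2_rep: "u \<bullet> v = Re (LINT x|lebesgue_on {0<..<1}. rep_L2_unit u x * cnj (rep_L2_unit v x))"
proof -
  have "u \<bullet> v = (LINT x|lebesgue_on {0<..<1}. rep_L2_unit u x \<bullet> rep_L2_unit v x)"
    using inner_L2_unit.abs_eq[of "rep_L2_unit u" "rep_L2_unit v"]
    by (simp add: L2_eq_refl rep_L2_square_integrable abs_rep_L2)
  also have "\<dots> = (LINT x|lebesgue_on {0<..<1}. Re (rep_L2_unit u x * cnj (rep_L2_unit v x)))"
    by (simp add: inner_complex_def)
  also have "\<dots> = Re (LINT x|lebesgue_on {0<..<1}. rep_L2_unit u x * cnj (rep_L2_unit v x))"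
    by (intro integral_Re square_integrable_mult square_integrable_cnj rep_L2_square_integrable)
  finally show ?thesis .
qed

lemma norm_L2_rep: "(norm u)\<^sup>2 = L2_normsq 0 1 (rep_L2_unit u)"
proof -
  have "(norm u)\<^sup>2 = u \<bullet> u" by (simp add: dot_square_norm)
  also have "\<dots> = (LINT x|lebesgue_on {0<..<1}. rep_L2_unit u x \<bullet> rep_L2_unit u x)"
    using inner_L2_unit.abs_eq[of "rep_L2_unit u" "rep_L2_unit u"]
    by (simp add: L2_eq_refl rep_L2_square_integrable abs_rep_L2)
  finally show ?thesis by (simp add: L2_normsq_def dot_square_norm)
qed

lemma norm_abs_L2: "square_integrable 0 1 f \<Longrightarrow> (norm (abs_L2_unit f))\<^sup>2 = L2_normsq 0 1 f"
  unfolding norm_L2_rep by (rule L2_normsq_cong_AE[OF rep_L2_square_integrable _ rep_abs_L2])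

text \<open>Point values of primitives and all Fourier coefficients have this form. As bounded
  linear maps they can be differentiated along orbits.\<close>

lemma bounded_linear_L2_functional:
  assumes \<theta>: "square_integrable 0 1 \<theta>"
  shows "bounded_linear (\<lambda>u. LINT x|lebesgue_on {0<..<1}. rep_L2_unit u x * \<theta> x)"
proof (rule bounded_linear_intro)
  note sq = rep_L2_square_integrable
  note int = square_integrable_mult[OF sq \<theta>]
  have cong: "(LINT x|lebesgue_on {0<..<1}. f x * \<theta> x) = (LINT x|lebesgue_on {0<..<1}. g x * \<theta> x)"
    if "square_integrable 0 1 f" "square_integrable 0 1 g" "AE x in lebesgue_on {0<..<1}. f x = g x" for f g
    by (rule integral_cong_AE) (use that \<theta> in \<open>auto simp: square_integrable_def elim!: eventually_mono\<close>)
  show "(LINT x|lebesgue_on {0<..<1}. rep_L2_unit (u + v) x * \<theta> x) =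
      (LINT x|lebesgue_on {0<..<1}. rep_L2_unit u x * \<theta> x) + (LINT x|lebesgue_on {0<..<1}. rep_L2_unit v x * \<theta> x)" for u v
    using cong[OF sq square_integrable_add[OF sq sq] rep_L2_add[of u v]] int by (simp add: distrib_right)
  show "(LINT x|lebesgue_on {0<..<1}. rep_L2_unit (r *\<^sub>R u) x * \<theta> x) =
      r *\<^sub>R (LINT x|lebesgue_on {0<..<1}. rep_L2_unit u x * \<theta> x)" for r u
    using cong[OF sq square_integrable_scale[OF sq] rep_L2_scaleR[of r u]] by (simp add: mult.assoc scaleR_conv_of_real)
  show "cmod (LINT x|lebesgue_on {0<..<1}. rep_L2_unit u x * \<theta> x) \<le> norm u * sqrt (L2_normsq 0 1 \<theta>)" for u
  proof (rule power2_le_imp_le)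
    show "(cmod (LINT x|lebesgue_on {0<..<1}. rep_L2_unit u x * \<theta> x))\<^sup>2 \<le> (norm u * sqrt (L2_normsq 0 1 \<theta>))\<^sup>2"
      using L2_Cauchy_Schwarz[OF sq[of u] \<theta>] by (simp add: power_mult_distrib norm_L2_rep L2_normsq_nonneg)
  qed (simp add: L2_normsq_nonneg)
qed

lemma prim_eq_functional:
  assumes "square_integrable 0 1 f" "x \<in> {0..1}"
  shows "prim 0 f x = (LINT y|lebesgue_on {0<..<1}. f y * indicator {0<..<x} y)"
proof -
  have "prim 0 f x = (LINT y|lebesgue_on {0<..<1}. (if y \<in> {0<..<x} then f y else 0))"
    unfolding prim_def using assms(2) by (intro integral_restrict[symmetric]) auto
  also have "\<dots> = (LINT y|lebesgue_on {0<..<1}. f y * indicator {0<..<x} y)"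
    by (rule Bochner_Integration.integral_cong) (auto simp: indicator_def)
  finally show ?thesis .
qed

lemma square_integrable_indicator: "square_integrable a b (indicator {c<..<d})"
  by (rule square_integrable_bounded[of _ a b 1]) (use measurable_restrict_space1[OF borel_measurable_indicator[OF sets_lebesgue_interval]] in \<open>auto simp: indicator_def\<close>)

lemma bounded_linear_prim:
  assumes "x \<in> {0..1}"
  shows "bounded_linear (\<lambda>u. prim 0 (rep_L2_unit u) x)"
  using bounded_linear_L2_functional[OF square_integrable_indicator[of 0 1 0 x]]
  by (simp add: prim_eq_functional[OF rep_L2_square_integrable assms])

lemma bounded_linear_coeff_sn: "bounded_linear (\<lambda>u. coeff sn (rep_L2_unit u) j)"
  and bounded_linear_coeff_cs: "bounded_linear (\<lambda>u. coeff cs (rep_L2_unit u) j)"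
  unfolding coeff_def by (intro bounded_linear_L2_functional square_integrable_sn square_integrable_cs)+

text \<open>Riesz-Fischer for geometrically convergent sequences, the only kind that the gliding
  hump argument produces. A pointwise limit is found almost everywhere, with an integrable majorant
  D for the squared errors.\<close>

lemma geometric_Cauchy_convergent_L2:
  fixes u :: "nat \<Rightarrow> L2_unit"
  assumes u: "\<And>n. norm (u (Suc n) - u n) \<le> K * (1 / 3) ^ n"
  obtains l where "u \<longlonglongrightarrow> l"
proof -
  have K: "K \<ge> 0" using order_trans[OF norm_ge_zero u[of 0]] by simp
  define f where "f = (\<lambda>n. rep_L2_unit (u n))"
  have sq: "square_integrable 0 1 (f n)" for n unfolding f_def by (rule rep_L2_square_integrable)
  note sqd = square_integrable_diff[OF sq sq]
  have d: "L2_normsq 0 1 (\<lambda>x. f (Suc n) x - f n x) \<le> K\<^sup>2 * (1 / 9) ^ n" for n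
  proof -
    have "L2_normsq 0 1 (\<lambda>x. f (Suc n) x - f n x) = (norm (u (Suc n) - u n))\<^sup>2"
      unfolding norm_L2_rep f_def
      by (rule L2_normsq_cong_AE[OF square_integrable_diff[OF rep_L2_square_integrable rep_L2_square_integrable] rep_L2_square_integrable])
        (rule eventually_mono[OF rep_L2_diff[of "u (Suc n)" "u n"]], simp)
    also have "\<dots> \<le> (K * (1 / 3) ^ n)\<^sup>2" by (rule power_mono[OF u]) simp
    also have "\<dots> = K\<^sup>2 * ((1 / 3)\<^sup>2) ^ n"
      unfolding power_mult_distrib by (simp only: power_mult[symmetric] mult.commute[of n 2])
    also have "((1 / 3)\<^sup>2 :: real) = 1 / 9" by (simp add: power2_eq_square)
    finally show ?thesis .
  qed
  \<comment> \<open>The weights grow, so that tails of the increments become small pointwise, but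
    slower than 9^n, so that the integrals still sum up like (2/9)^n.\<close>
  define w where "w = (\<lambda>n x. 2 ^ n * (cmod (f (Suc n) x - f n x))\<^sup>2)"
  have wint: "integrable (lebesgue_on {0<..<1}) (w n)" for n
    unfolding w_def using square_integrable_square[OF sqd] by (intro integrable_mult_right)
  have wle: "(LINT x|lebesgue_on {0<..<1}. w n x) \<le> K\<^sup>2 * (2 / 9) ^ n" for n
  proof -
    have "(LINT x|lebesgue_on {0<..<1}. w n x) = 2 ^ n * L2_normsq 0 1 (\<lambda>x. f (Suc n) x - f n x)"
      by (simp add: w_def L2_normsq_def)
    also have "\<dots> \<le> 2 ^ n * (K\<^sup>2 * (1 / 9) ^ n)" by (intro mult_left_mono d) simp
    finally show ?thesis by (simp add: power_divide mult.commute)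
  qed
  have wsum: "summable (\<lambda>n. LINT x|lebesgue_on {0<..<1}. norm (w n x))"
  proof (rule summable_comparison_test)
    show "\<exists>N. \<forall>n\<ge>N. norm (LINT x|lebesgue_on {0<..<1}. norm (w n x)) \<le> K\<^sup>2 * (2 / 9) ^ n"
    proof (intro exI allI impI)
      fix n
      have w0: "w n x \<ge> 0" for x by (simp add: w_def)
      then have "(LINT x|lebesgue_on {0<..<1}. norm (w n x)) = (LINT x|lebesgue_on {0<..<1}. w n x)" by simp
      moreover have "(LINT x|lebesgue_on {0<..<1}. w n x) \<ge> 0" using w0 by simp
      ultimately show "norm (LINT x|lebesgue_on {0<..<1}. norm (w n x)) \<le> K\<^sup>2 * (2 / 9) ^ n"
        using wle[of n] by (simp only: real_norm_def abs_of_nonneg)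
    qed
    show "summable (\<lambda>n. K\<^sup>2 * (2 / 9 :: real) ^ n)" by (intro summable_mult summable_geometric) simp
  qed
  have "AE x in lebesgue_on {0<..<1}. summable (\<lambda>n. norm (w n x))"
  proof -
    have "(\<integral>\<^sup>+x. (\<Sum>n. ennreal (norm (w n x))) \<partial>lebesgue_on {0<..<1}) = (\<Sum>n. \<integral>\<^sup>+x. ennreal (norm (w n x)) \<partial>lebesgue_on {0<..<1})"
      using wint by (intro nn_integral_suminf) (auto dest: borel_measurable_integrable)
    also have "\<dots> = (\<Sum>n. ennreal (LINT x|lebesgue_on {0<..<1}. norm (w n x)))"
      by (intro suminf_cong nn_integral_eq_integral integrable_norm wint) auto
    also have "\<dots> = ennreal (\<Sum>n. LINT x|lebesgue_on {0<..<1}. norm (w n x))"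
      by (intro suminf_ennreal2 wsum) auto
    finally have "(\<integral>\<^sup>+x. (\<Sum>n. ennreal (norm (w n x))) \<partial>lebesgue_on {0<..<1}) \<noteq> \<infinity>" by simp
    then have "AE x in lebesgue_on {0<..<1}. (\<Sum>n. ennreal (norm (w n x))) \<noteq> \<infinity>"
      using wint by (intro nn_integral_PInf_AE borel_measurable_suminf_order)
        (auto dest: borel_measurable_integrable)
    then show ?thesis
      by eventually_elim (rule summable_suminf_not_top, auto simp: infinity_ennreal_def)
  qed
  then have lim: "AE x in lebesgue_on {0<..<1}. summable (\<lambda>n. cmod (f (Suc n) x - f n x)) \<and> summable (\<lambda>n. w n x)"
  proof eventually_elim
    case (elim x)
    then have sw: "summable (\<lambda>n. w n x)" by (rule summable_norm_cancel)
    \<comment> \<open>With y = 2^n a this is y \<le> y^2 + 1 divided by 2^n.\<close>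
    have "cmod (f (Suc n) x - f n x) \<le> w n x + (1/2) ^ n" for n
    proof -
      define a where "a = cmod (f (Suc n) x - f n x)"
      define y where "y = 2 ^ n * a"
      have "y \<ge> 0" by (simp add: y_def a_def)
      then have "y \<le> y\<^sup>2 + 1" using sum_squares_bound[of y 1] by simp
      then have "a \<le> ((2 ^ n * a)\<^sup>2 + 1) / 2 ^ n" unfolding y_def by (simp only: pos_le_divide_eq zero_less_power zero_less_numeral mult.commute)
      also have "\<dots> = 2 ^ n * a\<^sup>2 + (1/2) ^ n"
        by (simp add: power_mult_distrib power2_eq_square add_divide_distrib power_divide)
      finally show ?thesis by (simp add: w_def a_def)
    qed
    moreover have "summable (\<lambda>n. w n x + (1/2::real) ^ n)"
      using sw by (intro summable_add summable_geometric) auto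
    ultimately have "summable (\<lambda>n. cmod (f (Suc n) x - f n x))"
      by (intro summable_comparison_test_ev[of "\<lambda>n. cmod (f (Suc n) x - f n x)" "\<lambda>n. w n x + (1/2) ^ n"]) auto
    with sw show ?case by simp
  qed
  define D where "D = (\<lambda>x. \<Sum>n. w n x)"
  have Dint: "integrable (lebesgue_on {0<..<1}) D"
    unfolding D_def
    by (rule integrable_suminf[OF wint _ wsum]) (use lim in \<open>auto elim!: eventually_mono simp: w_def\<close>)
  define h where "h = (\<lambda>x. lim (\<lambda>n. f n x))"
  have hm: "h \<in> borel_measurable (lebesgue_on {0<..<1})"
    unfolding h_def by (rule borel_measurable_lim_metric) (rule square_integrable_measurable[OF sq])
  have conv: "AE x in lebesgue_on {0<..<1}. (\<lambda>n. f n x) \<longlonglongrightarrow> h x \<and>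
     (\<forall>n. (cmod (h x - f n x))\<^sup>2 \<le> 2 * (1/2) ^ n * D x)"
    using lim
  proof eventually_elim
    case (elim x)
    define d where "d = (\<lambda>n. cmod (f (Suc n) x - f n x))"
    have sd: "summable d" and sw: "summable (\<lambda>n. w n x)" using elim by (auto simp: d_def)
    have "summable (\<lambda>n. f (Suc n) x - f n x)" using elim by (intro summable_norm_cancel[OF conjunct1])
    then obtain s where "(\<lambda>n. f (Suc n) x - f n x) sums s" by (auto simp: summable_def)
    then have "(\<lambda>n. f n x - f 0 x) \<longlonglongrightarrow> s" by (simp add: sums_def sum_lessThan_telescope[of "\<lambda>n. f n x"])
    then have "(\<lambda>n. (f n x - f 0 x) + f 0 x) \<longlonglongrightarrow> s + f 0 x" by (intro tendsto_intros)
    then have l': "(\<lambda>n. f n x) \<longlonglongrightarrow> s + f 0 x" by simp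
    then have l: "(\<lambda>n. f n x) \<longlonglongrightarrow> h x"
      unfolding h_def limI[OF l'] .
    have "(cmod (h x - f n x))\<^sup>2 \<le> 2 * (1/2) ^ n * D x" for n
    proof (rule LIMSEQ_le_const2)
      show "(\<lambda>m. (cmod (f m x - f n x))\<^sup>2) \<longlonglongrightarrow> (cmod (h x - f n x))\<^sup>2"
        by (intro tendsto_intros l)
      show "\<exists>N. \<forall>m\<ge>N. (cmod (f m x - f n x))\<^sup>2 \<le> 2 * (1/2) ^ n * D x"
      proof (intro exI allI impI)
        fix m assume m: "n \<le> m"
        have "f m x - f n x = (\<Sum>k=n..<m. f (Suc k) x - f k x)" using sum_Suc_diff'[OF m, of "\<lambda>k. f k x"] by simp
        then have "cmod (f m x - f n x) \<le> (\<Sum>k=n..<m. d k)" by (simp add: d_def norm_sum)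
        then have "(cmod (f m x - f n x))\<^sup>2 \<le> (\<Sum>k=n..<m. d k)\<^sup>2" by (rule power_mono) simp
        \<comment> \<open>Splitting off the weights and using Cauchy-Schwarz leaves a geometric tail
          of size 2 (1/2)^n times the weighted sum, which is at most D.\<close>
        also have "(\<Sum>k=n..<m. d k) = (\<Sum>k=n..<m. sqrt ((1/2) ^ k) * (sqrt (2 ^ k) * d k))"
        proof (rule sum.cong)
          fix k
          have "sqrt ((1/2) ^ k) * sqrt (2 ^ k) = (1::real)"
            unfolding real_sqrt_mult[symmetric] power_mult_distrib[symmetric] by simp
          then show "d k = sqrt ((1/2) ^ k) * (sqrt (2 ^ k) * d k)" by (simp only: mult.assoc[symmetric] mult_1_left)
        qed simp
        also have "\<dots>\<^sup>2 \<le> (\<Sum>k=n..<m. (sqrt ((1/2) ^ k))\<^sup>2) * (\<Sum>k=n..<m. (sqrt (2 ^ k) * d k)\<^sup>2)"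
          by (rule Cauchy_Schwarz_ineq_sum)
        also have "(\<Sum>k=n..<m. (sqrt ((1/2) ^ k))\<^sup>2) = (\<Sum>k=n..<m. (1/2::real) ^ k)" by simp
        also have "(\<Sum>k=n..<m. (sqrt (2 ^ k) * d k)\<^sup>2) = (\<Sum>k=n..<m. w k x)"
          by (simp add: power_mult_distrib w_def d_def)
        also have "(\<Sum>k=n..<m. (1/2::real) ^ k) * (\<Sum>k=n..<m. w k x) \<le> (2 * (1/2) ^ n) * D x"
        proof (intro mult_mono)
          show "(\<Sum>k=n..<m. (1/2::real) ^ k) \<le> 2 * (1/2) ^ n"
          proof -
            have "(\<Sum>k=n..<m. (1/2::real) ^ k) = 2 * (1/2) ^ n - 2 * (1/2) ^ m"
              using m by (induction m rule: dec_induct) auto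
            then show ?thesis by simp
          qed
          show "(\<Sum>k=n..<m. w k x) \<le> D x"
            unfolding D_def by (rule sum_le_suminf[OF sw]) (auto simp: w_def)
        qed (auto intro: sum_nonneg simp: w_def)
        finally show "(cmod (f m x - f n x))\<^sup>2 \<le> 2 * (1/2) ^ n * D x" .
      qed
    qed
    with l show ?case by blast
  qed
  have bound: "AE x in lebesgue_on {0<..<1}. norm ((cmod (h x - f n x))\<^sup>2) \<le> norm (2 * (1/2) ^ n * D x)" for n
    using conv
  proof eventually_elim
    case (elim x)
    then have "(cmod (h x - f n x))\<^sup>2 \<le> 2 * (1/2) ^ n * D x" by blast
    then show ?case unfolding real_norm_def abs_power2 by (rule order_trans[OF _ abs_ge_self])
  qed
  have hfm: "(\<lambda>x. h x - f n x) \<in> borel_measurable (lebesgue_on {0<..<1})" for n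
    by (intro borel_measurable_diff hm square_integrable_measurable[OF sq])
  have hf: "square_integrable 0 1 (\<lambda>x. h x - f n x)" for n
    unfolding square_integrable_def
  proof
    show "integrable (lebesgue_on {0<..<1}) (\<lambda>x. (cmod (h x - f n x))\<^sup>2)"
      by (rule Bochner_Integration.integrable_bound[OF integrable_mult_right[OF Dint] _ bound])
        (intro borel_measurable_power measurable_compose[OF hfm borel_measurable_norm])
  qed (rule hfm)
  have "square_integrable 0 1 (\<lambda>x. (h x - f 0 x) + f 0 x)" by (intro square_integrable_add hf sq)
  then have hsq: "square_integrable 0 1 h" by simp
  have nb: "(norm (u n - abs_L2_unit h))\<^sup>2 \<le> 2 * (1/2) ^ n * (LINT x|lebesgue_on {0<..<1}. D x)" for n
  proof -
    have ae: "AE x in lebesgue_on {0<..<1}. rep_L2_unit (u n - abs_L2_unit h) x = f n x - h x"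
      using rep_L2_diff[of "u n" "abs_L2_unit h"] rep_abs_L2[OF hsq] by eventually_elim (simp add: f_def)
    have "(norm (u n - abs_L2_unit h))\<^sup>2 = L2_normsq 0 1 (\<lambda>x. f n x - h x)"
      unfolding norm_L2_rep by (rule L2_normsq_cong_AE[OF rep_L2_square_integrable square_integrable_diff[OF sq hsq] ae])
    also have "\<dots> = L2_normsq 0 1 (\<lambda>x. h x - f n x)" by (rule L2_normsq_commute)
    also have "\<dots> \<le> (LINT x|lebesgue_on {0<..<1}. 2 * (1/2) ^ n * D x)"
      unfolding L2_normsq_def
    proof (rule integral_mono_AE)
      show "AE x in lebesgue_on {0<..<1}. (cmod (h x - f n x))\<^sup>2 \<le> 2 * (1/2) ^ n * D x"
        using conv by eventually_elim blast
    qed (use hf[of n] Dint in \<open>auto simp: square_integrable_def\<close>)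
    finally show ?thesis by simp
  qed
  have "(\<lambda>n. (norm (u n - abs_L2_unit h))\<^sup>2) \<longlonglongrightarrow> 0"
  proof (rule tendsto_sandwich[OF _ _ tendsto_const])
    have "(\<lambda>n. 2 * (1/2) ^ n * (LINT x|lebesgue_on {0<..<1}. D x)) \<longlonglongrightarrow> 2 * 0 * (LINT x|lebesgue_on {0<..<1}. D x)"
      by (intro tendsto_intros LIMSEQ_realpow_zero) auto
    then show "(\<lambda>n. 2 * (1/2) ^ n * (LINT x|lebesgue_on {0<..<1}. D x)) \<longlonglongrightarrow> 0" by simp
  qed (use nb in auto)
  then have "(\<lambda>n. norm (u n - abs_L2_unit h)) \<longlonglongrightarrow> 0"
    using tendsto_real_sqrt[of "\<lambda>n. (norm (u n - abs_L2_unit h))\<^sup>2" 0] by simp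
  then have "u \<longlonglongrightarrow> abs_L2_unit h" by (rule LIM_zero_cancel[OF tendsto_norm_zero_cancel])
  then show ?thesis by (rule that)
qed

subsection \<open>Coordinates on the state space\<close>

text \<open>The isometry \<open>(u, v) \<mapsto> (u', v)\<close> of the state space into a Hilbert space that is a type.\<close>

definition coords :: "state \<Rightarrow> L2_unit \<times> L2_unit" where
  "coords U = (abs_L2_unit (weak_deriv 0 1 (rep_L2_unit (fst U))), snd U)"

definition H10_deriv :: "L2_unit \<Rightarrow> L2_unit" where
  "H10_deriv u = abs_L2_unit (weak_deriv 0 1 (rep_L2_unit u))"

lemma coords_eq: "coords (u, v) = (H10_deriv u, v)"
  by (simp add: coords_def H10_deriv_def)

lemma H10_deriv:
  assumes "u \<in> H10_unit"
  shows "AE x in lebesgue_on {0<..<1}. rep_L2_unit (H10_deriv u) x = weak_deriv 0 1 (rep_L2_unit u) x"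
    "AE x in lebesgue_on {0<..<1}. rep_L2_unit u x = prim 0 (rep_L2_unit (H10_deriv u)) x"
    "prim 0 (rep_L2_unit (H10_deriv u)) 1 = 0"
proof -
  have u: "rep_L2_unit u \<in> H10 0 1" using assms by (simp add: H10_unit_def)
  then have "rep_L2_unit u \<in> H1 0 1" by (simp add: H10_def)
  note H1 = H1_weak_deriv[OF this]
  show ae: "AE x in lebesgue_on {0<..<1}. rep_L2_unit (H10_deriv u) x = weak_deriv 0 1 (rep_L2_unit u) x"
    unfolding H10_deriv_def by (rule rep_abs_L2[OF H1(2)])
  note pc = prim_cong_AE[OF rep_L2_square_integrable H1(2) _ ae]
  note hp = H10_imp_prim[OF u zero_less_one]
  show "prim 0 (rep_L2_unit (H10_deriv u)) 1 = 0" using pc[of 1] hp(2) by simp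
  show "AE x in lebesgue_on {0<..<1}. rep_L2_unit u x = prim 0 (rep_L2_unit (H10_deriv u)) x"
    using hp(1) AE_space[of "lebesgue_on {0<..<1::real}"] by eventually_elim (simp add: pc)
qed

text \<open>With \<open>H10_deriv\<close> this replaces approximation by test functions: being in
  H^1_0 means being the primitive of a mean-zero function, a description on which linearity is
  evident.\<close>

lemma H10_unitI:
  assumes "AE x in lebesgue_on {0<..<1}. rep_L2_unit u x = prim 0 (rep_L2_unit g) x" "prim 0 (rep_L2_unit g) 1 = 0"
  shows "u \<in> H10_unit" "H10_deriv u = g"
proof -
  note p = prim_in_H10[OF rep_L2_square_integrable rep_L2_square_integrable zero_less_one assms]
  show "u \<in> H10_unit" using p(1) by (simp add: H10_unit_def)
  from H10_deriv(1)[OF this] p(2) have "AE x in lebesgue_on {0<..<1}. rep_L2_unit (H10_deriv u) x = rep_L2_unit g x"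
    by eventually_elim simp
  then show "H10_deriv u = g" by (rule L2_unit_eqI)
qed

lemma H10_unit_add:
  assumes "u \<in> H10_unit" "v \<in> H10_unit"
  shows "u + v \<in> H10_unit" "H10_deriv (u + v) = H10_deriv u + H10_deriv v"
proof -
  note lin = linear_simps(1)[OF bounded_linear_prim]
  have ae: "AE x in lebesgue_on {0<..<1}. rep_L2_unit (u + v) x = prim 0 (rep_L2_unit (H10_deriv u + H10_deriv v)) x"
    using rep_L2_add[of u v] H10_deriv(2)[OF assms(1)] H10_deriv(2)[OF assms(2)] AE_space[of "lebesgue_on {0<..<1::real}"]
    by eventually_elim (simp add: lin)
  have z: "prim 0 (rep_L2_unit (H10_deriv u + H10_deriv v)) 1 = 0"
    using H10_deriv(3)[OF assms(1)] H10_deriv(3)[OF assms(2)] by (simp add: lin)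
  show "u + v \<in> H10_unit" "H10_deriv (u + v) = H10_deriv u + H10_deriv v"
    using H10_unitI[OF ae z] by auto
qed

lemma H10_unit_scaleR:
  assumes "u \<in> H10_unit"
  shows "r *\<^sub>R u \<in> H10_unit" "H10_deriv (r *\<^sub>R u) = r *\<^sub>R H10_deriv u"
proof -
  note lin = linear_simps(5)[OF bounded_linear_prim]
  have ae: "AE x in lebesgue_on {0<..<1}. rep_L2_unit (r *\<^sub>R u) x = prim 0 (rep_L2_unit (r *\<^sub>R H10_deriv u)) x"
    using rep_L2_scaleR[of r u] H10_deriv(2)[OF assms] AE_space[of "lebesgue_on {0<..<1::real}"]
    by eventually_elim (simp add: lin scaleR_conv_of_real)
  have z: "prim 0 (rep_L2_unit (r *\<^sub>R H10_deriv u)) 1 = 0"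
    using H10_deriv(3)[OF assms(1)] by (simp add: lin)
  show "r *\<^sub>R u \<in> H10_unit" "H10_deriv (r *\<^sub>R u) = r *\<^sub>R H10_deriv u"
    using H10_unitI[OF ae z] by auto
qed

lemma state_space_add: "x \<in> state_space \<Longrightarrow> y \<in> state_space \<Longrightarrow> x + y \<in> state_space"
  and state_space_scaleR: "x \<in> state_space \<Longrightarrow> r *\<^sub>R x \<in> state_space"
  by (auto simp: state_space_def H10_unit_add H10_unit_scaleR)

lemma coords_add: "x \<in> state_space \<Longrightarrow> y \<in> state_space \<Longrightarrow> coords (x + y) = coords x + coords y"
  and coords_scaleR: "x \<in> state_space \<Longrightarrow> coords (r *\<^sub>R x) = r *\<^sub>R coords x"
  by (auto simp: state_space_def coords_eq H10_unit_add H10_unit_scaleR)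

lemma state_norm_coords:
  assumes "x \<in> state_space"
  shows "state_norm x = norm (coords x)"
proof -
  obtain u v where x: "x = (u, v)" "u \<in> H10_unit" using assms by (auto simp: state_space_def)
  then have "rep_L2_unit u \<in> H1 0 1" by (simp add: H10_unit_def H10_def)
  note H1 = H1_weak_deriv[OF this]
  show ?thesis
    unfolding x(1) state_norm_def coords_eq norm_Pair by (simp add: H10_deriv_def norm_abs_L2[OF H1(2)])
qed

text \<open>The range of \<open>coords\<close> is cut out by the vanishing mean of the first
  component. This condition is closed, which is why the state space inherits completeness.\<close>

lemma coords_surj:
  assumes "prim 0 (rep_L2_unit g) 1 = 0"
  obtains x where "x \<in> state_space" "coords x = (g, v)"
proof -
  have "AE x in lebesgue_on {0<..<1}. rep_L2_unit (abs_L2_unit (prim 0 (rep_L2_unit g))) x = prim 0 (rep_L2_unit g) x"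
    by (intro rep_abs_L2 square_integrable_prim rep_L2_square_integrable)
  from H10_unitI[OF this assms] show ?thesis
    by (intro that[of "(abs_L2_unit (prim 0 (rep_L2_unit g)), v)"]) (auto simp: state_space_def coords_eq)
qed

lemma coords_mean_zero: "x \<in> state_space \<Longrightarrow> prim 0 (rep_L2_unit (fst (coords x))) 1 = 0"
  by (cases x) (auto simp: state_space_def coords_eq H10_deriv)

lemma state_space_geometric_Cauchy:
  assumes x: "\<And>n. x n \<in> state_space"
    and K: "\<And>n. state_norm (x (Suc n) - x n) \<le> K * (1 / 3) ^ n"
  obtains l where "l \<in> state_space" "(\<lambda>n. state_norm (x n - l)) \<longlonglongrightarrow> 0"
proof -
  have diff: "y - z \<in> state_space" "coords (y - z) = coords y - coords z" if "y \<in> state_space" "z \<in> state_space" for y z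
    using that state_space_add[of y "(-1) *\<^sub>R z"] coords_add[of y "(-1) *\<^sub>R z"]
      state_space_scaleR[of z "-1"] coords_scaleR[of z "-1"] by simp_all
  have c: "norm (coords (x (Suc n)) - coords (x n)) \<le> K * (1 / 3) ^ n" for n
    using K[of n] diff[OF x x, of "Suc n" n] by (simp add: state_norm_coords)
  have nf: "norm (fst z) \<le> norm z" and ns: "norm (snd z) \<le> norm z" for z :: "L2_unit \<times> L2_unit"
    by (metis norm_fst_le prod.collapse, metis norm_snd_le prod.collapse)
  obtain g where g: "(\<lambda>n. fst (coords (x n))) \<longlonglongrightarrow> g"
  proof (rule geometric_Cauchy_convergent_L2)
    show "norm (fst (coords (x (Suc n))) - fst (coords (x n))) \<le> K * (1 / 3) ^ n" for n
      using nf[of "coords (x (Suc n)) - coords (x n)"] c[of n] by simp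
  qed
  obtain v where v: "(\<lambda>n. snd (coords (x n))) \<longlonglongrightarrow> v"
  proof (rule geometric_Cauchy_convergent_L2)
    show "norm (snd (coords (x (Suc n))) - snd (coords (x n))) \<le> K * (1 / 3) ^ n" for n
      using ns[of "coords (x (Suc n)) - coords (x n)"] c[of n] by simp
  qed
  have "(\<lambda>n. prim 0 (rep_L2_unit (fst (coords (x n)))) 1) \<longlonglongrightarrow> prim 0 (rep_L2_unit g) 1"
    by (rule bounded_linear.tendsto[OF bounded_linear_prim g]) simp
  then have "prim 0 (rep_L2_unit g) 1 = 0"
    using LIMSEQ_unique[OF _ tendsto_const] by (simp add: coords_mean_zero[OF x])
  then obtain l where l: "l \<in> state_space" "coords l = (g, v)" by (rule coords_surj)
  have "(\<lambda>n. (fst (coords (x n)), snd (coords (x n)))) \<longlonglongrightarrow> (g, v)" by (intro tendsto_Pair g v)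
  then have "(\<lambda>n. norm (coords (x n) - coords l)) \<longlonglongrightarrow> 0"
    using l(2) by (simp add: LIM_zero_iff tendsto_norm_zero_iff)
  then show ?thesis
    using that[OF l(1)] diff[OF x l(1)] by (simp add: state_norm_coords)
qed

subsection \<open>The domain of the damped string operator\<close>

text \<open>In the coordinates (u', v) this is u(\<xi>). Applied to the coordinates of A (u, v),
  whose first component comes from v, it gives v(\<xi>).\<close>

definition trace_at :: "real \<Rightarrow> L2_unit \<times> L2_unit \<Rightarrow> complex" where
  "trace_at \<xi> y = prim 0 (rep_L2_unit (fst y)) \<xi>"

text \<open>The cosine coefficient of u', that is j pi times the sine coefficient of u; with this
  normalisation u and v enter the energy symmetrically.\<close>

definition u_coeff :: "nat \<Rightarrow> L2_unit \<times> L2_unit \<Rightarrow> complex" where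
  "u_coeff j y = coeff cs (rep_L2_unit (fst y)) j"

definition v_coeff :: "nat \<Rightarrow> L2_unit \<times> L2_unit \<Rightarrow> complex" where
  "v_coeff j y = coeff sn (rep_L2_unit (snd y)) j"

lemma bounded_linear_trace_at: "\<xi> \<in> {0..1} \<Longrightarrow> bounded_linear (trace_at \<xi>)"
  unfolding trace_at_def using bounded_linear_compose[OF bounded_linear_prim bounded_linear_fst] by (simp add: o_def)

lemma bounded_linear_u_coeff: "bounded_linear (u_coeff j)"
  unfolding u_coeff_def by (rule bounded_linear_compose[OF bounded_linear_coeff_cs bounded_linear_fst])

lemma bounded_linear_v_coeff: "bounded_linear (v_coeff j)"
  unfolding v_coeff_def by (rule bounded_linear_compose[OF bounded_linear_coeff_sn bounded_linear_snd])

lemma AE_interval_glue: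
  assumes "AE x in lebesgue_on {a<..<c}. P x" "AE x in lebesgue_on {c<..<b}. P x" "c \<in> {a<..<b}"
  shows "AE x in lebesgue_on {a<..<b::real}. P x"
proof -
  have "AE x in lebesgue. x \<noteq> c"
    by (rule AE_not_in[of "{c}", simplified]) simp
  moreover have "AE x in lebesgue. x \<in> {a<..<c} \<longrightarrow> P x" "AE x in lebesgue. x \<in> {c<..<b} \<longrightarrow> P x"
    using assms by (simp_all add: AE_restrict_space_iff)
  ultimately have "AE x in lebesgue. x \<in> {a<..<b} \<longrightarrow> P x"
    by eventually_elim (metis greaterThanLessThan_iff linorder_less_linear)
  then show ?thesis by (simp add: AE_restrict_space_iff)
qed

lemma AE_subinterval:
  assumes "AE x in lebesgue_on {a<..<b}. P x" "a \<le> c" "d \<le> b"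
  shows "AE x in lebesgue_on {c<..<d::real}. P x"
proof -
  have "AE x in lebesgue. x \<in> {a<..<b} \<longrightarrow> P x"
    using assms(1) by (simp add: AE_restrict_space_iff)
  then have "AE x in lebesgue. x \<in> {c<..<d} \<longrightarrow> P x"
    using assms(2,3) by (auto elim!: eventually_mono)
  then show ?thesis by (simp add: AE_restrict_space_iff)
qed

lemma square_integrable_cong:
  assumes "square_integrable a b f" "\<And>x. x \<in> {a<..<b} \<Longrightarrow> f x = g x"
  shows "square_integrable a b g"
proof -
  have "g \<in> borel_measurable (lebesgue_on {a<..<b})"
    using measurable_lebesgue_cong[of "{a<..<b}" f g borel] assms by (simp add: square_integrable_def)
  then show ?thesis
    by (rule square_integrable_cong_AE[OF assms(1)]) (use assms(2) in \<open>auto intro!: AE_I2\<close>)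
qed

lemma square_integrable_glue:
  assumes f: "square_integrable a c f" and g: "square_integrable c b g" and c: "c \<in> {a<..<b}"
  shows "square_integrable a b (\<lambda>x. if x < c then f x else g x)"
proof -
  let ?h1 = "\<lambda>x. if x \<in> {a<..<c} then f x else 0" and ?h2 = "\<lambda>x. if x \<in> {c<..<b} then g x else 0"
  have ext: "square_integrable a b (\<lambda>x. if x \<in> {p<..<q} then k x else 0)"
    if "square_integrable p q k" "{p<..<q} \<subseteq> {a<..<b}" for p q k
    unfolding square_integrable_def
  proof
    show "(\<lambda>x. if x \<in> {p<..<q} then k x else 0) \<in> borel_measurable (lebesgue_on {a<..<b})"
      using that borel_measurable_if_lebesgue_on[of "{p<..<q}" "{a<..<b}" k]
      by (simp add: square_integrable_def del: greaterThanLessThan_iff)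
    have "integrable lebesgue (\<lambda>x. if x \<in> {p<..<q} then (cmod (k x))\<^sup>2 else 0)"
      using Lebesgue_Measure.integrable_restrict_UNIV[of "{p<..<q}" "\<lambda>x. (cmod (k x))\<^sup>2"] that(1)
      by (simp add: square_integrable_def del: greaterThanLessThan_iff)
    then have "integrable (lebesgue_on UNIV) (\<lambda>x. if x \<in> {p<..<q} then (cmod (k x))\<^sup>2 else 0)"
      by (simp only: lebesgue_on_UNIV_eq)
    then have "integrable (lebesgue_on {a<..<b}) (\<lambda>x. if x \<in> {p<..<q} then (cmod (k x))\<^sup>2 else 0)"
      by (rule integrable_lebesgue_on_subset) auto
    then show "integrable (lebesgue_on {a<..<b}) (\<lambda>x. (cmod (if x \<in> {p<..<q} then k x else 0))\<^sup>2)"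
      by (rule Bochner_Integration.integrable_cong[THEN iffD1, rotated 2]) auto
  qed
  have s: "square_integrable a b (\<lambda>x. ?h1 x + ?h2 x)"
    using c by (intro square_integrable_add ext f g) auto
  define r where "r = (\<lambda>x. ?h1 x + ?h2 x)"
  \<comment> \<open>The sum of the two extensions by 0 is wrong exactly at c; correcting this one
    point keeps the equality pointwise, as measurability of the glued function requires.\<close>
  have "square_integrable a b (\<lambda>x. r x + (if x = c then g c - r c else 0))"
  proof (rule square_integrable_cong_AE[OF s])
    have "AE x in lebesgue. x \<noteq> c" by (rule AE_not_in[of "{c}", simplified]) simp
    then have "AE x in lebesgue_on UNIV. x \<noteq> c" by (simp only: lebesgue_on_UNIV_eq)
    then have "AE x in lebesgue_on {a<..<b}. x \<noteq> c"
      by (simp add: AE_restrict_space_iff) (auto elim: eventually_mono)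
    then show "AE x in lebesgue_on {a<..<b}. ?h1 x + ?h2 x = r x + (if x = c then g c - r c else 0)"
      by eventually_elim (simp add: r_def)
    have "(\<lambda>x. indicator {c} x * (g c - r c)) \<in> borel_measurable lebesgue"
      by (intro borel_measurable_times borel_measurable_indicator borel_measurable_const) simp
    also have "(\<lambda>x. indicator {c} x * (g c - r c)) = (\<lambda>x. if x = c then g c - r c else 0)"
      by (auto simp: indicator_def)
    finally show "(\<lambda>x. r x + (if x = c then g c - r c else 0)) \<in> borel_measurable (lebesgue_on {a<..<b})"
      by (rule borel_measurable_add[OF square_integrable_measurable[OF s, folded r_def] measurable_restrict_space1])
  qed
  moreover have "r x + (if x = c then g c - r c else 0) = (if x < c then f x else g x)" if "x \<in> {a<..<b}" for x
    using that by (auto simp: r_def)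
  ultimately show ?thesis
    by (rule square_integrable_cong)
qed

text \<open>On the whole interval u' is a primitive of u'' plus a step of height v(\<xi>) at \<xi>.
  Each side is a primitive by du Bois-Reymond, and the transmission condition links the two
  constants of integration.\<close>

lemma domA_structure:
  assumes \<xi>: "0 < \<xi>" "\<xi> < 1" and U: "U \<in> domA \<xi>"
  obtains p where
    "AE x in lebesgue_on {0<..<1}. rep_L2_unit (fst (coords U)) x =
      p + prim 0 (rep_L2_unit (snd (opA \<xi> U))) x + (if \<xi> < x then trace_at \<xi> (coords (opA \<xi> U)) else 0)"
proof -
  obtain u v where Uuv: "U = (u, v)" and u: "u \<in> H10_unit" and v: "v \<in> H10_unit"
    and H2: "rep_L2_unit u \<in> H2 0 \<xi>" "rep_L2_unit u \<in> H2 \<xi> 1"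
    and jump: "sobolev_trace \<xi> 1 (weak_deriv \<xi> 1 (rep_L2_unit u)) \<xi> - sobolev_trace 0 \<xi> (weak_deriv 0 \<xi> (rep_L2_unit u)) \<xi> =
       sobolev_trace 0 1 (rep_L2_unit v) \<xi>"
    using U by (auto simp: domA_def)
  let ?f = "rep_L2_unit u"
  define D1 D2 where "D1 = weak_deriv 0 \<xi> ?f" and "D2 = weak_deriv \<xi> 1 ?f"
  define E1 E2 where "E1 = weak_deriv 0 \<xi> D1" and "E2 = weak_deriv \<xi> 1 D2"
  have D: "D1 \<in> H1 0 \<xi>" "D2 \<in> H1 \<xi> 1" using H2 by (auto simp: H2_def D1_def D2_def)
  note H1 = H1_weak_deriv[OF D(1), folded E1_def] H1_weak_deriv[OF D(2), folded E2_def]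
  obtain c1 where c1: "AE x in lebesgue_on {0<..<\<xi>}. D1 x = c1 + prim 0 E1 x"
    by (rule du_Bois_Reymond[OF H1(1-3) \<xi>(1)])
  obtain c2 where c2: "AE x in lebesgue_on {\<xi><..<1}. D2 x = c2 + prim \<xi> E2 x"
    by (rule du_Bois_Reymond[OF H1(4-6) \<xi>(2)])
  define w where "w = trace_at \<xi> (coords (opA \<xi> U))"
  have w: "w = prim 0 (rep_L2_unit (H10_deriv v)) \<xi>"
    by (simp add: w_def trace_at_def opA_def Uuv coords_eq)
  have t1: "sobolev_trace 0 \<xi> D1 \<xi> = c1 + prim 0 E1 \<xi>"
    by (rule sobolev_trace_eq[OF _ c1]) (use \<xi> in \<open>auto intro!: continuous_intros continuous_on_prim H1\<close>)
  have t2: "sobolev_trace \<xi> 1 D2 \<xi> = c2 + prim \<xi> E2 \<xi>"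
    by (rule sobolev_trace_eq[OF _ c2]) (use \<xi> in \<open>auto intro!: continuous_intros continuous_on_prim H1\<close>)
  have t3: "sobolev_trace 0 1 (rep_L2_unit v) \<xi> = w"
    unfolding w by (rule sobolev_trace_eq[OF _ H10_deriv(2)[OF v]])
      (use \<xi> in \<open>auto intro!: continuous_on_prim rep_L2_square_integrable\<close>)
  \<comment> \<open>The transmission condition, with all three traces computed from continuous
    representatives.\<close>
  have c: "c2 = c1 + prim 0 E1 \<xi> + w"
    using jump t1 t2 t3 by (simp add: D1_def[symmetric] D2_def[symmetric] algebra_simps)
  define q where "q = rep_L2_unit (snd (opA \<xi> U))"
  have sq: "square_integrable 0 1 q" unfolding q_def by (rule rep_L2_square_integrable)
  have qae: "AE x in lebesgue_on {0<..<1}. q x = (if x < \<xi> then E1 x else E2 x)"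
    unfolding q_def opA_def Uuv prod.case snd_conv D1_def[symmetric] D2_def[symmetric] E1_def[symmetric] E2_def[symmetric]
    by (rule rep_abs_L2[OF square_integrable_glue[OF H1(2) H1(5)]]) (use \<xi> in auto)
  have q1: "prim 0 q x = prim 0 E1 x" if "x \<le> \<xi>" for x
  proof (rule prim_cong_AE[OF square_integrable_subinterval[OF sq] H1(2) that])
    show "AE x in lebesgue_on {0<..<\<xi>}. q x = E1 x"
      using AE_subinterval[OF qae, of 0 \<xi>] \<xi> AE_space[of "lebesgue_on {0<..<\<xi>}"] by (auto elim!: AE_mp)
  qed (use \<xi> in auto)
  have q2: "prim \<xi> q x = prim \<xi> E2 x" if "x \<le> 1" for x
  proof (rule prim_cong_AE[OF square_integrable_subinterval[OF sq] H1(5) that])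
    show "AE x in lebesgue_on {\<xi><..<1}. q x = E2 x"
      using AE_subinterval[OF qae, of \<xi> 1] \<xi> AE_space[of "lebesgue_on {\<xi><..<1}"] by (auto elim!: AE_mp)
  qed (use \<xi> in auto)
  have q3: "prim 0 q x = prim 0 q \<xi> + prim \<xi> q x" if "\<xi> \<le> x" "x \<le> 1" for x
    unfolding prim_def using that \<xi>
    by (intro LINT_interval_split square_integrable_integrable square_integrable_subinterval[OF sq]) auto
  have uH1: "?f \<in> H1 0 1" using u by (simp add: H10_unit_def H10_def)
  have s1: "AE x in lebesgue_on {0<..<\<xi>}. D1 x = weak_deriv 0 1 ?f x"
    unfolding D1_def by (rule H1_subinterval[OF uH1]) (use \<xi> in auto)
  have s2: "AE x in lebesgue_on {\<xi><..<1}. D2 x = weak_deriv 0 1 ?f x"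
    unfolding D2_def by (rule H1_subinterval[OF uH1]) (use \<xi> in auto)
  have "AE x in lebesgue_on {0<..<1}. weak_deriv 0 1 ?f x = c1 + prim 0 q x + (if \<xi> < x then w else 0)"
  proof (rule AE_interval_glue)
    show "AE x in lebesgue_on {0<..<\<xi>}. weak_deriv 0 1 ?f x = c1 + prim 0 q x + (if \<xi> < x then w else 0)"
      using s1 c1 AE_space[of "lebesgue_on {0<..<\<xi>}"] by eventually_elim (use \<xi> in \<open>auto simp: q1\<close>)
    show "AE x in lebesgue_on {\<xi><..<1}. weak_deriv 0 1 ?f x = c1 + prim 0 q x + (if \<xi> < x then w else 0)"
      using s2 c2 AE_space[of "lebesgue_on {\<xi><..<1}"]
    proof eventually_elim
      case (elim x)
      then show ?case using q3[of x] q1[of \<xi>] q2[of x] c by (simp add: algebra_simps)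
    qed
  qed (use \<xi> in auto)
  then have "AE x in lebesgue_on {0<..<1}. rep_L2_unit (fst (coords U)) x = c1 + prim 0 q x + (if \<xi> < x then w else 0)"
    using H10_deriv(1)[OF u] unfolding Uuv coords_eq by eventually_elim simp
  then show ?thesis unfolding q_def w_def by (rule that)
qed

text \<open>Testing \<open>u'\<close> against \<open>h\<close> for \<open>h\<close> of mean zero: the jump of \<open>u'\<close> at \<open>\<xi>\<close> contributes the last term.\<close>

lemma domA_by_parts:
  assumes \<xi>: "0 < \<xi>" "\<xi> < 1" and U: "U \<in> domA \<xi>"
    and h: "square_integrable 0 1 h" and z: "prim 0 h 1 = 0"
  shows "(LINT x|lebesgue_on {0<..<1}. rep_L2_unit (fst (coords U)) x * h x) =
    - (LINT x|lebesgue_on {0<..<1}. rep_L2_unit (snd (opA \<xi> U)) x * prim 0 h x)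
    - trace_at \<xi> (coords (opA \<xi> U)) * prim 0 h \<xi>"
proof -
  define q where "q = rep_L2_unit (snd (opA \<xi> U))"
  define w where "w = trace_at \<xi> (coords (opA \<xi> U))"
  have sq: "square_integrable 0 1 q" unfolding q_def by (rule rep_L2_square_integrable)
  obtain p where p: "AE x in lebesgue_on {0<..<1}. rep_L2_unit (fst (coords U)) x = p + prim 0 q x + (if \<xi> < x then w else 0)"
    unfolding q_def w_def by (rule domA_structure[OF \<xi> U])
  have si: "square_integrable 0 1 (indicator {\<xi><..<1})" by (rule square_integrable_indicator)
  have "(LINT x|lebesgue_on {0<..<1}. rep_L2_unit (fst (coords U)) x * h x) =
      (LINT x|lebesgue_on {0<..<1}. p * h x + prim 0 q x * h x + w * (indicator {\<xi><..<1} x * h x))"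
  proof (rule integral_cong_AE)
    show "AE x in lebesgue_on {0<..<1}. rep_L2_unit (fst (coords U)) x * h x =
        p * h x + prim 0 q x * h x + w * (indicator {\<xi><..<1} x * h x)"
      using p AE_space[of "lebesgue_on {0<..<1::real}"] by eventually_elim (auto simp: indicator_def algebra_simps)
  qed (use square_integrable_measurable[OF h] square_integrable_measurable[OF rep_L2_square_integrable]
        square_integrable_measurable[OF square_integrable_prim[OF sq]] square_integrable_measurable[OF si] in
        \<open>auto intro!: borel_measurable_times borel_measurable_add\<close>)
  also have "\<dots> = p * prim 0 h 1 + (LINT x|lebesgue_on {0<..<1}. prim 0 q x * h x)
      + w * (LINT x|lebesgue_on {0<..<1}. indicator {\<xi><..<1} x * h x)"
    using square_integrable_integrable[OF h] square_integrable_mult[OF square_integrable_prim[OF sq] h]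
      square_integrable_mult[OF si h]
    by (simp add: prim_def)
  also have "(LINT x|lebesgue_on {0<..<1}. indicator {\<xi><..<1} x * h x) = prim \<xi> h 1"
  proof -
    have "prim \<xi> h 1 = (LINT x|lebesgue_on {0<..<1}. (if x \<in> {\<xi><..<1} then h x else 0))"
      unfolding prim_def using \<xi> by (intro integral_restrict[symmetric]) auto
    also have "\<dots> = (LINT x|lebesgue_on {0<..<1}. indicator {\<xi><..<1} x * h x)"
      by (rule Bochner_Integration.integral_cong) (auto simp: indicator_def)
    finally show ?thesis by simp
  qed
  also have "prim \<xi> h 1 = - prim 0 h \<xi>"
  proof -
    have "prim 0 h 1 = prim 0 h \<xi> + prim \<xi> h 1"
      unfolding prim_def using \<xi> by (intro LINT_interval_split square_integrable_integrable h) auto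
    then show ?thesis using z by (simp add: eq_neg_iff_add_eq_0 add.commute)
  qed
  also have "(LINT x|lebesgue_on {0<..<1}. prim 0 q x * h x) = - (LINT x|lebesgue_on {0<..<1}. q x * prim 0 h x)"
    using prim_mult[OF sq h zero_le_one] z by (simp add: eq_neg_iff_add_eq_0)
  finally show ?thesis using z by (simp add: q_def w_def)
qed


section \<open>The operator in Fourier coefficients, dissipativity, Parseval on the domain\<close>

lemma u_coeff_opA:
  assumes \<xi>: "0 < \<xi>" "\<xi> < 1" and U: "U \<in> domA \<xi>"
  shows "u_coeff j (coords (opA \<xi> U)) = of_real (real j * pi) * v_coeff j (coords U)"
proof -
  obtain u v where Uuv: "U = (u, v)" and v: "v \<in> H10_unit" using U by (auto simp: domA_def)
  note H = H10_deriv[OF v] and sq = rep_L2_square_integrable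
  have "coeff cs (rep_L2_unit (H10_deriv v)) j = of_real (real j * pi) * coeff sn (prim 0 (rep_L2_unit (H10_deriv v))) j"
    by (rule coeff_prim[OF sq H(3)])
  also have "coeff sn (prim 0 (rep_L2_unit (H10_deriv v))) j = coeff sn (rep_L2_unit v) j"
    by (rule coeff_cong_AE[OF square_integrable_prim[OF sq] sq square_integrable_sn]) (use H(2) in \<open>auto elim: eventually_mono\<close>)
  finally show ?thesis by (simp add: u_coeff_def v_coeff_def Uuv opA_def coords_eq)
qed

lemma sn_endpoints: "sn j 0 = 0" "sn j 1 = 0"
proof -
  have "sin (real j * pi) = 0" by (rule sin_npi)
  then show "sn j 0 = 0" "sn j 1 = 0" by (simp_all add: sn_def)
qed

lemma prim_cs: "x \<in> {0..1} \<Longrightarrow> prim 0 (\<lambda>x. of_real (real j * pi) * cs j x) x = sn j x"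
  using prim_eq_diff[of 0 1 "sn j" "\<lambda>x. of_real (real j * pi) * cs j x", OF sn_has_derivative square_integrable_scale[OF square_integrable_cs]]
  by (simp add: sn_endpoints)

text \<open>Testing with j pi cos(j pi x), whose primitive sin(j pi x) vanishes at both ends: the
  jump of u' becomes a forcing of mode j with strength sin(j pi \<xi>).\<close>

lemma v_coeff_opA:
  assumes \<xi>: "0 < \<xi>" "\<xi> < 1" and U: "U \<in> domA \<xi>"
  shows "v_coeff j (coords (opA \<xi> U)) = - of_real (real j * pi) * u_coeff j (coords U) - sn j \<xi> * trace_at \<xi> (coords (opA \<xi> U))"
proof -
  define h where "h = (\<lambda>x. of_real (real j * pi) * cs j x)"
  have h: "square_integrable 0 1 h" unfolding h_def by (intro square_integrable_scale square_integrable_cs)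
  have ph: "prim 0 h x = sn j x" if "x \<in> {0..1}" for x unfolding h_def by (rule prim_cs[OF that])
  have 1: "(LINT x|lebesgue_on {0<..<1}. rep_L2_unit (fst (coords U)) x * h x) = of_real (real j * pi) * u_coeff j (coords U)"
    unfolding u_coeff_def coeff_def h_def integral_mult_right_zero[symmetric] by (simp only: mult.left_commute)
  have 2: "(LINT x|lebesgue_on {0<..<1}. rep_L2_unit (snd (opA \<xi> U)) x * prim 0 h x) = v_coeff j (coords (opA \<xi> U))"
    unfolding v_coeff_def coeff_def
    by (rule Bochner_Integration.integral_cong) (auto simp: ph coords_def)
  have 3: "prim 0 h 1 = 0" "prim 0 h \<xi> = sn j \<xi>" using \<xi> by (simp_all add: ph sn_endpoints)
  show ?thesis
    unfolding mult_minus_left domA_by_parts[OF \<xi> U h 3(1), unfolded 1 2 3(2)] by simp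
qed

text \<open>With h the conjugate of v' in \<open>domA_by_parts\<close>, the two integrals of the
  inner product cancel in the real part and only the jump term -|v(\<xi>)|^2 remains.\<close>

lemma domA_dissipative:
  assumes \<xi>: "0 < \<xi>" "\<xi> < 1" and U: "U \<in> domA \<xi>"
  shows "coords U \<bullet> coords (opA \<xi> U) = - (cmod (trace_at \<xi> (coords (opA \<xi> U))))\<^sup>2"
proof -
  obtain u v where Uuv: "U = (u, v)" and v: "v \<in> H10_unit" using U by (auto simp: domA_def)
  define q where "q = snd (opA \<xi> U)"
  define w where "w = trace_at \<xi> (coords (opA \<xi> U))"
  let ?g = "rep_L2_unit (H10_deriv v)"
  note H = H10_deriv[OF v] and sq = rep_L2_square_integrable
  have c: "coords (opA \<xi> U) = (H10_deriv v, q)" by (simp add: q_def Uuv opA_def coords_eq)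
  have w: "prim 0 ?g \<xi> = w" by (simp add: w_def trace_at_def c)
  have "(LINT x|lebesgue_on {0<..<1}. rep_L2_unit (fst (coords U)) x * cnj (?g x)) =
    - (LINT x|lebesgue_on {0<..<1}. rep_L2_unit q x * cnj (prim 0 ?g x)) - w * cnj w"
    using domA_by_parts[OF \<xi> U square_integrable_cnj[OF sq[of "H10_deriv v"]]] H(3)
    by (simp add: prim_cnj w q_def[symmetric] w_def[symmetric])
  also have "(LINT x|lebesgue_on {0<..<1}. rep_L2_unit q x * cnj (prim 0 ?g x)) = (LINT x|lebesgue_on {0<..<1}. rep_L2_unit q x * cnj (rep_L2_unit v x))"
  proof (rule integral_cong_AE)
    show "AE x in lebesgue_on {0<..<1}. rep_L2_unit q x * cnj (prim 0 ?g x) = rep_L2_unit q x * cnj (rep_L2_unit v x)"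
      using H(2) by eventually_elim simp
  qed (intro borel_measurable_times square_integrable_measurable[OF sq] square_integrable_measurable[OF square_integrable_cnj]
      square_integrable_prim sq)+
  finally have 1: "(LINT x|lebesgue_on {0<..<1}. rep_L2_unit (fst (coords U)) x * cnj (?g x)) =
    - (LINT x|lebesgue_on {0<..<1}. rep_L2_unit q x * cnj (rep_L2_unit v x)) - w * cnj w" .
  have "coords U \<bullet> coords (opA \<xi> U) = fst (coords U) \<bullet> H10_deriv v + v \<bullet> q"
    by (simp add: c inner_prod_def) (simp add: Uuv coords_eq)
  also have "v \<bullet> q = q \<bullet> v" by (rule inner_commute)
  finally show ?thesis
    unfolding inner_L2_rep 1 w_def[symmetric] by (simp add: complex_mult_cnj cmod_power2)
qed

text \<open>On the domain Parseval follows from integration by parts: h is the conjugate of u', its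
  primitive is expanded in the sine series, and \<open>v_coeff_opA\<close> turns the terms,
  including the point value at \<xi>, into 2 |u_j|^2.\<close>

lemma domA_parseval:
  assumes \<xi>: "0 < \<xi>" "\<xi> < 1" and U: "U \<in> domA \<xi>"
  shows "(\<lambda>j. 2 * (cmod (u_coeff (Suc j) (coords U)))\<^sup>2 + 2 * (cmod (v_coeff (Suc j) (coords U)))\<^sup>2) sums (norm (coords U))\<^sup>2"
proof -
  obtain u v where Uuv: "U = (u, v)" and u: "u \<in> H10_unit" and v: "v \<in> H10_unit" using U by (auto simp: domA_def)
  define w where "w = trace_at \<xi> (coords (opA \<xi> U))"
  define g where "g = rep_L2_unit (H10_deriv u)"
  define q where "q = rep_L2_unit (snd (opA \<xi> U))"
  note sq = rep_L2_square_integrable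
  have sg: "square_integrable 0 1 g" and sqq: "square_integrable 0 1 q" unfolding g_def q_def by (rule sq)+
  have zg: "prim 0 g 1 = 0" unfolding g_def by (rule H10_deriv(3)[OF u])
  have cu: "fst (coords U) = H10_deriv u" "snd (coords U) = v" by (auto simp: Uuv coords_eq)
  have cnj_coeff: "coeff cs (\<lambda>x. cnj (f x)) j = cnj (coeff cs f j)" for f j
  proof -
    have "coeff cs (\<lambda>x. cnj (f x)) j = (LINT x|lebesgue_on {0<..<1}. cnj (f x * cs j x))"
      by (simp add: coeff_def cs_def)
    then show ?thesis using Bochner_Integration.integral_cnj[of "lebesgue_on {0<..<1}" "\<lambda>x. f x * cs j x"] by (simp add: coeff_def)
  qed
  let ?g' = "\<lambda>x. cnj (g x)"
  note sg' = square_integrable_cnj[OF sg]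
  have zg': "prim 0 ?g' 1 = 0" by (simp add: prim_cnj zg)
  have "(\<lambda>j. - (2 * sine_coeff ?g' (Suc j) * coeff sn q (Suc j)) - w * (2 * sine_coeff ?g' (Suc j) * sn (Suc j) \<xi>)) sums
      (- (LINT x|lebesgue_on {0<..<1}. q x * prim 0 ?g' x) - w * prim 0 ?g' \<xi>)"
    by (intro sums_diff sums_minus sums_mult sine_series_integral[OF sg' zg' sqq] sine_series_pointwise[OF sg' zg'])
      (use \<xi> in auto)
  also have "- (LINT x|lebesgue_on {0<..<1}. q x * prim 0 ?g' x) - w * prim 0 ?g' \<xi> = (LINT x|lebesgue_on {0<..<1}. g x * ?g' x)"
    using domA_by_parts[OF \<xi> U sg' zg'] by (simp add: cu g_def[symmetric] q_def[symmetric] w_def[symmetric])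
  also have "(LINT x|lebesgue_on {0<..<1}. g x * ?g' x) = of_real (L2_normsq 0 1 g)"
    unfolding L2_normsq_def complex_norm_square[symmetric] by (rule integral_complex_of_real)
  also have "(\<lambda>j. - (2 * sine_coeff ?g' (Suc j) * coeff sn q (Suc j)) - w * (2 * sine_coeff ?g' (Suc j) * sn (Suc j) \<xi>)) =
      (\<lambda>j. of_real (2 * (cmod (u_coeff (Suc j) (coords U)))\<^sup>2))"
  proof
    fix j
    define n where "n = Suc j"
    have vq: "coeff sn q n = v_coeff n (coords (opA \<xi> U))"
      by (simp add: v_coeff_def q_def coords_def)
    have ug: "u_coeff n (coords U) = coeff cs g n" by (simp add: u_coeff_def cu g_def)
    have n0: "of_real (real n * pi) \<noteq> (0::complex)" by (simp add: n_def del: of_nat_Suc)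
    \<comment> \<open>The jump part of \<open>v_coeff_opA\<close> cancels against the series for the
      point value; the remaining n pi cancels the denominator of \<open>sine_coeff\<close>.\<close>
    have "- (2 * sine_coeff ?g' n * coeff sn q n) - w * (2 * sine_coeff ?g' n * sn n \<xi>) =
        2 * sine_coeff ?g' n * (of_real (real n * pi) * coeff cs g n)"
      unfolding vq v_coeff_opA[OF \<xi> U] ug w_def[symmetric] by (simp add: algebra_simps)
    also have "\<dots> = 2 * (coeff cs g n * cnj (coeff cs g n))"
      using n0 by (simp add: sine_coeff_def cnj_coeff)
    also have "\<dots> = of_real (2 * (cmod (u_coeff n (coords U)))\<^sup>2)"
      by (simp only: ug complex_norm_square of_real_mult of_real_numeral)
    finally show "- (2 * sine_coeff ?g' (Suc j) * coeff sn q (Suc j)) - w * (2 * sine_coeff ?g' (Suc j) * sn (Suc j) \<xi>) =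
        of_real (2 * (cmod (u_coeff (Suc j) (coords U)))\<^sup>2)" unfolding n_def .
  qed
  finally have su: "(\<lambda>j. 2 * (cmod (u_coeff (Suc j) (coords U)))\<^sup>2) sums L2_normsq 0 1 g"
    by (simp only: sums_of_real_iff)
  \<comment> \<open>For the velocity no operator is involved: v lies in H^1_0, so its own sine
    series can be integrated against v.\<close>
  define h where "h = rep_L2_unit (H10_deriv v)"
  have sh: "square_integrable 0 1 h" unfolding h_def by (rule sq)
  have zh: "prim 0 h 1 = 0" unfolding h_def by (rule H10_deriv(3)[OF v])
  have vae: "AE x in lebesgue_on {0<..<1}. rep_L2_unit v x = prim 0 h x" unfolding h_def by (rule H10_deriv(2)[OF v])
  let ?h' = "\<lambda>x. cnj (h x)"
  note sh' = square_integrable_cnj[OF sh]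
  have zh': "prim 0 ?h' 1 = 0" by (simp add: prim_cnj zh)
  have "(\<lambda>j. 2 * sine_coeff ?h' (Suc j) * coeff sn (rep_L2_unit v) (Suc j)) sums (LINT x|lebesgue_on {0<..<1}. rep_L2_unit v x * prim 0 ?h' x)"
    by (rule sine_series_integral[OF sh' zh' sq])
  also have "(LINT x|lebesgue_on {0<..<1}. rep_L2_unit v x * prim 0 ?h' x) = (LINT x|lebesgue_on {0<..<1}. rep_L2_unit v x * cnj (rep_L2_unit v x))"
  proof (rule integral_cong_AE)
    show "AE x in lebesgue_on {0<..<1}. rep_L2_unit v x * prim 0 ?h' x = rep_L2_unit v x * cnj (rep_L2_unit v x)"
      using vae by eventually_elim (simp add: prim_cnj)
  qed (intro borel_measurable_times square_integrable_measurable[OF sq] square_integrable_measurable[OF square_integrable_prim]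
      square_integrable_measurable[OF square_integrable_cnj] sq sh')+
  also have "(LINT x|lebesgue_on {0<..<1}. rep_L2_unit v x * cnj (rep_L2_unit v x)) = of_real (L2_normsq 0 1 (rep_L2_unit v))"
    unfolding L2_normsq_def complex_norm_square[symmetric] by (rule integral_complex_of_real)
  also have "(\<lambda>j. 2 * sine_coeff ?h' (Suc j) * coeff sn (rep_L2_unit v) (Suc j)) =
      (\<lambda>j. of_real (2 * (cmod (v_coeff (Suc j) (coords U)))\<^sup>2))"
  proof
    fix j
    define n where "n = Suc j"
    have vn: "v_coeff n (coords U) = coeff sn (rep_L2_unit v) n" by (simp add: v_coeff_def cu)
    have n0: "of_real (real n * pi) \<noteq> (0::complex)" by (simp add: n_def del: of_nat_Suc)
    have "sine_coeff h n = coeff sn (prim 0 h) n" using coeff_sn_prim[OF sh zh, of n] by (simp add: n_def)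
    also have "\<dots> = v_coeff n (coords U)"
      unfolding vn by (rule coeff_cong_AE[OF square_integrable_prim[OF sh] sq square_integrable_sn])
        (use vae in \<open>auto elim: eventually_mono\<close>)
    finally have hv: "sine_coeff h n = v_coeff n (coords U)" .
    have "sine_coeff ?h' n = cnj (sine_coeff h n)" by (simp add: sine_coeff_def cnj_coeff)
    then have "2 * sine_coeff ?h' n * coeff sn (rep_L2_unit v) n = 2 * (v_coeff n (coords U) * cnj (v_coeff n (coords U)))"
      by (simp add: hv vn mult_ac)
    also have "\<dots> = of_real (2 * (cmod (v_coeff n (coords U)))\<^sup>2)"
      by (simp only: complex_norm_square of_real_mult of_real_numeral)
    finally show "2 * sine_coeff ?h' (Suc j) * coeff sn (rep_L2_unit v) (Suc j) = of_real (2 * (cmod (v_coeff (Suc j) (coords U)))\<^sup>2)"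
      unfolding n_def .
  qed
  finally have sv: "(\<lambda>j. 2 * (cmod (v_coeff (Suc j) (coords U)))\<^sup>2) sums L2_normsq 0 1 (rep_L2_unit v)"
    by (simp only: sums_of_real_iff)
  have "(norm (coords U))\<^sup>2 = L2_normsq 0 1 g + L2_normsq 0 1 (rep_L2_unit v)"
    by (simp add: Uuv coords_eq norm_Pair norm_L2_rep g_def L2_normsq_nonneg)
  with sums_add[OF su sv] show ?thesis by simp
qed

lemma u_coeff_bessel: "(\<Sum>j<N. 2 * (cmod (u_coeff (Suc j) y))\<^sup>2) \<le> (norm y)\<^sup>2"
proof -
  have "(norm (fst y))\<^sup>2 \<le> (norm y)\<^sup>2" by (rule power_mono) (metis norm_fst_le prod.collapse, simp)
  then show ?thesis
    using bessel_cs[OF rep_L2_square_integrable[of "fst y"], of N] by (simp add: u_coeff_def norm_L2_rep)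
qed

lemma v_coeff_bessel: "(\<Sum>j<N. 2 * (cmod (v_coeff (Suc j) y))\<^sup>2) \<le> (norm y)\<^sup>2"
proof -
  have "(norm (snd y))\<^sup>2 \<le> (norm y)\<^sup>2" by (rule power_mono) (metis norm_snd_le prod.collapse, simp)
  then show ?thesis
    using bessel_sn[OF rep_L2_square_integrable[of "snd y"], of N] by (simp add: v_coeff_def norm_L2_rep)
qed

lemma trace_at_series:
  assumes "x \<in> state_space" "\<xi> \<in> {0..1}"
  shows "(\<lambda>j. 2 * (u_coeff (Suc j) (coords x) / of_real (real (Suc j) * pi)) * sn (Suc j) \<xi>) sums trace_at \<xi> (coords x)"
  using sine_series_pointwise[OF rep_L2_square_integrable coords_mean_zero[OF assms(1)] assms(2)]
  by (simp add: u_coeff_def trace_at_def sine_coeff_def)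

lemma L2_normsq_split:
  assumes "square_integrable a b f" "a \<le> c" "c \<le> b"
  shows "L2_normsq a b f = L2_normsq a c f + L2_normsq c b f"
  unfolding L2_normsq_def by (rule LINT_interval_split[OF square_integrable_square[OF assms(1)] assms(2,3)])

section \<open>Density of the domain; energy and norm\<close>

lemma smooth_AE_H1:
  assumes "square_integrable a b f" "AE x in lebesgue_on {a<..<b}. f x = \<phi> x" "smooth \<phi>"
  shows "f \<in> H1 a b" "AE x in lebesgue_on {a<..<b}. weak_deriv a b f x = vector_derivative \<phi> (at x)"
proof -
  have s: "square_integrable a b \<phi>" "square_integrable a b (\<lambda>x. vector_derivative \<phi> (at x))"
    using assms(3) by (auto intro: square_integrable_smooth smooth_vector_derivative)
  have "has_weak_deriv a b f (\<lambda>x. vector_derivative \<phi> (at x))"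
    by (rule has_weak_deriv_cong_AE[OF s(1) assms(1) _ s(2) s(2) _ test_function_weak_deriv[OF assms(3)]])
      (use assms(2) in \<open>auto elim: eventually_mono\<close>)
  from weak_deriv_unique[OF assms(1) s(2) this]
  show "f \<in> H1 a b" "AE x in lebesgue_on {a<..<b}. weak_deriv a b f x = vector_derivative \<phi> (at x)" by auto
qed

lemma test_function_H10_unit:
  assumes \<phi>: "\<phi> \<in> test_functions 0 1"
  shows "abs_L2_unit \<phi> \<in> H10_unit" "H10_deriv (abs_L2_unit \<phi>) = abs_L2_unit (\<lambda>x. vector_derivative \<phi> (at x))"
proof -
  let ?\<phi>' = "\<lambda>x. vector_derivative \<phi> (at x)"
  have s: "square_integrable 0 1 \<phi>" "square_integrable 0 1 ?\<phi>'"
    using \<phi> by (auto intro: square_integrable_test_function test_function_deriv)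
  have p: "prim 0 (rep_L2_unit (abs_L2_unit ?\<phi>')) x = \<phi> x" if "x \<in> {0..1}" for x
    using prim_cong_AE[OF rep_L2_square_integrable s(2) _ rep_abs_L2[OF s(2)], of x] test_function_prim[OF \<phi> that] that by simp
  have ae: "AE x in lebesgue_on {0<..<1}. rep_L2_unit (abs_L2_unit \<phi>) x = prim 0 (rep_L2_unit (abs_L2_unit ?\<phi>')) x"
    using rep_abs_L2[OF s(1)] AE_space[of "lebesgue_on {0<..<1::real}"] by eventually_elim (simp add: p)
  have "\<phi> 1 = 0" by (rule test_functionD(2)[OF \<phi>]) simp
  then have z: "prim 0 (rep_L2_unit (abs_L2_unit ?\<phi>')) 1 = 0" by (simp add: p)
  show "abs_L2_unit \<phi> \<in> H10_unit" "H10_deriv (abs_L2_unit \<phi>) = abs_L2_unit ?\<phi>'"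
    using H10_unitI[OF ae z] by auto
qed

text \<open>For a smooth first component u' has no jump, so the transmission condition reduces to
  \<psi>(\<xi>) = 0.\<close>

lemma test_functions_domA:
  assumes \<xi>: "0 < \<xi>" "\<xi> < 1" and \<phi>: "\<phi> \<in> test_functions 0 1" and \<psi>: "\<psi> \<in> test_functions 0 1" "\<psi> \<xi> = 0"
  shows "(abs_L2_unit \<phi>, abs_L2_unit \<psi>) \<in> domA \<xi>"
proof -
  let ?f = "rep_L2_unit (abs_L2_unit \<phi>)" and ?\<phi>' = "\<lambda>x. vector_derivative \<phi> (at x)"
  have sm: "smooth \<phi>" "smooth ?\<phi>'" using test_functionD(1)[OF \<phi>] smooth_vector_derivative by auto
  have ae: "AE x in lebesgue_on {0<..<1}. ?f x = \<phi> x"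
    using rep_abs_L2[OF square_integrable_smooth[OF sm(1)]] .
  have loc: "?f \<in> H2 a b \<and> (\<forall>x\<in>{a..b}. sobolev_trace a b (weak_deriv a b ?f) x = ?\<phi>' x)" if "0 \<le> a" "a < b" "b \<le> 1" for a b
  proof -
    note h = smooth_AE_H1[OF square_integrable_subinterval[OF rep_L2_square_integrable that(1,3)] AE_subinterval[OF ae that(1,3)] sm(1)]
    note h' = smooth_AE_H1[OF H1_weak_deriv(2)[OF h(1)] h(2) sm(2)]
    show ?thesis
      using h h' sobolev_trace_eq[OF smooth_continuous_on[OF sm(2)] h(2) that(2)] by (simp add: H2_def)
  qed
  have "sobolev_trace 0 1 (rep_L2_unit (abs_L2_unit \<psi>)) \<xi> = \<psi> \<xi>"
    by (rule sobolev_trace_eq[OF smooth_continuous_on rep_abs_L2])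
      (use \<xi> test_functionD(1)[OF \<psi>(1)] in \<open>auto intro: square_integrable_smooth\<close>)
  then show ?thesis
    using loc[of 0 \<xi>] loc[of \<xi> 1] \<xi> test_function_H10_unit(1)[OF \<phi>] test_function_H10_unit(1)[OF \<psi>(1)] \<psi>(2)
    by (simp add: domA_def)
qed

text \<open>The velocity is approximated separately on each side of \<xi> by functions with compact
  support there, so that the sum vanishes at \<xi> as \<open>test_functions_domA\<close>
  demands.\<close>

lemma domA_dense:
  assumes \<xi>: "0 < \<xi>" "\<xi> < 1" and x: "x \<in> state_space" and "e > 0"
  obtains y where "y \<in> domA \<xi>" "y \<in> state_space" "norm (coords x - coords y) < e"
proof -
  obtain u v where xuv: "x = (u, v)" and u: "u \<in> H10_unit" using x by (auto simp: state_space_def)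
  let ?f = "rep_L2_unit u" and ?v = "rep_L2_unit v"
  \<comment> \<open>One share for u' and one for v on each of the two subintervals.\<close>
  define \<delta> where "\<delta> = e\<^sup>2 / 3"
  have "\<delta> > 0" using \<open>e > 0\<close> by (simp add: \<delta>_def)
  have f: "?f \<in> H10 0 1" using u by (simp add: H10_unit_def)
  then have "?f \<in> H1 0 1" by (simp add: H10_def)
  note H1 = H1_weak_deriv[OF this]
  obtain \<phi> where \<phi>: "\<phi> \<in> test_functions 0 1"
    "L2_normsq 0 1 (\<lambda>x. ?f x - \<phi> x) + L2_normsq 0 1 (\<lambda>x. weak_deriv 0 1 ?f x - vector_derivative \<phi> (at x)) < \<delta>"
    using f \<open>\<delta> > 0\<close> unfolding H10_def by blast
  let ?\<phi>' = "\<lambda>x. vector_derivative \<phi> (at x)"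
  have d1: "L2_normsq 0 1 (\<lambda>x. weak_deriv 0 1 ?f x - ?\<phi>' x) < \<delta>"
    using \<phi>(2) L2_normsq_nonneg[of 0 1 "\<lambda>x. ?f x - \<phi> x"] by linarith
  note sv = rep_L2_square_integrable[of v]
  have sv1: "square_integrable 0 \<xi> ?v" and sv2: "square_integrable \<xi> 1 ?v"
    using \<xi> by (auto intro: square_integrable_subinterval[OF sv])
  obtain \<psi>1 where \<psi>1: "\<psi>1 \<in> test_functions 0 \<xi>" "L2_normsq 0 \<xi> (\<lambda>x. ?v x - \<psi>1 x) < \<delta>"
    by (rule L2_test_functions_dense[OF sv1 \<open>\<delta> > 0\<close>])
  obtain \<psi>2 where \<psi>2: "\<psi>2 \<in> test_functions \<xi> 1" "L2_normsq \<xi> 1 (\<lambda>x. ?v x - \<psi>2 x) < \<delta>"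
    by (rule L2_test_functions_dense[OF sv2 \<open>\<delta> > 0\<close>])
  define \<psi> where "\<psi> = (\<lambda>x. \<psi>1 x + \<psi>2 x)"
  have z1: "\<psi>1 x = 0" if "x \<ge> \<xi>" for x by (rule test_functionD(2)[OF \<psi>1(1)]) (use that in auto)
  have z2: "\<psi>2 x = 0" if "x \<le> \<xi>" for x by (rule test_functionD(2)[OF \<psi>2(1)]) (use that in auto)
  have \<psi>: "\<psi> \<in> test_functions 0 1"
    unfolding \<psi>_def using \<xi> by (intro test_function_add test_function_mono[OF \<psi>1(1)] test_function_mono[OF \<psi>2(1)]) auto
  have s\<psi>: "square_integrable 0 1 \<psi>" by (rule square_integrable_test_function[OF \<psi>])
  have s\<phi>': "square_integrable 0 1 ?\<phi>'" by (rule square_integrable_test_function[OF test_function_deriv[OF \<phi>(1)]])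
  have "L2_normsq 0 1 (\<lambda>x. ?v x - \<psi> x) = L2_normsq 0 \<xi> (\<lambda>x. ?v x - \<psi> x) + L2_normsq \<xi> 1 (\<lambda>x. ?v x - \<psi> x)"
    using \<xi> by (intro L2_normsq_split square_integrable_diff sv s\<psi>) auto
  also have "L2_normsq 0 \<xi> (\<lambda>x. ?v x - \<psi> x) = L2_normsq 0 \<xi> (\<lambda>x. ?v x - \<psi>1 x)"
    unfolding L2_normsq_def by (rule Bochner_Integration.integral_cong) (auto simp: \<psi>_def z2)
  also have "L2_normsq \<xi> 1 (\<lambda>x. ?v x - \<psi> x) = L2_normsq \<xi> 1 (\<lambda>x. ?v x - \<psi>2 x)"
    unfolding L2_normsq_def by (rule Bochner_Integration.integral_cong) (auto simp: \<psi>_def z1)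
  finally have d2: "L2_normsq 0 1 (\<lambda>x. ?v x - \<psi> x) < 2 * \<delta>" using \<psi>1(2) \<psi>2(2) by simp
  define y where "y = (abs_L2_unit \<phi>, abs_L2_unit \<psi>)"
  have y: "y \<in> domA \<xi>" unfolding y_def
    by (rule test_functions_domA[OF \<xi> \<phi>(1) \<psi>]) (simp add: \<psi>_def z1 z2)
  have cy: "coords y = (abs_L2_unit ?\<phi>', abs_L2_unit \<psi>)"
    by (simp add: y_def coords_eq test_function_H10_unit[OF \<phi>(1)])
  have n1: "(norm (H10_deriv u - abs_L2_unit ?\<phi>'))\<^sup>2 = L2_normsq 0 1 (\<lambda>x. weak_deriv 0 1 ?f x - ?\<phi>' x)"
    unfolding norm_L2_rep
  proof (rule L2_normsq_cong_AE[OF rep_L2_square_integrable square_integrable_diff[OF H1(2) s\<phi>']])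
    show "AE x in lebesgue_on {0<..<1}. rep_L2_unit (H10_deriv u - abs_L2_unit ?\<phi>') x = weak_deriv 0 1 ?f x - ?\<phi>' x"
      using rep_L2_diff[of "H10_deriv u" "abs_L2_unit ?\<phi>'"] rep_abs_L2[OF s\<phi>'] H10_deriv(1)[OF u] by eventually_elim simp
  qed
  have n2: "(norm (v - abs_L2_unit \<psi>))\<^sup>2 = L2_normsq 0 1 (\<lambda>x. ?v x - \<psi> x)"
    unfolding norm_L2_rep
  proof (rule L2_normsq_cong_AE[OF rep_L2_square_integrable square_integrable_diff[OF sv s\<psi>]])
    show "AE x in lebesgue_on {0<..<1}. rep_L2_unit (v - abs_L2_unit \<psi>) x = ?v x - \<psi> x"
      using rep_L2_diff[of v "abs_L2_unit \<psi>"] rep_abs_L2[OF s\<psi>] by eventually_elim simp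
  qed
  have "(norm (coords x - coords y))\<^sup>2 = (norm (H10_deriv u - abs_L2_unit ?\<phi>'))\<^sup>2 + (norm (v - abs_L2_unit \<psi>))\<^sup>2"
    by (simp add: xuv coords_eq cy norm_Pair)
  also have "\<dots> < e\<^sup>2" unfolding n1 n2 using d1 d2 by (simp add: \<delta>_def)
  finally have "norm (coords x - coords y) < e" using \<open>e > 0\<close> by (simp add: power2_less_imp_less)
  moreover have "y \<in> state_space" using y by (auto simp: domA_def state_space_def)
  ultimately show ?thesis using that y by blast
qed

lemma domA_subset_state_space: "domA \<xi> \<subseteq> state_space"
  by (auto simp: domA_def state_space_def)

lemma opA_in_state_space: "U \<in> domA \<xi> \<Longrightarrow> opA \<xi> U \<in> state_space"
  by (auto simp: domA_def opA_def state_space_def)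

lemma energy_eq_norm_coords:
  assumes \<xi>: "0 < \<xi>" "\<xi> < 1" and U: "U \<in> state_space"
  shows "energy \<xi> U = (norm (coords U))\<^sup>2 / 2"
proof -
  obtain u v where Uuv: "U = (u, v)" and u: "u \<in> H10_unit" using U by (auto simp: state_space_def)
  let ?f = "rep_L2_unit u" and ?v = "rep_L2_unit v"
  let ?g = "rep_L2_unit (H10_deriv u)"
  note sq = rep_L2_square_integrable
  have uH1: "?f \<in> H1 0 1" using u by (simp add: H10_unit_def H10_def)
  have piece: "(LINT x|lebesgue_on {a<..<b}. (cmod (?v x))\<^sup>2 + (cmod (weak_deriv a b ?f x))\<^sup>2) =
      L2_normsq a b ?v + L2_normsq a b ?g" if ab: "0 \<le> a" "b \<le> 1" for a b
  proof -
    note h = H1_subinterval[OF uH1 ab]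
    have ae: "AE x in lebesgue_on {a<..<b}. weak_deriv a b ?f x = ?g x"
      using h(2) AE_subinterval[OF H10_deriv(1)[OF u] ab] by eventually_elim simp
    note s = H1_weak_deriv(2)[OF h(1)] square_integrable_subinterval[OF sq ab]
    have "(LINT x|lebesgue_on {a<..<b}. (cmod (?v x))\<^sup>2 + (cmod (weak_deriv a b ?f x))\<^sup>2) =
        L2_normsq a b ?v + L2_normsq a b (weak_deriv a b ?f)"
      unfolding L2_normsq_def by (intro Bochner_Integration.integral_add square_integrable_square s)
    also have "L2_normsq a b (weak_deriv a b ?f) = L2_normsq a b ?g"
      by (rule L2_normsq_cong_AE[OF s ae])
    finally show ?thesis .
  qed
  have "energy \<xi> U = 1 / 2 * (L2_normsq 0 1 ?v + L2_normsq 0 1 ?g)"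
    using \<xi> piece[of 0 \<xi>] piece[of \<xi> 1] L2_normsq_split[OF sq[of v], of \<xi>] L2_normsq_split[OF sq[of "H10_deriv u"], of \<xi>]
    by (simp add: energy_def Uuv)
  then show ?thesis by (simp add: Uuv coords_eq norm_Pair norm_L2_rep L2_normsq_nonneg)
qed

subsection \<open>Orbits of strongly continuous semigroups\<close>

text \<open>The norm \<open>nrm\<close> lives on a subset X and is unrelated to the type class norm
  of the surrounding type. The isometry J carries it to a genuine norm, so that derivatives and
  integrals of orbits make sense.\<close>

locale complete_subspace =
  fixes X :: "'a::real_vector set" and J :: "'a \<Rightarrow> 'b::real_inner" and nrm :: "'a \<Rightarrow> real"
  assumes X_add: "\<And>x y. x \<in> X \<Longrightarrow> y \<in> X \<Longrightarrow> x + y \<in> X"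
    and X_scaleR: "\<And>r x. x \<in> X \<Longrightarrow> r *\<^sub>R x \<in> X"
    and J_add: "\<And>x y. x \<in> X \<Longrightarrow> y \<in> X \<Longrightarrow> J (x + y) = J x + J y"
    and J_scaleR: "\<And>r x. x \<in> X \<Longrightarrow> J (r *\<^sub>R x) = r *\<^sub>R J x"
    and nrm_J: "\<And>x. x \<in> X \<Longrightarrow> nrm x = norm (J x)"
    and geometric_complete: "\<And>x K. (\<And>n. x n \<in> X) \<Longrightarrow> (\<And>n. nrm (x (Suc n) - x n) \<le> K * (1 / 3) ^ n) \<Longrightarrow>
      \<exists>l\<in>X. (\<lambda>n. nrm (x n - l)) \<longlonglongrightarrow> 0"
    and X_nonempty: "X \<noteq> {}"
begin

lemma X_diff: "x \<in> X \<Longrightarrow> y \<in> X \<Longrightarrow> x - y \<in> X"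
  using X_add[of x "(-1) *\<^sub>R y"] X_scaleR[of y "-1"] by simp

lemma J_diff: "x \<in> X \<Longrightarrow> y \<in> X \<Longrightarrow> J (x - y) = J x - J y"
  using J_add[of x "(-1) *\<^sub>R y"] X_scaleR[of y "-1"] J_scaleR[of y "-1"] by simp

lemma X_zero: "0 \<in> X"
  using X_nonempty X_scaleR[of _ 0] by fastforce

lemma nrm_ge_0: "x \<in> X \<Longrightarrow> 0 \<le> nrm x"
  by (simp add: nrm_J)

lemma nrm_triangle: "x \<in> X \<Longrightarrow> y \<in> X \<Longrightarrow> nrm (x + y) \<le> nrm x + nrm y"
  by (simp add: nrm_J X_add J_add norm_triangle_ineq)

lemma nrm_scaleR: "x \<in> X \<Longrightarrow> nrm (r *\<^sub>R x) = \<bar>r\<bar> * nrm x"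
  by (simp add: nrm_J X_scaleR J_scaleR)

lemma nrm_diff_commute: "x \<in> X \<Longrightarrow> y \<in> X \<Longrightarrow> nrm (x - y) = nrm (y - x)"
  by (simp add: nrm_J X_diff J_diff norm_minus_commute)

lemma nrm_diff_triangle: "x \<in> X \<Longrightarrow> y \<in> X \<Longrightarrow> z \<in> X \<Longrightarrow> nrm (x - z) \<le> nrm (x - y) + nrm (y - z)"
  using nrm_triangle[of "x - y" "y - z"] by (simp add: X_diff)

text \<open>Uniform boundedness, by the gliding hump argument: the increments \<open>(1/3)^k\<close> are small enough that
  the hump created at step \<open>k\<close> survives all later steps.\<close>

lemma uniform_boundedness:
  fixes p :: "nat \<Rightarrow> 'a \<Rightarrow> real"
  assumes p_add: "\<And>n x y. x \<in> X \<Longrightarrow> y \<in> X \<Longrightarrow> p n (x + y) \<le> p n x + p n y"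
    and p_scaleR: "\<And>n r x. x \<in> X \<Longrightarrow> p n (r *\<^sub>R x) = \<bar>r\<bar> * p n x"
    and p_bdd: "\<And>n. \<exists>M. \<forall>x\<in>X. p n x \<le> M * nrm x"
    and pointwise: "\<And>x. x \<in> X \<Longrightarrow> \<exists>B. \<forall>n. p n x \<le> B"
  shows "\<exists>C. \<forall>n. \<forall>x\<in>X. p n x \<le> C * nrm x"
proof -
  define N where "N = (\<lambda>n. SUP x\<in>{x\<in>X. nrm x \<le> 1}. p n x)"
  obtain M where M: "\<And>n x. x \<in> X \<Longrightarrow> p n x \<le> M n * nrm x" using p_bdd by metis
  have p0: "p n 0 = 0" for n using p_scaleR[OF X_zero, of n 0] by simp
  have p_ge: "p n x \<ge> 0" if "x \<in> X" for n x
    using p_add[OF that X_scaleR[OF that, of "-1"], of n] p_scaleR[OF that, of n "-1"] p0[of n] by simp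
  have nrm0: "nrm 0 = 0" using nrm_scaleR[OF X_zero, of 0] by simp
  have Mb: "p n x \<le> \<bar>M n\<bar>" if "x \<in> X" "nrm x \<le> 1" for n x
  proof -
    have "M n * nrm x \<le> \<bar>M n\<bar> * nrm x" using nrm_ge_0[OF that(1)] by (intro mult_right_mono) auto
    also have "\<dots> \<le> \<bar>M n\<bar> * 1" using that by (intro mult_left_mono) auto
    finally show ?thesis using M[OF that(1), of n] by simp
  qed
  have bdd: "bdd_above (p n ` {x\<in>X. nrm x \<le> 1})" for n
    using Mb by (auto intro!: bdd_aboveI[of _ "\<bar>M n\<bar>"])
  have N_upper: "p n x \<le> N n" if "x \<in> X" "nrm x \<le> 1" for n x
    unfolding N_def by (rule cSUP_upper[OF _ bdd]) (use that in auto)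
  have N0: "N n \<ge> 0" for n using N_upper[OF X_zero, of n] nrm0 p0 by simp
  have pN: "p n x \<le> N n * nrm x" if x: "x \<in> X" for n x
  proof (cases "nrm x = 0")
    case True
    then show ?thesis using M[OF x, of n] by simp
  next
    case False
    then have pos: "nrm x > 0" using nrm_ge_0[OF x] by simp
    have "p n ((1 / nrm x) *\<^sub>R x) \<le> N n"
      using pos x by (intro N_upper X_scaleR) (auto simp: nrm_scaleR)
    then show ?thesis using pos by (simp add: p_scaleR[OF x] field_simps)
  qed
  show ?thesis
  proof (cases "\<exists>C. \<forall>n. N n \<le> C")
    case True
    then obtain C where C: "\<And>n. N n \<le> C" by auto
    have "p n x \<le> C * nrm x" if "x \<in> X" for n x
      using pN[OF that, of n] mult_right_mono[OF C[of n] nrm_ge_0[OF that]] by linarith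
    then show ?thesis by blast
  next
    case False
    have "\<exists>n. N n \<ge> 4 ^ k" for k :: nat using False by (meson linear)
    \<comment> \<open>The growth 4^k has to beat the step lengths (1/3)^k.\<close>
    then obtain m where m: "\<And>k::nat. N (m k) \<ge> 4 ^ k" by metis
    have step: "\<exists>x'. x' \<in> X \<and> nrm (x' - x) \<le> (1/3) ^ k \<and> p (m k) x' \<ge> 2/3 * (1/3) ^ k * N (m k)"
      if x: "x \<in> X" for x k
    proof -
      have Npos: "N (m k) > 0" using m[of k] zero_less_power[of "4::real" k] by linarith
      have "2/3 * N (m k) < N (m k)" using Npos by simp
      moreover have "{x\<in>X. nrm x \<le> 1} \<noteq> {}" using X_zero nrm0 by auto
      note less_cSUP_iff[OF this bdd[of "m k"], of "2/3 * N (m k)"]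
      ultimately have "\<exists>z\<in>{x\<in>X. nrm x \<le> 1}. 2/3 * N (m k) < p (m k) z" by (simp add: N_def)
      then obtain z where z: "z \<in> X" "nrm z \<le> 1" "2/3 * N (m k) < p (m k) z" by blast
      define y where "y = (1/3) ^ k *\<^sub>R z"
      have y: "y \<in> X" "nrm y \<le> (1/3) ^ k" "p (m k) y \<ge> 2/3 * (1/3) ^ k * N (m k)"
      proof -
        show "y \<in> X" unfolding y_def by (rule X_scaleR[OF z(1)])
        show "nrm y \<le> (1/3) ^ k" using z(2) by (simp add: y_def nrm_scaleR[OF z(1)] mult_left_le)
        have "(1/3) ^ k * (2/3 * N (m k)) \<le> (1/3) ^ k * p (m k) z"
          using z(3) by (intro mult_left_mono) auto
        then show "p (m k) y \<ge> 2/3 * (1/3) ^ k * N (m k)"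
          by (simp add: y_def p_scaleR[OF z(1)] mult_ac)
      qed
      \<comment> \<open>Since 2 y = (x + y) - (x - y), at least one of x + y and x - y is as large
        as y; no control of x itself is involved.\<close>
      have "2 * p (m k) y = p (m k) (2 *\<^sub>R y)" by (simp add: p_scaleR[OF y(1)])
      also have "2 *\<^sub>R y = (x + y) + (-1) *\<^sub>R (x - y)" by (simp add: scaleR_2)
      also have "p (m k) \<dots> \<le> p (m k) (x + y) + p (m k) ((-1) *\<^sub>R (x - y))"
        by (intro p_add X_add X_scaleR X_diff x y)
      also have "p (m k) ((-1) *\<^sub>R (x - y)) = p (m k) (x - y)" using p_scaleR[OF X_diff[OF x y(1)], of "m k" "-1"] by simp
      finally have "p (m k) y \<le> p (m k) (x + y) \<or> p (m k) y \<le> p (m k) (x - y)" by linarith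
      then show ?thesis
      proof
        assume "p (m k) y \<le> p (m k) (x + y)"
        then show ?thesis using y x by (intro exI[of _ "x + y"]) (auto intro: X_add)
      next
        assume "p (m k) y \<le> p (m k) (x - y)"
        moreover have "nrm (x - y - x) = nrm y" using nrm_scaleR[OF y(1), of "-1"] by simp
        ultimately show ?thesis using y x by (intro exI[of _ "x - y"]) (auto intro: X_diff)
      qed
    qed
    define nxt where "nxt = (\<lambda>k x. SOME x'. x' \<in> X \<and> nrm (x' - x) \<le> (1/3) ^ k \<and> p (m k) x' \<ge> 2/3 * (1/3) ^ k * N (m k))"
    define x where "x = rec_nat (0::'a) nxt"
    have xS: "x (Suc k) = nxt k (x k)" and x0: "x 0 = 0" for k by (auto simp: x_def)
    have nxt: "nxt k z \<in> X \<and> nrm (nxt k z - z) \<le> (1/3) ^ k \<and> p (m k) (nxt k z) \<ge> 2/3 * (1/3) ^ k * N (m k)"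
      if "z \<in> X" for k z
      unfolding nxt_def by (rule someI_ex[OF step[OF that]])
    have xX: "x k \<in> X" for k by (induction k) (auto simp: x0 xS X_zero nxt)
    have xd: "nrm (x (Suc k) - x k) \<le> (1/3) ^ k" for k using nxt[OF xX[of k], of k] by (simp add: xS)
    have xp: "p (m k) (x (Suc k)) \<ge> 2/3 * (1/3) ^ k * N (m k)" for k using nxt[OF xX[of k], of k] by (simp add: xS)
    obtain l where l: "l \<in> X" "(\<lambda>n. nrm (x n - l)) \<longlonglongrightarrow> 0"
      using geometric_complete[of x 1] xX xd by auto
    have far: "nrm (x n - x (n + j)) \<le> 3/2 * ((1/3) ^ n - (1/3) ^ (n + j))" for n j
    proof (induction j)
      case 0
      then show ?case by (simp add: nrm0)
    next
      case (Suc j)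
      have "nrm (x n - x (n + Suc j)) \<le> nrm (x n - x (n + j)) + nrm (x (n + j) - x (n + Suc j))"
        by (intro nrm_diff_triangle xX)
      also have "nrm (x (n + j) - x (n + Suc j)) \<le> (1/3) ^ (n + j)"
        using xd[of "n + j"] nrm_diff_commute[OF xX xX, of "n + j" "n + Suc j"] by simp
      finally show ?case using Suc by (simp add: algebra_simps)
    qed
    have lim: "nrm (x n - l) \<le> 3/2 * (1/3) ^ n" for n
    proof (rule LIMSEQ_le_const)
      show "(\<lambda>j. 3/2 * (1/3) ^ n + nrm (x (j + n) - l)) \<longlonglongrightarrow> 3/2 * (1/3) ^ n"
        using tendsto_add[OF tendsto_const LIMSEQ_ignore_initial_segment[OF l(2), of n], of "3/2 * (1/3) ^ n"] by simp
      have "nrm (x n - l) \<le> 3/2 * (1/3) ^ n + nrm (x (j + n) - l)" for j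
      proof -
        have "0 \<le> (1/3 :: real) ^ (n + j)" by simp
        moreover have "c \<le> 3/2 * a + e" if "c \<le> d + e" "d \<le> 3/2 * (a - b)" "0 \<le> b" for a b c d e :: real
        proof -
          have "3/2 * (a - b) \<le> 3/2 * a" using that(3) by simp
          then show ?thesis using that(1,2) by linarith
        qed
        ultimately show ?thesis
          unfolding add.commute[of j n] using nrm_diff_triangle[OF xX xX l(1), of n "n + j"] far[of n j] by blast
      qed
      then show "\<exists>N. \<forall>j\<ge>N. nrm (x n - l) \<le> 3/2 * (1/3) ^ n + nrm (x (j + n) - l)" by blast
    qed
    obtain B where B: "\<And>n. p n l \<le> B" using pointwise[OF l(1)] by auto
    \<comment> \<open>After step k the limit is still at most 3/2 (1/3)^(k+1) = 1/2 (1/3)^k away, so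
      of the hump 2/3 (1/3)^k N a share 2/3 - 1/2 = 1/6 survives.\<close>
    have hump: "1/6 * (4/3) ^ k \<le> p (m k) l" for k
    proof -
      have "p (m k) (x (Suc k)) = p (m k) (l + (x (Suc k) - l))" by simp
      also have "\<dots> \<le> p (m k) l + p (m k) (x (Suc k) - l)" by (intro p_add l X_diff xX)
      also have "p (m k) (x (Suc k) - l) \<le> N (m k) * nrm (x (Suc k) - l)" by (intro pN X_diff xX l)
      also have "\<dots> \<le> N (m k) * (3/2 * (1/3) ^ Suc k)" by (intro mult_left_mono lim N0)
      finally have "2/3 * (1/3) ^ k * N (m k) - N (m k) * (3/2 * (1/3) ^ Suc k) \<le> p (m k) l"
        using xp[of k] by linarith
      then have "1/6 * (1/3) ^ k * N (m k) \<le> p (m k) l" by (simp add: algebra_simps)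
      moreover have "1/6 * (1/3) ^ k * 4 ^ k \<le> 1/6 * (1/3) ^ k * N (m k)"
        by (intro mult_left_mono m) auto
      moreover have "1/6 * (1/3) ^ k * 4 ^ k = 1/6 * (4/3 :: real) ^ k" by (simp add: power_divide)
      ultimately show ?thesis by linarith
    qed
    obtain k where "(4/3 :: real) ^ k > 6 * B" using real_arch_pow[of "4/3" "6 * B"] by auto
    with hump[of k] B[of "m k"] show ?thesis by linarith
  qed
qed

context
  fixes S D A
  assumes gen: "generates X nrm D A S"
begin

lemma S_in: "t \<ge> 0 \<Longrightarrow> x \<in> X \<Longrightarrow> S t x \<in> X"
  and S_add: "t \<ge> 0 \<Longrightarrow> x \<in> X \<Longrightarrow> y \<in> X \<Longrightarrow> S t (x + y) = S t x + S t y"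
  and S_scaleR: "t \<ge> 0 \<Longrightarrow> x \<in> X \<Longrightarrow> S t (r *\<^sub>R x) = r *\<^sub>R S t x"
  and S_bounded: "t \<ge> 0 \<Longrightarrow> \<exists>M. \<forall>x\<in>X. nrm (S t x) \<le> M * nrm x"
  and S_0: "x \<in> X \<Longrightarrow> S 0 x = x"
  and S_semigroup: "s \<ge> 0 \<Longrightarrow> t \<ge> 0 \<Longrightarrow> x \<in> X \<Longrightarrow> S (s + t) x = S s (S t x)"
  and S_continuous: "x \<in> X \<Longrightarrow> ((\<lambda>h. nrm (S h x - x)) \<longlongrightarrow> 0) (at_right 0)"
  using gen unfolding generates_def C0_semigroup_def by blast+

lemma S_diff: "t \<ge> 0 \<Longrightarrow> x \<in> X \<Longrightarrow> y \<in> X \<Longrightarrow> S t (x - y) = S t x - S t y"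
  using S_add[of t x "(-1) *\<^sub>R y"] S_scaleR[of t y "-1"] X_scaleR[of y "-1"] by simp

lemma generator_iff: "(x, y) \<in> generator_graph X nrm S \<longleftrightarrow> x \<in> D \<and> y = A x"
  using gen unfolding generates_def by auto

lemma D_in_X: "x \<in> D \<Longrightarrow> x \<in> X" and A_in_X: "x \<in> D \<Longrightarrow> A x \<in> X"
  and generator_limit: "x \<in> D \<Longrightarrow> ((\<lambda>h. nrm ((S h x - x) /\<^sub>R h - A x)) \<longlongrightarrow> 0) (at_right 0)"
  using generator_iff[of x "A x"] by (auto simp: generator_graph_def)

lemma D_invariant:
  assumes t: "t \<ge> 0" and x: "x \<in> D"
  shows "S t x \<in> D" "A (S t x) = S t (A x)"
proof -
  note xX = D_in_X[OF x] and AX = A_in_X[OF x]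
  obtain M where M: "\<And>z. z \<in> X \<Longrightarrow> nrm (S t z) \<le> M * nrm z" using S_bounded[OF t] by auto
  have "((\<lambda>h. nrm ((S h (S t x) - S t x) /\<^sub>R h - S t (A x))) \<longlongrightarrow> 0) (at_right 0)"
  proof (rule tendsto_sandwich[OF _ _ tendsto_const])
    have "((\<lambda>h. M * nrm ((S h x - x) /\<^sub>R h - A x)) \<longlongrightarrow> M * 0) (at_right 0)"
      by (intro tendsto_intros generator_limit x)
    then show "((\<lambda>h. M * nrm ((S h x - x) /\<^sub>R h - A x)) \<longlongrightarrow> 0) (at_right 0)" by simp
    have *: "0 \<le> nrm ((S h (S t x) - S t x) /\<^sub>R h - S t (A x)) \<and>
        nrm ((S h (S t x) - S t x) /\<^sub>R h - S t (A x)) \<le> M * nrm ((S h x - x) /\<^sub>R h - A x)" if h: "h > 0" for h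
    proof -
      have ST: "S h (S t x) = S t (S h x)"
        using S_semigroup[of h t x] S_semigroup[of t h x] h t xX by (simp add: add.commute)
      have "(S h (S t x) - S t x) /\<^sub>R h - S t (A x) = S t ((S h x - x) /\<^sub>R h - A x)"
        using h t xX AX by (simp add: ST S_diff S_scaleR S_in X_diff X_scaleR)
      then show ?thesis using h t xX AX
        by (auto intro!: M nrm_ge_0 S_in X_diff X_scaleR)
    qed
    show "\<forall>\<^sub>F h in at_right 0. 0 \<le> nrm ((S h (S t x) - S t x) /\<^sub>R h - S t (A x))"
      "\<forall>\<^sub>F h in at_right 0. nrm ((S h (S t x) - S t x) /\<^sub>R h - S t (A x)) \<le> M * nrm ((S h x - x) /\<^sub>R h - A x)"
      using * by (auto intro!: eventually_at_rightI[of 0 1])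
  qed
  then have "(S t x, S t (A x)) \<in> generator_graph X nrm S"
    using t xX AX by (auto simp: generator_graph_def S_in)
  then show "S t x \<in> D" "A (S t x) = S t (A x)" by (auto simp: generator_iff)
qed

text \<open>The definition of a semigroup bounds each operator separately. If no uniform bound held
  near 0, there would be times t_n tending to 0 with norms above n; strong continuity makes these
  operators pointwise bounded, against \<open>uniform_boundedness\<close>.\<close>

lemma S_bounded_near_0: "\<exists>\<delta>>0. \<exists>C. \<forall>t\<in>{0..\<delta>}. \<forall>x\<in>X. nrm (S t x) \<le> C * nrm x"
proof (rule ccontr)
  assume neg: "\<not> ?thesis"
  have "\<exists>t. t \<in> {0..1 / Suc n} \<and> (\<exists>x\<in>X. nrm (S t x) > real n * nrm x)" for n
  proof (rule ccontr)
    assume "\<not> ?thesis"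
    then have "\<forall>t\<in>{0..1 / Suc n}. \<forall>x\<in>X. nrm (S t x) \<le> real n * nrm x" by (meson not_le)
    with neg show False by (metis of_nat_0_less_iff zero_less_Suc zero_less_divide_1_iff)
  qed
  then obtain t where t: "\<And>n. t n \<in> {0..1 / Suc n}" "\<And>n. \<exists>x\<in>X. nrm (S (t n) x) > real n * nrm x" by metis
  have t0: "t n \<ge> 0" for n using t(1)[of n] by simp
  have "\<exists>C. \<forall>n. \<forall>x\<in>X. nrm (S (t n) x) \<le> C * nrm x"
  proof (rule uniform_boundedness)
    fix x assume x: "x \<in> X"
    have "\<forall>\<^sub>F h in at_right 0. nrm (S h x - x) < 1"
      using order_tendstoD(2)[OF S_continuous[OF x], of 1] by simp
    then obtain d where d: "d > 0" "\<And>h. 0 < h \<Longrightarrow> h < d \<Longrightarrow> nrm (S h x - x) < 1"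
      by (auto simp: eventually_at_right_field)
    obtain N :: nat where N: "1 / Suc N < d" using d(1) nat_approx_posE by blast
    have tail: "nrm (S (t n) x) \<le> nrm x + 1" if "n \<ge> N" for n
    proof (cases "t n = 0")
      case True
      then show ?thesis using S_0[OF x] by simp
    next
      case False
      have "t n \<le> 1 / Suc n" using t(1)[of n] by simp
      also have "\<dots> \<le> 1 / Suc N" using that by (simp add: frac_le)
      finally have "nrm (S (t n) x - x) < 1" using d(2)[of "t n"] False t0[of n] N by simp
      moreover have "nrm (S (t n) x) \<le> nrm (S (t n) x - x) + nrm x"
        using nrm_triangle[of "S (t n) x - x" x] x t0 by (simp add: X_diff S_in)
      ultimately show ?thesis by simp
    qed
    define B where "B = nrm x + 1 + (\<Sum>n<N. nrm (S (t n) x))"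
    have "nrm (S (t n) x) \<le> B" for n
    proof (cases "n < N")
      case True
      have "nrm (S (t n) x) \<le> (\<Sum>n<N. nrm (S (t n) x))"
        using True x t0 by (intro member_le_sum) (auto intro: nrm_ge_0 S_in)
      then show ?thesis using nrm_ge_0[OF x] by (simp add: B_def)
    next
      case False
      have "(\<Sum>n<N. nrm (S (t n) x)) \<ge> 0" using x t0 by (intro sum_nonneg nrm_ge_0 S_in) auto
      with tail[of n] False show ?thesis by (simp add: B_def)
    qed
    then show "\<exists>B. \<forall>n. nrm (S (t n) x) \<le> B" by blast
  next
    fix n x y assume "x \<in> X" "y \<in> X"
    then show "nrm (S (t n) (x + y)) \<le> nrm (S (t n) x) + nrm (S (t n) y)"
      using t0 by (simp add: S_add nrm_triangle S_in)
  next
    fix n r x assume "x \<in> X"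
    then show "nrm (S (t n) (r *\<^sub>R x)) = \<bar>r\<bar> * nrm (S (t n) x)"
      using t0 by (simp add: S_scaleR nrm_scaleR S_in)
  qed (rule S_bounded[OF t0])
  then obtain C where C: "\<And>n x. x \<in> X \<Longrightarrow> nrm (S (t n) x) \<le> C * nrm x" by auto
  obtain n :: nat where n: "C \<le> n" using real_arch_simple by blast
  obtain x where x: "x \<in> X" "nrm (S (t n) x) > real n * nrm x" using t(2)[of n] by auto
  have "C * nrm x \<le> real n * nrm x" using n nrm_ge_0[OF x(1)] by (rule mult_right_mono)
  with C[OF x(1), of n] x(2) show False by simp
qed

lemma S_locally_bounded: "\<exists>K>0. \<forall>t\<in>{0..T}. \<forall>x\<in>X. nrm (S t x) \<le> K * nrm x"
proof -
  obtain \<delta> C where \<delta>: "\<delta> > 0" and C: "\<And>t x. 0 \<le> t \<Longrightarrow> t \<le> \<delta> \<Longrightarrow> x \<in> X \<Longrightarrow> nrm (S t x) \<le> C * nrm x"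
    using S_bounded_near_0 by (metis atLeastAtMost_iff)
  define K where "K = max 1 C"
  have K: "K \<ge> 1" by (simp add: K_def)
  have C: "nrm (S t x) \<le> K * nrm x" if "0 \<le> t" "t \<le> \<delta>" "x \<in> X" for t x
    using C[OF that] mult_right_mono[of C K "nrm x"] nrm_ge_0[OF that(3)] by (simp add: K_def)
  have ind: "\<forall>t x. 0 \<le> t \<longrightarrow> t \<le> real m * \<delta> \<longrightarrow> x \<in> X \<longrightarrow> nrm (S t x) \<le> K ^ m * nrm x" for m
  proof (induction m)
    case 0
    then show ?case using S_0 by (metis antisym_conv lambda_zero mult_1 of_nat_0 order_refl power_0)
  next
    case (Suc m)
    show ?case
    proof (intro allI impI)
      fix t x assume t: "0 \<le> t" "t \<le> real (Suc m) * \<delta>" and x: "x \<in> X"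
      show "nrm (S t x) \<le> K ^ Suc m * nrm x"
      proof (cases "t \<le> \<delta>")
        case True
        have "nrm (S t x) \<le> K * nrm x" by (rule C[OF t(1) True x])
        also have "\<dots> \<le> K ^ Suc m * nrm x"
          using K nrm_ge_0[OF x] by (intro mult_right_mono) (auto simp: mult_le_cancel_left1)
        finally show ?thesis .
      next
        case False
        have "S t x = S (t - \<delta>) (S \<delta> x)"
          using S_semigroup[of "t - \<delta>" \<delta> x] False \<delta> x by simp
        also have "nrm \<dots> \<le> K ^ m * nrm (S \<delta> x)"
          using False t \<delta> x by (intro Suc.IH[rule_format] S_in) (auto simp: algebra_simps)
        also have "\<dots> \<le> K ^ m * (K * nrm x)"
          using C[of \<delta> x] \<delta> x K by (intro mult_left_mono) auto
        finally show ?thesis by (simp add: mult_ac)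
      qed
    qed
  qed
  obtain m :: nat where "T / \<delta> \<le> m" using real_arch_simple by blast
  then have "T \<le> real m * \<delta>" using \<delta> by (simp add: field_simps)
  then show ?thesis using ind[of m] K by (intro exI[of _ "K ^ m"]) auto
qed

text \<open>Strong continuity speaks only of the right limit at 0. For s < t the factor S(s) is
  pulled out of S(t) x - S(s) x and its norm depends on s, so continuity from the left needs the
  local bound.\<close>

lemma orbit_continuous:
  assumes x: "x \<in> X"
  shows "continuous_on {0..} (\<lambda>t. J (S t x))"
  unfolding continuous_on_iff
proof (intro ballI allI impI)
  fix t e :: real assume t: "t \<in> {0..}" and "e > 0"
  obtain K where K: "K > 0" "\<And>s z. 0 \<le> s \<Longrightarrow> s \<le> t + 1 \<Longrightarrow> z \<in> X \<Longrightarrow> nrm (S s z) \<le> K * nrm z"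
    using S_locally_bounded[of "t + 1"] by auto
  have "\<forall>\<^sub>F h in at_right 0. nrm (S h x - x) < e / K"
    using order_tendstoD(2)[OF S_continuous[OF x], of "e / K"] \<open>e > 0\<close> K(1) by simp
  then obtain d where d: "d > 0" "\<And>h. 0 < h \<Longrightarrow> h < d \<Longrightarrow> nrm (S h x - x) < e / K"
    by (auto simp: eventually_at_right_field)
  have main: "norm (J (S (a + h) x) - J (S a x)) < e" if "0 \<le> a" "a \<le> t + 1" "0 < h" "h < d" for a h
  proof -
    have "J (S (a + h) x) - J (S a x) = J (S a (S h x - x))"
      using that x S_semigroup[of a h x] by (simp add: S_diff J_diff S_in)
    also have "norm \<dots> = nrm (S a (S h x - x))" using that x by (simp add: nrm_J S_in X_diff)
    also have "\<dots> \<le> K * nrm (S h x - x)" using that x by (intro K X_diff S_in) auto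
    also have "\<dots> < K * (e / K)" using that d K by (intro mult_strict_left_mono) auto
    finally show ?thesis using K by simp
  qed
  show "\<exists>d>0. \<forall>s\<in>{0..}. dist s t < d \<longrightarrow> dist (J (S s x)) (J (S t x)) < e"
  proof (intro exI conjI ballI impI)
    show "min d 1 > 0" using d by simp
    fix s assume s: "s \<in> {0..}" "dist s t < min d 1"
    consider "s = t" | "s > t" | "s < t" by linarith
    then show "dist (J (S s x)) (J (S t x)) < e"
    proof cases
      case 1
      then show ?thesis using \<open>e > 0\<close> by simp
    next
      case 2
      then show ?thesis using main[of t "s - t"] t s by (simp add: dist_norm)
    next
      case 3
      then show ?thesis using main[of s "t - s"] t s by (simp add: dist_norm norm_minus_commute)
    qed
  qed
qed

text \<open>The generator provides right difference quotients at 0. The left derivative again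
  factors out S(t - h), and its base point must be moved from t - h to t by continuity of the orbit
  of A x.\<close>

lemma orbit_has_vector_derivative:
  assumes x: "x \<in> D" and t: "t \<ge> 0"
  shows "((\<lambda>t. J (S t x)) has_vector_derivative J (S t (A x))) (at t within {0..})"
  unfolding has_vector_derivative_def has_derivative_within_alt
proof (intro conjI allI impI)
  show "bounded_linear (\<lambda>s. s *\<^sub>R J (S t (A x)))" by (rule bounded_linear_scaleR_left)
  fix e :: real assume "e > 0"
  note xX = D_in_X[OF x] and AX = A_in_X[OF x]
  obtain K where K: "K > 0" "\<And>s z. 0 \<le> s \<Longrightarrow> s \<le> t + 1 \<Longrightarrow> z \<in> X \<Longrightarrow> nrm (S s z) \<le> K * nrm z"
    using S_locally_bounded[of "t + 1"] by auto
  have "\<forall>\<^sub>F h in at_right 0. nrm ((S h x - x) /\<^sub>R h - A x) < e / (2 * K)" "\<forall>\<^sub>F h in at_right 0. nrm (S h (A x) - A x) < e / (2 * K)"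
    using order_tendstoD(2)[OF generator_limit[OF x], of "e / (2 * K)"]
      order_tendstoD(2)[OF S_continuous[OF AX], of "e / (2 * K)"] \<open>e > 0\<close> K(1) by simp_all
  then have "\<forall>\<^sub>F h in at_right 0. nrm ((S h x - x) /\<^sub>R h - A x) < e / (2 * K) \<and> nrm (S h (A x) - A x) < e / (2 * K)"
    by (rule eventually_conj)
  then obtain d where d: "d > 0" "\<And>h. 0 < h \<Longrightarrow> h < d \<Longrightarrow> nrm ((S h x - x) /\<^sub>R h - A x) < e / (2 * K)"
      "\<And>h. 0 < h \<Longrightarrow> h < d \<Longrightarrow> nrm (S h (A x) - A x) < e / (2 * K)"
    by (auto simp: eventually_at_right_field)
  have main: "norm (J (S (a + h) x) - J (S a x) - h *\<^sub>R J (S a (A x))) \<le> (e / 2) * h"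
    if "0 \<le> a" "a \<le> t + 1" "0 < h" "h < d" for a h
  proof -
    let ?r = "(S h x - x) /\<^sub>R h - A x"
    have rX: "?r \<in> X" using that xX AX by (intro X_diff X_scaleR S_in) auto
    have "h *\<^sub>R ?r = S h x - x - h *\<^sub>R A x" using that by (simp add: scaleR_diff_right)
    then have "J (S (a + h) x) - J (S a x) - h *\<^sub>R J (S a (A x)) = J (S a (h *\<^sub>R ?r))"
      using that xX AX S_semigroup[of a h x] by (simp add: S_diff J_diff S_in X_diff X_scaleR S_scaleR J_scaleR)
    also have "norm \<dots> = nrm (S a (h *\<^sub>R ?r))" by (rule nrm_J[symmetric]) (intro S_in X_scaleR rX that)
    also have "\<dots> \<le> K * nrm (h *\<^sub>R ?r)" using that by (intro K X_scaleR rX) auto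
    also have "\<dots> = K * (h * nrm ?r)" using that by (simp only: nrm_scaleR[OF rX] abs_of_pos)
    also have "\<dots> \<le> K * (h * (e / (2 * K)))" using that K d(2)[of h] by (intro mult_left_mono) auto
    finally show ?thesis using K by (simp add: mult_ac)
  qed
  show "\<exists>d>0. \<forall>s\<in>{0..}. norm (s - t) < d \<longrightarrow> norm (J (S s x) - J (S t x) - (s - t) *\<^sub>R J (S t (A x))) \<le> e * norm (s - t)"
  proof (intro exI conjI ballI impI)
    show "min d 1 > 0" using d by simp
    fix s assume s: "s \<in> {0..}" "norm (s - t) < min d 1"
    consider "s = t" | "s > t" | "s < t" by linarith
    then show "norm (J (S s x) - J (S t x) - (s - t) *\<^sub>R J (S t (A x))) \<le> e * norm (s - t)"
    proof cases
      case 1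
      then show ?thesis by simp
    next
      case 2
      have "norm (J (S s x) - J (S t x) - (s - t) *\<^sub>R J (S t (A x))) \<le> (e / 2) * (s - t)"
        using main[of t "s - t"] t s 2 by simp
      also have "\<dots> \<le> e * norm (s - t)" using 2 \<open>e > 0\<close> by simp
      finally show ?thesis .
    next
      \<comment> \<open>Expansion around s = t - h: one error comes from the difference quotient at
        s, the other from replacing S(s) A x by S(t) A x, each at most half of the
        allowance.\<close>
      case 3
      define h where "h = t - s"
      have h: "0 < h" "h < d" "t = s + h" "0 \<le> s" "s \<le> t + 1" using 3 s by (auto simp: h_def)
      have b1: "norm (J (S (s + h) x) - J (S s x) - h *\<^sub>R J (S s (A x))) \<le> (e / 2) * h" using main[of s h] h by simp
      have b2: "norm (h *\<^sub>R (J (S (s + h) (A x)) - J (S s (A x)))) \<le> h * (e / 2)"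
      proof -
        have "J (S (s + h) (A x)) - J (S s (A x)) = J (S s (S h (A x) - A x))"
          using h AX S_semigroup[of s h "A x"] by (simp add: S_diff J_diff S_in)
        also have "norm \<dots> = nrm (S s (S h (A x) - A x))" using h AX by (simp add: nrm_J S_in X_diff)
        also have "\<dots> \<le> K * nrm (S h (A x) - A x)" using h AX by (intro K X_diff S_in) auto
        also have "\<dots> \<le> K * (e / (2 * K))" using h K d(3)[of h] by (intro mult_left_mono) auto
        finally show ?thesis using h K by simp
      qed
      have eq: "J (S s x) - J (S t x) - (s - t) *\<^sub>R J (S t (A x)) =
          h *\<^sub>R (J (S (s + h) (A x)) - J (S s (A x))) - (J (S (s + h) x) - J (S s x) - h *\<^sub>R J (S s (A x)))"
        using h(3) by (simp add: algebra_simps)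
      have "norm (J (S s x) - J (S t x) - (s - t) *\<^sub>R J (S t (A x))) \<le> h * (e / 2) + (e / 2) * h"
        unfolding eq by (rule order_trans[OF norm_triangle_ineq4 add_mono[OF b2 b1]])
      then show ?thesis using 3 by (simp add: h_def algebra_simps)
    qed
  qed
qed

lemma orbit_energy_derivative:
  assumes x: "x \<in> D" and t: "t \<ge> 0"
  shows "((\<lambda>t. (norm (J (S t x)))\<^sup>2) has_vector_derivative 2 * (J (S t x) \<bullet> J (A (S t x)))) (at t within {0..})"
proof -
  have "((\<lambda>t. J (S t x) \<bullet> J (S t x)) has_vector_derivative J (S t x) \<bullet> J (S t (A x)) + J (S t (A x)) \<bullet> J (S t x)) (at t within {0..})"
    by (rule bounded_bilinear.has_vector_derivative[OF bounded_bilinear_inner];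
        rule orbit_has_vector_derivative[OF x t])
  then show ?thesis by (simp add: dot_square_norm D_invariant[OF t x] inner_commute)
qed

context
  assumes dissipative: "\<And>x. x \<in> D \<Longrightarrow> J x \<bullet> J (A x) \<le> 0"
    and dense: "\<And>x e. x \<in> X \<Longrightarrow> e > 0 \<Longrightarrow> \<exists>y\<in>D. norm (J x - J y) < e"
begin

lemma contraction_D:
  assumes x: "x \<in> D" and st: "0 \<le> s" "s \<le> t"
  shows "norm (J (S t x)) \<le> norm (J (S s x))"
proof -
  let ?f = "\<lambda>t. (norm (J (S t x)))\<^sup>2"
  have "((\<lambda>t. 2 * (J (S t x) \<bullet> J (A (S t x)))) has_integral (?f t - ?f s)) {s..t}"
    using st by (intro fundamental_theorem_of_calculus has_vector_derivative_within_subset[OF orbit_energy_derivative[OF x]]) auto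
  then have "?f t - ?f s \<le> 0"
    by (rule has_integral_le[OF _ has_integral_0]) (use st in \<open>auto intro!: dissipative D_invariant x\<close>)
  then have "?f t \<le> ?f s" by simp
  then show ?thesis by (rule power2_le_imp_le) simp
qed

lemma contraction:
  assumes x: "x \<in> X" and t: "t \<ge> 0"
  shows "norm (J (S t x)) \<le> norm (J x)"
proof (rule field_le_epsilon)
  fix e :: real assume "e > 0"
  obtain M where M: "\<And>z. z \<in> X \<Longrightarrow> nrm (S t z) \<le> M * nrm z" using S_bounded[OF t] by auto
  \<comment> \<open>The approximation enters twice, through the bound M at the fixed time t and
    through the initial value, so (|M| + 1) d = e is needed.\<close>
  define d where "d = e / (\<bar>M\<bar> + 1)"
  have "d > 0" using \<open>e > 0\<close> by (auto simp: d_def)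
  then obtain y where y: "y \<in> D" "norm (J x - J y) < d" using dense[OF x] by blast
  note yX = D_in_X[OF y(1)]
  have "norm (J (S t x) - J (S t y)) = nrm (S t (x - y))"
    using x yX t by (simp add: nrm_J S_in X_diff S_diff J_diff)
  also have "\<dots> \<le> M * nrm (x - y)" by (intro M X_diff x yX)
  also have "\<dots> = M * norm (J x - J y)" using x yX by (simp add: nrm_J X_diff J_diff)
  also have "\<dots> \<le> \<bar>M\<bar> * norm (J x - J y)" by (intro mult_right_mono) auto
  also have "\<dots> \<le> \<bar>M\<bar> * d" using y(2) by (intro mult_left_mono) auto
  finally have 1: "norm (J (S t x) - J (S t y)) \<le> \<bar>M\<bar> * d" .
  have 2: "norm (J (S t y)) \<le> norm (J y)" using contraction_D[OF y(1), of 0 t] t S_0[OF yX] by simp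
  have "norm (J (S t x)) \<le> norm (J x) + (\<bar>M\<bar> * d + d)"
    using norm_triangle_sub[of "J (S t x)" "J (S t y)"] norm_triangle_sub[of "J y" "J x"] norm_minus_commute[of "J x" "J y"] y(2) 1 2
    by linarith
  also have "\<bar>M\<bar> * d + d = (\<bar>M\<bar> + 1) * d" by (simp add: distrib_right)
  also have "\<dots> = e" using abs_ge_zero[of M] unfolding d_def by (intro nonzero_mult_div_cancel_left[of "\<bar>M\<bar> + 1" e, folded times_divide_eq_right]) linarith
  finally show "norm (J (S t x)) \<le> norm (J x) + e" .
qed

end

end

end

subsection \<open>Forced oscillators over one period\<close>

text \<open>The modes are instances with s = sin(j pi \<xi>); the trace of the solution at \<xi> is
  one with frequency 0 and s = -1.\<close>

locale forced_oscillator =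
  fixes z w :: "real \<Rightarrow> complex" and \<omega> :: real and s :: complex
  assumes z: "\<And>t. t \<in> {0..2} \<Longrightarrow> (z has_vector_derivative \<i> * of_real \<omega> * z t - s * w t) (at t within {0..2})"
    and w: "continuous_on {0..2} w" and s: "cmod s \<le> 1"
begin

abbreviation W where "W \<equiv> integral {0..2} (\<lambda>t. cmod (w t))"

lemma continuous_z: "continuous_on {0..2} z"
  using z by (meson continuous_on_eq_continuous_within has_vector_derivative_continuous)

text \<open>Modulation by frequency \<kappa> lowers the frequency of the oscillator to \<omega> -
  \<kappa>. For \<kappa> = \<omega> only the forcing is left; for other \<kappa> the free motion is
  integrated explicitly.\<close>

lemma modulated:
  assumes t: "t \<in> {0..2}"
  shows "((\<lambda>r. cis (- \<kappa> * r) * (\<i> * of_real (\<omega> - \<kappa>) * z r - s * w r)) has_integral (cis (- \<kappa> * t) * z t - z 0)) {0..t}"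
proof -
  have "((\<lambda>r. cis (- \<kappa> * r) * z r) has_vector_derivative cis (- \<kappa> * r) * (\<i> * of_real (\<omega> - \<kappa>) * z r - s * w r)) (at r within {0..t})"
    if r: "r \<in> {0..t}" for r
  proof -
    have "((\<lambda>r. cis (- \<kappa> * r)) has_vector_derivative - \<i> * of_real \<kappa> * cis (- \<kappa> * r)) (at r within {0..2})"
    proof -
      have "((\<lambda>x. exp (- \<i> * of_real \<kappa> * x)) has_field_derivative - \<i> * of_real \<kappa> * exp (- \<i> * of_real \<kappa> * of_real r)) (at (of_real r))"
        by (auto intro!: derivative_eq_intros)
      from has_vector_derivative_real_field[OF this]
      have "((\<lambda>r. exp (- \<i> * of_real \<kappa> * of_real r)) has_vector_derivative - \<i> * of_real \<kappa> * exp (- \<i> * of_real \<kappa> * of_real r)) (at r within {0..2})" .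
      moreover have "cis (- \<kappa> * x) = exp (- \<i> * of_real \<kappa> * of_real x)" for x by (simp add: cis_conv_exp mult_ac)
      ultimately show ?thesis by simp
    qed
    from has_vector_derivative_mult[OF this z[of r]] r t
    have "((\<lambda>r. cis (- \<kappa> * r) * z r) has_vector_derivative cis (- \<kappa> * r) * (\<i> * of_real \<omega> * z r - s * w r)
        + (- \<i> * of_real \<kappa> * cis (- \<kappa> * r)) * z r) (at r within {0..2})" by simp
    then have "((\<lambda>r. cis (- \<kappa> * r) * z r) has_vector_derivative cis (- \<kappa> * r) * (\<i> * of_real (\<omega> - \<kappa>) * z r - s * w r)) (at r within {0..2})"
      by (rule has_vector_derivative_eq_rhs) (simp add: algebra_simps)
    then show ?thesis by (rule has_vector_derivative_within_subset) (use t in auto)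
  qed
  from fundamental_theorem_of_calculus[OF _ this] t show ?thesis by simp
qed

lemma W_nonneg: "W \<ge> 0"
  by (intro integral_nonneg integrable_continuous_interval continuous_intros w) simp

lemma forcing_bound:
  assumes t: "t \<in> {0..2}"
  shows "cmod (integral {0..t} (\<lambda>r. cis (- \<kappa> * r) * (- (s * w r)))) \<le> W"
proof -
  have wt: "continuous_on {0..t} w" by (rule continuous_on_subset[OF w]) (use t in auto)
  have "cmod (integral {0..t} (\<lambda>r. cis (- \<kappa> * r) * (- (s * w r)))) \<le> integral {0..t} (\<lambda>r. cmod (w r))"
  proof (rule integral_norm_bound_integral)
    show "(\<lambda>r. cis (- \<kappa> * r) * (- (s * w r))) integrable_on {0..t}" "(\<lambda>r. cmod (w r)) integrable_on {0..t}"
      by (intro integrable_continuous_interval continuous_intros wt)+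
    show "cmod (cis (- \<kappa> * r) * (- (s * w r))) \<le> cmod (w r)" for r
      using s by (simp add: norm_mult mult_left_le_one_le)
  qed
  also have "\<dots> \<le> W"
    by (rule integral_subset_le) (use t in \<open>auto intro!: integrable_continuous_interval continuous_intros wt w\<close>)
  finally show ?thesis .
qed

lemma own_frequency:
  assumes t: "t \<in> {0..2}"
  shows "cmod (cis (- \<omega> * t) * z t - z 0) \<le> W"
  using integral_unique[OF modulated[OF t, of \<omega>]] forcing_bound[OF t, of \<omega>] by simp

lemma periodic_increment:
  assumes "cis (- \<omega> * 2) = 1"
  shows "cmod (z 2 - z 0) \<le> W"
  using own_frequency[of 2] assms by simp

text \<open>Both frequencies have period 2, so the boundary term is z(2) - z(0), which the forcing
  alone produces. It and the forcing integral contribute W each.\<close>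

lemma off_resonance:
  assumes "cis (- \<omega> * 2) = 1" "cis (- \<kappa> * 2) = 1"
  shows "\<bar>\<omega> - \<kappa>\<bar> * cmod (integral {0..2} (\<lambda>t. cis (- \<kappa> * t) * z t)) \<le> 2 * W"
proof -
  have i1: "(\<lambda>r. \<i> * of_real (\<omega> - \<kappa>) * (cis (- \<kappa> * r) * z r)) integrable_on {0..2}"
    and i2: "(\<lambda>r. cis (- \<kappa> * r) * (- (s * w r))) integrable_on {0..2}"
    by (intro integrable_continuous_interval continuous_intros continuous_z w)+
  have "z 2 - z 0 = integral {0..2} (\<lambda>r. cis (- \<kappa> * r) * (\<i> * of_real (\<omega> - \<kappa>) * z r - s * w r))"
    using integral_unique[OF modulated[of 2 \<kappa>]] assms by simp
  also have "\<dots> = integral {0..2} (\<lambda>r. \<i> * of_real (\<omega> - \<kappa>) * (cis (- \<kappa> * r) * z r) + cis (- \<kappa> * r) * (- (s * w r)))"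
    by (simp add: algebra_simps)
  also have "\<dots> = \<i> * of_real (\<omega> - \<kappa>) * integral {0..2} (\<lambda>r. cis (- \<kappa> * r) * z r) + integral {0..2} (\<lambda>r. cis (- \<kappa> * r) * (- (s * w r)))"
    by (simp only: Henstock_Kurzweil_Integration.integral_add[OF i1 i2] integral_mult_right)
  finally have "\<i> * of_real (\<omega> - \<kappa>) * integral {0..2} (\<lambda>r. cis (- \<kappa> * r) * z r) =
      (z 2 - z 0) - integral {0..2} (\<lambda>r. cis (- \<kappa> * r) * (- (s * w r)))" by simp
  moreover have "cmod (\<i> * of_real (\<omega> - \<kappa>) * integral {0..2} (\<lambda>r. cis (- \<kappa> * r) * z r)) =
      \<bar>\<omega> - \<kappa>\<bar> * cmod (integral {0..2} (\<lambda>r. cis (- \<kappa> * r) * z r))"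
    by (simp only: norm_mult norm_ii mult_1 norm_of_real)
  ultimately have "\<bar>\<omega> - \<kappa>\<bar> * cmod (integral {0..2} (\<lambda>r. cis (- \<kappa> * r) * z r)) =
      cmod ((z 2 - z 0) - integral {0..2} (\<lambda>r. cis (- \<kappa> * r) * (- (s * w r))))" by simp
  also have "\<dots> \<le> W + W"
    by (rule order_trans[OF norm_triangle_ineq4 add_mono[OF periodic_increment[OF assms(1)] forcing_bound]]) simp
  finally show ?thesis by simp
qed

text \<open>Modulated by its own frequency, z stays within W of z(0), so its integral over a period
  of length 2 is close to 2 z(0).\<close>

lemma resonance: "2 * cmod (z 0) \<le> cmod (integral {0..2} (\<lambda>t. cis (- \<omega> * t) * z t)) + 2 * W"
proof -
  have i: "(\<lambda>t. cis (- \<omega> * t) * z t) integrable_on {0..2}"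
    by (intro integrable_continuous_interval continuous_intros continuous_z)
  have "integral {0..2} (\<lambda>t. cis (- \<omega> * t) * z t) - 2 * z 0 = integral {0..2} (\<lambda>t. cis (- \<omega> * t) * z t - z 0)"
    using Henstock_Kurzweil_Integration.integral_diff[OF i integrable_const_ivl[of "z 0" 0 2]] by (simp add: scaleR_conv_of_real)
  also have "cmod \<dots> \<le> integral {0..2} (\<lambda>t::real. W)"
  proof (rule integral_norm_bound_integral)
    show "(\<lambda>t. cis (- \<omega> * t) * z t - z 0) integrable_on {0..2}"
      by (intro integrable_continuous_interval continuous_intros continuous_z)
  qed (use own_frequency in auto)
  finally have "cmod (integral {0..2} (\<lambda>t. cis (- \<omega> * t) * z t) - 2 * z 0) \<le> 2 * W" by simp
  then show ?thesis
    using norm_triangle_sub[of "2 * z 0" "integral {0..2} (\<lambda>t. cis (- \<omega> * t) * z t)"]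
    by (simp add: norm_mult norm_minus_commute)
qed

end

subsection \<open>Observability of the damped string\<close>

lemma complete_subspace_state_space: "complete_subspace state_space coords state_norm"
proof
  fix x :: "nat \<Rightarrow> state" and K
  assume "\<And>n. x n \<in> state_space" "\<And>n. state_norm (x (Suc n) - x n) \<le> K * (1 / 3) ^ n"
  then obtain l where "l \<in> state_space" "(\<lambda>n. state_norm (x n - l)) \<longlonglongrightarrow> 0"
    by (rule state_space_geometric_Cauchy)
  then show "\<exists>l\<in>state_space. (\<lambda>n. state_norm (x n - l)) \<longlonglongrightarrow> 0" by blast
next
  obtain y where "y \<in> domA (1/2)"
    using test_functions_domA[of "1/2" "\<lambda>x. 0" "\<lambda>x. 0"] smooth_ring_smooth[OF smooth_ring.const[of 0]]
    by (force simp: test_functions_def)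
  then show "state_space \<noteq> {}" using domA_subset_state_space by blast
qed (auto simp: state_space_add state_space_scaleR coords_add coords_scaleR state_norm_coords)

lemma trace_at_bound:
  assumes "\<xi> \<in> {0..1}"
  shows "cmod (trace_at \<xi> y) \<le> norm y"
proof -
  have "(cmod (trace_at \<xi> y))\<^sup>2 \<le> (norm (fst y))\<^sup>2"
    using prim_bound[OF rep_L2_square_integrable assms, of "fst y"] by (simp add: trace_at_def norm_L2_rep)
  then have "cmod (trace_at \<xi> y) \<le> norm (fst y)" by (rule power2_le_imp_le) simp
  also have "\<dots> \<le> norm y" by (metis norm_fst_le prod.collapse)
  finally show ?thesis .
qed

lemma v_coeff_bound: "cmod (v_coeff (Suc j) y) \<le> norm y"
proof -
  have "2 * (cmod (v_coeff (Suc j) y))\<^sup>2 \<le> (\<Sum>i<Suc j. 2 * (cmod (v_coeff (Suc i) y))\<^sup>2)"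
    by (rule member_le_sum) auto
  also have "\<dots> \<le> (norm y)\<^sup>2" by (rule v_coeff_bessel)
  finally have "(cmod (v_coeff (Suc j) y))\<^sup>2 \<le> (norm y)\<^sup>2" using zero_le_power2[of "cmod (v_coeff (Suc j) y)"] by linarith
  then show ?thesis by (rule power2_le_imp_le) simp
qed

lemma sum_inverse_squares_le: "(\<Sum>j<m. 1 / (real (Suc j))\<^sup>2) \<le> pi\<^sup>2 / 6"
  using sum_le_suminf[OF summable_inverse_Suc_squares, of "{..<m}"] inverse_squares_sums
  by (simp add: sums_iff add.commute)

text \<open>Turns the reciprocal of the frequency gap into (k + 1)/j, the decay in j that makes the
  sum of the non-resonant terms converge.\<close>

lemma sum_gap_bound:
  assumes "\<sigma> \<in> {1, -1::real}" "\<epsilon> \<in> {1, -1::real}" "j > 0" "k > 0" "\<not> (j = k \<and> \<sigma> = \<epsilon>)"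
  shows "real j \<le> real (k + 1) * \<bar>\<sigma> * real j - \<epsilon> * real k\<bar>"
proof -
  have "\<bar>\<sigma> * real j - \<epsilon> * real k\<bar> = \<bar>real j - real k\<bar> \<or> \<bar>\<sigma> * real j - \<epsilon> * real k\<bar> = real j + real k"
    using assms by auto
  then show ?thesis
  proof
    assume a: "\<bar>\<sigma> * real j - \<epsilon> * real k\<bar> = \<bar>real j - real k\<bar>"
    have "j \<noteq> k" using a assms by auto
    then consider "j < k" | "j > k" by linarith
    then show ?thesis
    proof cases
      case 1
      then have "real (k + 1) * 1 \<le> real (k + 1) * \<bar>real j - real k\<bar>" by (intro mult_left_mono) auto
      moreover have "real j \<le> real (k + 1) * 1" using 1 by simp
      ultimately show ?thesis unfolding a by linarith
    next
      case 2
      then have "real k * 1 \<le> real k * (real j - real k)" by (intro mult_left_mono) auto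
      moreover have "real (k + 1) * (real j - real k) = real k * (real j - real k) + (real j - real k)"
        by (simp add: algebra_simps)
      moreover have "\<bar>real j - real k\<bar> = real j - real k" using 2 by simp
      ultimately show ?thesis unfolding a by linarith
    qed
  next
    assume a: "\<bar>\<sigma> * real j - \<epsilon> * real k\<bar> = real j + real k"
    have "real j \<le> 1 * (real j + real k)" by simp
    also have "\<dots> \<le> real (k + 1) * (real j + real k)" by (intro mult_right_mono) auto
    finally show ?thesis by (simp only: a)
  qed
qed

locale damped_string =
  fixes \<xi> :: real and S :: "real \<Rightarrow> state \<Rightarrow> state"
  assumes \<xi>: "0 < \<xi>" "\<xi> < 1"
    and gen: "generates state_space state_norm (domA \<xi>) (opA \<xi>) S"
begin

sublocale complete_subspace state_space coords state_norm
  by (rule complete_subspace_state_space)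

lemma \<xi>_01: "\<xi> \<in> {0..1}"
  using \<xi> by simp

lemma dissipative: "U \<in> domA \<xi> \<Longrightarrow> coords U \<bullet> coords (opA \<xi> U) \<le> 0"
  by (simp add: domA_dissipative[OF \<xi>])

lemma dense: "x \<in> state_space \<Longrightarrow> e > 0 \<Longrightarrow> \<exists>y\<in>domA \<xi>. norm (coords x - coords y) < e"
  using domA_dense[OF \<xi>] by metis

lemma S_contraction: "x \<in> state_space \<Longrightarrow> t \<ge> 0 \<Longrightarrow> norm (coords (S t x)) \<le> norm (coords x)"
  by (rule contraction[OF gen]) (auto intro: dissipative dense)

lemmas S_invariant = D_invariant[OF gen]
lemmas S_in_X = S_in[OF gen]
lemmas S_plus = S_semigroup[OF gen]
lemmas S_deriv = orbit_has_vector_derivative[OF gen]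

definition w :: "state \<Rightarrow> real \<Rightarrow> complex" where
  "w U t = trace_at \<xi> (coords (opA \<xi> (S t U)))"

lemma domA_X: "U \<in> domA \<xi> \<Longrightarrow> U \<in> state_space"
  using domA_subset_state_space by blast

text \<open>The point value of a velocity is not continuous in the norm of the state. Commuting the
  semigroup with A presents w as a bounded functional of the orbit of A U, so it is continuous in
  time.\<close>

lemma w_eq: "U \<in> domA \<xi> \<Longrightarrow> t \<ge> 0 \<Longrightarrow> w U t = trace_at \<xi> (coords (S t (opA \<xi> U)))"
  by (simp add: w_def S_invariant)

lemma continuous_on_w:
  assumes U: "U \<in> domA \<xi>"
  shows "continuous_on {0..} (w U)"
proof -
  have "continuous_on {0..} (\<lambda>t. trace_at \<xi> (coords (S t (opA \<xi> U))))"
    by (intro bounded_linear.continuous_on[OF bounded_linear_trace_at[OF \<xi>_01]] orbit_continuous[OF gen] opA_in_state_space[OF U])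
  then show ?thesis by (rule continuous_on_eq) (simp add: w_eq[OF U])
qed

lemma energy_identity:
  assumes U: "U \<in> domA \<xi>" and "0 \<le> a" "a \<le> b"
  shows "((\<lambda>t. 2 * (cmod (w U t))\<^sup>2) has_integral ((norm (coords (S a U)))\<^sup>2 - (norm (coords (S b U)))\<^sup>2)) {a..b}"
proof -
  have "((\<lambda>t. 2 * (coords (S t U) \<bullet> coords (opA \<xi> (S t U)))) has_integral ((norm (coords (S b U)))\<^sup>2 - (norm (coords (S a U)))\<^sup>2)) {a..b}"
    using assms by (intro fundamental_theorem_of_calculus has_vector_derivative_within_subset[OF orbit_energy_derivative[OF gen U]]) auto
  from has_integral_neg[OF this]
  have "((\<lambda>t. - (2 * (coords (S t U) \<bullet> coords (opA \<xi> (S t U))))) has_integral ((norm (coords (S a U)))\<^sup>2 - (norm (coords (S b U)))\<^sup>2)) {a..b}" by simp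
  then show ?thesis
    by (rule has_integral_eq[rotated]) (use assms in \<open>auto simp: w_def domA_dissipative[OF \<xi> S_invariant(1)[OF _ U]]\<close>)
qed

lemma energy_decreasing:
  assumes U: "U \<in> state_space" and "0 \<le> a" "a \<le> b"
  shows "norm (coords (S b U)) \<le> norm (coords (S a U))"
  using S_contraction[OF S_in_X[OF assms(2) U], of "b - a"] S_plus[of "b - a" a U] assms by simp

text \<open>The combinations v_j + i u_j and v_j - i u_j diagonalise the free string: the pair of
  first order equations for u_j and v_j decouples into frequencies j pi and -j pi.\<close>

definition mode :: "real \<Rightarrow> nat \<Rightarrow> state \<Rightarrow> complex" where
  "mode \<sigma> j U = v_coeff j (coords U) + of_real \<sigma> * \<i> * u_coeff j (coords U)"

lemma mode_oscillator:
  assumes U: "U \<in> domA \<xi>" and \<sigma>: "\<sigma> \<in> {1, -1}"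
  shows "forced_oscillator (\<lambda>t. mode \<sigma> j (S t U)) (w U) (\<sigma> * real j * pi) (sn j \<xi>)"
proof
  show "continuous_on {0..2} (w U)" by (rule continuous_on_subset[OF continuous_on_w[OF U]]) auto
  show "cmod (sn j \<xi>) \<le> 1" by (rule norm_sn)
  fix t :: real assume t: "t \<in> {0..2}"
  have "((\<lambda>t. coords (S t U)) has_vector_derivative coords (S t (opA \<xi> U))) (at t within {0..2})"
    using t by (intro has_vector_derivative_within_subset[OF S_deriv[OF U]]) auto
  note d = bounded_linear.has_vector_derivative[OF bounded_linear_v_coeff this] bounded_linear.has_vector_derivative[OF bounded_linear_u_coeff this]
  have "((\<lambda>t. mode \<sigma> j (S t U)) has_vector_derivative v_coeff j (coords (S t (opA \<xi> U))) + of_real \<sigma> * \<i> * u_coeff j (coords (S t (opA \<xi> U)))) (at t within {0..2})"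
    unfolding mode_def by (intro has_vector_derivative_add has_vector_derivative_mult_right d)
  moreover have "v_coeff j (coords (S t (opA \<xi> U))) + of_real \<sigma> * \<i> * u_coeff j (coords (S t (opA \<xi> U))) =
      \<i> * of_real (\<sigma> * real j * pi) * mode \<sigma> j (S t U) - sn j \<xi> * w U t"
  proof -
    have tD: "S t U \<in> domA \<xi>" and e: "S t (opA \<xi> U) = opA \<xi> (S t U)" using S_invariant[OF _ U, of t] t by auto
    have "of_real \<sigma> * of_real \<sigma> = (1::complex)" using \<sigma> by auto
    then have "\<i> * of_real (\<sigma> * real j * pi) * (of_real \<sigma> * \<i> * u_coeff j (coords (S t U))) = - of_real (real j * pi) * u_coeff j (coords (S t U))"
      by (simp add: algebra_simps)
    then show ?thesis
      unfolding e v_coeff_opA[OF \<xi> tD] u_coeff_opA[OF \<xi> tD] w_def mode_def by (simp add: algebra_simps)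
  qed
  ultimately show "((\<lambda>t. mode \<sigma> j (S t U)) has_vector_derivative \<i> * of_real (\<sigma> * real j * pi) * mode \<sigma> j (S t U) - sn j \<xi> * w U t) (at t within {0..2})"
    by simp
qed

text \<open>The time derivative of u(\<xi>, t) is w. Read as an oscillator of frequency 0, this lets
  \<open>off_resonance\<close> bound the modulated integral of the trace as well.\<close>

lemma trace_oscillator:
  assumes U: "U \<in> domA \<xi>"
  shows "forced_oscillator (\<lambda>t. trace_at \<xi> (coords (S t U))) (w U) 0 (-1)"
proof
  show "continuous_on {0..2} (w U)" by (rule continuous_on_subset[OF continuous_on_w[OF U]]) auto
  fix t :: real assume t: "t \<in> {0..2}"
  have "((\<lambda>t. coords (S t U)) has_vector_derivative coords (S t (opA \<xi> U))) (at t within {0..2})"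
    using t by (intro has_vector_derivative_within_subset[OF S_deriv[OF U]]) auto
  from bounded_linear.has_vector_derivative[OF bounded_linear_trace_at[OF \<xi>_01] this]
  show "((\<lambda>t. trace_at \<xi> (coords (S t U))) has_vector_derivative \<i> * of_real 0 * trace_at \<xi> (coords (S t U)) - - 1 * w U t) (at t within {0..2})"
    using t by (simp add: w_eq[OF U])
qed simp

text \<open>Together with contractivity for A U this is uniform in time, and after division by j pi
  it dominates the sine series of the trace by a multiple of the sum of 1/j^2.\<close>

lemma u_coeff_decay:
  assumes U: "U \<in> domA \<xi>"
  shows "cmod (u_coeff (Suc j) (coords U)) \<le> 2 * norm (coords (opA \<xi> U)) / (real (Suc j) * pi)"
proof -
  let ?n = "of_real (real (Suc j) * pi) :: complex"
  have "?n * u_coeff (Suc j) (coords U) = - v_coeff (Suc j) (coords (opA \<xi> U)) - sn (Suc j) \<xi> * trace_at \<xi> (coords (opA \<xi> U))"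
    by (simp only: v_coeff_opA[OF \<xi> U, of "Suc j"]) simp
  then have "(real (Suc j) * pi) * cmod (u_coeff (Suc j) (coords U)) =
      cmod (- v_coeff (Suc j) (coords (opA \<xi> U)) - sn (Suc j) \<xi> * trace_at \<xi> (coords (opA \<xi> U)))"
    by (metis abs_of_nonneg norm_mult norm_of_real mult_nonneg_nonneg of_nat_0_le_iff pi_ge_zero)
  also have "\<dots> \<le> cmod (v_coeff (Suc j) (coords (opA \<xi> U))) + cmod (sn (Suc j) \<xi>) * cmod (trace_at \<xi> (coords (opA \<xi> U)))"
    using norm_triangle_ineq4[of "- v_coeff (Suc j) (coords (opA \<xi> U))" "sn (Suc j) \<xi> * trace_at \<xi> (coords (opA \<xi> U))"]
    by (simp add: norm_mult)
  also have "\<dots> \<le> norm (coords (opA \<xi> U)) + 1 * norm (coords (opA \<xi> U))"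
    by (intro add_mono mult_mono v_coeff_bound norm_sn trace_at_bound[OF \<xi>_01]) auto
  finally show ?thesis by (simp add: field_simps del: of_nat_Suc)
qed

lemma cis_period: "cis (- (real_of_int m * pi) * 2) = 1"
proof -
  have "- (real_of_int m * pi) * 2 = 2 * pi * real_of_int (- m)" by simp
  then show ?thesis by (simp only: cis_multiple_2pi Ints_of_int)
qed

text \<open>Integrating the sine series of the trace against the exponential of frequency \<open>\<epsilon> k \<pi>\<close>, only one term resonates.\<close>

lemma mode_observable:
  assumes U: "U \<in> domA \<xi>" and \<epsilon>: "\<epsilon> \<in> {1, -1}" and k: "k > 0"
  shows "cmod (sn k \<xi>) * cmod (mode \<epsilon> k U) \<le> 4 * (real k + 2)\<^sup>2 * integral {0..2} (\<lambda>t. cmod (w U t))"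
proof -
  define W where "W = integral {0..2} (\<lambda>t. cmod (w U t))"
  define \<kappa> where "\<kappa> = \<epsilon> * real k * pi"
  define m where "m = (\<lambda>\<sigma> j. integral {0..2} (\<lambda>t. cis (- \<kappa> * t) * mode \<sigma> j (S t U)))"
  have osc: "forced_oscillator (\<lambda>t. mode \<sigma> j (S t U)) (w U) (\<sigma> * real j * pi) (sn j \<xi>)" if "\<sigma> \<in> {1,-1}" for \<sigma> j
    by (rule mode_oscillator[OF U that])
  have W0: "W \<ge> 0" unfolding W_def by (rule forced_oscillator.W_nonneg[OF trace_oscillator[OF U]])
  have per: "cis (- (\<sigma> * real j * pi) * 2) = 1" if "\<sigma> \<in> {1,-1}" for \<sigma> j
    using cis_period[of "int j"] cis_period[of "- int j"] that by auto
  have S0: "S 0 U = U" by (rule S_0[OF gen domA_X[OF U]])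
  have cz: "continuous_on {0..2} (\<lambda>t. mode \<sigma> j (S t U))" if "\<sigma> \<in> {1,-1}" for \<sigma> j
    by (rule forced_oscillator.continuous_z[OF osc[OF that]])
  have off: "cmod (m \<sigma> j) \<le> 2 * W * (real k + 1) / (pi * real j)"
    if \<sigma>: "\<sigma> \<in> {1,-1}" and j: "j > 0" and ne: "\<not> (j = k \<and> \<sigma> = \<epsilon>)" for \<sigma> j
  proof -
    have "\<bar>\<sigma> * real j * pi - \<kappa>\<bar> * cmod (m \<sigma> j) \<le> 2 * W"
      unfolding m_def W_def
      by (rule forced_oscillator.off_resonance[OF osc[OF \<sigma>] per[OF \<sigma>]]) (simp only: \<kappa>_def per[OF \<epsilon>])
    also have "\<bar>\<sigma> * real j * pi - \<kappa>\<bar> = pi * \<bar>\<sigma> * real j - \<epsilon> * real k\<bar>"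
    proof -
      have "\<sigma> * real j * pi - \<kappa> = pi * (\<sigma> * real j - \<epsilon> * real k)" by (simp add: \<kappa>_def algebra_simps)
      then show ?thesis by (simp only: abs_mult) simp
    qed
    finally have 1: "pi * \<bar>\<sigma> * real j - \<epsilon> * real k\<bar> * cmod (m \<sigma> j) \<le> 2 * W" .
    have "pi * real j * cmod (m \<sigma> j) \<le> pi * (real (k + 1) * \<bar>\<sigma> * real j - \<epsilon> * real k\<bar>) * cmod (m \<sigma> j)"
      by (intro mult_right_mono mult_left_mono sum_gap_bound \<sigma> \<epsilon> j k ne) auto
    also have "\<dots> = real (k + 1) * (pi * \<bar>\<sigma> * real j - \<epsilon> * real k\<bar> * cmod (m \<sigma> j))" by (simp only: mult_ac)
    also have "\<dots> \<le> real (k + 1) * (2 * W)" by (intro mult_left_mono 1) auto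
    finally have "cmod (m \<sigma> j) * (pi * real j) \<le> 2 * W * (real k + 1)" by (simp add: algebra_simps)
    then show ?thesis using j by (simp add: pos_le_divide_eq)
  qed
  \<comment> \<open>The integrated series term: 2 u_j equals the difference of the two modes divided
    by i.\<close>
  define c where "c = (\<lambda>j. sn j \<xi> / (of_real (real j * pi) * \<i>) * (m 1 j - m (-1) j))"
  define T where "T = integral {0..2} (\<lambda>t. cis (- \<kappa> * t) * trace_at \<xi> (coords (S t U)))"
  have T: "(\<lambda>j. c (Suc j)) sums T"
  proof -
    let ?t = "\<lambda>j t. cis (- \<kappa> * t) * (sn (Suc j) \<xi> / (of_real (real (Suc j) * pi) * \<i>) * (mode 1 (Suc j) (S t U) - mode (-1) (Suc j) (S t U)))"
    define M where "M = norm (coords (opA \<xi> U))"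
    have eq: "?t j t = cis (- \<kappa> * t) * (2 * (u_coeff (Suc j) (coords (S t U)) / of_real (real (Suc j) * pi)) * sn (Suc j) \<xi>)" for j t
      by (simp add: mode_def field_simps del: of_nat_Suc)
    have bound: "cmod (?t j t) \<le> 4 * M * (1 / (real (Suc j))\<^sup>2)" if t: "t \<in> {0..2}" for j t
    proof -
      have t0: "t \<ge> 0" using t by simp
      have tD: "S t U \<in> domA \<xi>" by (rule S_invariant(1)[OF t0 U])
      have Mt: "norm (coords (opA \<xi> (S t U))) \<le> M"
        unfolding S_invariant(2)[OF t0 U] M_def by (rule S_contraction[OF opA_in_state_space[OF U] t0])
      let ?n = "real (Suc j)"
      have "cmod (?t j t) = 2 * cmod (u_coeff (Suc j) (coords (S t U))) / (?n * pi) * cmod (sn (Suc j) \<xi>)"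
        unfolding eq norm_mult norm_divide norm_of_real norm_cis by simp
      also have "\<dots> \<le> 2 * cmod (u_coeff (Suc j) (coords (S t U))) / (?n * pi) * 1"
        by (intro mult_left_mono norm_sn) auto
      also have "\<dots> \<le> 2 * (2 * M / (?n * pi)) / (?n * pi) * 1"
        using u_coeff_decay[OF tD, of j] Mt
        by (intro mult_right_mono divide_right_mono mult_left_mono order_trans[OF u_coeff_decay[OF tD, of j]]) auto
      also have "\<dots> = 4 * M / (?n\<^sup>2 * pi\<^sup>2)" by (simp add: power2_eq_square field_simps)
      also have "\<dots> \<le> 4 * M / (?n\<^sup>2 * 1)"
        using pi_gt3 by (intro divide_left_mono mult_left_mono mult_pos_pos) (auto simp: M_def one_le_power)
      finally show ?thesis by simp
    qed
    \<comment> \<open>Uniform convergence in time permits termwise integration over the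
      period.\<close>
    have ul: "uniform_limit {0..2} (\<lambda>n t. \<Sum>j<n. ?t j t) (\<lambda>t. \<Sum>j. ?t j t) sequentially"
      by (rule Weierstrass_m_test[OF bound summable_mult[OF summable_inverse_Suc_squares]])
    have lim: "(\<Sum>j. ?t j t) = cis (- \<kappa> * t) * trace_at \<xi> (coords (S t U))" if t: "t \<in> {0..2}" for t
    proof -
      have "(\<lambda>j. ?t j t) sums (cis (- \<kappa> * t) * trace_at \<xi> (coords (S t U)))"
        unfolding eq using t U by (intro sums_mult trace_at_series S_in_X domA_X \<xi>_01) auto
      then show ?thesis by (rule sums_unique[symmetric])
    qed
    have ct: "continuous_on {0..2} (?t j)" for j
      by (intro continuous_intros cz) auto
    obtain I L where IL: "\<And>n. ((\<lambda>t. \<Sum>j<n. ?t j t) has_integral I n) {0..2}"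
      "((\<lambda>t. \<Sum>j. ?t j t) has_integral L) {0..2}" "I \<longlonglongrightarrow> L"
      by (rule uniform_limit_integral[OF ul]) (intro continuous_intros cz, auto)
    have "(\<lambda>n. integral {0..2} (\<lambda>t. \<Sum>j<n. ?t j t)) \<longlonglongrightarrow> integral {0..2} (\<lambda>t. \<Sum>j. ?t j t)"
      unfolding integral_unique[OF IL(1)] integral_unique[OF IL(2)] by (rule IL(3))
    also have "(\<lambda>n. integral {0..2} (\<lambda>t. \<Sum>j<n. ?t j t)) = (\<lambda>n. \<Sum>j<n. c (Suc j))"
    proof
      fix n
      have "integral {0..2} (\<lambda>t. \<Sum>j<n. ?t j t) = (\<Sum>j<n. integral {0..2} (?t j))"
        by (intro Henstock_Kurzweil_Integration.integral_sum integrable_continuous_interval ct) auto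
      also have "\<dots> = (\<Sum>j<n. c (Suc j))"
      proof (rule sum.cong[OF refl])
        fix j
        let ?a = "sn (Suc j) \<xi> / (of_real (real (Suc j) * pi) * \<i>)"
        have i: "(\<lambda>t. cis (- \<kappa> * t) * mode \<sigma> (Suc j) (S t U)) integrable_on {0..2}" if "\<sigma> \<in> {1,-1}" for \<sigma>
          by (intro integrable_continuous_interval continuous_intros cz that)
        have "integral {0..2} (?t j) = integral {0..2} (\<lambda>t. ?a * (cis (- \<kappa> * t) * mode 1 (Suc j) (S t U) - cis (- \<kappa> * t) * mode (-1) (Suc j) (S t U)))"
          by (rule Henstock_Kurzweil_Integration.integral_cong) (simp add: right_diff_distrib mult.left_commute)
        also have "\<dots> = ?a * integral {0..2} (\<lambda>t. cis (- \<kappa> * t) * mode 1 (Suc j) (S t U) - cis (- \<kappa> * t) * mode (-1) (Suc j) (S t U))"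
          by (rule integral_mult_right)
        also have "\<dots> = c (Suc j)"
          using i[of 1] i[of "-1"] by (simp only: Henstock_Kurzweil_Integration.integral_diff insertI1 insertI2 c_def m_def)
        finally show "integral {0..2} (?t j) = c (Suc j)" .
      qed
      finally show "integral {0..2} (\<lambda>t. \<Sum>j<n. ?t j t) = (\<Sum>j<n. c (Suc j))" .
    qed
    also have "integral {0..2} (\<lambda>t. \<Sum>j. ?t j t) = T"
      unfolding T_def by (rule Henstock_Kurzweil_Integration.integral_cong) (rule lim)
    finally show ?thesis by (simp only: sums_def)
  qed
  \<comment> \<open>The resonant part of the term k; the sign \<epsilon> appears because the mode
    for -1 is subtracted in c.\<close>
  define R where "R = of_real \<epsilon> * sn k \<xi> / (of_real (real k * pi) * \<i>) * m \<epsilon> k"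
  define r where "r = (\<lambda>j. c j - (if j = k then R else 0))"
  have single: "(\<lambda>j. if Suc j = k then R else 0) sums R"
  proof -
    have "(\<lambda>j. if j = k - 1 then R else 0) sums R" by (rule sums_single)
    moreover have "j = k - 1 \<longleftrightarrow> Suc j = k" for j using k by auto
    ultimately show ?thesis by (simp only:)
  qed
  have rs: "(\<lambda>j. r (Suc j)) sums (T - R)" unfolding r_def by (rule sums_diff[OF T single])
  have rb: "cmod (r (Suc j)) \<le> 4 * W * (real k + 1) / pi\<^sup>2 * (1 / (real (Suc j))\<^sup>2)" for j
  proof -
    define n where "n = Suc j"
    define a where "a = sn n \<xi> / (of_real (real n * pi) * \<i>)"
    define b where "b = 2 * W * (real k + 1) / (pi * real n)"
    have b0: "b \<ge> 0" using W0 by (auto simp: b_def)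
    have a: "cmod a \<le> 1 / (real n * pi)"
      using norm_sn[of n \<xi>] by (simp add: a_def norm_divide norm_mult divide_right_mono)
    \<comment> \<open>Removing R replaces the resonant integral by 0. At n = k the other sign
      remains and is off resonance too.\<close>
    define x1 x2 where "x1 = (if n = k \<and> \<epsilon> = 1 then 0 else m 1 n)" and "x2 = (if n = k \<and> \<epsilon> = -1 then 0 else m (-1) n)"
    have "cmod x1 \<le> b" "cmod x2 \<le> b"
      using off[of 1 n] off[of "-1" n] b0 by (auto simp: x1_def x2_def b_def n_def)
    moreover have "r n = a * (x1 - x2)"
      using \<epsilon> by (auto simp: r_def c_def R_def x1_def x2_def a_def diff_divide_distrib right_diff_distrib)
    ultimately have "cmod (r n) \<le> cmod a * (b + b)"
      using norm_triangle_ineq4[of x1 x2] by (simp only: norm_mult) (intro mult_left_mono, auto)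
    also have "\<dots> \<le> 1 / (real n * pi) * (b + b)" using b0 by (intro mult_right_mono a) auto
    also have "\<dots> = 4 * W * (real k + 1) / pi\<^sup>2 * (1 / (real n)\<^sup>2)"
      by (simp add: b_def power2_eq_square n_def field_simps del: of_nat_Suc)
    finally show ?thesis by (simp only: n_def)
  qed
  have TR: "cmod (T - R) \<le> W * (real k + 1)"
  proof -
    have sb: "(\<lambda>j. 4 * W * (real k + 1) / pi\<^sup>2 * (1 / (real (Suc j))\<^sup>2)) sums (4 * W * (real k + 1) / pi\<^sup>2 * (pi\<^sup>2 / 6))"
      by (intro sums_mult) (use inverse_squares_sums in \<open>simp add: add.commute\<close>)
    have "cmod (T - R) \<le> (\<Sum>j. 4 * W * (real k + 1) / pi\<^sup>2 * (1 / (real (Suc j))\<^sup>2))"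
      unfolding sums_unique[OF rs] by (rule norm_suminf_le[OF rb sums_summable[OF sb]])
    also have "\<dots> = 4 * W * (real k + 1) / pi\<^sup>2 * (pi\<^sup>2 / 6)" by (rule sums_unique[OF sb, symmetric])
    also have "\<dots> = 2/3 * (W * (real k + 1))" by simp
    also have "\<dots> \<le> 1 * (W * (real k + 1))" using W0 by (intro mult_right_mono) auto
    finally show ?thesis by simp
  qed
  \<comment> \<open>The frequency 0 of the trace is at distance k pi \<ge> 2 from the modulation
    frequency.\<close>
  have Tb: "cmod T \<le> W"
  proof -
    have h1: "\<bar>0 - \<kappa>\<bar> * cmod T \<le> 2 * W"
      unfolding T_def W_def
      by (rule forced_oscillator.off_resonance[OF trace_oscillator[OF U]]) (simp, simp only: \<kappa>_def per[OF \<epsilon>])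
    have h2: "2 \<le> \<bar>0 - \<kappa>\<bar>"
    proof -
      have "\<bar>0 - \<kappa>\<bar> = real k * pi" using \<epsilon> by (auto simp: \<kappa>_def abs_mult)
      moreover have "1 * 2 \<le> real k * pi" using k pi_gt3 by (intro mult_mono) auto
      ultimately show ?thesis by simp
    qed
    have "2 * cmod T \<le> 2 * W" by (rule order_trans[OF mult_right_mono[OF h2 norm_ge_zero] h1])
    then show ?thesis by simp
  qed
  have "cmod R \<le> cmod T + cmod (T - R)" using norm_triangle_ineq4[of T "T - R"] by simp
  then have Rb: "cmod R \<le> W * (real k + 2)" using Tb TR by (simp add: algebra_simps)
  have "cmod R = cmod (sn k \<xi>) * cmod (m \<epsilon> k) / (real k * pi)"
    using \<epsilon> by (auto simp: R_def norm_mult norm_divide)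
  then have sm: "cmod (sn k \<xi>) * cmod (m \<epsilon> k) \<le> W * (real k + 2) * (real k * pi)"
    using Rb k by (simp add: divide_le_eq)
  have res: "2 * cmod (mode \<epsilon> k U) \<le> cmod (m \<epsilon> k) + 2 * W"
    using forced_oscillator.resonance[OF osc[OF \<epsilon>, of k]] by (simp add: m_def W_def \<kappa>_def S0)
  have "2 * (cmod (sn k \<xi>) * cmod (mode \<epsilon> k U)) = cmod (sn k \<xi>) * (2 * cmod (mode \<epsilon> k U))" by simp
  also have "\<dots> \<le> cmod (sn k \<xi>) * (cmod (m \<epsilon> k) + 2 * W)" by (intro mult_left_mono res) auto
  also have "\<dots> = cmod (sn k \<xi>) * cmod (m \<epsilon> k) + cmod (sn k \<xi>) * (2 * W)" by (rule distrib_left)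
  also have "\<dots> \<le> W * (real k + 2) * (real k * pi) + 1 * (2 * W)"
    using W0 by (intro add_mono sm mult_right_mono norm_sn) auto
  \<comment> \<open>Crude bounds k pi \<le> 4 (k + 2) and 1 \<le> (k + 2)^2: the total of 6
    multiples of W (k + 2)^2 is at most 8, and 4 after halving.\<close>
  also have "\<dots> \<le> W * (real k + 2) * ((real k + 2) * 4) + (2 * W) * ((real k + 2) * (real k + 2))"
  proof (rule add_mono)
    show "W * (real k + 2) * (real k * pi) \<le> W * (real k + 2) * ((real k + 2) * 4)"
      using W0 pi_less_4 by (intro mult_left_mono mult_mono) auto
    have "1 * 1 \<le> (real k + 2) * (real k + 2)" by (intro mult_mono) auto
    then show "1 * (2 * W) \<le> 2 * W * ((real k + 2) * (real k + 2))"
      using W0 mult_left_mono[of 1 "(real k + 2) * (real k + 2)" "2 * W"] by simp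
  qed
  also have "\<dots> \<le> 2 * (4 * (real k + 2)\<^sup>2 * W)" using W0 by (simp add: power2_eq_square algebra_simps)
  finally show ?thesis by (simp add: W_def)
qed

end

section \<open>From single modes to the energy balance over one time step\<close>

context damped_string
begin

lemma continuous_on_w_interval: "U \<in> domA \<xi> \<Longrightarrow> 0 \<le> a \<Longrightarrow> continuous_on {a..b} (w U)"
  by (rule continuous_on_subset[OF continuous_on_w]) auto

lemma w_L1_bound:
  assumes U: "U \<in> domA \<xi>"
  shows "(integral {0..2} (\<lambda>t. cmod (w U t)))\<^sup>2 \<le> (norm (coords U))\<^sup>2 - (norm (coords (S 2 U)))\<^sup>2"
proof -
  note cw = continuous_on_w_interval[OF U order_refl, of 2]
  define I where "I = integral {0..2} (\<lambda>t. cmod (w U t))"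
  define Q where "Q = integral {0..2} (\<lambda>t. (cmod (w U t))\<^sup>2)"
  have i1: "((\<lambda>t. cmod (w U t)) has_integral I) {0..2}" and i2: "((\<lambda>t. (cmod (w U t))\<^sup>2) has_integral Q) {0..2}"
    unfolding I_def Q_def by (intro integrable_integral integrable_continuous_interval continuous_intros cw)+
  have i3: "((\<lambda>t::real. (I / 2)\<^sup>2) has_integral (2 * (I / 2)\<^sup>2)) {0..2}"
    using has_integral_const_real[of "(I / 2)\<^sup>2" 0 2] by simp
  \<comment> \<open>Cauchy-Schwarz as nonnegativity of a variance: I/2 is the mean of |w|. The
    result I^2 \<le> 2 Q fits, because 2 Q is exactly the dissipated energy.\<close>
  have "((\<lambda>t. (cmod (w U t))\<^sup>2 - I * cmod (w U t) + (I / 2)\<^sup>2) has_integral (Q - I * I + 2 * (I / 2)\<^sup>2)) {0..2}"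
    by (intro has_integral_add has_integral_diff has_integral_mult_right i1 i2 i3)
  moreover have "(cmod (w U t))\<^sup>2 - I * cmod (w U t) + (I / 2)\<^sup>2 = (cmod (w U t) - I / 2)\<^sup>2" for t
    by (simp add: power2_diff)
  ultimately have "((\<lambda>t. (cmod (w U t) - I / 2)\<^sup>2) has_integral (Q - I * I + 2 * (I / 2)\<^sup>2)) {0..2}" by simp
  then have "0 \<le> Q - I * I + 2 * (I / 2)\<^sup>2" by (rule has_integral_nonneg) simp
  then have "I\<^sup>2 \<le> 2 * Q" by (simp add: power2_eq_square)
  also have "2 * Q = (norm (coords U))\<^sup>2 - (norm (coords (S 2 U)))\<^sup>2"
    using has_integral_unique[OF has_integral_mult_right[OF i2, of 2] energy_identity[OF U, of 0 2]]
      S_0[OF gen domA_X[OF U]] by simp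
  finally show ?thesis by (simp add: I_def)
qed

text \<open>By the parallelogram identity the two modes of index k carry together 2 |u_k|^2 + 2
  |v_k|^2; each contributes 16 (k + 2)^4 times the squared L^1 norm of w.\<close>

lemma coeffs_observable:
  assumes U: "U \<in> domA \<xi>" and k: "k > 0"
  shows "(cmod (sn k \<xi>))\<^sup>2 * (2 * (cmod (u_coeff k (coords U)))\<^sup>2 + 2 * (cmod (v_coeff k (coords U)))\<^sup>2)
    \<le> 32 * (real k + 2) ^ 4 * ((norm (coords U))\<^sup>2 - (norm (coords (S 2 U)))\<^sup>2)"
proof -
  define W where "W = integral {0..2} (\<lambda>t. cmod (w U t))"
  have one: "(cmod (sn k \<xi>))\<^sup>2 * (cmod (mode \<epsilon> k U))\<^sup>2 \<le> 16 * (real k + 2) ^ 4 * W\<^sup>2" if "\<epsilon> \<in> {1,-1}" for \<epsilon>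
  proof -
    have "(cmod (sn k \<xi>) * cmod (mode \<epsilon> k U))\<^sup>2 \<le> (4 * (real k + 2)\<^sup>2 * W)\<^sup>2"
      unfolding W_def by (intro power_mono mode_observable U that k) simp
    also have "\<dots> = 16 * (real k + 2) ^ 4 * W\<^sup>2"
      by (simp add: power_mult_distrib flip: power_mult)
    finally show ?thesis by (simp add: power_mult_distrib)
  qed
  have "(cmod (mode 1 k U))\<^sup>2 + (cmod (mode (-1) k U))\<^sup>2 = 2 * (cmod (u_coeff k (coords U)))\<^sup>2 + 2 * (cmod (v_coeff k (coords U)))\<^sup>2"
    unfolding mode_def cmod_power2 by (simp add: power2_eq_square algebra_simps)
  then have "(cmod (sn k \<xi>))\<^sup>2 * (2 * (cmod (u_coeff k (coords U)))\<^sup>2 + 2 * (cmod (v_coeff k (coords U)))\<^sup>2)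
      \<le> 32 * (real k + 2) ^ 4 * W\<^sup>2"
    using one[of 1] one[of "-1"] by (simp add: distrib_left flip: \<open>(cmod (mode 1 k U))\<^sup>2 + _ = _\<close>)
  also have "\<dots> \<le> 32 * (real k + 2) ^ 4 * ((norm (coords U))\<^sup>2 - (norm (coords (S 2 U)))\<^sup>2)"
    unfolding W_def by (intro mult_left_mono w_L1_bound U) auto
  finally show ?thesis .
qed

text \<open>Unlike in \<open>u_coeff_decay\<close>, the trace is kept as a separate term: it is the
  part that does not gain from summability over k and is later absorbed by the dissipation.\<close>

lemma coeffs_decay:
  assumes U: "U \<in> domA \<xi>" and k: "k > 0"
  shows "2 * (cmod (u_coeff k (coords U)))\<^sup>2 + 2 * (cmod (v_coeff k (coords U)))\<^sup>2 \<le>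
    (2 * (cmod (u_coeff k (coords (opA \<xi> U))))\<^sup>2 + 4 * (cmod (v_coeff k (coords (opA \<xi> U))))\<^sup>2
      + 4 * (cmod (trace_at \<xi> (coords (opA \<xi> U))))\<^sup>2) / (real k * pi)\<^sup>2"
proof -
  define n where "n = real k * pi"
  have n: "n > 0" using k by (simp add: n_def)
  define a b a' b' T where "a = u_coeff k (coords U)" and "b = v_coeff k (coords U)"
    and "a' = u_coeff k (coords (opA \<xi> U))" and "b' = v_coeff k (coords (opA \<xi> U))" and "T = trace_at \<xi> (coords (opA \<xi> U))"
  have "a' = of_real n * b" unfolding a'_def b_def n_def by (rule u_coeff_opA[OF \<xi> U])
  then have b: "(cmod b)\<^sup>2 * n\<^sup>2 = (cmod a')\<^sup>2" by (simp add: norm_mult power_mult_distrib mult.commute)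
  have "b' = - of_real n * a - sn k \<xi> * T" unfolding a_def b'_def T_def n_def by (rule v_coeff_opA[OF \<xi> U])
  then have "of_real n * a = - b' - sn k \<xi> * T" by simp
  then have "cmod (of_real n * a) \<le> cmod b' + cmod (sn k \<xi>) * cmod T"
    using norm_triangle_ineq4[of "- b'" "sn k \<xi> * T"] by (simp add: norm_mult)
  also have "\<dots> \<le> cmod b' + 1 * cmod T" by (intro add_left_mono mult_right_mono norm_sn) auto
  finally have "n * cmod a \<le> cmod b' + cmod T" using n by (simp add: norm_mult)
  then have "(n * cmod a)\<^sup>2 \<le> (cmod b' + cmod T)\<^sup>2" using n by (intro power_mono) auto
  also have "\<dots> \<le> 2 * (cmod b')\<^sup>2 + 2 * (cmod T)\<^sup>2"
    using sum_squares_bound[of "cmod b'" "cmod T"] by (simp add: power2_sum)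
  finally have "(2 * (cmod a)\<^sup>2 + 2 * (cmod b)\<^sup>2) * n\<^sup>2 \<le> 2 * (cmod a')\<^sup>2 + 4 * (cmod b')\<^sup>2 + 4 * (cmod T)\<^sup>2"
    using b by (simp add: power_mult_distrib algebra_simps)
  then have "2 * (cmod a)\<^sup>2 + 2 * (cmod b)\<^sup>2 \<le> (2 * (cmod a')\<^sup>2 + 4 * (cmod b')\<^sup>2 + 4 * (cmod T)\<^sup>2) / n\<^sup>2"
    using n by (simp add: pos_le_divide_eq)
  then show ?thesis by (simp only: a_def b_def a'_def b'_def T_def n_def)
qed

text \<open>Modes of index at most N are observed from a time \<tau> in [0,1] on, during one period;
  higher ones are controlled by A U. Since \<tau> + 2 \<le> 3, all the dissipation used happens
  before time 3.\<close>

lemma observability_with_loss: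
  assumes U: "U \<in> domA \<xi>" and c: "c > 0" and K: "K > 0" and N: "N \<ge> 1"
    and dio: "\<And>k. k > 0 \<Longrightarrow> c * exp (- K * real k) \<le> (cmod (sn k \<xi>))\<^sup>2"
  shows "(norm (coords (S 3 U)))\<^sup>2 \<le> (32 / c * exp 10 + 1) * exp ((K + 5) * real N) * ((norm (coords U))\<^sup>2 - (norm (coords (S 3 U)))\<^sup>2)
    + 3 / (real N)\<^sup>2 * (norm (coords (opA \<xi> U)))\<^sup>2"
proof -
  define D where "D = (norm (coords U))\<^sup>2 - (norm (coords (S 3 U)))\<^sup>2"
  note UX = domA_X[OF U]
  have S0: "S 0 U = U" by (rule S_0[OF gen UX])
  have dec: "(norm (coords (S b U)))\<^sup>2 \<le> (norm (coords (S a U)))\<^sup>2" if "0 \<le> a" "a \<le> b" for a b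
    by (intro power_mono energy_decreasing UX that) simp
  \<comment> \<open>The minimum of 2 |w|^2 over [0,1] is at most its mean, that is the energy lost
    during this unit of time.\<close>
  obtain \<tau> where \<tau>: "\<tau> \<in> {0..1}" "2 * (cmod (w U \<tau>))\<^sup>2 \<le> D"
  proof -
    have "continuous_on {0..1} (\<lambda>t. 2 * (cmod (w U t))\<^sup>2)"
      by (intro continuous_intros continuous_on_w_interval U) auto
    then obtain \<tau> where \<tau>: "\<tau> \<in> {0..1}" "\<And>t. t \<in> {0..1} \<Longrightarrow> 2 * (cmod (w U \<tau>))\<^sup>2 \<le> 2 * (cmod (w U t))\<^sup>2"
      using continuous_attains_inf[of "{0..1::real}"] by (metis atLeastatMost_empty_iff compact_Icc zero_le_one)
    have "((\<lambda>t::real. 2 * (cmod (w U \<tau>))\<^sup>2) has_integral (2 * (cmod (w U \<tau>))\<^sup>2)) {0..1}"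
      using has_integral_const_real[of "2 * (cmod (w U \<tau>))\<^sup>2" 0 1] by simp
    from has_integral_le[OF this energy_identity[OF U, of 0 1] \<tau>(2)]
    have "2 * (cmod (w U \<tau>))\<^sup>2 \<le> (norm (coords (S 0 U)))\<^sup>2 - (norm (coords (S 1 U)))\<^sup>2" by simp
    also have "\<dots> \<le> D" using dec[of 1 3] S0 by (simp add: D_def)
    finally show ?thesis using that \<tau>(1) by blast
  qed
  have \<tau>0: "\<tau> \<ge> 0" using \<tau> by simp
  define V where "V = S \<tau> U"
  have V: "V \<in> domA \<xi>" unfolding V_def by (rule S_invariant(1)[OF \<tau>0 U])
  define M where "M = norm (coords (opA \<xi> U))"
  define A where "A = coords (opA \<xi> V)"
  have AM: "(norm A)\<^sup>2 \<le> M\<^sup>2"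
    unfolding A_def V_def S_invariant(2)[OF \<tau>0 U] M_def by (intro power_mono S_contraction opA_in_state_space U \<tau>0) simp
  define T where "T = trace_at \<xi> A"
  have T: "2 * (cmod T)\<^sup>2 \<le> D" using \<tau>(2) by (simp add: T_def A_def V_def w_def)
  have D0: "D \<ge> 0" using dec[of 0 3] S0 by (simp add: D_def)
  have DV: "(norm (coords V))\<^sup>2 - (norm (coords (S 2 V)))\<^sup>2 \<le> D"
  proof -
    have eq: "S 2 V = S (2 + \<tau>) U" unfolding V_def using S_plus[of 2 \<tau> U] \<tau>0 UX by simp
    have "(norm (coords V))\<^sup>2 \<le> (norm (coords U))\<^sup>2"
      using dec[of 0 \<tau>, unfolded S0] \<tau>0 unfolding V_def by blast
    moreover have "(norm (coords (S 3 U)))\<^sup>2 \<le> (norm (coords (S (2 + \<tau>) U)))\<^sup>2"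
      by (rule dec) (use \<tau> in auto)
    ultimately show ?thesis unfolding D_def eq by linarith
  qed
  define L where "L = 32 * (real N + 2) ^ 4 * exp (K * real N) / c"
  have L0: "L \<ge> 0" using c by (simp add: L_def)
  define f where "f = (\<lambda>j. 2 * (cmod (u_coeff (Suc j) (coords V)))\<^sup>2 + 2 * (cmod (v_coeff (Suc j) (coords V)))\<^sup>2)"
  have low: "f j \<le> L * D" if "j < N" for j
  proof -
    define k where "k = Suc j"
    have k: "k > 0" "k \<le> N" using that by (auto simp: k_def)
    have f0: "f j \<ge> 0" by (simp add: f_def)
    have "c * exp (- K * real N) * f j \<le> c * exp (- K * real k) * f j"
      using k c K f0 by (intro mult_right_mono mult_left_mono) auto
    also have "\<dots> \<le> (cmod (sn k \<xi>))\<^sup>2 * f j" by (intro mult_right_mono dio k f0)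
    also have "\<dots> \<le> 32 * (real k + 2) ^ 4 * ((norm (coords V))\<^sup>2 - (norm (coords (S 2 V)))\<^sup>2)"
      unfolding f_def k_def[symmetric] by (rule coeffs_observable[OF V k(1)])
    also have "\<dots> \<le> 32 * (real k + 2) ^ 4 * D" by (intro mult_left_mono DV) auto
    also have "\<dots> \<le> 32 * (real N + 2) ^ 4 * D" using k D0 by (intro mult_right_mono mult_left_mono power_mono) auto
    finally have "exp (K * real N) / c * (c * exp (- K * real N) * f j) \<le> exp (K * real N) / c * (32 * (real N + 2) ^ 4 * D)"
      using c by (intro mult_left_mono) auto
    moreover have "exp (K * real N) / c * (c * exp (- K * real N) * f j) = f j"
      using c by (simp add: exp_minus field_simps)
    moreover have "exp (K * real N) / c * (32 * (real N + 2) ^ 4 * D) = L * D" by (simp add: L_def field_simps)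
    ultimately show ?thesis by simp
  qed
  \<comment> \<open>In the summable part the denominator is frozen at N^2 so that Bessel applies;
    the trace part keeps j^2, as it has no other source of summability.\<close>
  define g where "g = (\<lambda>j. (2 * (cmod (u_coeff (Suc j) A))\<^sup>2 + 4 * (cmod (v_coeff (Suc j) A))\<^sup>2) / (real N)\<^sup>2
      + 4 * (cmod T)\<^sup>2 / pi\<^sup>2 * (1 / (real (Suc j))\<^sup>2))"
  have g0: "g j \<ge> 0" for j by (simp add: g_def)
  have high: "f j \<le> g j" if "N \<le> j" for j
  proof -
    define X where "X = 2 * (cmod (u_coeff (Suc j) A))\<^sup>2 + 4 * (cmod (v_coeff (Suc j) A))\<^sup>2"
    have X0: "X \<ge> 0" by (simp add: X_def)
    have "f j \<le> (X + 4 * (cmod T)\<^sup>2) / (real (Suc j) * pi)\<^sup>2"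
      unfolding f_def X_def A_def T_def by (rule coeffs_decay[OF V]) simp
    also have "\<dots> = X / (real (Suc j) * pi)\<^sup>2 + 4 * (cmod T)\<^sup>2 / pi\<^sup>2 * (1 / (real (Suc j))\<^sup>2)"
      by (simp add: add_divide_distrib power_mult_distrib mult.commute)
    also have "X / (real (Suc j) * pi)\<^sup>2 \<le> X / (real N)\<^sup>2"
    proof (rule divide_left_mono[OF _ X0])
      have "real N * 1 \<le> real (Suc j) * pi" using that pi_gt3 by (intro mult_mono) auto
      then show "(real N)\<^sup>2 \<le> (real (Suc j) * pi)\<^sup>2" by (intro power_mono) auto
    qed (use N in auto)
    finally show ?thesis by (simp add: g_def X_def)
  qed
  have "(\<Sum>j<m. f j) \<le> real N * (L * D) + 3 * M\<^sup>2 / (real N)\<^sup>2 + D" for m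
  proof -
    have "(\<Sum>j<m. f j) \<le> (\<Sum>j<m. (if j \<in> {..<N} then L * D else 0) + g j)"
    proof (rule sum_mono)
      fix j
      show "f j \<le> (if j \<in> {..<N} then L * D else 0) + g j"
        using low[of j] high[of j] g0[of j] by (cases "j < N") auto
    qed
    also have "\<dots> = (\<Sum>j<m. if j \<in> {..<N} then L * D else 0) + (\<Sum>j<m. g j)" by (rule sum.distrib)
    also have "(\<Sum>j<m. if j \<in> {..<N} then L * D else 0) = (\<Sum>j\<in>{..<m} \<inter> {..<N}. L * D)"
      by (rule sum.inter_restrict[symmetric]) simp
    also have "\<dots> \<le> (\<Sum>j<N. L * D)" using L0 D0 by (intro sum_mono2) auto
    also have "\<dots> = real N * (L * D)" by simp
    also have "(\<Sum>j<m. g j) = ((\<Sum>j<m. 2 * (cmod (u_coeff (Suc j) A))\<^sup>2) + 2 * (\<Sum>j<m. 2 * (cmod (v_coeff (Suc j) A))\<^sup>2)) / (real N)\<^sup>2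
        + 4 * (cmod T)\<^sup>2 / pi\<^sup>2 * (\<Sum>j<m. 1 / (real (Suc j))\<^sup>2)"
      unfolding g_def sum.distrib sum_distrib_left sum_divide_distrib[symmetric] by simp
    \<comment> \<open>Bessel for u once and for v twice gives the constant 3; the trace part is 2/3
      |T|^2, at most D by the choice of \<tau>.\<close>
    also have "\<dots> \<le> (M\<^sup>2 + 2 * M\<^sup>2) / (real N)\<^sup>2 + 4 * (cmod T)\<^sup>2 / pi\<^sup>2 * (pi\<^sup>2 / 6)"
      using order_trans[OF u_coeff_bessel[of A m] AM] order_trans[OF v_coeff_bessel[of A m] AM]
      by (intro add_mono divide_right_mono mult_left_mono sum_inverse_squares_le) auto
    also have "4 * (cmod T)\<^sup>2 / pi\<^sup>2 * (pi\<^sup>2 / 6) \<le> D" using T D0 by simp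
    finally show ?thesis by simp
  qed
  moreover have "(\<lambda>m. \<Sum>j<m. f j) \<longlonglongrightarrow> (norm (coords V))\<^sup>2"
    using domA_parseval[OF \<xi> V] by (simp add: f_def sums_def)
  ultimately have Vb: "(norm (coords V))\<^sup>2 \<le> real N * (L * D) + 3 * M\<^sup>2 / (real N)\<^sup>2 + D"
    by (intro LIMSEQ_le_const2) auto
  \<comment> \<open>The polynomial N (N + 2)^4 is absorbed by exp(5 (N + 2)), whence exp 10 and the
    rate K + 5.\<close>
  have NL: "real N * L \<le> 32 / c * exp 10 * exp ((K + 5) * real N)"
  proof -
    have "real N * (real N + 2) ^ 4 \<le> (real N + 2) * (real N + 2) ^ 4" by (intro mult_right_mono) auto
    also have "\<dots> = (real N + 2) ^ 5" by (simp add: eval_nat_numeral)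
    also have "\<dots> \<le> exp (real N + 2) ^ 5"
      using exp_ge_add_one_self[of "real N + 2"] by (intro power_mono) auto
    also have "\<dots> = exp (5 * (real N + 2))" using exp_of_nat_mult[of 5 "real N + 2"] by simp
    finally have "32 / c * exp (K * real N) * (real N * (real N + 2) ^ 4) \<le> 32 / c * exp (K * real N) * exp (5 * (real N + 2))"
      using c by (intro mult_left_mono) auto
    moreover have "real N * L = 32 / c * exp (K * real N) * (real N * (real N + 2) ^ 4)" by (simp add: L_def)
    ultimately have "real N * L \<le> 32 / c * exp (K * real N) * exp (5 * (real N + 2))" by (simp only:)
    also have "\<dots> = 32 / c * exp 10 * exp ((K + 5) * real N)" by (simp add: exp_add[symmetric] algebra_simps)
    finally show ?thesis .
  qed
  have "(norm (coords (S 3 U)))\<^sup>2 \<le> (norm (coords V))\<^sup>2" unfolding V_def using \<tau> by (intro dec) auto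
  also have "\<dots> \<le> (real N * L + 1) * D + 3 / (real N)\<^sup>2 * M\<^sup>2" using Vb by (simp add: algebra_simps)
  also have "\<dots> \<le> ((32 / c * exp 10 + 1) * exp ((K + 5) * real N)) * D + 3 / (real N)\<^sup>2 * M\<^sup>2"
  proof -
    have "1 \<le> exp ((K + 5) * real N)" using K by simp
    with NL have "real N * L + 1 \<le> (32 / c * exp 10 + 1) * exp ((K + 5) * real N)" unfolding distrib_right by linarith
    then show ?thesis using D0 by (intro add_right_mono mult_right_mono)
  qed
  finally show ?thesis by (simp add: D_def M_def)
qed

end

subsection \<open>Logarithmic decay\<close>

text \<open>For fixed N the recursion is a contraction towards F = 3 P / N^2 with ratio r = Q / (1 +
  Q). Given the final index m, N is taken near ln(2 + m) / (2 B): then Q is of order sqrt(m), r^m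
  decays faster than any power of the logarithm, and F is of order 1/ln^2. C depends on A and B
  only.\<close>

lemma log_decay_sequence:
  fixes A B :: real
  assumes A: "A > 0" and B: "B > 0"
  obtains C where "C > 0"
    "\<And>(e :: nat \<Rightarrow> real) P m. P \<ge> 0 \<Longrightarrow> e 0 \<le> P \<Longrightarrow>
      (\<And>m N. N \<ge> 1 \<Longrightarrow> e (Suc m) \<le> A * exp (B * real N) * (e m - e (Suc m)) + 3 / (real N)\<^sup>2 * P) \<Longrightarrow>
      e m \<le> C * P / (ln (2 + real m))\<^sup>2"
proof -
  \<comment> \<open>Chosen so that 1 + Q \<le> a sqrt(2 + m); exp B pays for rounding N up.\<close>
  define a where "a = 1 + A * exp B"
  have a: "a > 0" using A by (simp add: a_def add_pos_pos)
  have "(\<lambda>m::nat. exp (- (real m / (a * sqrt (2 + real m)))) * (ln (2 + real m))\<^sup>2) \<longlonglongrightarrow> 0"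
    using a by real_asymp
  then have "Bseq (\<lambda>m::nat. exp (- (real m / (a * sqrt (2 + real m)))) * (ln (2 + real m))\<^sup>2)"
    by (intro convergent_imp_Bseq convergentI)
  then obtain C1 where C1: "C1 > 0" "\<And>m::nat. norm (exp (- (real m / (a * sqrt (2 + real m)))) * (ln (2 + real m))\<^sup>2) \<le> C1"
    by (auto simp: Bseq_def)
  show ?thesis
  proof (rule that[of "C1 + 12 * B\<^sup>2"])
    show "C1 + 12 * B\<^sup>2 > 0" using C1 by (simp add: add_pos_nonneg)
    fix e :: "nat \<Rightarrow> real" and P :: real and m :: nat
    assume P: "P \<ge> 0" and e0: "e 0 \<le> P"
      and step: "\<And>m N. N \<ge> 1 \<Longrightarrow> e (Suc m) \<le> A * exp (B * real N) * (e m - e (Suc m)) + 3 / (real N)\<^sup>2 * P"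
    define x where "x = ln (2 + real m)"
    have x: "x > 0" by (simp add: x_def)
    define N where "N = nat \<lceil>x / (2 * B)\<rceil>"
    have xB: "x / (2 * B) > 0" using x B by simp
    then have N: "N \<ge> 1" "x / (2 * B) \<le> real N" "real N \<le> x / (2 * B) + 1"
      unfolding N_def by linarith+
    define Q where "Q = A * exp (B * real N)"
    have Q: "Q > 0" using A by (simp add: Q_def)
    define F where "F = 3 / (real N)\<^sup>2 * P"
    have F: "F \<ge> 0" using P by (simp add: F_def)
    define r where "r = Q / (1 + Q)"
    have r: "r \<ge> 0" using Q by (simp add: r_def)
    \<comment> \<open>N, and with it r and F, is fixed by m and stays the same for all j in this
      iteration.\<close>
    have "e j - F \<le> r ^ j * P" for j
    proof (induction j)
      case 0
      then show ?case using e0 F by simp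
    next
      case (Suc j)
      have "(1 + Q) * (e (Suc j) - F) \<le> Q * (e j - F)"
        using step[OF N(1), of j, folded Q_def, folded F_def] by (simp add: algebra_simps)
      then have "e (Suc j) - F \<le> r * (e j - F)" using Q by (simp add: r_def field_simps)
      also have "\<dots> \<le> r * (r ^ j * P)" by (intro mult_left_mono Suc r)
      finally show ?case by (simp add: mult_ac)
    qed
    then have em: "e m \<le> r ^ m * P + F" by (simp add: algebra_simps)
    have "r = 1 + (- 1 / (1 + Q))" using Q by (simp add: r_def field_simps)
    also have "\<dots> \<le> exp (- 1 / (1 + Q))" by (rule exp_ge_add_one_self)
    finally have "r ^ m \<le> exp (- 1 / (1 + Q)) ^ m" using r by (intro power_mono)
    also have "\<dots> = exp (- (real m / (1 + Q)))" by (simp add: exp_of_nat_mult[symmetric])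
    also have "\<dots> \<le> exp (- (real m / (a * sqrt (2 + real m))))"
    proof -
      have "exp (B * real N) \<le> exp (B * (x / (2 * B) + 1))" using N(3) B by simp
      also have "\<dots> = exp B * exp (x / 2)" using B by (simp add: exp_add[symmetric] algebra_simps)
      also have "exp (x / 2) = sqrt (2 + real m)"
      proof -
        have "(exp (x / 2))\<^sup>2 = 2 + real m" by (simp add: exp_double[symmetric] x_def)
        then show ?thesis by (metis exp_ge_zero real_sqrt_unique)
      qed
      finally have "1 + Q \<le> sqrt (2 + real m) + A * (exp B * sqrt (2 + real m))"
        using A unfolding Q_def by (intro add_mono mult_left_mono) auto
      then have "1 + Q \<le> a * sqrt (2 + real m)" by (simp add: a_def algebra_simps)
      then show ?thesis using Q by (simp add: frac_le)
    qed
    also have "\<dots> \<le> C1 / x\<^sup>2"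
      using C1(2)[of m] x by (simp add: x_def[symmetric] pos_le_divide_eq)
    finally have "r ^ m * P \<le> C1 / x\<^sup>2 * P" using P by (rule mult_right_mono)
    moreover have "F \<le> 12 * B\<^sup>2 / x\<^sup>2 * P"
    proof -
      have "(x / (2 * B))\<^sup>2 \<le> (real N)\<^sup>2" using N(2) xB by (intro power_mono) auto
      then have "3 / (real N)\<^sup>2 \<le> 3 / (x / (2 * B))\<^sup>2" using xB by (intro divide_left_mono mult_pos_pos zero_less_power) (use N in auto)
      also have "\<dots> = 12 * B\<^sup>2 / x\<^sup>2" using B x by (simp add: power_divide power_mult_distrib)
      finally show ?thesis unfolding F_def using P by (rule mult_right_mono)
    qed
    ultimately have "e m \<le> C1 / x\<^sup>2 * P + 12 * B\<^sup>2 / x\<^sup>2 * P" using em by linarith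
    also have "\<dots> = (C1 + 12 * B\<^sup>2) * P / x\<^sup>2" by (simp add: add_divide_distrib distrib_right)
    finally show "e m \<le> (C1 + 12 * B\<^sup>2) * P / (ln (2 + real m))\<^sup>2" by (simp only: x_def)
  qed
qed

lemma sine_lower_bound:
  assumes irr: "\<xi> \<notin> \<rat>" and M: "\<xi> \<in> set_M"
  obtains c K where "c > 0" "K > 0" "\<And>k. k > 0 \<Longrightarrow> c * exp (- K * real k) \<le> (cmod (sn k \<xi>))\<^sup>2"
proof -
  obtain K1 K2 where K: "K1 > 0" "K2 > 0" and ev: "eventually (\<lambda>\<mu>::real.
     ((sin \<mu>)\<^sup>2 + (sin (\<xi> * \<mu>))\<^sup>2 * (sin ((1 - \<xi>) * \<mu>))\<^sup>2) * exp (K1 * \<mu>) \<ge> K2) at_top"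
    using M by (auto simp: set_M_def)
  then obtain \<mu>0 where \<mu>0: "\<And>\<mu>. \<mu> \<ge> \<mu>0 \<Longrightarrow> ((sin \<mu>)\<^sup>2 + (sin (\<xi> * \<mu>))\<^sup>2 * (sin ((1 - \<xi>) * \<mu>))\<^sup>2) * exp (K1 * \<mu>) \<ge> K2"
    by (auto simp: eventually_at_top_linorder)
  define s where "s = (\<lambda>k. (cmod (sn k \<xi>))\<^sup>2)"
  have s: "s k = (sin (real k * pi * \<xi>))\<^sup>2" for k by (simp add: s_def sn_def)
  obtain k0 :: nat where k0: "\<mu>0 \<le> real k0" using real_arch_simple by blast
  have big: "K2 * exp (- (K1 * pi) * real k) \<le> s k" if "k \<ge> k0" for k
  proof -
    have "real k * 1 \<le> real k * pi" using pi_gt3 by (intro mult_left_mono) auto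
    then have "real k * pi \<ge> \<mu>0" using k0 that by linarith
    note b = \<mu>0[OF this]
    have "(1 - \<xi>) * (real k * pi) = real k * pi - real k * pi * \<xi>" by (simp add: algebra_simps)
    \<comment> \<open>At multiples of pi the two factors of the product agree up to sign, and the
      first summand vanishes.\<close>
    then have "sin ((1 - \<xi>) * (real k * pi)) = - (cos (real k * pi) * sin (real k * pi * \<xi>))"
      by (simp only: sin_diff sin_npi)
    moreover have "(cos (real k * pi))\<^sup>2 = 1" by (simp add: cos_npi power_mult[symmetric] mult.commute)
    ultimately have "(sin ((1 - \<xi>) * (real k * pi)))\<^sup>2 = s k" by (simp add: s power_mult_distrib)
    moreover have "(sin (\<xi> * (real k * pi)))\<^sup>2 = s k" by (simp add: s mult_ac)
    ultimately have "K2 \<le> s k * s k * exp (K1 * (real k * pi))" using b by simp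
    \<comment> \<open>Bounding one of the two equal factors by 1 leaves a lower bound for s
      itself.\<close>
    also have "\<dots> \<le> s k * 1 * exp (K1 * (real k * pi))"
      by (intro mult_right_mono mult_left_mono) (auto simp: s power_le_one_iff abs_square_le_1)
    finally have "K2 * exp (- (K1 * (real k * pi))) \<le> s k * exp (K1 * (real k * pi)) * exp (- (K1 * (real k * pi)))"
      by (intro mult_right_mono) auto
    then show ?thesis by (simp add: exp_minus mult_ac)
  qed
  have pos: "s k > 0" if "k > 0" for k
  proof (rule ccontr)
    assume "\<not> s k > 0"
    then have "sin (real k * pi * \<xi>) = 0" by (simp add: s)
    then obtain i :: int where "real k * pi * \<xi> = of_int i * pi" by (auto simp: sin_zero_iff_int2)
    then have "\<xi> = of_int i / of_nat k" using that by (simp add: field_simps)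
    then show False using irr by (auto simp: Rats_divide)
  qed
  \<comment> \<open>One constant for all k: the finitely many indices before the asymptotic range
    enter with their own values, which are positive by irrationality.\<close>
  define c where "c = Min (insert K2 (s ` {1..k0}))"
  have fin: "finite (insert K2 (s ` {1..k0}))" by simp
  have cpos: "c > 0" unfolding c_def using K pos by (subst Min_gr_iff) auto
  have cK: "c \<le> K2" unfolding c_def by (rule Min_le[OF fin]) simp
  have cs: "c \<le> s k" if "k \<in> {1..k0}" for k unfolding c_def by (rule Min_le[OF fin]) (use that in simp)
  show ?thesis
  proof (rule that[of c "K1 * pi"])
    show "c > 0" by (rule cpos)
    show "K1 * pi > 0" using K by simp
    fix k :: nat assume k: "k > 0"
    show "c * exp (- (K1 * pi) * real k) \<le> (cmod (sn k \<xi>))\<^sup>2"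
    proof (cases "k \<ge> k0")
      case True
      have "c * exp (- (K1 * pi) * real k) \<le> K2 * exp (- (K1 * pi) * real k)" by (intro mult_right_mono cK) simp
      with big[OF True] show ?thesis unfolding s_def by linarith
    next
      case False
      have "c * exp (- (K1 * pi) * real k) \<le> c * 1" using cpos K by (intro mult_left_mono) auto
      also have "\<dots> \<le> s k" using cs[of k] False k by simp
      finally show ?thesis by (simp add: s_def)
    qed
  qed
qed

text \<open>The recursion runs over the times 3 m. By contractivity for A U the loss term stays
  below the same P at every step. The constant is fixed before the semigroup.\<close>

lemma damped_string_decay_domA:
  assumes \<xi>: "0 < \<xi>" "\<xi> < 1" and irr: "\<xi> \<notin> \<rat>" and M: "\<xi> \<in> set_M"
  obtains C where "C > 0" "\<And>S U t. damped_string \<xi> S \<Longrightarrow> U \<in> domA \<xi> \<Longrightarrow> t \<ge> 0 \<Longrightarrow>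
    (norm (coords (S t U)))\<^sup>2 \<le> C / (ln (2 + t))\<^sup>2 * ((norm (coords U))\<^sup>2 + (norm (coords (opA \<xi> U)))\<^sup>2)"
proof -
  obtain c K where c: "c > 0" "K > 0" "\<And>k. k > 0 \<Longrightarrow> c * exp (- K * real k) \<le> (cmod (sn k \<xi>))\<^sup>2"
    using sine_lower_bound[OF irr M] by metis
  define A where "A = 32 / c * exp 10 + 1"
  have "A > 0" using c by (simp add: A_def add_pos_pos)
  moreover have "K + 5 > 0" using c by simp
  ultimately obtain C where C: "C > 0" and Cb: "\<And>(e :: nat \<Rightarrow> real) P m. P \<ge> 0 \<Longrightarrow> e 0 \<le> P \<Longrightarrow>
      (\<And>m N. N \<ge> 1 \<Longrightarrow> e (Suc m) \<le> A * exp ((K + 5) * real N) * (e m - e (Suc m)) + 3 / (real N)\<^sup>2 * P) \<Longrightarrow>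
      e m \<le> C * P / (ln (2 + real m))\<^sup>2"
    using log_decay_sequence[of A "K + 5"] by metis
  show ?thesis
  proof (rule that[of "9 * C"])
    show "9 * C > 0" using C by simp
    fix S U and t :: real assume S: "damped_string \<xi> S" and U: "U \<in> domA \<xi>" and t: "t \<ge> 0"
    interpret damped_string \<xi> S by (rule S)
    define P where "P = (norm (coords U))\<^sup>2 + (norm (coords (opA \<xi> U)))\<^sup>2"
    have P: "P \<ge> 0" by (simp add: P_def)
    define e where "e = (\<lambda>m. (norm (coords (S (3 * real m) U)))\<^sup>2)"
    have eb: "e m \<le> C * P / (ln (2 + real m))\<^sup>2" for m
    proof (rule Cb[OF P])
      show "e 0 \<le> P" by (simp add: e_def P_def S_0[OF gen domA_X[OF U]])
      fix m N :: nat assume N: "1 \<le> N"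
      define V where "V = S (3 * real m) U"
      have V: "V \<in> domA \<xi>" unfolding V_def by (rule S_invariant(1)[OF _ U]) simp
      have S3: "S 3 V = S (3 * real (Suc m)) U"
        unfolding V_def using S_plus[of 3 "3 * real m" U] domA_X[OF U] by (simp add: algebra_simps)
      have "norm (coords (opA \<xi> V)) \<le> norm (coords (opA \<xi> U))"
        unfolding V_def S_invariant(2)[OF _ U, of "3 * real m", simplified]
        by (rule S_contraction[OF opA_in_state_space[OF U]]) simp
      then have "(norm (coords (opA \<xi> V)))\<^sup>2 \<le> (norm (coords (opA \<xi> U)))\<^sup>2" by (rule power_mono) simp
      also have "\<dots> \<le> P" by (simp add: P_def)
      finally have AV: "3 / (real N)\<^sup>2 * (norm (coords (opA \<xi> V)))\<^sup>2 \<le> 3 / (real N)\<^sup>2 * P" by (intro mult_left_mono) auto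
      have "e (Suc m) \<le> A * exp ((K + 5) * real N) * (e m - e (Suc m)) + 3 / (real N)\<^sup>2 * (norm (coords (opA \<xi> V)))\<^sup>2"
        using observability_with_loss[OF V c(1,2) N c(3)] unfolding S3 by (simp add: e_def V_def A_def)
      with AV show "e (Suc m) \<le> A * exp ((K + 5) * real N) * (e m - e (Suc m)) + 3 / (real N)\<^sup>2 * P" by linarith
    qed
    define m where "m = nat \<lfloor>t / 3\<rfloor>"
    have "real m = of_int \<lfloor>t / 3\<rfloor>" using t by (simp add: m_def)
    then have "real m \<le> t / 3" "t / 3 < real m + 1" using floor_correct[of "t / 3"] by simp_all
    then have m: "3 * real m \<le> t" "t \<le> 3 * (real m + 1)" by simp_all
    \<comment> \<open>Passing from t to m costs a power 3 inside the logarithm, hence the factor 9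
      in the constant.\<close>
    have l: "ln (2 + t) \<le> 3 * ln (2 + real m)"
    proof -
      have "2 + t \<le> (2 + real m) ^ 3"
      proof -
        have "2 + t \<le> 5 + 3 * real m" using m by simp
        also have "\<dots> \<le> 8 + 12 * real m + 6 * (real m)\<^sup>2 + (real m) ^ 3" using zero_le_power2[of "real m"] zero_le_power[of "real m" 3] by linarith
        also have "\<dots> = (2 + real m) ^ 3" by (simp add: eval_nat_numeral algebra_simps)
        finally show ?thesis .
      qed
      then have "ln (2 + t) \<le> ln ((2 + real m) ^ 3)" using t by (subst ln_le_cancel_iff) auto
      also have "\<dots> = 3 * ln (2 + real m)" by (simp add: ln_realpow)
      finally show ?thesis .
    qed
    have lt: "ln (2 + t) > 0" using t by simp
    have "(norm (coords (S t U)))\<^sup>2 \<le> e m"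
      unfolding e_def by (intro power_mono energy_decreasing domA_X U m) auto
    also have "\<dots> \<le> C * P / (ln (2 + real m))\<^sup>2" by (rule eb)
    also have "\<dots> \<le> C * P / (ln (2 + t) / 3)\<^sup>2"
      using l lt C P by (intro divide_left_mono power_mono mult_pos_pos) auto
    also have "\<dots> = 9 * C / (ln (2 + t))\<^sup>2 * P" by (simp add: power_divide)
    finally show "(norm (coords (S t U)))\<^sup>2 \<le> 9 * C / (ln (2 + t))\<^sup>2 * ((norm (coords U))\<^sup>2 + (norm (coords (opA \<xi> U)))\<^sup>2)"
      by (simp only: P_def)
  qed
qed

lemma dom_power_Suc_subset:
  assumes "D \<subseteq> X"
  shows "dom_power X D A (Suc n) \<subseteq> dom_power X D A n"
  by (induction n) (use assms in auto)

lemma state_norm_nonneg: "state_norm U \<ge> 0"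
  by (cases U) (simp add: state_norm_def L2_normsq_nonneg)

text \<open>The time is split into halves: on the first the induction hypothesis is applied to U and
  to A U, on the second the estimate for the domain is applied to S(t/2) U, so that the powers of
  the logarithm multiply.\<close>

lemma damped_string_decay:
  assumes \<xi>: "0 < \<xi>" "\<xi> < 1" and irr: "\<xi> \<notin> \<rat>" and M: "\<xi> \<in> set_M"
  shows "\<exists>C>0. \<forall>S U t. damped_string \<xi> S \<longrightarrow> U \<in> dom_power state_space (domA \<xi>) (opA \<xi>) n \<longrightarrow> t \<ge> 0 \<longrightarrow>
    (norm (coords (S t U)))\<^sup>2 \<le> C / (ln (2 + t)) ^ (2 * n) * (graph_norm state_norm (opA \<xi>) n U)\<^sup>2"
proof (induction n)
  case 0
  have "(norm (coords (S t U)))\<^sup>2 \<le> 1 / (ln (2 + t)) ^ (2 * 0) * (graph_norm state_norm (opA \<xi>) 0 U)\<^sup>2"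
    if S: "damped_string \<xi> S" and U: "U \<in> dom_power state_space (domA \<xi>) (opA \<xi>) 0" and t: "t \<ge> 0" for S U t
  proof -
    interpret damped_string \<xi> S by (rule S)
    have "U \<in> state_space" using U by simp
    then show ?thesis using S_contraction[of U t] t by (simp add: graph_norm_def state_norm_coords power_mono)
  qed
  then show ?case by (intro exI[of _ 1]) auto
next
  case (Suc n)
  then obtain C where C: "C > 0" and IH: "\<And>S U t. damped_string \<xi> S \<Longrightarrow> U \<in> dom_power state_space (domA \<xi>) (opA \<xi>) n \<Longrightarrow> t \<ge> 0 \<Longrightarrow>
    (norm (coords (S t U)))\<^sup>2 \<le> C / (ln (2 + t)) ^ (2 * n) * (graph_norm state_norm (opA \<xi>) n U)\<^sup>2" by blast
  obtain C1 where C1: "C1 > 0" "\<And>S U t. damped_string \<xi> S \<Longrightarrow> U \<in> domA \<xi> \<Longrightarrow> t \<ge> 0 \<Longrightarrow>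
    (norm (coords (S t U)))\<^sup>2 \<le> C1 / (ln (2 + t))\<^sup>2 * ((norm (coords U))\<^sup>2 + (norm (coords (opA \<xi> U)))\<^sup>2)"
    using damped_string_decay_domA[OF \<xi> irr M] by metis
  \<comment> \<open>The 2 counts the two uses of the induction hypothesis; 4^(n+1) stems from ln(2 +
    t) \<le> 2 ln(2 + t/2) in the power 2 (n + 1).\<close>
  define C' where "C' = 2 * C1 * C * 4 ^ Suc n"
  have "(norm (coords (S t U)))\<^sup>2 \<le> C' / (ln (2 + t)) ^ (2 * Suc n) * (graph_norm state_norm (opA \<xi>) (Suc n) U)\<^sup>2"
    if S: "damped_string \<xi> S" and U: "U \<in> dom_power state_space (domA \<xi>) (opA \<xi>) (Suc n)" and t: "t \<ge> 0" for S U t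
  proof -
    interpret damped_string \<xi> S by (rule S)
    have UD: "U \<in> domA \<xi>" and AU: "opA \<xi> U \<in> dom_power state_space (domA \<xi>) (opA \<xi>) n" using U by auto
    have Un: "U \<in> dom_power state_space (domA \<xi>) (opA \<xi>) n"
      using dom_power_Suc_subset[OF domA_subset_state_space] U by blast
    define G where "G = graph_norm state_norm (opA \<xi>) (Suc n) U"
    have g1: "(graph_norm state_norm (opA \<xi>) n U)\<^sup>2 \<le> G\<^sup>2"
      unfolding G_def graph_norm_def by (intro power_mono sum_mono2 sum_nonneg) (auto simp: state_norm_nonneg)
    have "graph_norm state_norm (opA \<xi>) n (opA \<xi> U) = (\<Sum>k\<le>n. state_norm ((opA \<xi> ^^ Suc k) U))"
      by (simp add: graph_norm_def funpow_swap1)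
    also have "\<dots> \<le> G"
      unfolding G_def graph_norm_def sum.atMost_Suc_shift[of _ n] by (simp add: state_norm_nonneg)
    finally have g2: "(graph_norm state_norm (opA \<xi>) n (opA \<xi> U))\<^sup>2 \<le> G\<^sup>2"
      by (rule power_mono) (auto simp: graph_norm_def state_norm_nonneg intro: sum_nonneg)
    define h where "h = t / 2"
    have h: "h \<ge> 0" using t by (simp add: h_def)
    define V where "V = S h U"
    have V: "V \<in> domA \<xi>" "opA \<xi> V = S h (opA \<xi> U)" unfolding V_def by (rule S_invariant[OF h UD])+
    define \<beta> where "\<beta> = ln (2 + h)"
    have \<beta>: "\<beta> > 0" using h by (simp add: \<beta>_def)
    have "S t U = S h V" unfolding V_def using S_plus[OF h h domA_X[OF UD]] by (simp add: h_def)
    then have "(norm (coords (S t U)))\<^sup>2 \<le> C1 / \<beta>\<^sup>2 * ((norm (coords V))\<^sup>2 + (norm (coords (opA \<xi> V)))\<^sup>2)"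
      using C1(2)[OF S V(1) h] by (simp add: \<beta>_def)
    also have "\<dots> \<le> C1 / \<beta>\<^sup>2 * (C / \<beta> ^ (2 * n) * G\<^sup>2 + C / \<beta> ^ (2 * n) * G\<^sup>2)"
    proof (intro mult_left_mono add_mono)
      have pos: "0 \<le> C / \<beta> ^ (2 * n)" using C \<beta> by simp
      show "(norm (coords V))\<^sup>2 \<le> C / \<beta> ^ (2 * n) * G\<^sup>2"
        unfolding V_def \<beta>_def using IH[OF S Un h] mult_left_mono[OF g1 pos] by (simp add: \<beta>_def)
      show "(norm (coords (opA \<xi> V)))\<^sup>2 \<le> C / \<beta> ^ (2 * n) * G\<^sup>2"
        unfolding V(2) \<beta>_def using IH[OF S AU h] mult_left_mono[OF g2 pos] by (simp add: \<beta>_def)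
    qed (use C1 in auto)
    also have "\<dots> = 2 * C1 * C / \<beta> ^ (2 * Suc n) * G\<^sup>2" by (simp add: power2_eq_square field_simps)
    also have "\<dots> \<le> 2 * C1 * C / (ln (2 + t) / 2) ^ (2 * Suc n) * G\<^sup>2"
    proof -
      have "2 + t \<le> (2 + h)\<^sup>2" using t by (simp add: h_def power2_eq_square algebra_simps)
      then have "ln (2 + t) \<le> ln ((2 + h)\<^sup>2)" using t h by (subst ln_le_cancel_iff) auto
      then have "ln (2 + t) / 2 \<le> \<beta>" using h by (simp add: ln_realpow \<beta>_def)
      moreover have "ln (2 + t) / 2 > 0" using t by simp
      ultimately show ?thesis
        using C C1 \<beta> by (intro mult_right_mono divide_left_mono power_mono mult_pos_pos zero_less_power) auto
    qed
    also have "\<dots> = C' / (ln (2 + t)) ^ (2 * Suc n) * G\<^sup>2"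
    proof -
      have "(2::real) ^ (2 * Suc n) = 4 ^ Suc n" by (simp only: power_mult) simp
      then show ?thesis by (simp only: power_divide C'_def divide_divide_eq_right)
    qed
    finally show ?thesis by (simp only: G_def)
  qed
  moreover have "C' > 0" using C C1 by (simp add: C'_def)
  ultimately show ?case by blast
qed

theorem theorem1p1:
  fixes \<xi> :: real
  assumes "0 < \<xi>" and "\<xi> < 1" and "\<xi> \<notin> \<rat>" and "\<xi> \<in> set_M"
  shows "\<forall>n::nat. \<exists>C>0. \<forall>S. generates state_space state_norm (domA \<xi>) (opA \<xi>) S \<longrightarrow>
    (\<forall>U\<in>dom_power state_space (domA \<xi>) (opA \<xi>) n. \<forall>t>0.
      energy \<xi> (S t U) \<le> C / (ln (2 + t)) ^ (2 * n) * (graph_norm state_norm (opA \<xi>) n U)\<^sup>2)"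
proof
  fix n
  obtain C where C: "C > 0" "\<And>S U t. damped_string \<xi> S \<Longrightarrow> U \<in> dom_power state_space (domA \<xi>) (opA \<xi>) n \<Longrightarrow> t \<ge> 0 \<Longrightarrow>
    (norm (coords (S t U)))\<^sup>2 \<le> C / (ln (2 + t)) ^ (2 * n) * (graph_norm state_norm (opA \<xi>) n U)\<^sup>2"
    using damped_string_decay[OF assms, of n] by blast
  have "energy \<xi> (S t U) \<le> C / (ln (2 + t)) ^ (2 * n) * (graph_norm state_norm (opA \<xi>) n U)\<^sup>2"
    if gen: "generates state_space state_norm (domA \<xi>) (opA \<xi>) S"
      and U: "U \<in> dom_power state_space (domA \<xi>) (opA \<xi>) n" and t: "t > 0" for S U t
  proof -
    interpret damped_string \<xi> S by unfold_locales (use assms gen in auto)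
    have "U \<in> state_space" using U domA_subset_state_space by (cases n) auto
    then have "S t U \<in> state_space" using t by (intro S_in_X) auto
    then have "energy \<xi> (S t U) \<le> (norm (coords (S t U)))\<^sup>2"
      by (simp add: energy_eq_norm_coords[OF assms(1,2)])
    also have "\<dots> \<le> C / (ln (2 + t)) ^ (2 * n) * (graph_norm state_norm (opA \<xi>) n U)\<^sup>2"
      by (rule C(2)[OF _ U]) (use t in \<open>auto intro: damped_string_axioms\<close>)
    finally show ?thesis .
  qed
  then show "\<exists>C>0. \<forall>S. generates state_space state_norm (domA \<xi>) (opA \<xi>) S \<longrightarrow>
    (\<forall>U\<in>dom_power state_space (domA \<xi>) (opA \<xi>) n. \<forall>t>0.
      energy \<xi> (S t U) \<le> C / (ln (2 + t)) ^ (2 * n) * (graph_norm state_norm (opA \<xi>) n U)\<^sup>2)"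
    using C(1) by blast
qed

end
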